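(* For real $M>11$ let $y_1(t),\dots,y_{15}(t)$, $0\le t\le 1-1/M$, be the solution of the Cauchy problem $$ \begin{aligned} \dot y_1&=-2u_p^2,\quad \dot y_2=4\big(y_1+2y_4u_p-2(2t-1)u_p^2\big),\\ \dot y_3&=2(7t-3)y_1+4y_2-4y_4^2+8(5t-3)y_4u_p+8y_5u_p-2(47t^2-46t+9)u_p^2,\\ \dot y_4&=-2u_p,\quad \dot y_5=4\big(y_4+(1-3t)u_p\big),\quad \dot y_6=-4\Big(t+1-\frac4M\Big)u_p-4y_4,\\ \dot y_7&=-2u_q^2,\quad \dot y_8=4\big(y_7+2y_{10}u_q-2(2t-1)u_q^2\big),\\ \dot y_9&=2(7t-3)y_7+4y_8-4y_{10}^2+8(5t-3)y_{10}u_q+8y_{11}u_q-2(47t^2-46t+9)u_q^2,\\ \dot y_{10}&=-2u_q,\quad \dot y_{11}=4\big(y_{10}+(1-3t)u_q\big),\quad \dot y_{12}=-4\Big(t+1-\frac4M\Big)u_q-4y_{10}-4,\\ \dot y_{13}&=-2u_pu_q,\quad \dot y_{14}=4(y_{13}+y_4u_q+y_{10}u_p)-8(2t-1)u_pu_q,\\ \dot y_{15}&=2(7t-3)y_{13}+4y_{14}-4y_4y_{10}+4(5t-3)(y_4u_q+y_{10}u_p)+4y_5u_q+4y_{11}u_p-2(47t^2-46t+9)u_pu_q, \end{aligned} $$ with initial values $y_6(0)=1$ and $y_k(0)=0$ for all $k\neq 6$, where $$ u_p=\frac{2(3-4/M-5t)y_4+2y_5-y_6}{16t^2-(8+16/M)t+2-8/M+15/M^2},\qquad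 u_q=\frac{2(3-4/M-5t)y_{10}+2y_{11}-y_{12}+2(1-3t)}{16t^2-(8+16/M)t+2-8/M+15/M^2}. $$ Let $M_0$ be the maximum of the roots $M$ of the two equations $$ y_3(1-1/M)=0 \qquad\text{and}\qquad y_3(1-1/M)\,y_9(1-1/M)-y_{15}^2(1-1/M)=0 . $$ Then the Pick function $P_M$ locally maximizes $\operatorname{Re}a_4$ in $S^M$ if $M>M_0$, and $P_M$ does not give a local maximum to $\operatorname{Re}a_4$ in $S^M$ if $1<M<M_0$.
   Context: For $M\ge1$, $S^M$ is the class of holomorphic univalent functions $f(z)=z+\sum_{n\ge2}a_nz^n$ in the unit disk $U=\{z:|z|<1\}$ with $|f(z)|<M$ in $U$ (with $S^1=\{z\}$). $K(z)=z/(1-z)^2$ is the Koebe function and $P_M(z)=MK^{-1}(K(z)/M)\in S^M$ is the Pick function. "$P_M$ locally maximizes $\operatorname{Re}a_4$ in $S^M$" means that $\operatorname{Re}a_4(f)\le\operatorname{Re}a_4(P_M)$ for all $f\in S^M$ in some neighbourhood of $P_M$ in the topology of locally uniform convergence in $U$. The letters $u_p,u_q$ are merely names for the displayed expressions in $t,M,y_k$; the dot denotes $d/dt$. *)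

theory Defs
  imports "HOL-Complex_Analysis.Complex_Analysis"
begin

definition bounded_univalent :: "real \<Rightarrow> (complex \<Rightarrow> complex) set" where
  "bounded_univalent M =
     {f. f holomorphic_on ball 0 1 \<and> inj_on f (ball 0 1) \<and> f 0 = 0 \<and> deriv f 0 = 1 \<and>
         (\<forall>z\<in>ball 0 1. norm (f z) < M)}"

definition taylor_coeff :: "(complex \<Rightarrow> complex) \<Rightarrow> nat \<Rightarrow> complex" where
  "taylor_coeff f n = fps_nth (fps_expansion f 0) n"

definition koebe :: "complex \<Rightarrow> complex" where
  "koebe z = z / (1 - z)\<^sup>2"

text \<open>The inverse is that of the Koebe function restricted to the unit disk, where it is
  injective. Its image there is starlike with respect to 0, so for \<open>M \<ge> 1\<close> and \<open>z\<close> in the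
  disk the argument \<open>koebe z / M\<close> lies in that image. Values outside the disk are irrelevant.\<close>

definition pick :: "real \<Rightarrow> complex \<Rightarrow> complex" where
  "pick M z = of_real M * inv_into (ball 0 1) koebe (koebe z / of_real M)"

text \<open>The neighbourhood filter of \<open>l\<close> in the topology of locally uniform convergence in \<open>U\<close>,
  for functions that are only considered on \<open>U\<close>; the lemma spells out its basis.\<close>

definition locally_uniform_nhds ::
    "'a::topological_space set \<Rightarrow> ('a \<Rightarrow> 'b::metric_space) \<Rightarrow> ('a \<Rightarrow> 'b) filter" where
  "locally_uniform_nhds U l = (INF C\<in>{C. compact C \<and> C \<subseteq> U}. uniformly_on C l)"

lemma eventually_locally_uniform_nhds:
  "eventually P (locally_uniform_nhds U l) \<longleftrightarrow>
     (\<exists>C e. compact C \<and> C \<subseteq> U \<and> e > 0 \<and> (\<forall>f. (\<forall>x\<in>C. dist (f x) (l x) < e) \<longrightarrow> P f))"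
proof -
  have ev: "eventually P (uniformly_on C l) \<longleftrightarrow>
      (\<exists>e>0. \<forall>f. (\<forall>x\<in>C. dist (f x) (l x) < e) \<longrightarrow> P f)" for P and C :: "'a set"
    unfolding uniformly_on_def
    by (subst eventually_INF_base)
       (auto simp: eventually_principal Ball_def
             intro!: bexI[of _ "min a b" for a b :: real])
  have mono: "uniformly_on D l \<le> uniformly_on C l" if "C \<subseteq> D" for C D
    using that by (auto simp: le_filter_def ev) (metis subsetD)
  have "eventually P (locally_uniform_nhds U l) \<longleftrightarrow>
      (\<exists>C\<in>{C. compact C \<and> C \<subseteq> U}. eventually P (uniformly_on C l))"
    unfolding locally_uniform_nhds_def
  proof (rule eventually_INF_base)
    show "{C. compact C \<and> C \<subseteq> U} \<noteq> {}" by auto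
    fix C D assume "C \<in> {C. compact C \<and> C \<subseteq> U}" "D \<in> {C. compact C \<and> C \<subseteq> U}"
    then show "\<exists>x\<in>{C. compact C \<and> C \<subseteq> U}.
        uniformly_on x l \<le> inf (uniformly_on C l) (uniformly_on D l)"
      by (intro bexI[of _ "C \<union> D"]) (auto intro!: mono compact_Un)
  qed
  then show ?thesis by (auto simp: ev)
qed

definition pick_locally_maximizes_Re_a4 :: "real \<Rightarrow> bool" where
  "pick_locally_maximizes_Re_a4 M \<longleftrightarrow>
     (\<forall>\<^sub>F f in locally_uniform_nhds (ball 0 1) (pick M).
        f \<in> bounded_univalent M \<longrightarrow> Re (taylor_coeff f 4) \<le> Re (taylor_coeff (pick M) 4))"

text \<open>The discriminant of this quadratic in \<open>t\<close> is \<open>- 64 (1 - 1/M) (1 - 11/M)\<close>, so the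
  denominator has no real zero when \<open>M > 11\<close>.\<close>

definition u_denom :: "real \<Rightarrow> real \<Rightarrow> real" where
  "u_denom M t = 16 * t\<^sup>2 - (8 + 16 / M) * t + 2 - 8 / M + 15 / M\<^sup>2"

definition u_p :: "real \<Rightarrow> (nat \<Rightarrow> real \<Rightarrow> real) \<Rightarrow> real \<Rightarrow> real" where
  "u_p M y t = (2 * (3 - 4 / M - 5 * t) * y 4 t + 2 * y 5 t - y 6 t) / u_denom M t"

definition u_q :: "real \<Rightarrow> (nat \<Rightarrow> real \<Rightarrow> real) \<Rightarrow> real \<Rightarrow> real" where
  "u_q M y t =
     (2 * (3 - 4 / M - 5 * t) * y 10 t + 2 * y 11 t - y 12 t + 2 * (1 - 3 * t)) / u_denom M t"

text \<open>\<open>y k t\<close> is the value at \<open>t\<close> of the \<open>k\<close>-th unknown; only the indices 1 to 15 matter.\<close>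

definition solves_cauchy_problem :: "real \<Rightarrow> (nat \<Rightarrow> real \<Rightarrow> real) \<Rightarrow> bool" where
  "solves_cauchy_problem M y \<longleftrightarrow>
     (\<forall>k\<in>{1..15}. y k 0 = (if k = 6 then 1 else 0)) \<and>
     (\<forall>t\<in>{0..1 - 1 / M}.
        let D = (\<lambda>k d. (y k has_real_derivative d) (at t within {0..1 - 1 / M}));
            p = u_p M y t; q = u_q M y t
        in
          D 1 (- 2 * p\<^sup>2) \<and>
          D 2 (4 * (y 1 t + 2 * y 4 t * p - 2 * (2 * t - 1) * p\<^sup>2)) \<and>
          D 3 (2 * (7 * t - 3) * y 1 t + 4 * y 2 t - 4 * (y 4 t)\<^sup>2
               + 8 * (5 * t - 3) * y 4 t * p + 8 * y 5 t * p
               - 2 * (47 * t\<^sup>2 - 46 * t + 9) * p\<^sup>2) \<and>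
          D 4 (- 2 * p) \<and>
          D 5 (4 * (y 4 t + (1 - 3 * t) * p)) \<and>
          D 6 (- 4 * (t + 1 - 4 / M) * p - 4 * y 4 t) \<and>
          D 7 (- 2 * q\<^sup>2) \<and>
          D 8 (4 * (y 7 t + 2 * y 10 t * q - 2 * (2 * t - 1) * q\<^sup>2)) \<and>
          D 9 (2 * (7 * t - 3) * y 7 t + 4 * y 8 t - 4 * (y 10 t)\<^sup>2
               + 8 * (5 * t - 3) * y 10 t * q + 8 * y 11 t * q
               - 2 * (47 * t\<^sup>2 - 46 * t + 9) * q\<^sup>2) \<and>
          D 10 (- 2 * q) \<and>
          D 11 (4 * (y 10 t + (1 - 3 * t) * q)) \<and>
          D 12 (- 4 * (t + 1 - 4 / M) * q - 4 * y 10 t - 4) \<and>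
          D 13 (- 2 * p * q) \<and>
          D 14 (4 * (y 13 t + y 4 t * q + y 10 t * p) - 8 * (2 * t - 1) * p * q) \<and>
          D 15 (2 * (7 * t - 3) * y 13 t + 4 * y 14 t - 4 * y 4 t * y 10 t
                + 4 * (5 * t - 3) * (y 4 t * q + y 10 t * p) + 4 * y 5 t * q + 4 * y 11 t * p
                - 2 * (47 * t\<^sup>2 - 46 * t + 9) * p * q))"

definition critical_bounds :: "(real \<Rightarrow> nat \<Rightarrow> real \<Rightarrow> real) \<Rightarrow> real set" where
  "critical_bounds y =
     {M. M > 11 \<and>
         (y M 3 (1 - 1 / M) = 0 \<or>
          y M 3 (1 - 1 / M) * y M 9 (1 - 1 / M) - (y M 15 (1 - 1 / M))\<^sup>2 = 0)}"

end

theory Submission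
  imports Defs
begin

text \<open>Let \<open>T = 1 - 1/M\<close> and \<open>r = 1/T\<close>. Factoring \<open>f / M\<close> into many univalent self-maps of the disk with
  prescribed derivatives at \<open>0\<close> (a discrete Loewner chain) expresses \<open>a\<^sub>4\<close>, up to an error that vanishes
  with the mesh, by the first three moments of probability measures on the circle, one for each time
  in \<open>[0, T]\<close>; the Pick function belongs to the point masses at the angle \<open>0\<close>. Around it, \<open>Re a\<^sub>4\<close> decreases by
  the mean excess of Pontryagin's Hamiltonian and increases by a quadratic form in the means of the
  sine. The excess is nonnegative exactly if \<open>M \<ge> 11\<close>, and to second order the balance is
  \<open>- T\<^sup>3\<close> times the second variation \<open>b\<^sub>r\<close> on \<open>[0, 1]\<close>. If \<open>b\<^sub>r\<close> is coercive, a cutoff of the sine turns this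
  into an upper bound for all nearby \<open>f\<close>. If \<open>b\<^sub>r\<close> takes a negative value, compositions of slit maps with
  small angles exceed the Pick function, and for \<open>M < 11\<close> a single short slit at a large angle does.

  In rescaled time the Cauchy problem is the Jacobi equation of \<open>b\<^sub>r\<close> with two inhomogeneities:
  \<open>y\<^sub>3\<close>, \<open>y\<^sub>9\<close>, \<open>y\<^sub>1\<^sub>5\<close> at \<open>T\<close> are the same negative multiple of \<open>b\<^sub>r(u\<^sub>p, u\<^sub>p)\<close>, \<open>b\<^sub>r(u\<^sub>q, u\<^sub>q)\<close>, \<open>b\<^sub>r(u\<^sub>p, u\<^sub>q)\<close>, and a
  semidefinite \<open>b\<^sub>r\<close> degenerates only on the span of \<open>u\<^sub>p\<close> and \<open>u\<^sub>q\<close>. Since \<open>b\<^sub>r\<close> is strictly decreasing in \<open>r\<close>,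
  coercive at \<open>r = 1\<close> and indefinite at \<open>r = 11/10\<close>, its coercivity is lost at exactly one \<open>r\<close>,
  and the corresponding \<open>M\<close> is \<open>M\<^sub>0\<close>.\<close>

section \<open>Piecewise continuous functions and their primitives\<close>

text \<open>The two sides of the balance have the same order. If \<open>e1\<close> is the mean of
  \<open>1 - cos\<close> and \<open>s1\<close> the mean of \<open>sin\<close>, one only has
  \<open>s1\<^sup>2 \<le> 2 * e1\<close>; so the linear excess and the quadratic form must be
  compared exactly, and only terms of order \<open>e1\<close> to the power 3/2 may be absorbed by a
  fixed multiple of the total of \<open>e1\<close>. This total is \<open>T - Re a_2 / 2\<close> up
  to a mesh error. Closeness to the Pick function therefore enters through \<open>a_2\<close> alone,
  and once the neighbourhood is fixed the mesh can be refined for each single \<open>f\<close>.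
  Rescaling time to \<open>[0, 1]\<close> leaves \<open>M\<close> only in the weight and in one
  coefficient of the form, both decreasing in \<open>r\<close> on the relevant range. Hence a null
  vector at the critical ratio has a negative value at every larger ratio. In place of spectral
  theory there are integral equations and a Gronwall bound: modulo the span of two Jacobi fields, a
  semidefinite form is controlled by its own Euler operator.\<close>

definition pwc :: "(real \<Rightarrow> real) \<Rightarrow> bool" where
  "pwc f \<longleftrightarrow> (\<exists>S. finite S \<and> continuous_on ({0..1} - S) f) \<and> bounded (f ` {0..1})"

definition prim :: "(real \<Rightarrow> real) \<Rightarrow> real \<Rightarrow> real" where
  "prim f s = integral {0..s} f"

lemma pwc_continuous: "continuous_on {0..1} f \<Longrightarrow> pwc f"
  unfolding pwc_def
  by (metis Diff_empty compact_continuous_image compact_Icc compact_imp_bounded finite.emptyI)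

lemma pwcE:
  assumes "pwc f"
  obtains S B where "finite S" "continuous_on ({0..1} - S) f" "0 \<le> B" "\<And>x. x \<in> {0..1} \<Longrightarrow> \<bar>f x\<bar> \<le> B"
proof -
  from assms obtain S B where "finite S" "continuous_on ({0..1} - S) f" "\<forall>x\<in>{0..1}. \<bar>f x\<bar> \<le> B"
    unfolding pwc_def bounded_iff by auto
  then show ?thesis by (intro that[of S "\<bar>B\<bar>"]) (auto intro: order_trans[OF _ abs_ge_self])
qed

text \<open>The class has to contain the step functions of the discretization as well as the
  continuous Jacobi fields; the bound built into \<open>pwc\<close> keeps squares and products
  inside it.\<close>

lemma pwc_mult:
  assumes "pwc f" "pwc g"
  shows "pwc (\<lambda>x. f x * g x)"
proof -
  obtain S a where S: "finite S" "continuous_on ({0..1} - S) f" "0 \<le> a" "\<And>x. x \<in> {0..1} \<Longrightarrow> \<bar>f x\<bar> \<le> a"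
    using pwcE[OF assms(1)] by blast
  obtain T b where T: "finite T" "continuous_on ({0..1} - T) g" "0 \<le> b" "\<And>x. x \<in> {0..1} \<Longrightarrow> \<bar>g x\<bar> \<le> b"
    using pwcE[OF assms(2)] by blast
  have "continuous_on ({0..1} - (S \<union> T)) (\<lambda>x. f x * g x)"
    by (intro continuous_intros continuous_on_subset[OF S(2)] continuous_on_subset[OF T(2)]) auto
  moreover have "\<bar>f x * g x\<bar> \<le> a * b" if "x \<in> {0..1}" for x
    unfolding abs_mult using S(3,4) T(3,4) that by (intro mult_mono) auto
  ultimately show ?thesis using S(1) T(1) unfolding pwc_def bounded_iff
    by (intro conjI exI[of _ "S \<union> T"] exI[of _ "a * b"]) auto
qed

lemma pwc_add:
  assumes "pwc f" "pwc g"
  shows "pwc (\<lambda>x. f x + g x)"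
proof -
  obtain S T where S: "finite S" "continuous_on ({0..1} - S) f"
    and T: "finite T" "continuous_on ({0..1} - T) g"
    using assms unfolding pwc_def by auto
  have "continuous_on ({0..1} - (S \<union> T)) (\<lambda>x. f x + g x)"
    by (intro continuous_intros continuous_on_subset[OF S(2)] continuous_on_subset[OF T(2)]) auto
  then show ?thesis using S(1) T(1) assms unfolding pwc_def
    by (intro conjI exI[of _ "S \<union> T"] bounded_plus_comp) auto
qed

lemma pwc_const: "pwc (\<lambda>x. c)"
  by (simp add: pwc_continuous)

lemma pwc_cmult: "pwc f \<Longrightarrow> pwc (\<lambda>x. c * f x)"
  using pwc_mult[OF pwc_const] .

lemma pwc_diff: "pwc f \<Longrightarrow> pwc g \<Longrightarrow> pwc (\<lambda>x. f x - g x)"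
  using pwc_add[of f "\<lambda>x. -1 * g x"] pwc_cmult[of g "-1"] by simp

lemma pwc_power2: "pwc f \<Longrightarrow> pwc (\<lambda>x. (f x)\<^sup>2)"
  unfolding power2_eq_square by (rule pwc_mult)

lemma pwc_abs:
  assumes "pwc f"
  shows "pwc (\<lambda>x. \<bar>f x\<bar>)"
proof -
  obtain S where S: "finite S" "continuous_on ({0..1} - S) f" using assms unfolding pwc_def by auto
  have "continuous_on ({0..1} - S) (\<lambda>x. \<bar>f x\<bar>)" by (intro continuous_intros S)
  with S(1) assms show ?thesis unfolding pwc_def bounded_iff by auto
qed

text \<open>Set to zero on the finite exceptional set, the function becomes Borel measurable, and a
  bounded measurable function is integrable on an interval.\<close>

lemma pwc_integrable:
  assumes "pwc f" "0 \<le> a" "b \<le> 1"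
  shows "f integrable_on {a..b}"
proof -
  obtain S B where S: "finite S" "continuous_on ({0..1} - S) f" "0 \<le> B" "\<And>x. x \<in> {0..1} \<Longrightarrow> \<bar>f x\<bar> \<le> B"
    using pwcE[OF assms(1)] by blast
  define h where "h x = (if x \<in> {0..1} - S then f x else 0)" for x
  have "h \<in> borel_measurable borel"
    unfolding h_def
  proof (rule borel_measurable_continuous_on_if)
    show "{0..1} - S \<in> sets borel" using S(1) by (simp add: borel_closed finite_imp_closed sets.Diff)
  qed (use S in auto)
  then have hm: "h \<in> borel_measurable (lebesgue_on {a..b})"
    by (intro measurable_restrict_space1 measurable_completion) simp
  have "h integrable_on {a..b}"
  proof (rule measurable_bounded_by_integrable_imp_integrable_real[OF hm])
    show "(\<lambda>x. B) integrable_on {a..b}" by (rule integrable_const_ivl)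
    show "\<bar>h x\<bar> \<le> B" if "x \<in> {a..b}" for x
      using S(3) S(4)[of x] that assms by (auto simp: h_def)
  qed simp
  then show ?thesis
  proof (rule integrable_spike_finite[OF S(1), rotated -1])
    show "f x = h x" if "x \<in> {a..b} - S" for x using that assms by (auto simp: h_def)
  qed
qed

lemma prim_0 [simp]: "prim f 0 = 0"
  by (simp add: prim_def)

lemma continuous_on_prim: "pwc f \<Longrightarrow> continuous_on {0..1} (prim f)"
  unfolding prim_def[abs_def] by (rule indefinite_integral_continuous_1[OF pwc_integrable]) auto

lemma pwc_prim: "pwc f \<Longrightarrow> pwc (prim f)"
  by (rule pwc_continuous[OF continuous_on_prim])

lemma prim_has_derivative:
  assumes "pwc f"
  obtains S where "finite S" "\<And>x. x \<in> {0<..<1} - S \<Longrightarrow> (prim f has_real_derivative f x) (at x)"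
proof -
  obtain S where S: "finite S" "continuous_on ({0..1} - S) f" using assms unfolding pwc_def by auto
  have "(prim f has_real_derivative f x) (at x)" if x: "x \<in> {0<..<1} - S" for x
  proof -
    have o: "open ({0<..<1} - S)" using S(1) by (simp add: finite_imp_closed open_Diff)
    have "(prim f has_vector_derivative f x) (at x within ({0..1} - S))"
      unfolding prim_def[abs_def]
      using x S by (intro integral_has_vector_derivative_continuous_at pwc_integrable assms)
        (auto simp: continuous_on_eq_continuous_within)
    then have "(prim f has_vector_derivative f x) (at x within ({0<..<1} - S))"
      by (rule has_vector_derivative_within_subset) auto
    then show ?thesis
      unfolding has_real_derivative_iff_has_vector_derivative at_within_open[OF x o] .
  qed
  with S(1) show ?thesis by (rule that)
qed

lemma prim_has_derivative_continuous:
  assumes "continuous_on {0..1} f" "x \<in> {0..1}"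
  shows "(prim f has_real_derivative f x) (at x within {0..1})"
  unfolding prim_def[abs_def] has_real_derivative_iff_has_vector_derivative
  using assms by (rule integral_has_vector_derivative)

lemma pwc_FTC:
  assumes "finite S" "0 \<le> s" "s \<le> 1" "continuous_on {0..1} F"
    "\<And>x. x \<in> {0<..<1} - S \<Longrightarrow> (F has_real_derivative f x) (at x)"
  shows "prim f s = F s - F 0"
  unfolding prim_def
proof (rule integral_unique, rule fundamental_theorem_of_calculus_interior_strong[OF assms(1,2)])
  show "(F has_vector_derivative f x) (at x)" if "x \<in> {0<..<s} - S" for x
    using assms(5)[of x] that assms by (auto simp: has_real_derivative_iff_has_vector_derivative)
  show "continuous_on {0..s} F" by (rule continuous_on_subset[OF assms(4)]) (use assms in auto)
qed

lemma prim_add: "pwc f \<Longrightarrow> pwc g \<Longrightarrow> s \<le> 1 \<Longrightarrow> prim (\<lambda>x. f x + g x) s = prim f s + prim g s"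
  unfolding prim_def by (intro integral_add pwc_integrable) auto

lemma prim_diff: "pwc f \<Longrightarrow> pwc g \<Longrightarrow> s \<le> 1 \<Longrightarrow> prim (\<lambda>x. f x - g x) s = prim f s - prim g s"
  unfolding prim_def by (intro integral_diff pwc_integrable) auto

lemma prim_cmult: "prim (\<lambda>x. c * f x) s = c * prim f s"
  unfolding prim_def by simp

lemma prim_const: "0 \<le> s \<Longrightarrow> prim (\<lambda>x. c) s = c * s"
  unfolding prim_def by simp

lemma prim_mono:
  assumes "pwc f" "pwc g" "s \<le> 1" "\<And>x. x \<in> {0..s} \<Longrightarrow> f x \<le> g x"
  shows "prim f s \<le> prim g s"
  unfolding prim_def using assms by (intro integral_le pwc_integrable) auto

lemma prim_nonneg:
  assumes "pwc f" "0 \<le> s" "s \<le> 1" "\<And>x. x \<in> {0..1} \<Longrightarrow> 0 \<le> f x"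
  shows "0 \<le> prim f s"
  unfolding prim_def using assms by (intro integral_nonneg pwc_integrable) auto

lemma prim_abs_le:
  assumes "pwc f" "s \<le> 1"
  shows "\<bar>prim f s\<bar> \<le> prim (\<lambda>x. \<bar>f x\<bar>) s"
  using integral_norm_bound_integral[of f "{0..s}" "\<lambda>x. \<bar>f x\<bar>"]
  by (simp add: prim_def pwc_integrable pwc_abs assms)

lemma prim_mono_upper:
  assumes "pwc f" "0 \<le> s" "s \<le> t" "t \<le> 1" "\<And>x. x \<in> {0..1} \<Longrightarrow> 0 \<le> f x"
  shows "prim f s \<le> prim f t"
  unfolding prim_def using assms by (intro integral_subset_le pwc_integrable) auto

lemma prim_Cauchy_Schwarz:
  assumes f: "pwc f" and g: "pwc g" and s: "0 \<le> s" "s \<le> 1"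
  shows "(prim (\<lambda>x. f x * g x) s)\<^sup>2 \<le> prim (\<lambda>x. (f x)\<^sup>2) s * prim (\<lambda>x. (g x)\<^sup>2) s"
proof -
  define a b c where "a = prim (\<lambda>x. (f x)\<^sup>2) s" and "b = prim (\<lambda>x. f x * g x) s" and "c = prim (\<lambda>x. (g x)\<^sup>2) s"
  have q: "0 \<le> l\<^sup>2 * a + 2 * l * m * b + m\<^sup>2 * c" for l m :: real
  proof -
    have "0 \<le> prim (\<lambda>x. (l * f x + m * g x)\<^sup>2) s"
      by (intro prim_nonneg pwc_power2 pwc_add pwc_cmult f g s) auto
    also have "(\<lambda>x. (l * f x + m * g x)\<^sup>2) =
        (\<lambda>x. l\<^sup>2 * (f x)\<^sup>2 + (2 * l * m) * (f x * g x) + m\<^sup>2 * (g x)\<^sup>2)"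
      by (auto simp: power2_eq_square algebra_simps)
    also have "prim \<dots> s = l\<^sup>2 * a + 2 * l * m * b + m\<^sup>2 * c"
      unfolding a_def b_def c_def
      by (simp add: prim_add prim_cmult pwc_add pwc_cmult pwc_mult pwc_power2 f g s)
    finally show ?thesis .
  qed
  have a: "0 \<le> a" and c: "0 \<le> c" unfolding a_def c_def
    by (intro prim_nonneg pwc_power2 f g s; simp)+
  show ?thesis
  proof (cases "a = 0")
    case True
    have "b = 0"
    proof (rule ccontr)
      assume "b \<noteq> 0"
      \<comment> \<open>With \<open>a = 0\<close> and \<open>m = 1\<close>, this choice of
        \<open>l\<close> would give the form the value -1.\<close>
      have "2 * (-(c+1)/(2*b)) * 1 * b = -(c+1)" using \<open>b \<noteq> 0\<close> by simp
      with q[of "-(c+1)/(2*b)" 1] True show False by simp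
    qed
    then show ?thesis using a c by (simp add: a_def[symmetric] b_def[symmetric] c_def[symmetric])
  next
    case False
    have "0 \<le> a * (a * c - b\<^sup>2)" using q[of "-b" a] by (simp add: power2_eq_square algebra_simps)
    with False a have "b\<^sup>2 \<le> a * c" by (simp add: zero_le_mult_iff)
    then show ?thesis by (simp add: a_def b_def c_def)
  qed
qed

lemma prim_pos_continuous:
  assumes "continuous_on {0..1} f" "x \<in> {0..1}" "f x \<noteq> 0"
  shows "0 < prim (\<lambda>x. (f x)\<^sup>2) 1"
proof -
  have c: "continuous_on {0..1} (\<lambda>x. (f x)\<^sup>2)" by (intro continuous_intros assms)
  have "0 \<le> prim (\<lambda>x. (f x)\<^sup>2) 1" by (intro prim_nonneg pwc_continuous c) auto
  moreover have "prim (\<lambda>x. (f x)\<^sup>2) 1 \<noteq> 0"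
    unfolding prim_def using integral_eq_0_iff[OF c] assms by auto
  ultimately show ?thesis by linarith
qed

section \<open>The second variation\<close>

text \<open>With \<open>r = 1 / T\<close> and \<open>s = t / T\<close>, the product with
  \<open>T\<^sup>2\<close> is \<open>u_denom M t\<close>. Completing the square gives
  \<open>(4 * s - (3 * r - 2))\<^sup>2 + (11 - 10 * r)\<close>; hence the bound
  \<open>r < 11/10\<close>, that is \<open>M > 11\<close>.\<close>

definition legendre_weight :: "real \<Rightarrow> real \<Rightarrow> real" where
  "legendre_weight r s = 16 * s\<^sup>2 - (24 * r - 16) * s + 15 - 22 * r + 9 * r\<^sup>2"

text \<open>Polarized, so that the values at the two Jacobi fields and their mixed value are
  instances of one expression. As long as the weight is positive and \<open>r < 3\<close>, only the
  middle term can make the form negative.\<close>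

definition second_variation :: "real \<Rightarrow> (real \<Rightarrow> real) \<Rightarrow> (real \<Rightarrow> real) \<Rightarrow> real" where
  "second_variation r f g =
     prim (\<lambda>s. legendre_weight r s * (f s * g s)) 1
     - 4 * prim (\<lambda>s. (prim f s + 2 * prim f 1) * (prim g s + 2 * prim g 1)) 1
     + (60 - 20 * r) * (prim f 1 * prim g 1)"

text \<open>Half the gradient of the quadratic form. Setting it to zero says that
  \<open>legendre_weight r s * g s + 4 * prim (prim g) s\<close> is an affine function of
  \<open>s\<close>, whose coefficients are tied to \<open>prim g 1\<close> and
  \<open>prim (prim g) 1\<close>.\<close>

definition euler_op :: "real \<Rightarrow> (real \<Rightarrow> real) \<Rightarrow> real \<Rightarrow> real" where
  "euler_op r g s = legendre_weight r s * g s + 4 * prim (\<lambda>s. prim g s + 2 * prim g 1) s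
     - 12 * prim (\<lambda>s. prim g s + 2 * prim g 1) 1 + (60 - 20 * r) * prim g 1"

lemmas pwc_intros = pwc_const pwc_mult pwc_add pwc_diff pwc_power2 pwc_prim

lemma continuous_legendre_weight: "continuous_on A (legendre_weight r)"
  unfolding legendre_weight_def[abs_def] by (intro continuous_intros)

lemma pwc_legendre_weight: "pwc (legendre_weight r)"
  by (rule pwc_continuous[OF continuous_legendre_weight])

lemma pwc_euler_op: "pwc g \<Longrightarrow> pwc (euler_op r g)"
  unfolding euler_op_def[abs_def] by (intro pwc_intros pwc_legendre_weight)

lemma second_variation_commute: "second_variation r f g = second_variation r g f"
  by (simp add: second_variation_def mult.commute)

lemma second_variation_add_left:
  assumes "pwc f" "pwc g" "pwc h"
  shows "second_variation r (\<lambda>s. f s + g s) h = second_variation r f h + second_variation r g h"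
proof -
  note p = pwc_intros pwc_legendre_weight assms
  have 1: "prim (\<lambda>s. legendre_weight r s * ((f s + g s) * h s)) 1 =
      prim (\<lambda>s. legendre_weight r s * (f s * h s)) 1 + prim (\<lambda>s. legendre_weight r s * (g s * h s)) 1"
    by (subst prim_add[symmetric]) (simp_all add: p algebra_simps)
  have s: "prim (\<lambda>s. f s + g s) s = prim f s + prim g s" if "s \<le> 1" for s
    by (intro prim_add assms that)
  have "prim (\<lambda>s. (prim (\<lambda>s. f s + g s) s + 2 * prim (\<lambda>s. f s + g s) 1) * (prim h s + 2 * prim h 1)) 1
      = prim (\<lambda>s. (prim f s + 2 * prim f 1) * (prim h s + 2 * prim h 1) +
                  (prim g s + 2 * prim g 1) * (prim h s + 2 * prim h 1)) 1"
    unfolding prim_def[of _ 1] by (rule integral_cong) (simp add: s[unfolded prim_def] prim_def s algebra_simps)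
  also have "\<dots> = prim (\<lambda>s. (prim f s + 2 * prim f 1) * (prim h s + 2 * prim h 1)) 1 +
      prim (\<lambda>s. (prim g s + 2 * prim g 1) * (prim h s + 2 * prim h 1)) 1"
    by (intro prim_add pwc_intros assms) simp
  finally show ?thesis unfolding second_variation_def 1 by (simp add: s algebra_simps)
qed

lemma second_variation_cmult_left:
  "second_variation r (\<lambda>s. c * f s) h = c * second_variation r f h"
proof -
  have "(\<lambda>s. legendre_weight r s * (c * f s * h s)) = (\<lambda>s. c * (legendre_weight r s * (f s * h s)))"
    "(\<lambda>s. (c * prim f s + 2 * (c * prim f 1)) * (prim h s + 2 * prim h 1)) =
      (\<lambda>s. c * ((prim f s + 2 * prim f 1) * (prim h s + 2 * prim h 1)))"
    by (auto simp: algebra_simps)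
  then show ?thesis unfolding second_variation_def prim_cmult by (simp only: prim_cmult) (simp add: algebra_simps)
qed

text \<open>Integration by parts moves the primitive from \<open>f\<close> to the other factor. The
  coefficient 12 collects 4 from the boundary term and 8 from the shift
  \<open>2 * prim f 1\<close>.\<close>

lemma second_variation_euler:
  assumes f: "pwc f" and g: "pwc g"
  shows "second_variation r f g = prim (\<lambda>s. f s * euler_op r g s) 1"
proof -
  note p = pwc_intros pwc_legendre_weight assms
  define G where "G s = prim g s + 2 * prim g 1" for s
  have G: "continuous_on {0..1} G" unfolding G_def by (intro continuous_intros continuous_on_prim g)
  then have pG: "pwc G" by (rule pwc_continuous)
  obtain S where S: "finite S" "\<And>x. x \<in> {0<..<1} - S \<Longrightarrow> (prim f has_real_derivative f x) (at x)"
    using prim_has_derivative[OF f] by blast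
  have "prim (\<lambda>s. f s * prim G s + prim f s * G s) 1 = prim f 1 * prim G 1 - prim f 0 * prim G 0"
  proof (rule pwc_FTC[OF S(1)])
    show "continuous_on {0..1} (\<lambda>s. prim f s * prim G s)"
      by (intro continuous_intros continuous_on_prim f pG)
    fix x assume x: "x \<in> {0<..<1} - S"
    have "(prim G has_real_derivative G x) (at x within {0..1})"
      using x by (intro prim_has_derivative_continuous G) auto
    then have "(prim G has_real_derivative G x) (at x)"
      using x at_within_Icc_at[of 0 x 1] by simp
    then show "((\<lambda>s. prim f s * prim G s) has_real_derivative f x * prim G x + prim f x * G x) (at x)"
      using S(2)[OF x] by (auto intro!: derivative_eq_intros)
  qed auto
  then have 1: "prim (\<lambda>s. f s * prim G s) 1 = prim f 1 * prim G 1 - prim (\<lambda>s. prim f s * G s) 1"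
    by (subst (asm) prim_add) (simp_all add: p pG)
  have 2: "prim (\<lambda>s. (prim f s + 2 * prim f 1) * G s) 1 =
      prim (\<lambda>s. prim f s * G s) 1 + 2 * prim f 1 * prim G 1"
  proof -
    have "(\<lambda>s. (prim f s + 2 * prim f 1) * G s) = (\<lambda>s. prim f s * G s + (2 * prim f 1) * G s)"
      by (simp add: algebra_simps)
    then show ?thesis by (simp add: prim_add p pG prim_cmult)
  qed
  have "prim (\<lambda>s. f s * euler_op r g s) 1 =
     prim (\<lambda>s. legendre_weight r s * (f s * g s) + (4 * (f s * prim G s) +
        (- 12 * prim G 1 + (60 - 20 * r) * prim g 1) * f s)) 1"
    unfolding euler_op_def G_def[symmetric] by (rule arg_cong2[where f=prim]) (auto simp: algebra_simps)
  also have "\<dots> = prim (\<lambda>s. legendre_weight r s * (f s * g s)) 1 + (4 * prim (\<lambda>s. f s * prim G s) 1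
     + (- 12 * prim G 1 + (60 - 20 * r) * prim g 1) * prim f 1)"
    by (simp add: prim_add prim_cmult p pG pwc_cmult)
  finally show ?thesis
    unfolding second_variation_def G_def[symmetric] 1 2 by (simp add: algebra_simps)
qed

lemma prim_power2_le:
  assumes "pwc f" "0 \<le> s" "s \<le> 1"
  shows "(prim f s)\<^sup>2 \<le> prim (\<lambda>x. (f x)\<^sup>2) 1"
proof -
  have n: "0 \<le> prim (\<lambda>x. (f x)\<^sup>2) s" using assms by (intro prim_nonneg pwc_power2) auto
  have "(prim f s)\<^sup>2 \<le> prim (\<lambda>x. (f x)\<^sup>2) s * prim (\<lambda>x. 1\<^sup>2) s"
    using prim_Cauchy_Schwarz[OF assms(1) pwc_const[of 1] assms(2,3)] by simp
  also have "\<dots> \<le> prim (\<lambda>x. (f x)\<^sup>2) s * 1"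
    using n assms by (intro mult_left_mono) (auto simp: prim_const)
  also have "\<dots> \<le> prim (\<lambda>x. (f x)\<^sup>2) 1"
    using assms by (simp, intro prim_mono_upper pwc_power2) auto
  finally show ?thesis .
qed

text \<open>The factor \<open>9 * (q + r) - 22 - 24 * s\<close> lies between
  \<open>18 - 22 - 24 = -28\<close> and \<open>108/5 - 22 = -2/5\<close>. The limit
  \<open>6/5\<close> leaves room above \<open>11/10\<close> and still keeps this factor
  negative.\<close>

lemma legendre_weight_diff:
  assumes "1 \<le> r" "r \<le> q" "q \<le> 6/5" "0 \<le> s" "s \<le> 1"
  shows "legendre_weight q s - legendre_weight r s \<le> - (2/5) * (q - r)"
    "legendre_weight q s - legendre_weight r s \<ge> - 28 * (q - r)"
proof -
  have e: "legendre_weight q s - legendre_weight r s = (q - r) * (9 * (q + r) - 22 - 24 * s)"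
    by (simp add: legendre_weight_def power2_eq_square algebra_simps)
  show "legendre_weight q s - legendre_weight r s \<le> - (2/5) * (q - r)"
    unfolding e using mult_left_mono[of "9 * (q + r) - 22 - 24 * s" "-(2/5)" "q - r"] assms by (simp add: mult.commute)
  show "legendre_weight q s - legendre_weight r s \<ge> - 28 * (q - r)"
    unfolding e using mult_left_mono[of "-28" "9 * (q + r) - 22 - 24 * s" "q - r"] assms by (simp add: mult.commute)
qed

text \<open>The middle term of the form is free of \<open>r\<close>, so the dependence on
  \<open>r\<close> is explicit. Both contributions decrease for \<open>1 \<le> r \<le> 6/5\<close>,
  so coercivity, once lost, does not return in this range.\<close>

lemma second_variation_diff:
  assumes f: "pwc f"
  shows "second_variation q f f - second_variation r f f =
    prim (\<lambda>s. (legendre_weight q s - legendre_weight r s) * (f s)\<^sup>2) 1 - 20 * (q - r) * (prim f 1)\<^sup>2"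
proof -
  have "prim (\<lambda>s. (legendre_weight q s - legendre_weight r s) * (f s)\<^sup>2) 1 =
     prim (\<lambda>s. legendre_weight q s * (f s * f s) - legendre_weight r s * (f s * f s)) 1"
    by (simp add: algebra_simps power2_eq_square)
  also have "\<dots> = prim (\<lambda>s. legendre_weight q s * (f s * f s)) 1 - prim (\<lambda>s. legendre_weight r s * (f s * f s)) 1"
    by (intro prim_diff pwc_intros pwc_legendre_weight f) simp
  finally show ?thesis by (simp add: second_variation_def power2_eq_square algebra_simps)
qed

lemma second_variation_decreasing:
  assumes f: "pwc f" and "1 \<le> r" "r \<le> q" "q \<le> 6/5"
  shows "second_variation q f f \<le> second_variation r f f - (2/5) * (q - r) * prim (\<lambda>s. (f s)\<^sup>2) 1"
proof -
  have "prim (\<lambda>s. (legendre_weight q s - legendre_weight r s) * (f s)\<^sup>2) 1 \<le>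
      prim (\<lambda>s. (- (2/5) * (q - r)) * (f s)\<^sup>2) 1"
    using assms legendre_weight_diff(1)[OF assms(2-4)]
    by (intro prim_mono pwc_intros pwc_legendre_weight f mult_right_mono) auto
  moreover have "0 \<le> 20 * (q - r) * (prim f 1)\<^sup>2" using assms by simp
  ultimately show ?thesis using second_variation_diff[OF f, of q r] unfolding prim_cmult by linarith
qed

text \<open>The constant 48 is 28 from the weight plus 20 from the coefficient of
  \<open>(prim f 1)\<^sup>2\<close>.\<close>

lemma second_variation_lipschitz:
  assumes f: "pwc f" and "1 \<le> r" "r \<le> q" "q \<le> 6/5"
  shows "second_variation q f f \<ge> second_variation r f f - 48 * (q - r) * prim (\<lambda>s. (f s)\<^sup>2) 1"
proof -
  have "prim (\<lambda>s. (legendre_weight q s - legendre_weight r s) * (f s)\<^sup>2) 1 \<ge>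
      prim (\<lambda>s. (- 28 * (q - r)) * (f s)\<^sup>2) 1"
    using assms legendre_weight_diff(2)[OF assms(2-4)]
    by (intro prim_mono pwc_intros pwc_legendre_weight f mult_right_mono) auto
  moreover have "20 * (q - r) * (prim f 1)\<^sup>2 \<le> 20 * (q - r) * prim (\<lambda>s. (f s)\<^sup>2) 1"
    using assms prim_power2_le[OF f, of 1] by (intro mult_left_mono) auto
  ultimately show ?thesis using second_variation_diff[OF f, of q r] unfolding prim_cmult by (simp add: algebra_simps)
qed

lemma second_variation_upper:
  assumes f: "pwc f" and r: "1 \<le> r" "r \<le> 6/5"
  shows "second_variation r f f \<le> 100 * prim (\<lambda>s. (f s)\<^sup>2) 1"
proof -
  have "legendre_weight r s \<le> 60" if "s \<in> {0..1}" for s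
  proof -
    have "r\<^sup>2 \<le> (6/5)\<^sup>2" using r by (intro power_mono) auto
    moreover have "s\<^sup>2 \<le> 1" using that by (auto simp: power_le_one)
    moreover have "0 \<le> (24 * r - 16) * s" using r that by (intro mult_nonneg_nonneg) auto
    ultimately show ?thesis using r unfolding legendre_weight_def by (simp add: power2_eq_square)
  qed
  then have "prim (\<lambda>s. legendre_weight r s * (f s * f s)) 1 \<le> prim (\<lambda>s. 60 * (f s)\<^sup>2) 1"
    using r by (intro prim_mono pwc_intros pwc_legendre_weight f) (auto simp: power2_eq_square intro!: mult_right_mono)
  moreover have "0 \<le> prim (\<lambda>s. (prim f s + 2 * prim f 1) * (prim f s + 2 * prim f 1)) 1"
    by (intro prim_nonneg pwc_intros f) auto
  moreover have "(60 - 20 * r) * (prim f 1 * prim f 1) \<le> 40 * prim (\<lambda>s. (f s)\<^sup>2) 1"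
    using r prim_power2_le[OF f, of 1] by (intro mult_mono) (auto simp: power2_eq_square)
  ultimately show ?thesis unfolding second_variation_def by (simp add: prim_cmult)
qed

lemma psd_Cauchy_Schwarz:
  fixes a b c :: real
  assumes "\<And>l m. 0 \<le> l\<^sup>2 * a + 2 * l * m * b + m\<^sup>2 * c"
  shows "b\<^sup>2 \<le> a * c"
proof -
  have a: "0 \<le> a" and c: "0 \<le> c" using assms[of 1 0] assms[of 0 1] by auto
  show ?thesis
  proof (cases "a = 0")
    case True
    have "b = 0"
    proof (rule ccontr)
      assume "b \<noteq> 0"
      have "2 * (-(c+1)/(2*b)) * 1 * b = -(c+1)" using \<open>b \<noteq> 0\<close> by simp
      with assms[of "-(c+1)/(2*b)" 1] True show False by simp
    qed
    then show ?thesis using a c by simp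
  next
    case False
    have "0 \<le> a * (a * c - b\<^sup>2)" using assms[of "-b" a] by (simp add: power2_eq_square algebra_simps)
    with False a show ?thesis by (simp add: zero_le_mult_iff)
  qed
qed

lemma second_variation_combination:
  assumes f: "pwc f" and g: "pwc g"
  shows "second_variation r (\<lambda>s. l * f s + m * g s) (\<lambda>s. l * f s + m * g s) =
    l\<^sup>2 * second_variation r f f + 2 * l * m * second_variation r f g + m\<^sup>2 * second_variation r g g"
proof -
  note p = pwc_cmult pwc_add f g
  have 1: "second_variation r (\<lambda>s. l * f s + m * g s) h = l * second_variation r f h + m * second_variation r g h"
    if "pwc h" for h
    by (subst second_variation_add_left) (simp_all add: p that second_variation_cmult_left)
  show ?thesis
    by (subst 1, simp add: p, subst (1 2) second_variation_commute, subst (1 2) 1)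
       (simp_all add: p second_variation_commute[of r g f] power2_eq_square algebra_simps)
qed

lemma second_variation_Cauchy_Schwarz:
  assumes "\<And>f. pwc f \<Longrightarrow> 0 \<le> second_variation r f f" and f: "pwc f" and g: "pwc g"
  shows "(second_variation r f g)\<^sup>2 \<le> second_variation r f f * second_variation r g g"
proof (rule psd_Cauchy_Schwarz)
  fix l m :: real
  show "0 \<le> l\<^sup>2 * second_variation r f f + 2 * l * m * second_variation r f g + m\<^sup>2 * second_variation r g g"
    unfolding second_variation_combination[OF f g, symmetric] using f g by (intro assms(1) pwc_add pwc_cmult)
qed

section \<open>Jacobi fields and coercivity\<close>

lemma add_power2_le: "(x + y)\<^sup>2 \<le> 2 * x\<^sup>2 + 2 * y\<^sup>2" for x y :: real
  using zero_le_power2[of "x - y"] by (simp add: power2_eq_square algebra_simps)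

text \<open>By Cayley-Hamilton, trace times the matrix minus determinant times the identity is the
  square of the matrix, hence a sum of squares. So determinant over trace bounds the form from
  below.\<close>

lemma posdef_lower:
  fixes a b c :: real
  assumes "0 < a" "b\<^sup>2 < a * c"
  shows "(a * c - b\<^sup>2) / (a + c) * (x\<^sup>2 + y\<^sup>2) \<le> x\<^sup>2 * a + 2 * x * y * b + y\<^sup>2 * c" "0 < c"
proof -
  have "0 < a * c" using assms(2) zero_le_power2[of b] by linarith
  then show c: "0 < c" using assms(1) by (simp add: zero_less_mult_iff)
  have "(a + c) * (x\<^sup>2 * a + 2 * x * y * b + y\<^sup>2 * c) - (a * c - b\<^sup>2) * (x\<^sup>2 + y\<^sup>2)
      = (a * x + b * y)\<^sup>2 + (b * x + c * y)\<^sup>2"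
    by (simp add: power2_eq_square algebra_simps)
  then have "(a * c - b\<^sup>2) * (x\<^sup>2 + y\<^sup>2) \<le> (a + c) * (x\<^sup>2 * a + 2 * x * y * b + y\<^sup>2 * c)"
    by (metis add_nonneg_nonneg diff_ge_0_iff_ge zero_le_power2)
  then show "(a * c - b\<^sup>2) / (a + c) * (x\<^sup>2 + y\<^sup>2) \<le> x\<^sup>2 * a + 2 * x * y * b + y\<^sup>2 * c"
    using assms(1) c by (simp add: divide_le_eq mult.commute)
qed

text \<open>Compare with \<open>exp (l * s)\<close> at the maximum of the quotient.\<close>

lemma prim_Gronwall:
  assumes m: "continuous_on {0..1} m" and A: "0 \<le> A" and k: "0 < k"
    and le: "\<And>s. s \<in> {0..1} \<Longrightarrow> m s \<le> A + k * prim m s" and s: "s \<in> {0..1}"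
  shows "m s \<le> 2 * A * exp (2 * k)"
proof -
  define q where "q s = exp (- (2 * k * s)) * m s" for s
  have "continuous_on {0..1} q" unfolding q_def by (intro continuous_intros m)
  then obtain z where z: "z \<in> {0..1}" "\<And>s. s \<in> {0..1} \<Longrightarrow> q s \<le> q z"
    using continuous_attains_sup[of "{0..1}" q] by auto
  define E where "E = max 0 (q z)"
  have mE: "m s \<le> E * exp (2 * k * s)" if "s \<in> {0..1}" for s
  proof -
    have "m s = q s * exp (2 * k * s)" by (simp add: q_def exp_minus field_simps)
    also have "\<dots> \<le> E * exp (2 * k * s)" using z(2)[OF that] by (intro mult_right_mono) (auto simp: E_def)
    finally show ?thesis .
  qed
  have ex: "continuous_on {0..1} (\<lambda>s. E * exp (2 * k * s))" by (intro continuous_intros)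
  have "prim m z \<le> prim (\<lambda>s. E * exp (2 * k * s)) z"
    using z(1) mE by (intro prim_mono pwc_continuous m ex) auto
  also have "\<dots> = E * exp (2 * k * z) / (2 * k) - E * exp (2 * k * 0) / (2 * k)"
  proof (rule pwc_FTC[of "{}"])
    show "continuous_on {0..1} (\<lambda>s. E * exp (2 * k * s) / (2 * k))"
      by (intro continuous_intros) (use k in auto)
    show "((\<lambda>s. E * exp (2 * k * s) / (2 * k)) has_real_derivative E * exp (2 * k * x)) (at x)" for x
      using k by (auto intro!: derivative_eq_intros)
  qed (use z in auto)
  also have "\<dots> \<le> E * exp (2 * k * z) / (2 * k)" using k by (simp add: E_def)
  finally have "k * prim m z \<le> E * exp (2 * k * z) / 2" using k by (simp add: field_simps)
  then have "m z \<le> A + E * exp (2 * k * z) / 2" using le[OF z(1)] by linarith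
  then have "exp (- (2 * k * z)) * m z \<le> exp (- (2 * k * z)) * (A + E * exp (2 * k * z) / 2)"
    by (intro mult_left_mono) auto
  also have "\<dots> = exp (- (2 * k * z)) * A + E / 2" by (simp add: exp_minus field_simps)
  also have "\<dots> \<le> 1 * A + E / 2" using k z A by (intro add_right_mono mult_right_mono) auto
  \<comment> \<open>The doubled rate in the exponent leaves only \<open>E / 2\<close> on the right,
    which is absorbed on the left.\<close>
  finally have "E \<le> 2 * A" using A by (auto simp: E_def q_def max_def split: if_splits)
  then have "m s \<le> 2 * A * exp (2 * k * s)"
    using mE[OF s] by (meson exp_ge_zero mult_right_mono order_trans)
  also have "\<dots> \<le> 2 * A * exp (2 * k)" using s k A by (intro mult_left_mono) auto
  finally show ?thesis .
qed

text \<open>Solutions of the Jacobi equation with a free affine inhomogeneity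
  span the candidates for the kernel of the second variation.\<close>

lemma jacobi_perturbation:
  assumes w: "pwc w" "\<And>s. s \<in> {0..1} \<Longrightarrow> d0 \<le> w s" and d0: "0 < d0"
  obtains C where "0 \<le> C" "\<And>f \<rho>. pwc f \<Longrightarrow> pwc \<rho> \<Longrightarrow>
      (\<And>s. s \<in> {0..1} \<Longrightarrow> w s * f s = \<rho> s - 4 * prim (prim f) s) \<Longrightarrow>
      prim (\<lambda>s. (f s)\<^sup>2) 1 \<le> C * prim (\<lambda>s. (\<rho> s)\<^sup>2) 1"
proof (rule that)
  define k where "k = 4 / d0"
  define e where "e = 2 * (1 / d0) * exp (2 * k)"
  have k: "0 < k" using d0 by (simp add: k_def)
  have e: "0 \<le> e" using d0 by (simp add: e_def)
  show "0 \<le> 2 / d0\<^sup>2 + 2 * (4 * e / d0)\<^sup>2" by simp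
  fix f \<rho> assume f: "pwc f" and \<rho>: "pwc \<rho>" and eq: "\<And>s. s \<in> {0..1} \<Longrightarrow> w s * f s = \<rho> s - 4 * prim (prim f) s"
  define R where "R = prim (\<lambda>s. (\<rho> s)\<^sup>2) 1"
  \<comment> \<open>The integral of \<open>\<bar>f\<bar>\<close> dominates \<open>prim f\<close>, so
    the equation turns into a Gronwall inequality for \<open>m\<close>.\<close>
  define m where "m = prim (\<lambda>s. \<bar>f s\<bar>)"
  have R: "0 \<le> R" unfolding R_def by (intro prim_nonneg pwc_power2 \<rho>) auto
  have mc: "continuous_on {0..1} m" unfolding m_def by (intro continuous_on_prim pwc_abs f)
  have m0: "0 \<le> m s" if "s \<in> {0..1}" for s
    unfolding m_def using that by (intro prim_nonneg pwc_abs f) auto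
  have pm: "pwc m" by (rule pwc_continuous[OF mc])
  have 2: "\<bar>prim (prim f) s\<bar> \<le> prim m s" if "s \<in> {0..1}" for s
  proof -
    have "\<bar>prim (prim f) s\<bar> \<le> prim (\<lambda>s. \<bar>prim f s\<bar>) s" using that by (intro prim_abs_le pwc_prim f) auto
    also have "\<dots> \<le> prim m s" unfolding m_def
      using that by (intro prim_mono pwc_abs pwc_prim f prim_abs_le) auto
    finally show ?thesis .
  qed
  have 3: "\<bar>f s\<bar> \<le> (1/d0) * \<bar>\<rho> s\<bar> + k * prim m s" if s: "s \<in> {0..1}" for s
  proof -
    have "d0 * \<bar>f s\<bar> \<le> w s * \<bar>f s\<bar>" using w(2)[OF s] by (intro mult_right_mono) auto
    also have "\<dots> = \<bar>\<rho> s - 4 * prim (prim f) s\<bar>" using w(2)[OF s] d0 eq[OF s] by (simp add: abs_mult flip: eq[OF s])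
    also have "\<dots> \<le> \<bar>\<rho> s\<bar> + 4 * prim m s" using 2[OF s] by linarith
    finally show ?thesis using d0 by (simp add: k_def field_simps)
  qed
  have 4: "m s \<le> e * sqrt R" if s: "s \<in> {0..1}" for s
  proof -
    have "m s \<le> 2 * ((1 / d0) * sqrt R) * exp (2 * k)"
    proof (rule prim_Gronwall[OF mc _ k _ s])
      show "0 \<le> (1 / d0) * sqrt R" using d0 R by simp
      fix s :: real assume s: "s \<in> {0..1}"
      have "m s \<le> prim (\<lambda>x. (1/d0) * \<bar>\<rho> x\<bar> + k * prim m s) s"
        unfolding m_def
      proof (rule prim_mono)
        fix x assume x: "x \<in> {0..s}"
        have "prim m x \<le> prim m s" using x s m0 by (intro prim_mono_upper pm) auto
        then show "\<bar>f x\<bar> \<le> (1/d0) * \<bar>\<rho> x\<bar> + k * prim (prim (\<lambda>s. \<bar>f s\<bar>)) s"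
          using 3[of x] x s k unfolding m_def[symmetric]
          by (smt (verit, best) atLeastAtMost_iff mult_left_mono)
      qed (use s in \<open>(intro pwc_intros pwc_abs f \<rho> | simp)+\<close>)
      also have "\<dots> = (1/d0) * prim (\<lambda>x. \<bar>\<rho> x\<bar>) s + k * prim m s * s"
        using s by (simp add: prim_add pwc_cmult pwc_const pwc_abs \<rho> prim_cmult prim_const del: times_divide_eq_left)
      also have "\<dots> \<le> (1/d0) * sqrt R + k * prim m s * 1"
      proof (intro add_mono mult_left_mono)
        have "(prim (\<lambda>x. \<bar>\<rho> x\<bar>) s)\<^sup>2 \<le> R"
          using prim_power2_le[of "\<lambda>x. \<bar>\<rho> x\<bar>" s] s by (simp add: R_def pwc_abs \<rho>)
        then show "prim (\<lambda>x. \<bar>\<rho> x\<bar>) s \<le> sqrt R" by (rule real_le_rsqrt)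
        show "0 \<le> k * prim m s" using k s m0 by (intro mult_nonneg_nonneg prim_nonneg pm) auto
      qed (use d0 s in auto)
      finally show "m s \<le> (1/d0) * sqrt R + k * prim m s" by simp
    qed
    then show ?thesis by (simp add: e_def algebra_simps)
  qed
  have "prim (\<lambda>s. (f s)\<^sup>2) 1 \<le> prim (\<lambda>s. (2 / d0\<^sup>2) * (\<rho> s)\<^sup>2 + 2 * (4 * e / d0)\<^sup>2 * R) 1"
  proof (rule prim_mono)
    fix s :: real assume s: "s \<in> {0..1}"
    have "prim m s \<le> prim (\<lambda>x. e * sqrt R) s"
      using s 4 by (intro prim_mono pm pwc_const) auto
    also have "\<dots> \<le> e * sqrt R * 1" using s e R by (subst prim_const) (auto intro!: mult_left_le)
    finally have "k * prim m s \<le> k * (e * sqrt R)" using k by (intro mult_left_mono) auto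
    with 3[OF s] have "\<bar>f s\<bar> \<le> (1/d0) * \<bar>\<rho> s\<bar> + k * (e * sqrt R)" by linarith
    then have "\<bar>f s\<bar>\<^sup>2 \<le> ((1/d0) * \<bar>\<rho> s\<bar> + k * (e * sqrt R))\<^sup>2" by (rule power_mono) simp
    also have "\<dots> \<le> 2 * ((1/d0) * \<bar>\<rho> s\<bar>)\<^sup>2 + 2 * (k * (e * sqrt R))\<^sup>2"
      by (rule add_power2_le)
    also have "\<dots> = (2 / d0\<^sup>2) * (\<rho> s)\<^sup>2 + 2 * (4 * e / d0)\<^sup>2 * R"
      using R by (simp add: k_def power_mult_distrib power_divide)
    finally show "(f s)\<^sup>2 \<le> (2 / d0\<^sup>2) * (\<rho> s)\<^sup>2 + 2 * (4 * e / d0)\<^sup>2 * R" by simp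
  qed (intro pwc_intros f \<rho> | simp)+
  also have "\<dots> = (2 / d0\<^sup>2 + 2 * (4 * e / d0)\<^sup>2) * R"
    unfolding R_def prim_add[OF pwc_cmult[OF pwc_power2[OF \<rho>]] pwc_const order_refl]
    unfolding prim_cmult by (simp add: prim_const algebra_simps)
  finally show "prim (\<lambda>s. (f s)\<^sup>2) 1 \<le> (2 / d0\<^sup>2 + 2 * (4 * e / d0)\<^sup>2) * prim (\<lambda>s. (\<rho> s)\<^sup>2) 1"
    unfolding R_def .
qed

definition coercive_at :: "real \<Rightarrow> bool" where
  "coercive_at r \<longleftrightarrow> (\<exists>\<kappa>>0. \<forall>f. pwc f \<longrightarrow> \<kappa> * prim (\<lambda>s. (f s)\<^sup>2) 1 \<le> second_variation r f f)"

text \<open>The inhomogeneities are \<open>a\<close> and \<open>b + c * s\<close>. As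
  \<open>a\<close> and \<open>c\<close> are nonzero they span all affine functions, so
  \<open>p\<close> and \<open>q\<close> span all solutions with an affine right-hand side.\<close>

locale jacobi_fields =
  fixes r :: real and p q :: "real \<Rightarrow> real" and a b c :: real
  assumes r: "1 \<le> r" "r \<le> 6/5" and w_pos: "\<And>s. s \<in> {0..1} \<Longrightarrow> 0 < legendre_weight r s"
    and cont: "continuous_on {0..1} p" "continuous_on {0..1} q" and ac: "a \<noteq> 0" "c \<noteq> 0"
    and p: "\<And>s. s \<in> {0..1} \<Longrightarrow> legendre_weight r s * p s = a - 4 * prim (prim p) s"
    and q: "\<And>s. s \<in> {0..1} \<Longrightarrow> legendre_weight r s * q s = b + c * s - 4 * prim (prim q) s"
begin

lemma pwc_p: "pwc p" and pwc_q: "pwc q"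
  using cont by (auto intro: pwc_continuous)

text \<open>A vanishing combination has a vanishing double primitive, so the affine function
  \<open>l * a + m * (b + c * s)\<close> would vanish as well.\<close>

lemma combination_nonzero:
  assumes "(l, m) \<noteq> (0, 0)"
  shows "0 < prim (\<lambda>s. (l * p s + m * q s)\<^sup>2) 1"
proof (rule ccontr)
  have cc: "continuous_on {0..1} (\<lambda>s. l * p s + m * q s)" by (intro continuous_intros cont)
  assume "\<not> ?thesis"
  then have z: "l * p s + m * q s = 0" if "s \<in> {0..1}" for s
    using prim_pos_continuous[OF cc that] by auto
  have e: "l * a + m * (b + c * s) = 0" if s: "s \<in> {0..1}" for s
  proof -
    have x1: "l * prim p x + m * prim q x = 0" if "x \<in> {0..1}" for x
    proof -
      have "l * prim p x + m * prim q x = prim (\<lambda>s. l * p s + m * q s) x"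
        using that by (simp add: prim_add pwc_cmult pwc_p pwc_q prim_cmult)
      also have "\<dots> = prim (\<lambda>s. 0) x" unfolding prim_def by (rule integral_cong) (use z that in auto)
      finally show ?thesis by (simp add: prim_def)
    qed
    have "l * prim (prim p) s + m * prim (prim q) s = prim (\<lambda>s. l * prim p s + m * prim q s) s"
      using s by (simp add: prim_add pwc_cmult pwc_prim pwc_p pwc_q prim_cmult)
    also have "\<dots> = prim (\<lambda>s. 0) s" unfolding prim_def[of _ s] by (rule integral_cong) (use x1 s in auto)
    finally have "l * prim (prim p) s + m * prim (prim q) s = 0" by (simp add: prim_def)
    moreover have "l * (legendre_weight r s * p s) + m * (legendre_weight r s * q s) = legendre_weight r s * (l * p s + m * q s)"
      by (simp add: algebra_simps)
    moreover have "l * a + m * (b + c * s) = l * (legendre_weight r s * p s + 4 * prim (prim p) s)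
        + m * (legendre_weight r s * q s + 4 * prim (prim q) s)"
      unfolding p[OF s] q[OF s] by simp
    ultimately show ?thesis using z[OF s] by (simp add: distrib_left)
  qed
  have "m * c = (l * a + m * (b + c * 1)) - (l * a + m * (b + c * 0))" by (simp add: algebra_simps)
  also have "\<dots> = 0" using e[of 0] e[of 1] by simp
  finally have "m = 0" using ac by simp
  with e[of 0] ac have "l = 0" by simp
  with \<open>m = 0\<close> assms show False by simp
qed

abbreviation "Q\<^sub>p \<equiv> second_variation r p p"
abbreviation "Q\<^sub>q \<equiv> second_variation r q q"
abbreviation "Q\<^sub>p\<^sub>q \<equiv> second_variation r p q"

lemma coercive_imp:
  assumes "coercive_at r"
  shows "0 < Q\<^sub>p" "Q\<^sub>p\<^sub>q\<^sup>2 < Q\<^sub>p * Q\<^sub>q"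
proof -
  have pos: "0 < l\<^sup>2 * Q\<^sub>p + 2 * l * m * Q\<^sub>p\<^sub>q + m\<^sup>2 * Q\<^sub>q" if "(l, m) \<noteq> (0, 0)" for l m
  proof -
    obtain k where "k > 0" "\<And>f. pwc f \<Longrightarrow> k * prim (\<lambda>s. (f s)\<^sup>2) 1 \<le> second_variation r f f"
      using assms unfolding coercive_at_def by blast
    then have "0 < k * prim (\<lambda>s. (l * p s + m * q s)\<^sup>2) 1"
        "k * prim (\<lambda>s. (l * p s + m * q s)\<^sup>2) 1 \<le> second_variation r (\<lambda>s. l * p s + m * q s) (\<lambda>s. l * p s + m * q s)"
      using combination_nonzero[OF that] by (simp, blast intro: pwc_add pwc_cmult pwc_p pwc_q)
    then show ?thesis unfolding second_variation_combination[OF pwc_p pwc_q] by linarith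
  qed
  show 1: "0 < Q\<^sub>p" using pos[of 1 0] by simp
  \<comment> \<open>The combination with coefficients \<open>- Q\<^sub>p\<^sub>q\<close> and
    \<open>Q\<^sub>p\<close> is orthogonal to \<open>p\<close> with respect to the form; its value
    is \<open>Q\<^sub>p\<close> times the determinant.\<close>
  have "0 < Q\<^sub>p * (Q\<^sub>p * Q\<^sub>q - Q\<^sub>p\<^sub>q\<^sup>2)" using pos[of "-Q\<^sub>p\<^sub>q" "Q\<^sub>p"] 1 by (simp add: power2_eq_square algebra_simps)
  with 1 show "Q\<^sub>p\<^sub>q\<^sup>2 < Q\<^sub>p * Q\<^sub>q" by (simp add: zero_less_mult_iff)
qed

lemma degenerate_imp:
  assumes nn: "\<And>f. pwc f \<Longrightarrow> 0 \<le> second_variation r f f" and "Q\<^sub>p * Q\<^sub>q = Q\<^sub>p\<^sub>q\<^sup>2"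
  obtains f where "continuous_on {0..1} f" "0 < prim (\<lambda>s. (f s)\<^sup>2) 1" "second_variation r f f = 0"
proof -
  obtain l m where lm: "(l, m) \<noteq> (0, 0)" "l\<^sup>2 * Q\<^sub>p + 2 * l * m * Q\<^sub>p\<^sub>q + m\<^sup>2 * Q\<^sub>q = 0"
  proof (cases "Q\<^sub>p = 0")
    case True
    then show ?thesis by (intro that[of 1 0]) auto
  next
    case False
    have "Q\<^sub>p\<^sub>q\<^sup>2 * Q\<^sub>p + 2 * (- Q\<^sub>p\<^sub>q) * Q\<^sub>p * Q\<^sub>p\<^sub>q + Q\<^sub>p\<^sup>2 * Q\<^sub>q = Q\<^sub>p * (Q\<^sub>p * Q\<^sub>q - Q\<^sub>p\<^sub>q\<^sup>2)"
      by (simp add: power2_eq_square algebra_simps)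
    with False assms(2) show ?thesis by (intro that[of "- Q\<^sub>p\<^sub>q" "Q\<^sub>p"]) auto
  qed
  show ?thesis
  proof (rule that)
    show "continuous_on {0..1} (\<lambda>s. l * p s + m * q s)" by (intro continuous_intros cont)
    show "0 < prim (\<lambda>s. (l * p s + m * q s)\<^sup>2) 1" by (rule combination_nonzero[OF lm(1)])
    show "second_variation r (\<lambda>s. l * p s + m * q s) (\<lambda>s. l * p s + m * q s) = 0"
      unfolding second_variation_combination[OF pwc_p pwc_q] by (rule lm(2))
  qed
qed

text \<open>Subtract from \<open>f\<close> the combination \<open>g\<close> of \<open>p\<close> and
  \<open>q\<close> with the same affine inhomogeneity. The rest \<open>h\<close> solves the Jacobi
  equation with right-hand side \<open>euler_op r f\<close>, whose square integral is controlled by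
  the form itself. On the span of \<open>p\<close> and \<open>q\<close> the form is a positive
  definite two by two matrix. Both estimates together bound the square integral of
  \<open>f\<close>.\<close>

lemma nondegenerate_imp_coercive:
  assumes nn: "\<And>f. pwc f \<Longrightarrow> 0 \<le> second_variation r f f" and nd: "Q\<^sub>p * Q\<^sub>q \<noteq> Q\<^sub>p\<^sub>q\<^sup>2"
  shows "coercive_at r"
proof -
  note pw = pwc_intros pwc_p pwc_q pwc_cmult pwc_euler_op
  have "Q\<^sub>p\<^sub>q\<^sup>2 < Q\<^sub>p * Q\<^sub>q"
    using second_variation_Cauchy_Schwarz[OF nn pwc_p pwc_q] nd by simp
  moreover have "0 < Q\<^sub>p" using nn[OF pwc_p] calculation zero_le_power2[of "Q\<^sub>p\<^sub>q"]
    by (cases "Q\<^sub>p = 0") (auto simp del: zero_le_power2)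
  ultimately have pd: "0 < Q\<^sub>p" "Q\<^sub>p\<^sub>q\<^sup>2 < Q\<^sub>p * Q\<^sub>q" by auto
  define k where "k = (Q\<^sub>p * Q\<^sub>q - Q\<^sub>p\<^sub>q\<^sup>2) / (Q\<^sub>p + Q\<^sub>q)"
  define P where "P = prim (\<lambda>s. (p s)\<^sup>2) 1 + prim (\<lambda>s. (q s)\<^sup>2) 1"
  have k: "0 < k" unfolding k_def using pd posdef_lower(2)[OF pd] by simp
  have P: "0 < P" using combination_nonzero[of 1 0] combination_nonzero[of 0 1] by (simp add: P_def)
  have span: "k / (2 * P) * prim (\<lambda>s. (l * p s + m * q s)\<^sup>2) 1 \<le>
      second_variation r (\<lambda>s. l * p s + m * q s) (\<lambda>s. l * p s + m * q s)" for l m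
  proof -
    have "prim (\<lambda>s. (l * p s + m * q s)\<^sup>2) 1 \<le> prim (\<lambda>s. 2 * l\<^sup>2 * (p s)\<^sup>2 + 2 * m\<^sup>2 * (q s)\<^sup>2) 1"
    proof (rule prim_mono)
      show "(l * p s + m * q s)\<^sup>2 \<le> 2 * l\<^sup>2 * (p s)\<^sup>2 + 2 * m\<^sup>2 * (q s)\<^sup>2" for s
        using zero_le_power2[of "l * p s - m * q s"] by (simp add: power2_eq_square algebra_simps)
    qed (auto intro!: pw)
    also have "\<dots> = 2 * l\<^sup>2 * prim (\<lambda>s. (p s)\<^sup>2) 1 + 2 * m\<^sup>2 * prim (\<lambda>s. (q s)\<^sup>2) 1"
      by (simp add: prim_add prim_cmult pw)
    also have "\<dots> \<le> 2 * P * (l\<^sup>2 + m\<^sup>2)"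
    proof -
      have "0 \<le> prim (\<lambda>s. (p s)\<^sup>2) 1" "0 \<le> prim (\<lambda>s. (q s)\<^sup>2) 1" by (auto intro!: prim_nonneg pw)
      then have "0 \<le> prim (\<lambda>s. (q s)\<^sup>2) 1 * l\<^sup>2" "0 \<le> prim (\<lambda>s. (p s)\<^sup>2) 1 * m\<^sup>2" by auto
      then show ?thesis by (simp add: P_def algebra_simps)
    qed
    finally have "k / (2 * P) * prim (\<lambda>s. (l * p s + m * q s)\<^sup>2) 1 \<le> k / (2 * P) * (2 * P * (l\<^sup>2 + m\<^sup>2))"
      using k P by (intro mult_left_mono) auto
    also have "\<dots> = k * (l\<^sup>2 + m\<^sup>2)" using P by simp
    also have "\<dots> \<le> l\<^sup>2 * Q\<^sub>p + 2 * l * m * Q\<^sub>p\<^sub>q + m\<^sup>2 * Q\<^sub>q"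
      unfolding k_def by (rule posdef_lower(1)[OF pd])
    finally show ?thesis unfolding second_variation_combination[OF pwc_p pwc_q] .
  qed
  obtain x0 where x0: "x0 \<in> {0..1}" "\<And>s. s \<in> {0..1} \<Longrightarrow> legendre_weight r x0 \<le> legendre_weight r s"
    using continuous_attains_inf[of "{0..1}" "legendre_weight r"] continuous_legendre_weight by auto
  obtain C where C: "0 \<le> C" "\<And>f \<rho>. pwc f \<Longrightarrow> pwc \<rho> \<Longrightarrow>
      (\<And>s. s \<in> {0..1} \<Longrightarrow> legendre_weight r s * f s = \<rho> s - 4 * prim (prim f) s) \<Longrightarrow>
      prim (\<lambda>s. (f s)\<^sup>2) 1 \<le> C * prim (\<lambda>s. (\<rho> s)\<^sup>2) 1"
    using jacobi_perturbation[OF pwc_legendre_weight x0(2) w_pos[OF x0(1)]] by blast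
  \<comment> \<open>Cauchy-Schwarz for the semidefinite form at \<open>euler_op r f\<close> and
    \<open>f\<close>: the mixed value is the square integral \<open>R\<close> of the Euler operator,
    and the form at \<open>euler_op r f\<close> is at most \<open>100 * R\<close>.\<close>
  have euler_bound: "prim (\<lambda>s. (euler_op r f s)\<^sup>2) 1 \<le> 100 * second_variation r f f" if f: "pwc f" for f
  proof -
    define R where "R = prim (\<lambda>s. (euler_op r f s)\<^sup>2) 1"
    have R: "0 \<le> R" unfolding R_def by (intro prim_nonneg pw f) auto
    have "R = second_variation r (euler_op r f) f"
      by (simp add: second_variation_euler pw f R_def power2_eq_square)
    then have "R\<^sup>2 \<le> second_variation r (euler_op r f) (euler_op r f) * second_variation r f f"
      using second_variation_Cauchy_Schwarz[OF nn, of "euler_op r f" f] f pw by auto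
    also have "\<dots> \<le> (100 * R) * second_variation r f f"
      unfolding R_def by (intro mult_right_mono second_variation_upper r nn f pw)
    finally have "R * R \<le> R * (100 * second_variation r f f)" by (simp add: power2_eq_square algebra_simps)
    then show ?thesis using R nn[OF f] unfolding R_def[symmetric]
      by (cases "R = 0") (auto simp: mult_le_cancel_left)
  qed
  define K where "K = 2 * ((2 * P / k) * (2 + 20000 * C)) + 2 * (100 * C)"
  have K: "0 \<le> K" unfolding K_def using C(1) k P by (auto intro!: add_nonneg_nonneg mult_nonneg_nonneg)
  have main: "prim (\<lambda>s. (f s)\<^sup>2) 1 \<le> K * second_variation r f f" if f: "pwc f" for f
  proof -
    define E where "E = second_variation r f f"
    define X where "X = prim f 1"
    define c0 where "c0 = 12 * prim (\<lambda>s. prim f s + 2 * X) 1 - (60 - 20 * r) * X"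
    \<comment> \<open>With these coefficients the inhomogeneity of \<open>g\<close> is
      \<open>c0 - 8 * X * s\<close>, the affine part of \<open>euler_op r f\<close> moved to the
      other side.\<close>
    define m where "m = - 8 * X / c"
    define l where "l = (c0 - m * b) / a"
    define g where "g = (\<lambda>s. l * p s + m * q s)"
    define h where "h = (\<lambda>s. f s - g s)"
    have pg: "pwc g" and ph: "pwc h" unfolding g_def h_def by (auto intro!: pw f)
    have E: "0 \<le> E" unfolding E_def by (rule nn[OF f])
    have jac: "legendre_weight r s * h s = euler_op r f s - 4 * prim (prim h) s" if s: "s \<in> {0..1}" for s
    proof -
      have pf: "prim (\<lambda>s. prim f s + 2 * X) s = prim (prim f) s + 2 * X * s"
        using s by (simp add: prim_add pw f prim_const)
      have 1: "legendre_weight r s * f s = euler_op r f s + c0 - 8 * X * s - 4 * prim (prim f) s"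
        unfolding euler_op_def X_def[symmetric] pf c0_def by (simp add: algebra_simps)
      have pg1: "prim g x = l * prim p x + m * prim q x" if "x \<le> 1" for x
        unfolding g_def using that by (simp add: prim_add pw prim_cmult)
      have "prim (prim g) s = prim (\<lambda>x. l * prim p x + m * prim q x) s"
        unfolding prim_def[of _ s] by (rule integral_cong) (use s pg1 in auto)
      then have pg2: "prim (prim g) s = l * prim (prim p) s + m * prim (prim q) s"
        using s by (simp add: prim_add pw prim_cmult)
      have "legendre_weight r s * g s = l * (legendre_weight r s * p s) + m * (legendre_weight r s * q s)"
        by (simp add: g_def algebra_simps)
      also have "\<dots> = l * a + m * b + m * c * s - 4 * prim (prim g) s"
        unfolding p[OF s] q[OF s] pg2 by (simp add: algebra_simps)
      also have "\<dots> = c0 - 8 * X * s - 4 * prim (prim g) s" using ac by (simp add: l_def m_def)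
      finally have 2: "legendre_weight r s * g s = c0 - 8 * X * s - 4 * prim (prim g) s" .
      have "prim (prim h) s = prim (\<lambda>x. prim f x - prim g x) s"
        unfolding prim_def[of _ s] h_def
        by (rule integral_cong) (use s in \<open>auto intro!: prim_diff f pg\<close>)
      then have "prim (prim h) s = prim (prim f) s - prim (prim g) s"
        using s by (simp add: prim_diff pw f pg)
      then show ?thesis using 1 2 by (simp add: h_def algebra_simps)
    qed
    have H: "prim (\<lambda>s. (h s)\<^sup>2) 1 \<le> 100 * C * E"
    proof -
      have "prim (\<lambda>s. (h s)\<^sup>2) 1 \<le> C * prim (\<lambda>s. (euler_op r f s)\<^sup>2) 1" by (rule C(2)) (auto intro!: ph pw f jac)
      also have "\<dots> \<le> C * (100 * E)" unfolding E_def by (intro mult_left_mono euler_bound f C(1))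
      finally show ?thesis by simp
    qed
    define G where "G = prim (\<lambda>s. (g s)\<^sup>2) 1"
    have G0: "0 \<le> G" unfolding G_def by (auto intro!: prim_nonneg pw pg)
    define F where "F = second_variation r g g"
    \<comment> \<open>Parallelogram identity for \<open>g = f - h\<close>; the value at
      \<open>f + h\<close> is nonnegative and dropped.\<close>
    have F: "F \<le> 2 * E + 2 * (100 * (100 * C * E))"
    proof -
      have g: "g = (\<lambda>s. 1 * f s + (-1) * h s)" by (auto simp: h_def)
      have "F + second_variation r (\<lambda>s. 1 * f s + 1 * h s) (\<lambda>s. 1 * f s + 1 * h s) = 2 * E + 2 * second_variation r h h"
        unfolding F_def g second_variation_combination[OF f ph] E_def by simp
      moreover have "0 \<le> second_variation r (\<lambda>s. 1 * f s + 1 * h s) (\<lambda>s. 1 * f s + 1 * h s)"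
        by (intro nn pw f ph)
      moreover have "second_variation r h h \<le> 100 * (100 * C * E)"
        using second_variation_upper[OF ph r] H by simp
      ultimately show ?thesis by linarith
    qed
    have "k / (2 * P) * G \<le> F" unfolding G_def F_def g_def by (rule span)
    then have "G \<le> (2 * P / k) * F" using k P by (simp add: field_simps)
    also have "\<dots> \<le> (2 * P / k) * (2 * E + 2 * (100 * (100 * C * E)))" using F k P by (intro mult_left_mono) auto
    finally have G: "G \<le> (2 * P / k) * (2 + 20000 * C) * E" by (simp add: algebra_simps)
    have "prim (\<lambda>s. (f s)\<^sup>2) 1 \<le> prim (\<lambda>s. 2 * (g s)\<^sup>2 + 2 * (h s)\<^sup>2) 1"
    proof (rule prim_mono)
      show "(f s)\<^sup>2 \<le> 2 * (g s)\<^sup>2 + 2 * (h s)\<^sup>2" for s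
        using zero_le_power2[of "g s - h s"] unfolding h_def by (simp add: power2_eq_square algebra_simps)
    qed (auto intro!: pw pg ph f)
    also have "\<dots> = 2 * G + 2 * prim (\<lambda>s. (h s)\<^sup>2) 1" unfolding G_def by (simp add: prim_add prim_cmult pw pg ph)
    finally have "prim (\<lambda>s. (f s)\<^sup>2) 1 \<le> 2 * G + 2 * (100 * C * E)" using H by linarith
    with G show ?thesis unfolding E_def[symmetric] K_def by (simp add: distrib_right)
  qed
  show ?thesis unfolding coercive_at_def
  proof (intro exI conjI allI impI)
    show "0 < 1 / (K + 1)" using K by simp
    fix f assume f: "pwc f"
    have "prim (\<lambda>s. (f s)\<^sup>2) 1 \<le> (K + 1) * second_variation r f f"
      using main[OF f] nn[OF f] by (simp add: algebra_simps)
    then show "1 / (K + 1) * prim (\<lambda>s. (f s)\<^sup>2) 1 \<le> second_variation r f f"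
      using K by (simp add: field_simps)
  qed
qed

end

section \<open>The Cauchy problem and the Jacobi equation\<close>

lemma eq_if_same_derivative:
  fixes F G :: "real \<Rightarrow> real"
  assumes "\<And>x. x \<in> {0..1} \<Longrightarrow> (F has_real_derivative f x) (at x within {0..1})"
    "\<And>x. x \<in> {0..1} \<Longrightarrow> (G has_real_derivative f x) (at x within {0..1})" "F 0 = G 0" "s \<in> {0..1}"
  shows "F s = G s"
proof -
  have "\<exists>c. \<forall>x\<in>{0..1}. F x - G x = c"
  proof (rule has_field_derivative_zero_constant)
    show "((\<lambda>x. F x - G x) has_real_derivative 0) (at x within {0..1})" if "x \<in> {0..1}" for x
      using DERIV_diff[OF assms(1,2)[OF that]] by simp
  qed simp
  then have "F s - G s = F 0 - G 0" using assms(4) by force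
  with assms(3) show ?thesis by simp
qed

text \<open>One statement for three blocks of the Cauchy problem: \<open>u = v\<close> yields
  \<open>y 3\<close> and \<open>y 9\<close>, the mixed choice yields \<open>y 15\<close>. The
  unknowns of a block are integrated in closed form one after the other, each formula being checked
  by differentiation.\<close>

lemma second_order_terms:
  fixes T :: real and u v z1 z2 z3 :: "real \<Rightarrow> real"
  assumes T: "T \<noteq> 0" and u: "continuous_on {0..1} u" and v: "continuous_on {0..1} v"
    and x4: "\<And>s. s \<in> {0..1} \<Longrightarrow> x4 s = - 2 * T * prim u s" "\<And>s. s \<in> {0..1} \<Longrightarrow> v4 s = - 2 * T * prim v s"
    and x5: "\<And>s. s \<in> {0..1} \<Longrightarrow> x5 s = 4 * T\<^sup>2 * prim (prim u) s + 4 * T * prim u s - 12 * T\<^sup>2 * s * prim u s"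
      "\<And>s. s \<in> {0..1} \<Longrightarrow> v5 s = 4 * T\<^sup>2 * prim (prim v) s + 4 * T * prim v s - 12 * T\<^sup>2 * s * prim v s"
    and z0: "z1 0 = 0" "z2 0 = 0" "z3 0 = 0"
    and z1: "\<And>s. s \<in> {0..1} \<Longrightarrow> (z1 has_real_derivative T * (- 2 * u s * v s)) (at s within {0..1})"
    and z2: "\<And>s. s \<in> {0..1} \<Longrightarrow> (z2 has_real_derivative
        T * (4 * (z1 s + x4 s * v s + v4 s * u s) - 8 * (2 * (T * s) - 1) * u s * v s)) (at s within {0..1})"
    and z3: "\<And>s. s \<in> {0..1} \<Longrightarrow> (z3 has_real_derivative
        T * (2 * (7 * (T * s) - 3) * z1 s + 4 * z2 s - 4 * x4 s * v4 s
             + 4 * (5 * (T * s) - 3) * (x4 s * v s + v4 s * u s) + 4 * x5 s * v s + 4 * v5 s * u s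
             - 2 * (47 * (T * s)\<^sup>2 - 46 * (T * s) + 9) * u s * v s)) (at s within {0..1})"
  shows "z3 1 = - 2 * T ^ 3 * second_variation (1 / T) u v"
proof -
  note pc = prim_has_derivative_continuous
  have cX: "continuous_on {0..1} (prim u)" "continuous_on {0..1} (prim v)"
    using u v by (auto intro: continuous_on_prim pwc_continuous)
  \<comment> \<open>Moments up to degree 2 suffice because the weight is quadratic in
    \<open>s\<close>.\<close>
  define J0 where "J0 = prim (\<lambda>s. u s * v s)"
  define J1 where "J1 = prim (\<lambda>s. s * (u s * v s))"
  define J2 where "J2 = prim (\<lambda>s. s\<^sup>2 * (u s * v s))"
  define K where "K = prim (\<lambda>s. prim u s * prim v s)"
  have d: "\<And>s. s \<in> {0..1} \<Longrightarrow> (J0 has_real_derivative u s * v s) (at s within {0..1})"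
    "\<And>s. s \<in> {0..1} \<Longrightarrow> (J1 has_real_derivative s * (u s * v s)) (at s within {0..1})"
    "\<And>s. s \<in> {0..1} \<Longrightarrow> (J2 has_real_derivative s\<^sup>2 * (u s * v s)) (at s within {0..1})"
    "\<And>s. s \<in> {0..1} \<Longrightarrow> (K has_real_derivative prim u s * prim v s) (at s within {0..1})"
    "\<And>s. s \<in> {0..1} \<Longrightarrow> (prim u has_real_derivative u s) (at s within {0..1})"
    "\<And>s. s \<in> {0..1} \<Longrightarrow> (prim v has_real_derivative v s) (at s within {0..1})"
    "\<And>s. s \<in> {0..1} \<Longrightarrow> (prim (prim u) has_real_derivative prim u s) (at s within {0..1})"
    "\<And>s. s \<in> {0..1} \<Longrightarrow> (prim (prim v) has_real_derivative prim v s) (at s within {0..1})"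
    unfolding J0_def J1_def J2_def K_def
    by (rule pc; (intro continuous_intros u v cX)?; assumption?)+
  have e1: "z1 s = - 2 * T * J0 s" if "s \<in> {0..1}" for s
  proof (rule eq_if_same_derivative[OF z1 _ _ that])
    fix x :: real assume x: "x \<in> {0..1}"
    show "((\<lambda>s. - 2 * T * J0 s) has_real_derivative T * (- 2 * u x * v x)) (at x within {0..1})"
      by (rule derivative_eq_intros d[OF x] refl)+ simp
  qed (simp_all add: z0 J0_def)
  have e2: "z2 s = 4 * (T * s) * (- 2 * T * J0 s) - 8 * T\<^sup>2 * (prim u s * prim v s) + 8 * (T * J0 s - T\<^sup>2 * J1 s)"
    if "s \<in> {0..1}" for s
  proof (rule eq_if_same_derivative[OF z2 _ _ that])
    fix x :: real assume x: "x \<in> {0..1}"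
    show "((\<lambda>s. 4 * (T * s) * (- 2 * T * J0 s) - 8 * T\<^sup>2 * (prim u s * prim v s) + 8 * (T * J0 s - T\<^sup>2 * J1 s))
      has_real_derivative T * (4 * (z1 x + x4 x * v x + v4 x * u x) - 8 * (2 * (T * x) - 1) * u x * v x)) (at x within {0..1})"
      by (rule derivative_eq_intros d[OF x] refl)+ (simp add: e1[OF x] x4[OF x] power2_eq_square algebra_simps)
  qed (simp_all add: z0 J0_def J1_def)
  have e3: "z3 s = - 2 * (16 * T ^ 3 * J2 s - (24 - 16 * (T * s)) * T\<^sup>2 * J1 s
      + (15 * (T * s)\<^sup>2 - 22 * (T * s) + 9) * T * J0 s - 4 * T ^ 3 * K s
      - 8 * T ^ 3 * (prim u s * prim (prim v) s + prim v s * prim (prim u) s)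
      + (44 * (T * s) - 20) * T\<^sup>2 * (prim u s * prim v s))"
    if "s \<in> {0..1}" for s
  proof (rule eq_if_same_derivative[OF z3 _ _ that])
    fix x :: real assume x: "x \<in> {0..1}"
    show "((\<lambda>s. - 2 * (16 * T ^ 3 * J2 s - (24 - 16 * (T * s)) * T\<^sup>2 * J1 s
      + (15 * (T * s)\<^sup>2 - 22 * (T * s) + 9) * T * J0 s - 4 * T ^ 3 * K s
      - 8 * T ^ 3 * (prim u s * prim (prim v) s + prim v s * prim (prim u) s)
      + (44 * (T * s) - 20) * T\<^sup>2 * (prim u s * prim v s)))
      has_real_derivative T * (2 * (7 * (T * x) - 3) * z1 x + 4 * z2 x - 4 * x4 x * v4 x
             + 4 * (5 * (T * x) - 3) * (x4 x * v x + v4 x * u x) + 4 * x5 x * v x + 4 * v5 x * u x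
             - 2 * (47 * (T * x)\<^sup>2 - 46 * (T * x) + 9) * u x * v x)) (at x within {0..1})"
      unfolding e1[OF x] e2[OF x] x4[OF x] x5[OF x]
      by (rule derivative_eq_intros d[OF x] refl)+ (simp add: power2_eq_square power3_eq_cube algebra_simps)
  qed (simp_all add: z0 J0_def J1_def J2_def K_def)
  have p: "pwc u" "pwc v" "pwc (\<lambda>s. s)" using u v by (auto intro!: pwc_continuous continuous_intros)
  note pw = pwc_intros pwc_cmult p
  have w: "prim (\<lambda>s. legendre_weight (1 / T) s * (u s * v s)) 1 =
      16 * J2 1 - (24 / T - 16) * J1 1 + (15 - 22 / T + 9 / T\<^sup>2) * J0 1"
  proof -
    have "(\<lambda>s. legendre_weight (1 / T) s * (u s * v s)) =
      (\<lambda>s. 16 * (s\<^sup>2 * (u s * v s)) - (24 / T - 16) * (s * (u s * v s)) + (15 - 22 / T + 9 / T\<^sup>2) * (u s * v s))"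
      by (auto simp: legendre_weight_def power_divide algebra_simps)
    then show ?thesis unfolding J0_def J1_def J2_def
      by (simp add: prim_add prim_diff prim_cmult pw del: times_divide_eq_left)
  qed
  have k: "prim (\<lambda>s. (prim u s + 2 * prim u 1) * (prim v s + 2 * prim v 1)) 1 =
      K 1 + 2 * prim u 1 * prim (prim v) 1 + 2 * prim v 1 * prim (prim u) 1 + 4 * (prim u 1 * prim v 1)"
  proof -
    have "(\<lambda>s. (prim u s + 2 * prim u 1) * (prim v s + 2 * prim v 1)) =
      (\<lambda>s. prim u s * prim v s + (2 * prim u 1) * prim v s + (2 * prim v 1) * prim u s + 4 * (prim u 1 * prim v 1))"
      by (auto simp: algebra_simps)
    then show ?thesis unfolding K_def by (simp add: prim_add prim_cmult prim_const pw)
  qed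
  show ?thesis unfolding e3[of 1, simplified] second_variation_def w k
    using T by (simp add: field_simps power2_eq_square power3_eq_cube)
qed

text \<open>All terms with a single \<open>prim u\<close> cancel in the numerator of the feedback
  law. What remains is affine in \<open>s\<close> plus the double primitive, and so the law for
  \<open>u\<close> becomes the Jacobi equation.\<close>

lemma jacobi_numerator:
  fixes T M b c :: real and u x4 x5 x6 :: "real \<Rightarrow> real"
  assumes T: "T = 1 - 1 / M" "M \<noteq> 0" and u: "continuous_on {0..1} u"
    and z0: "x4 0 = 0" "x5 0 = 0"
    and d4: "\<And>s. s \<in> {0..1} \<Longrightarrow> (x4 has_real_derivative T * (- 2 * u s)) (at s within {0..1})"
    and d5: "\<And>s. s \<in> {0..1} \<Longrightarrow> (x5 has_real_derivative T * (4 * (x4 s + (1 - 3 * (T * s)) * u s))) (at s within {0..1})"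
    and d6: "\<And>s. s \<in> {0..1} \<Longrightarrow> (x6 has_real_derivative
      T * (- 4 * (T * s + 1 - 4 / M) * u s - 4 * x4 s + b)) (at s within {0..1})"
    and s: "s \<in> {0..1}"
  shows "x4 s = - 2 * T * prim u s"
    "x5 s = 4 * T\<^sup>2 * prim (prim u) s + 4 * T * prim u s - 12 * T\<^sup>2 * s * prim u s"
    "2 * (3 - 4 / M - 5 * (T * s)) * x4 s + 2 * x5 s - x6 s = - x6 0 - T * s * b - 4 * T\<^sup>2 * prim (prim u) s"
proof -
  have cX: "continuous_on {0..1} (prim u)" using u by (auto intro: continuous_on_prim pwc_continuous)
  note pd = prim_has_derivative_continuous[OF u] prim_has_derivative_continuous[OF cX]
  have e4: "x4 s = - 2 * T * prim u s" if "s \<in> {0..1}" for s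
    by (rule eq_if_same_derivative[OF d4 _ _ that]) (auto intro!: derivative_eq_intros pd simp: z0)
  have e5: "x5 s = 4 * T\<^sup>2 * prim (prim u) s + 4 * T * prim u s - 12 * T\<^sup>2 * s * prim u s" if "s \<in> {0..1}" for s
  proof (rule eq_if_same_derivative[OF d5 _ _ that])
    fix x :: real assume x: "x \<in> {0..1}"
    show "((\<lambda>s. 4 * T\<^sup>2 * prim (prim u) s + 4 * T * prim u s - 12 * T\<^sup>2 * s * prim u s) has_real_derivative
      T * (4 * (x4 x + (1 - 3 * (T * x)) * u x))) (at x within {0..1})"
      by (rule derivative_eq_intros pd[OF x] refl)+ (simp add: e4[OF x] power2_eq_square algebra_simps)
  qed (simp_all add: z0)
  have e6: "x6 s = x6 0 + T * s * b + 8 * T\<^sup>2 * prim (prim u) s - 4 * T * (T * s + 1 - 4 / M) * prim u s + 4 * T\<^sup>2 * prim (prim u) s"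
    if "s \<in> {0..1}" for s
  proof (rule eq_if_same_derivative[OF d6 _ _ that])
    fix x :: real assume x: "x \<in> {0..1}"
    show "((\<lambda>s. x6 0 + T * s * b + 8 * T\<^sup>2 * prim (prim u) s - 4 * T * (T * s + 1 - 4 / M) * prim u s + 4 * T\<^sup>2 * prim (prim u) s)
       has_real_derivative T * (- 4 * (T * x + 1 - 4 / M) * u x - 4 * x4 x + b)) (at x within {0..1})"
      by (rule derivative_eq_intros pd[OF x] refl)+ (simp add: e4[OF x] power2_eq_square algebra_simps)
  qed simp_all
  show "x4 s = - 2 * T * prim u s" by (rule e4[OF s])
  show "x5 s = 4 * T\<^sup>2 * prim (prim u) s + 4 * T * prim u s - 12 * T\<^sup>2 * s * prim u s" by (rule e5[OF s])
  show "2 * (3 - 4 / M - 5 * (T * s)) * x4 s + 2 * x5 s - x6 s = - x6 0 - T * s * b - 4 * T\<^sup>2 * prim (prim u) s"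
    unfolding e4[OF s] e5[OF s] e6[OF s] by (simp add: power2_eq_square algebra_simps)
qed

section \<open>Coercivity at \<open>r = 1\<close>, a negative value at \<open>r = 11/10\<close>, and
  the critical ratio in between\<close>

lemma legendre_weight_square: "legendre_weight r s = (4 * s - (3 * r - 2))\<^sup>2 + (11 - 10 * r)"
  by (simp add: legendre_weight_def power2_eq_square algebra_simps)

text \<open>At \<open>r = 1\<close> a polynomial subsolution \<open>w\<close> of the Riccati equation certifies positivity;
  the polynomial inequality is read off from nonnegative Bernstein coefficients in degree 10.\<close>

lemma coercive_at_1: "coercive_at 1"
  unfolding coercive_at_def
proof (intro exI[of _ "1/100"] conjI allI impI)
  fix f assume f: "pwc f"
  define w where "w s = - 7/4 + 6 * s - 11/4 * s\<^sup>2 + 2 * s ^ 3" for s :: real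
  define w' where "w' s = 6 - 11/2 * s + 6 * s\<^sup>2" for s :: real
  define X where "X = prim f 1"
  define Y where "Y s = prim f s + 2 * X" for s
  obtain S where S: "finite S" "\<And>x. x \<in> {0<..<1} - S \<Longrightarrow> (prim f has_real_derivative f x) (at x)"
    using prim_has_derivative[OF f] by blast
  have pY: "pwc Y" and cY: "continuous_on {0..1} Y" unfolding Y_def
    by (auto intro!: pwc_intros f continuous_intros continuous_on_prim)
  have pw: "pwc w" "pwc w'" unfolding w_def w'_def by (auto intro!: pwc_continuous continuous_intros)
  note p = pwc_intros pwc_cmult pwc_legendre_weight f pY pw
  have "prim (\<lambda>s. w' s * (Y s)\<^sup>2 + 2 * (w s * (Y s * f s))) 1 = w 1 * (Y 1)\<^sup>2 - w 0 * (Y 0)\<^sup>2"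
  proof (rule pwc_FTC[OF S(1)])
    show "continuous_on {0..1} (\<lambda>s. w s * (Y s)\<^sup>2)" unfolding w_def by (intro continuous_intros cY)
    fix x assume x: "x \<in> {0<..<1} - S"
    show "((\<lambda>s. w s * (Y s)\<^sup>2) has_real_derivative w' x * (Y x)\<^sup>2 + 2 * (w x * (Y x * f x))) (at x)"
      unfolding w_def w'_def Y_def
      by (rule derivative_eq_intros S(2)[OF x] refl)+ (simp add: power2_eq_square algebra_simps)
  qed auto
  \<comment> \<open>As \<open>Y\<close> runs from \<open>2 * X\<close> to \<open>3 * X\<close>, the
    boundary term is \<open>(9 * w 1 - 4 * w 0) * X\<^sup>2\<close> with \<open>w 1 = 7/2\<close>
    and \<open>w 0 = - 7/4\<close>. It must stay below the coefficient \<open>60 - 20 = 40\<close>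
    of \<open>X\<^sup>2\<close> in the form.\<close>
  then have 1: "prim (\<lambda>s. w' s * (Y s)\<^sup>2 + 2 * (w s * (Y s * f s))) 1 = 77/2 * X\<^sup>2"
    by (simp add: w_def Y_def X_def power2_eq_square)
  have poly: "(w s)\<^sup>2 \<le> (legendre_weight 1 s - 1/100) * (w' s - 4)" if s: "s \<in> {0..1}" for s
  proof -
    have "400 * ((legendre_weight 1 s - 1/100) * (w' s - 4) - (w s)\<^sup>2) =
        2 * ((1600 * s^2 - 800 * s + 199) * (4 - 11 * s + 12 * s^2)) - 25 * (- 7 + 24 * s - 11 * s^2 + 8 * s^3)^2"
      unfolding legendre_weight_def w_def w'_def by (simp add: field_simps power2_eq_square power3_eq_cube)
    also have "\<dots> =
      367 * (1-s)^10 + 1292 * (s * (1-s)^9) + 12039 * (s^2 * (1-s)^8) + 55440 * (s^3 * (1-s)^7)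
      + 108221 * (s^4 * (1-s)^6) + 93362 * (s^5 * (1-s)^5) + 25287 * (s^6 * (1-s)^4) + 1244 * (s^7 * (1-s)^3)
      + 19460 * (s^8 * (1-s)^2) + 19126 * (s^9 * (1-s)) + 5090 * s^10"
      by algebra
    finally have "0 \<le> 400 * ((legendre_weight 1 s - 1/100) * (w' s - 4) - (w s)\<^sup>2)"
      using s by (simp only: atLeastAtMost_iff) (intro add_nonneg_nonneg mult_nonneg_nonneg zero_le_power; simp)
    then show ?thesis by simp
  qed
  have "1/100 * prim (\<lambda>s. (f s)\<^sup>2) 1 = prim (\<lambda>s. 1/100 * (f s)\<^sup>2) 1" by (simp only: prim_cmult)
  also have "\<dots> \<le> prim (\<lambda>s. legendre_weight 1 s * (f s * f s) - 4 * (Y s * Y s)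
      + (w' s * (Y s)\<^sup>2 + 2 * (w s * (Y s * f s)))) 1"
  proof (rule prim_mono)
    fix s :: real assume s: "s \<in> {0..1}"
    define d where "d = legendre_weight 1 s - 1/100"
    have d: "0 < d" unfolding d_def legendre_weight_square using zero_le_power2[of "4 * s - (3 * 1 - 2)"] by linarith
    have "0 \<le> (d * f s + w s * Y s)\<^sup>2 + (d * (w' s - 4) - (w s)\<^sup>2) * (Y s)\<^sup>2"
      using poly[OF s] unfolding d_def by (intro add_nonneg_nonneg mult_nonneg_nonneg) auto
    also have "\<dots> = d * (d * (f s)\<^sup>2 + 2 * w s * Y s * f s + (w' s - 4) * (Y s)\<^sup>2)"
      by (simp add: power2_eq_square algebra_simps)
    finally have "0 \<le> d * (f s)\<^sup>2 + 2 * w s * Y s * f s + (w' s - 4) * (Y s)\<^sup>2"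
      using d by (simp add: zero_le_mult_iff)
    then show "1/100 * (f s)\<^sup>2 \<le> legendre_weight 1 s * (f s * f s) - 4 * (Y s * Y s)
      + (w' s * (Y s)\<^sup>2 + 2 * (w s * (Y s * f s)))"
      unfolding d_def by (simp add: power2_eq_square algebra_simps)
  qed (intro p | simp)+
  also have "\<dots> = prim (\<lambda>s. legendre_weight 1 s * (f s * f s)) 1 - 4 * prim (\<lambda>s. Y s * Y s) 1
      + 77/2 * X\<^sup>2"
    unfolding 1[symmetric]
    by (subst prim_add; (subst prim_diff)?; (intro p | simp add: prim_cmult))
  also have "\<dots> \<le> second_variation 1 f f"
    unfolding second_variation_def X_def[symmetric] Y_def[symmetric] by (simp add: power2_eq_square)
  finally show "1/100 * prim (\<lambda>s. (f s)\<^sup>2) 1 \<le> second_variation 1 f f" .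
qed simp

definition glue :: "real \<Rightarrow> real \<Rightarrow> (real \<Rightarrow> real) \<Rightarrow> (real \<Rightarrow> real) \<Rightarrow> (real \<Rightarrow> real) \<Rightarrow> real \<Rightarrow> real" where
  "glue a b f g h s = (if s \<le> a then f s else if s \<le> b then g s else h s)"

lemma continuous_on_glue:
  assumes "continuous_on UNIV f" "continuous_on UNIV g" "continuous_on UNIV h" "f a = g a" "g b = h b" "a < b"
  shows "continuous_on A (glue a b f g h)"
  unfolding glue_def[abs_def] using assms
  by (intro continuous_on_cases_1) (auto intro: continuous_on_subset)

lemma prim_glue:
  assumes ab: "0 < a" "a < b" "b < 1" "0 \<le> s" "s \<le> 1"
    and F: "\<And>x. (F has_real_derivative f x) (at x)" "\<And>x. (G has_real_derivative g x) (at x)"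
      "\<And>x. (H has_real_derivative h x) (at x)"
  shows "prim (glue a b f g h) s = glue a b (\<lambda>s. F s - F 0) (\<lambda>s. G s - G a + F a - F 0)
      (\<lambda>s. H s - H b + G b - G a + F a - F 0) s"
    (is "_ = glue a b ?F ?G ?H s")
proof -
  have d: "(?F has_real_derivative f x) (at x)" "(?G has_real_derivative g x) (at x)"
      "(?H has_real_derivative h x) (at x)" for x
    by (rule derivative_eq_intros F refl | simp)+
  have "prim (glue a b f g h) s = glue a b ?F ?G ?H s - glue a b ?F ?G ?H 0"
  proof (rule pwc_FTC[of "{a,b}"])
    have "continuous_on UNIV ?F" "continuous_on UNIV ?G" "continuous_on UNIV ?H"
      using d by (blast intro: DERIV_continuous_on has_field_derivative_at_within)+
    then show "continuous_on {0..1} (glue a b ?F ?G ?H)"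
      by (rule continuous_on_glue) (use ab in auto)
    fix x assume x: "x \<in> {0<..<1} - {a, b}"
    consider "x < a" | "a < x" "x < b" | "b < x" using x by fastforce
    then show "(glue a b ?F ?G ?H has_real_derivative glue a b f g h x) (at x)"
    proof cases
      case 1
      have "(glue a b ?F ?G ?H has_real_derivative f x) (at x)"
        by (rule has_field_derivative_transform_within_open[OF d(1), of "{..<a}"]) (use 1 in \<open>auto simp: glue_def\<close>)
      with 1 show ?thesis by (simp add: glue_def)
    next
      case 2
      have "(glue a b ?F ?G ?H has_real_derivative g x) (at x)"
        by (rule has_field_derivative_transform_within_open[OF d(2), of "{a<..<b}"]) (use 2 in \<open>auto simp: glue_def\<close>)
      with 2 show ?thesis by (simp add: glue_def)
    next
      case 3
      have "(glue a b ?F ?G ?H has_real_derivative h x) (at x)"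
        by (rule has_field_derivative_transform_within_open[OF d(3), of "{b<..}"]) (use 3 ab in \<open>auto simp: glue_def\<close>)
      with 3 ab show ?thesis by (simp add: glue_def)
    qed
  qed (use ab in auto)
  then show ?thesis using ab by (simp add: glue_def)
qed

lemma pwc_glue:
  assumes "continuous_on UNIV f" "continuous_on UNIV g" "continuous_on UNIV h" "a < b"
  shows "pwc (glue a b f g h)"
  unfolding pwc_def
proof
  have "continuous_on ({..<a} \<union> {a<..<b} \<union> {b<..}) (glue a b f g h)"
  proof (intro continuous_on_open_Un open_Un)
    show "continuous_on {..<a} (glue a b f g h)"
      by (rule continuous_on_eq[of _ f]) (auto simp: glue_def intro: continuous_on_subset[OF assms(1)])
    show "continuous_on {a<..<b} (glue a b f g h)"
      by (rule continuous_on_eq[of _ g]) (auto simp: glue_def intro: continuous_on_subset[OF assms(2)])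
    show "continuous_on {b<..} (glue a b f g h)"
      by (rule continuous_on_eq[of _ h]) (use assms(4) in \<open>auto simp: glue_def intro: continuous_on_subset[OF assms(3)]\<close>)
  qed auto
  then have "continuous_on ({0..1} - {a, b}) (glue a b f g h)" by (rule continuous_on_subset) auto
  then show "\<exists>S. finite S \<and> continuous_on ({0..1} - S) (glue a b f g h)" by (intro exI[of _ "{a, b}"]) auto
  have "bounded (f ` {0..1} \<union> g ` {0..1} \<union> h ` {0..1})"
    using assms by (intro bounded_Un[THEN iffD2] conjI compact_imp_bounded compact_continuous_image)
      (auto intro: continuous_on_subset)
  then show "bounded (glue a b f g h ` {0..1})"
    by (rule bounded_subset) (auto simp: glue_def)
qed

text \<open>At \<open>r = 11/10\<close> the weight \<open>(4 s - 13/10)\<^sup>2\<close> vanishes at \<open>s = 13/40\<close>,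
  so that a primitive that is nearly discontinuous there costs almost nothing.\<close>

lemma second_variation_negative:
  obtains f where "pwc f" "second_variation (11/10) f f < 0"
proof
  \<comment> \<open>The steep slope \<open>1093/20\<close> acts on an interval of length
    \<open>1/20\<close> centred at \<open>13/40\<close> and lifts the primitive from
    \<open>9/10\<close> to \<open>1453/400\<close>; from there it descends along a parabola to
    \<open>prim f 1 = 1\<close>.\<close>
  define f1 f2 f3 where "f1 = (\<lambda>s::real. 3 :: real)" and "f2 = (\<lambda>s::real. 1093 / 20 :: real)"
    and "f3 = (\<lambda>s::real. 10 * s - 54 / 5 :: real)"
  define X1 X2 X3 where "X1 = (\<lambda>s::real. 3 * s)" and "X2 = (\<lambda>s::real. 1093 / 20 * s - 3099 / 200)"
    and "X3 = (\<lambda>s::real. 5 * s^2 - 54 / 5 * s + 34 / 5)"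
  define f where "f = glue (3/10) (7/20) f1 f2 f3"
  have D: "(X1 has_real_derivative f1 s) (at s)" "(X2 has_real_derivative f2 s) (at s)"
    "(X3 has_real_derivative f3 s) (at s)" for s
    unfolding f1_def f2_def f3_def X1_def X2_def X3_def
    by (rule derivative_eq_intros refl | simp)+
  show pf: "pwc f" unfolding f_def f1_def f2_def f3_def by (rule pwc_glue) (auto intro!: continuous_intros)
  have X: "prim f s = glue (3/10) (7/20) X1 X2 X3 s" if "s \<in> {0..1}" for s
    unfolding f_def using that
    by (subst prim_glue[OF _ _ _ _ _ D]) (auto simp: glue_def X1_def X2_def X3_def algebra_simps power2_eq_square)
  have X1: "prim f 1 = 1" by (simp add: X glue_def X3_def)
  define g1 where "g1 = (\<lambda>s. 108 * s\<^sup>2 - 708 / 5 * s - 79 / 100 :: real)"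
  define g2 where "g2 = (\<lambda>s. 3583947 / 100 * s\<^sup>2 - 1258043 / 50 * s + 172757277 / 40000 :: real)"
  define g3 where "g3 = (\<lambda>s. 1500 * s ^ 4 - 4064 * s ^ 3 + 86577 / 25 * s\<^sup>2 - 102222 / 125 * s - 70399 / 625 :: real)"
  define G1 where "G1 = (\<lambda>s. 36 * s ^ 3 - 354 / 5 * s\<^sup>2 - 79 / 100 * s :: real)"
  define G2 where "G2 = (\<lambda>s. 1194649 / 100 * s ^ 3 - 1258043 / 100 * s\<^sup>2 + 172757277 / 40000 * s :: real)"
  define G3 where "G3 = (\<lambda>s. 300 * s ^ 5 - 1016 * s ^ 4 + 28859 / 25 * s ^ 3 - 51111 / 125 * s\<^sup>2 - 70399 / 625 * s :: real)"
  have DG: "(G1 has_real_derivative g1 s) (at s)" "(G2 has_real_derivative g2 s) (at s)"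
    "(G3 has_real_derivative g3 s) (at s)" for s
    unfolding g1_def g2_def g3_def G1_def G2_def G3_def
    by (rule derivative_eq_intros refl | simp)+
  have "second_variation (11/10) f f = prim (\<lambda>s. legendre_weight (11/10) s * (f s * f s)
      - 4 * ((prim f s + 2 * prim f 1) * (prim f s + 2 * prim f 1))) 1 + 38"
    by (simp add: second_variation_def X1 prim_diff prim_cmult pwc_intros pwc_cmult pf pwc_legendre_weight)
  also have "prim (\<lambda>s. legendre_weight (11/10) s * (f s * f s)
      - 4 * ((prim f s + 2 * prim f 1) * (prim f s + 2 * prim f 1))) 1 = prim (glue (3/10) (7/20) g1 g2 g3) 1"
    unfolding prim_def[of _ 1] X1[unfolded prim_def]
  proof (rule integral_cong)
    fix s :: real assume s: "s \<in> {0..1}"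
    show "legendre_weight (11/10) s * (f s * f s) - 4 * ((prim f s + 2 * 1) * (prim f s + 2 * 1)) =
        glue (3/10) (7/20) g1 g2 g3 s"
      unfolding X[OF s] unfolding f_def glue_def f1_def f2_def f3_def g1_def g2_def g3_def X1_def X2_def X3_def legendre_weight_def
      by (auto simp: field_simps power2_eq_square power3_eq_cube power4_eq_xxxx)
  qed
  also have "\<dots> = - 30704417 / 800000"
    by (subst prim_glue[OF _ _ _ _ _ DG]) (simp_all add: glue_def G1_def G2_def G3_def power2_eq_square power3_eq_cube eval_nat_numeral)
  finally show "second_variation (11/10) f f < 0" by simp
qed

lemma legendre_weight_pos: "r < 11 / 10 \<Longrightarrow> 0 < legendre_weight r s"
  unfolding legendre_weight_square by (simp add: add_nonneg_pos)

lemma coercive_at_mono: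
  assumes "coercive_at q" "1 \<le> r" "r \<le> q" "q \<le> 6/5"
  shows "coercive_at r"
proof -
  obtain k where k: "0 < k" "\<And>f. pwc f \<Longrightarrow> k * prim (\<lambda>s. (f s)\<^sup>2) 1 \<le> second_variation q f f"
    using assms(1) unfolding coercive_at_def by blast
  have "k * prim (\<lambda>s. (f s)\<^sup>2) 1 \<le> second_variation r f f" if f: "pwc f" for f
  proof -
    have "0 \<le> (2/5) * (q - r) * prim (\<lambda>s. (f s)\<^sup>2) 1"
      using assms by (intro mult_nonneg_nonneg prim_nonneg pwc_power2 f) auto
    then show ?thesis using k(2)[OF f] second_variation_decreasing[OF f assms(2-4)] by linarith
  qed
  with k(1) show ?thesis unfolding coercive_at_def by blast
qed

lemma coercive_at_open:
  assumes "coercive_at r" "1 \<le> r"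
  obtains e where "0 < e" "\<And>q. r \<le> q \<Longrightarrow> q < r + e \<Longrightarrow> q \<le> 6/5 \<Longrightarrow> coercive_at q"
proof -
  obtain k where k: "0 < k" "\<And>f. pwc f \<Longrightarrow> k * prim (\<lambda>s. (f s)\<^sup>2) 1 \<le> second_variation r f f"
    using assms(1) unfolding coercive_at_def by blast
  show ?thesis
  proof (rule that[of "k / 96"])
    show "0 < k / 96" using k by simp
    fix q assume q: "r \<le> q" "q < r + k / 96" "q \<le> 6/5"
    have "k / 2 * prim (\<lambda>s. (f s)\<^sup>2) 1 \<le> second_variation q f f" if f: "pwc f" for f
    proof -
      have "48 * (q - r) * prim (\<lambda>s. (f s)\<^sup>2) 1 \<le> k / 2 * prim (\<lambda>s. (f s)\<^sup>2) 1"
        using q by (intro mult_right_mono prim_nonneg pwc_power2 f) auto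
      then show ?thesis using k(2)[OF f] second_variation_lipschitz[OF f assms(2) q(1,3)] by (simp add: algebra_simps)
    qed
    with k(1) show "coercive_at q" unfolding coercive_at_def by (metis half_gt_zero)
  qed
qed

text \<open>\<open>r0\<close> is the supremum of the coercive ratios. Openness of coercivity gives
  \<open>1 < r0\<close> and excludes \<open>r0\<close> itself. The Lipschitz bound in
  \<open>r\<close> carries nonnegativity up to \<open>r0\<close> and, combined with the negative
  value at \<open>11/10\<close>, keeps \<open>r0\<close> away from \<open>11/10\<close>.\<close>

lemma critical_ratio:
  obtains r0 where "1 < r0" "r0 < 11/10" "\<not> coercive_at r0"
    "\<And>r. 1 \<le> r \<Longrightarrow> r < r0 \<Longrightarrow> coercive_at r"
    "\<And>f. pwc f \<Longrightarrow> 0 \<le> second_variation r0 f f"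
proof -
  define A where "A = {r. 1 \<le> r \<and> r \<le> 11/10 \<and> coercive_at r}"
  define r0 where "r0 = Sup A"
  have A1: "1 \<in> A" unfolding A_def using coercive_at_1 by simp
  have bdd: "bdd_above A" by (rule bdd_aboveI[of _ "11/10"]) (auto simp: A_def)
  obtain f0 where f0: "pwc f0" "second_variation (11/10) f0 f0 < 0" using second_variation_negative .
  define N where "N = prim (\<lambda>s. (f0 s)\<^sup>2) 1"
  have N: "0 \<le> N" unfolding N_def by (intro prim_nonneg pwc_power2 f0) auto
  obtain e1 where e1: "0 < e1" "\<And>q. 1 \<le> q \<Longrightarrow> q < 1 + e1 \<Longrightarrow> q \<le> 6/5 \<Longrightarrow> coercive_at q"
    using coercive_at_open[OF coercive_at_1] by auto
  have "min (1 + e1 / 2) (11/10) \<in> A" unfolding A_def using e1(1) e1(2)[of "min (1 + e1 / 2) (11/10)"] by (simp add: min_def)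
  then have r1: "1 < r0" unfolding r0_def using e1(1) by (intro less_le_trans[OF _ cSup_upper[OF _ bdd]]) auto
  have le: "r \<le> 11/10 + second_variation (11/10) f0 f0 / (48 * (N + 1))" if "r \<in> A" for r
  proof -
    have "0 \<le> second_variation r f0 f0"
    proof -
      obtain k where "0 < k" "\<And>f. pwc f \<Longrightarrow> k * prim (\<lambda>s. (f s)\<^sup>2) 1 \<le> second_variation r f f"
        using \<open>r \<in> A\<close> unfolding A_def coercive_at_def by blast
      from this(1) this(2)[OF f0(1)] N show ?thesis unfolding N_def
        by (meson mult_nonneg_nonneg less_imp_le order_trans)
    qed
    then have "0 \<le> second_variation (11/10) f0 f0 + 48 * (11/10 - r) * N"
      using second_variation_lipschitz[OF f0(1), of r "11/10"] \<open>r \<in> A\<close> unfolding A_def N_def by simp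
    also have "\<dots> \<le> second_variation (11/10) f0 f0 + 48 * (11/10 - r) * (N + 1)"
      using \<open>r \<in> A\<close> unfolding A_def by (intro add_left_mono mult_left_mono) auto
    finally show ?thesis using N by (simp add: field_simps)
  qed
  have "r0 \<le> 11/10 + second_variation (11/10) f0 f0 / (48 * (N + 1))"
    unfolding r0_def by (rule cSup_least) (use A1 le in auto)
  moreover have "second_variation (11/10) f0 f0 / (48 * (N + 1)) < 0" using f0(2) N by (simp add: divide_neg_pos)
  ultimately have r2: "r0 < 11/10" by linarith
  have below: "coercive_at r" if "1 \<le> r" "r < r0" for r
  proof -
    have "\<exists>q\<in>A. r < q" using less_cSup_iff[of A r] that A1 bdd unfolding r0_def by auto
    then obtain q where "q \<in> A" "r < q" by auto
    with that show ?thesis unfolding A_def by (auto intro!: coercive_at_mono[of q r])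
  qed
  have "\<not> coercive_at r0"
  proof
    assume "coercive_at r0"
    then obtain e where e: "0 < e" "\<And>q. r0 \<le> q \<Longrightarrow> q < r0 + e \<Longrightarrow> q \<le> 6/5 \<Longrightarrow> coercive_at q"
      using coercive_at_open r1 by (metis less_imp_le)
    have "min (r0 + e / 2) (11/10) \<in> A" unfolding A_def using e(1) e(2)[of "min (r0 + e / 2) (11/10)"] r1 r2 by (simp add: min_def)
    then have "min (r0 + e / 2) (11/10) \<le> r0" unfolding r0_def by (rule cSup_upper[OF _ bdd])
    with e(1) r2 show False by auto
  qed
  moreover have "0 \<le> second_variation r0 f f" if f: "pwc f" for f
  proof (rule ccontr)
    assume neg: "\<not> ?thesis"
    define n where "n = prim (\<lambda>s. (f s)\<^sup>2) 1"
    have n: "0 \<le> n" unfolding n_def by (intro prim_nonneg pwc_power2 f) auto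
    \<comment> \<open>So close to \<open>r0\<close> that the Lipschitz bound would leave the form at
      \<open>f\<close> negative, although every ratio from 1 up to below \<open>r0\<close> is
      coercive.\<close>
    define r where "r = max 1 (r0 + second_variation r0 f f / (48 * (n + 1)))"
    have "second_variation r0 f f / (48 * (n + 1)) < 0" using neg n by (simp add: divide_neg_pos)
    then have r: "1 \<le> r" "r < r0" unfolding r_def using r1 by auto
    obtain k where "0 < k" "\<And>f. pwc f \<Longrightarrow> k * prim (\<lambda>s. (f s)\<^sup>2) 1 \<le> second_variation r f f"
      using below[OF r] unfolding coercive_at_def by blast
    from this(1) this(2)[OF f] n have "0 \<le> second_variation r f f" unfolding n_def
      by (meson mult_nonneg_nonneg less_imp_le order_trans)
    moreover have "second_variation r f f \<le> second_variation r0 f f + 48 * (r0 - r) * n"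
      using second_variation_lipschitz[OF f, of r r0] r r2 unfolding n_def by simp
    moreover have "48 * (r0 - r) * n \<le> 48 * (r0 - r) * (n + 1)" using r by (intro mult_left_mono) auto
    moreover have "48 * (r0 - r) * (n + 1) \<le> - second_variation r0 f f"
    proof -
      have "48 * (n + 1) * (r0 - r) \<le> 48 * (n + 1) * (- second_variation r0 f f / (48 * (n + 1)))"
        using n by (intro mult_left_mono) (auto simp: r_def)
      also have "\<dots> = - second_variation r0 f f" using n by simp
      finally show ?thesis by (simp add: algebra_simps)
    qed
    moreover have "48 * (r0 - r) * n < 48 * (r0 - r) * (n + 1)" using r by simp
    ultimately show False by linarith
  qed
  ultimately show ?thesis using that r1 r2 below by blast
qed

section \<open>The critical bound\<close>

definition scaled :: "real \<Rightarrow> (real \<Rightarrow> real) \<Rightarrow> real \<Rightarrow> real" where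
  "scaled M f s = f ((1 - 1 / M) * s)"

lemma scaled_derivative:
  assumes T: "0 < 1 - 1 / M" and s: "s \<in> {0..1}"
    and d: "\<And>t. t \<in> {0..1 - 1 / M} \<Longrightarrow> (f has_real_derivative f' t) (at t within {0..1 - 1 / M})"
  shows "(scaled M f has_real_derivative (1 - 1 / M) * f' ((1 - 1 / M) * s)) (at s within {0..1})"
proof -
  define T where "T = 1 - 1 / M"
  have "(f has_real_derivative f' (T * s)) (at (T * s) within (\<lambda>s. T * s) ` {0..1})"
    by (rule has_field_derivative_subset[OF d[of "T * s", folded T_def]])
       (use T s in \<open>auto simp: T_def[symmetric] mult_le_cancel_left2 intro!: mult_left_le\<close>)
  then have "(f \<circ> (\<lambda>s. T * s) has_real_derivative f' (T * s) * T) (at s within {0..1})"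
    by (rule DERIV_image_chain) (auto intro!: derivative_eq_intros)
  then show ?thesis by (simp add: scaled_def[abs_def] comp_def T_def mult.commute)
qed

text \<open>Multiplied by its denominator, which is positive for \<open>M > 11\<close>, each
  feedback law is a Jacobi equation. The inhomogeneity of \<open>p\<close> stems from the initial
  value 1 of \<open>y 6\<close>, that of \<open>q\<close> from the constant drift of
  \<open>y 12\<close> and the extra term \<open>2 * (1 - 3 * t)\<close>.\<close>

lemma jacobi_fields_of_solution:
  assumes M: "11 < M" and y: "solves_cauchy_problem M y"
  defines "T \<equiv> 1 - 1 / M"
  obtains p q where "jacobi_fields (1 / T) p q (- (1 / T)\<^sup>2) (2 * (1 / T)\<^sup>2) (- 2 * (1 / T))"
    "y 3 T = - 2 * T ^ 3 * second_variation (1 / T) p p"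
    "y 9 T = - 2 * T ^ 3 * second_variation (1 / T) q q"
    "y 15 T = - 2 * T ^ 3 * second_variation (1 / T) p q"
proof -
  have T: "10 / 11 < T" "T < 1" using M by (auto simp: T_def field_simps)
  have r: "1 \<le> 1 / T" "1 / T < 11 / 10" using T by (auto simp: field_simps)
  define p where "p = scaled M (u_p M y)"
  define q where "q = scaled M (u_q M y)"
  note S = y[unfolded solves_cauchy_problem_def Let_def, folded T_def]
  have y0: "y k 0 = (if k = 6 then 1 else 0)" if "1 \<le> k" "k \<le> 15" for k using S that by auto
  have weight: "u_denom M (T * s) = T\<^sup>2 * legendre_weight (1 / T) s" for s
  proof -
    have "T * T * legendre_weight (1 / T) s = 16 * (T * s)\<^sup>2 - (24 - 16 * T) * (T * s) + 15 * T\<^sup>2 - 22 * T + 9"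
      using T by (simp add: legendre_weight_def field_simps power2_eq_square)
    also have "\<dots> = u_denom M (T * s)"
      unfolding u_denom_def T_def using M by (simp add: field_simps power2_eq_square)
    finally show ?thesis by (simp add: power2_eq_square)
  qed
  have wpos: "0 < legendre_weight (1 / T) s" for s by (rule legendre_weight_pos[OF r(2)])
  have dn: "u_denom M (T * s) \<noteq> 0" for s unfolding weight using wpos[of s] T by simp
  have Tp: "0 < 1 - 1 / M" using T by (simp add: T_def)
  note sd = scaled_derivative[OF Tp, folded T_def]
  note D = S[THEN conjunct2, rule_format]
  note D1 = D[THEN conjunct1]
  note D2 = D[THEN conjunct2, THEN conjunct1]
  note D3 = D[THEN conjunct2, THEN conjunct2, THEN conjunct1]
  note D4 = D[THEN conjunct2, THEN conjunct2, THEN conjunct2, THEN conjunct1]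
  note D5 = D[THEN conjunct2, THEN conjunct2, THEN conjunct2, THEN conjunct2, THEN conjunct1]
  note D6 = D[THEN conjunct2, THEN conjunct2, THEN conjunct2, THEN conjunct2, THEN conjunct2, THEN conjunct1]
  note D7 = D[THEN conjunct2, THEN conjunct2, THEN conjunct2, THEN conjunct2, THEN conjunct2, THEN conjunct2, THEN conjunct1]
  note D8 = D[THEN conjunct2, THEN conjunct2, THEN conjunct2, THEN conjunct2, THEN conjunct2, THEN conjunct2, THEN conjunct2, THEN conjunct1]
  note D9 = D[THEN conjunct2, THEN conjunct2, THEN conjunct2, THEN conjunct2, THEN conjunct2, THEN conjunct2, THEN conjunct2, THEN conjunct2, THEN conjunct1]
  note D10 = D[THEN conjunct2, THEN conjunct2, THEN conjunct2, THEN conjunct2, THEN conjunct2, THEN conjunct2, THEN conjunct2, THEN conjunct2, THEN conjunct2, THEN conjunct1]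
  note D11 = D[THEN conjunct2, THEN conjunct2, THEN conjunct2, THEN conjunct2, THEN conjunct2, THEN conjunct2, THEN conjunct2, THEN conjunct2, THEN conjunct2, THEN conjunct2, THEN conjunct1]
  note D12 = D[THEN conjunct2, THEN conjunct2, THEN conjunct2, THEN conjunct2, THEN conjunct2, THEN conjunct2, THEN conjunct2, THEN conjunct2, THEN conjunct2, THEN conjunct2, THEN conjunct2, THEN conjunct1]
  note D13 = D[THEN conjunct2, THEN conjunct2, THEN conjunct2, THEN conjunct2, THEN conjunct2, THEN conjunct2, THEN conjunct2, THEN conjunct2, THEN conjunct2, THEN conjunct2, THEN conjunct2, THEN conjunct2, THEN conjunct1]
  note D14 = D[THEN conjunct2, THEN conjunct2, THEN conjunct2, THEN conjunct2, THEN conjunct2, THEN conjunct2, THEN conjunct2, THEN conjunct2, THEN conjunct2, THEN conjunct2, THEN conjunct2, THEN conjunct2, THEN conjunct2, THEN conjunct1]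
  note D15 = D[THEN conjunct2, THEN conjunct2, THEN conjunct2, THEN conjunct2, THEN conjunct2, THEN conjunct2, THEN conjunct2, THEN conjunct2, THEN conjunct2, THEN conjunct2, THEN conjunct2, THEN conjunct2, THEN conjunct2, THEN conjunct2]
  have d1: "\<And>s. s \<in> {0..1} \<Longrightarrow> (scaled M (y 1) has_real_derivative T * (- 2 * p s * p s)) (at s within {0..1})"
    by (rule DERIV_cong[OF sd[OF _ D1]]) (simp_all add: p_def q_def scaled_def T_def power2_eq_square algebra_simps)
  have d2: "\<And>s. s \<in> {0..1} \<Longrightarrow> (scaled M (y 2) has_real_derivative
       T * (4 * (scaled M (y 1) s + scaled M (y 4) s * p s + scaled M (y 4) s * p s) - 8 * (2 * (T * s) - 1) * p s * p s)) (at s within {0..1})"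
    by (rule DERIV_cong[OF sd[OF _ D2]]) (simp_all add: p_def q_def scaled_def T_def power2_eq_square algebra_simps)
  have d3: "\<And>s. s \<in> {0..1} \<Longrightarrow> (scaled M (y 3) has_real_derivative
        T * (2 * (7 * (T * s) - 3) * scaled M (y 1) s + 4 * scaled M (y 2) s - 4 * scaled M (y 4) s * scaled M (y 4) s
             + 4 * (5 * (T * s) - 3) * (scaled M (y 4) s * p s + scaled M (y 4) s * p s) + 4 * scaled M (y 5) s * p s + 4 * scaled M (y 5) s * p s
             - 2 * (47 * (T * s)\<^sup>2 - 46 * (T * s) + 9) * p s * p s)) (at s within {0..1})"
    by (rule DERIV_cong[OF sd[OF _ D3]]) (simp_all add: p_def q_def scaled_def T_def power2_eq_square algebra_simps)
  have d4: "\<And>s. s \<in> {0..1} \<Longrightarrow> (scaled M (y 4) has_real_derivative T * (- 2 * p s)) (at s within {0..1})"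
    by (rule DERIV_cong[OF sd[OF _ D4]]) (simp_all add: p_def q_def scaled_def T_def power2_eq_square algebra_simps)
  have d5: "\<And>s. s \<in> {0..1} \<Longrightarrow> (scaled M (y 5) has_real_derivative T * (4 * (scaled M (y 4) s + (1 - 3 * (T * s)) * p s))) (at s within {0..1})"
    by (rule DERIV_cong[OF sd[OF _ D5]]) (simp_all add: p_def q_def scaled_def T_def power2_eq_square algebra_simps)
  have d6: "\<And>s. s \<in> {0..1} \<Longrightarrow> (scaled M (y 6) has_real_derivative
      T * (- 4 * (T * s + 1 - 4 / M) * p s - 4 * scaled M (y 4) s + 0)) (at s within {0..1})"
    by (rule DERIV_cong[OF sd[OF _ D6]]) (simp_all add: p_def q_def scaled_def T_def power2_eq_square algebra_simps)
  have d7: "\<And>s. s \<in> {0..1} \<Longrightarrow> (scaled M (y 7) has_real_derivative T * (- 2 * q s * q s)) (at s within {0..1})"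
    by (rule DERIV_cong[OF sd[OF _ D7]]) (simp_all add: p_def q_def scaled_def T_def power2_eq_square algebra_simps)
  have d8: "\<And>s. s \<in> {0..1} \<Longrightarrow> (scaled M (y 8) has_real_derivative
       T * (4 * (scaled M (y 7) s + scaled M (y 10) s * q s + scaled M (y 10) s * q s) - 8 * (2 * (T * s) - 1) * q s * q s)) (at s within {0..1})"
    by (rule DERIV_cong[OF sd[OF _ D8]]) (simp_all add: p_def q_def scaled_def T_def power2_eq_square algebra_simps)
  have d9: "\<And>s. s \<in> {0..1} \<Longrightarrow> (scaled M (y 9) has_real_derivative
        T * (2 * (7 * (T * s) - 3) * scaled M (y 7) s + 4 * scaled M (y 8) s - 4 * scaled M (y 10) s * scaled M (y 10) s
             + 4 * (5 * (T * s) - 3) * (scaled M (y 10) s * q s + scaled M (y 10) s * q s) + 4 * scaled M (y 11) s * q s + 4 * scaled M (y 11) s * q s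
             - 2 * (47 * (T * s)\<^sup>2 - 46 * (T * s) + 9) * q s * q s)) (at s within {0..1})"
    by (rule DERIV_cong[OF sd[OF _ D9]]) (simp_all add: p_def q_def scaled_def T_def power2_eq_square algebra_simps)
  have d10: "\<And>s. s \<in> {0..1} \<Longrightarrow> (scaled M (y 10) has_real_derivative T * (- 2 * q s)) (at s within {0..1})"
    by (rule DERIV_cong[OF sd[OF _ D10]]) (simp_all add: p_def q_def scaled_def T_def power2_eq_square algebra_simps)
  have d11: "\<And>s. s \<in> {0..1} \<Longrightarrow> (scaled M (y 11) has_real_derivative T * (4 * (scaled M (y 10) s + (1 - 3 * (T * s)) * q s))) (at s within {0..1})"
    by (rule DERIV_cong[OF sd[OF _ D11]]) (simp_all add: p_def q_def scaled_def T_def power2_eq_square algebra_simps)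
  have d12: "\<And>s. s \<in> {0..1} \<Longrightarrow> (scaled M (y 12) has_real_derivative
      T * (- 4 * (T * s + 1 - 4 / M) * q s - 4 * scaled M (y 10) s + (- 4))) (at s within {0..1})"
    by (rule DERIV_cong[OF sd[OF _ D12]]) (simp_all add: p_def q_def scaled_def T_def power2_eq_square algebra_simps)
  have d13: "\<And>s. s \<in> {0..1} \<Longrightarrow> (scaled M (y 13) has_real_derivative T * (- 2 * p s * q s)) (at s within {0..1})"
    by (rule DERIV_cong[OF sd[OF _ D13]]) (simp_all add: p_def q_def scaled_def T_def power2_eq_square algebra_simps)
  have d14: "\<And>s. s \<in> {0..1} \<Longrightarrow> (scaled M (y 14) has_real_derivative
       T * (4 * (scaled M (y 13) s + scaled M (y 4) s * q s + scaled M (y 10) s * p s) - 8 * (2 * (T * s) - 1) * p s * q s)) (at s within {0..1})"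
    by (rule DERIV_cong[OF sd[OF _ D14]]) (simp_all add: p_def q_def scaled_def T_def power2_eq_square algebra_simps)
  have d15: "\<And>s. s \<in> {0..1} \<Longrightarrow> (scaled M (y 15) has_real_derivative
        T * (2 * (7 * (T * s) - 3) * scaled M (y 13) s + 4 * scaled M (y 14) s - 4 * scaled M (y 4) s * scaled M (y 10) s
             + 4 * (5 * (T * s) - 3) * (scaled M (y 4) s * q s + scaled M (y 10) s * p s) + 4 * scaled M (y 5) s * q s + 4 * scaled M (y 11) s * p s
             - 2 * (47 * (T * s)\<^sup>2 - 46 * (T * s) + 9) * p s * q s)) (at s within {0..1})"
    by (rule DERIV_cong[OF sd[OF _ D15]]) (simp_all add: p_def q_def scaled_def T_def power2_eq_square algebra_simps)
  have cp: "continuous_on {0..1} p" "continuous_on {0..1} q"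
  proof -
    have "p = (\<lambda>s. (2 * (3 - 4 / M - 5 * (T * s)) * scaled M (y 4) s + 2 * scaled M (y 5) s - scaled M (y 6) s) / u_denom M (T * s))"
      "q = (\<lambda>s. (2 * (3 - 4 / M - 5 * (T * s)) * scaled M (y 10) s + 2 * scaled M (y 11) s - scaled M (y 12) s
          + 2 * (1 - 3 * (T * s))) / u_denom M (T * s))"
      by (auto simp: p_def q_def scaled_def u_p_def u_q_def T_def)
    then show "continuous_on {0..1} p" "continuous_on {0..1} q"
      using dn by (auto intro!: continuous_intros DERIV_continuous_on[OF d4] DERIV_continuous_on[OF d5]
        DERIV_continuous_on[OF d6] DERIV_continuous_on[OF d10] DERIV_continuous_on[OF d11] DERIV_continuous_on[OF d12] simp: u_denom_def)
  qed
  note nump = jacobi_numerator[OF T_def[THEN meta_eq_to_obj_eq] _ cp(1) _ _ d4 d5 d6]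
  note numq = jacobi_numerator[OF T_def[THEN meta_eq_to_obj_eq] _ cp(2) _ _ d10 d11 d12]
  have z: "scaled M (y k) 0 = (if k = 6 then 1 else 0)" if "1 \<le> k" "k \<le> 15" for k
    using y0[OF that] by (simp add: scaled_def)
  have M0: "M \<noteq> 0" using M by simp
  have p: "legendre_weight (1 / T) s * p s = - (1 / T)\<^sup>2 - 4 * prim (prim p) s" if s: "s \<in> {0..1}" for s
  proof -
    have "T\<^sup>2 * (legendre_weight (1 / T) s * p s) = u_denom M (T * s) * p s" by (simp add: weight)
    also have "\<dots> = 2 * (3 - 4 / M - 5 * (T * s)) * scaled M (y 4) s + 2 * scaled M (y 5) s - scaled M (y 6) s"
      using dn[of s] by (simp add: p_def scaled_def u_p_def T_def[symmetric])
    also have "\<dots> = - 1 - 4 * T\<^sup>2 * prim (prim p) s"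
      using nump(3)[OF M0 _ _ _ _ _ s] by (simp add: z)
    also have "\<dots> = T\<^sup>2 * (- (1 / T)\<^sup>2 - 4 * prim (prim p) s)" using T by (simp add: field_simps)
    finally show ?thesis using T by simp
  qed
  have q: "legendre_weight (1 / T) s * q s = 2 * (1 / T)\<^sup>2 + (- 2 * (1 / T)) * s - 4 * prim (prim q) s" if s: "s \<in> {0..1}" for s
  proof -
    have "T\<^sup>2 * (legendre_weight (1 / T) s * q s) = u_denom M (T * s) * q s" by (simp add: weight)
    also have "\<dots> = (2 * (3 - 4 / M - 5 * (T * s)) * scaled M (y 10) s + 2 * scaled M (y 11) s - scaled M (y 12) s)
        + 2 * (1 - 3 * (T * s))"
      using dn[of s] by (simp add: q_def scaled_def u_q_def T_def[symmetric])
    \<comment> \<open>The drift -4 of \<open>y 12\<close> contributes \<open>4 * T * s\<close>, and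
      \<open>2 - 6 * T * s + 4 * T * s = 2 - 2 * T * s\<close>.\<close>
    also have "\<dots> = 2 - 2 * T * s - 4 * T\<^sup>2 * prim (prim q) s"
      using numq(3)[OF M0 _ _ _ _ _ s] by (simp add: z)
    also have "\<dots> = T\<^sup>2 * (2 * (1 / T)\<^sup>2 + (- 2 * (1 / T)) * s - 4 * prim (prim q) s)"
      using T by (simp add: field_simps power2_eq_square)
    finally show ?thesis using T by simp
  qed
  have T0: "T \<noteq> 0" using T by simp
  note x = nump(1,2)[OF M0] numq(1,2)[OF M0]
  have y1: "y k T = scaled M (y k) 1" for k by (simp add: scaled_def T_def)
  show ?thesis
  proof (rule that)
    show "jacobi_fields (1 / T) p q (- (1 / T)\<^sup>2) (2 * (1 / T)\<^sup>2) (- 2 * (1 / T))"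
      by unfold_locales (use r T0 wpos cp p q in auto)
    show "y 3 T = - 2 * T ^ 3 * second_variation (1 / T) p p"
      unfolding y1 by (rule second_order_terms[OF T0 cp(1,1) _ _ _ _ _ _ _ d1 d2 d3]) (use z x in auto)
    show "y 9 T = - 2 * T ^ 3 * second_variation (1 / T) q q"
      unfolding y1 by (rule second_order_terms[OF T0 cp(2,2) _ _ _ _ _ _ _ d7 d8 d9]) (use z x in auto)
    show "y 15 T = - 2 * T ^ 3 * second_variation (1 / T) p q"
      unfolding y1 by (rule second_order_terms[OF T0 cp(1,2) _ _ _ _ _ _ _ d13 d14 d15]) (use z x in auto)
  qed
qed

text \<open>The ratio \<open>M / (M - 1)\<close> decreases in \<open>M\<close>, so \<open>r0\<close>
  corresponds to one \<open>M0\<close>. There the form is semidefinite without being coercive, which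
  forces the determinant of the two Jacobi fields to vanish: \<open>M0\<close> solves the second
  equation. For larger \<open>M\<close> coercivity excludes roots of either equation.\<close>

lemma critical_bound:
  fixes y :: "real \<Rightarrow> nat \<Rightarrow> real \<Rightarrow> real"
  assumes y: "\<And>M. M > 11 \<Longrightarrow> solves_cauchy_problem M (y M)"
  obtains M0 where "11 < M0" "M0 \<in> critical_bounds y" "\<And>M. M \<in> critical_bounds y \<Longrightarrow> M \<le> M0"
    "\<And>M. M0 < M \<Longrightarrow> coercive_at (1 / (1 - 1 / M))"
    "\<And>M. 11 \<le> M \<Longrightarrow> M < M0 \<Longrightarrow> \<exists>f. continuous_on {0..1} f \<and> second_variation (1 / (1 - 1 / M)) f f < 0"
proof -
  define R where "R M = 1 / (1 - 1 / M)" for M :: real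
  have R: "1 < R M" "R M = M / (M - 1)" if "1 < M" for M using that by (auto simp: R_def field_simps)
  have R_less: "R M < R N \<longleftrightarrow> N < M" if "1 < M" "1 < N" for M N
    using that by (simp add: R(2) field_simps)
  have R_le: "R M \<le> 11/10" if "11 \<le> M" for M using that by (simp add: R(2) field_simps)
  obtain r0 where r0: "1 < r0" "r0 < 11/10" "\<not> coercive_at r0"
    "\<And>r. 1 \<le> r \<Longrightarrow> r < r0 \<Longrightarrow> coercive_at r" "\<And>f. pwc f \<Longrightarrow> 0 \<le> second_variation r0 f f"
    using critical_ratio by blast
  define M0 where "M0 = r0 / (r0 - 1)"
  have M0: "11 < M0" "R M0 = r0" using r0(1,2) by (auto simp: M0_def R_def field_simps)
  obtain p q where J: "jacobi_fields (1 / (1 - 1 / M0)) p q (- (1 / (1 - 1 / M0))\<^sup>2) (2 * (1 / (1 - 1 / M0))\<^sup>2) (- 2 * (1 / (1 - 1 / M0)))"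
    and y3: "y M0 3 (1 - 1 / M0) = - 2 * (1 - 1 / M0) ^ 3 * second_variation (1 / (1 - 1 / M0)) p p"
    and y9: "y M0 9 (1 - 1 / M0) = - 2 * (1 - 1 / M0) ^ 3 * second_variation (1 / (1 - 1 / M0)) q q"
    and y15: "y M0 15 (1 - 1 / M0) = - 2 * (1 - 1 / M0) ^ 3 * second_variation (1 / (1 - 1 / M0)) p q"
    using jacobi_fields_of_solution[OF M0(1) y[OF M0(1)]] by blast
  interpret J: jacobi_fields r0 p q "- r0\<^sup>2" "2 * r0\<^sup>2" "- 2 * r0"
    using J unfolding R_def[symmetric] M0(2) .
  have deg: "J.Q\<^sub>p * J.Q\<^sub>q = J.Q\<^sub>p\<^sub>q\<^sup>2" using J.nondegenerate_imp_coercive[OF r0(5)] r0(3) by blast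
  obtain f where f: "continuous_on {0..1} f" "0 < prim (\<lambda>s. (f s)\<^sup>2) 1" "second_variation r0 f f = 0"
    using J.degenerate_imp[OF r0(5) deg] by blast
  show ?thesis
  proof (rule that)
    show "11 < M0" by (rule M0(1))
    show "M0 \<in> critical_bounds y"
      unfolding critical_bounds_def mem_Collect_eq y3 y9 y15 unfolding R_def[symmetric] M0(2)
      using M0(1) deg by (simp add: power2_eq_square algebra_simps)
    show coer: "coercive_at (1 / (1 - 1 / M))" if "M0 < M" for M
      unfolding R_def[symmetric] using R[of M] R_less[of M M0] that M0 by (intro r0(4)) auto
    show "M \<le> M0" if M: "M \<in> critical_bounds y" for M
    proof (rule ccontr)
      assume "\<not> M \<le> M0"
      then have c: "coercive_at (R M)" using coer[of M] by (simp add: R_def)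
      have M11: "11 < M" using M by (simp add: critical_bounds_def)
      obtain p q where J: "jacobi_fields (R M) p q (- (R M)\<^sup>2) (2 * (R M)\<^sup>2) (- 2 * R M)"
        and y3: "y M 3 (1 - 1 / M) = - 2 * (1 - 1 / M) ^ 3 * second_variation (R M) p p"
        and y9: "y M 9 (1 - 1 / M) = - 2 * (1 - 1 / M) ^ 3 * second_variation (R M) q q"
        and y15: "y M 15 (1 - 1 / M) = - 2 * (1 - 1 / M) ^ 3 * second_variation (R M) p q"
        using jacobi_fields_of_solution[OF M11 y[OF M11]] unfolding R_def by blast
      interpret K: jacobi_fields "R M" p q "- (R M)\<^sup>2" "2 * (R M)\<^sup>2" "- 2 * R M" by (rule J)
      have "1 - 1 / M \<noteq> 0" using M11 by auto
      moreover have "y M 3 (1 - 1 / M) * y M 9 (1 - 1 / M) - (y M 15 (1 - 1 / M))\<^sup>2 =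
          (2 * (1 - 1 / M) ^ 3)\<^sup>2 * (K.Q\<^sub>p * K.Q\<^sub>q - K.Q\<^sub>p\<^sub>q\<^sup>2)"
        unfolding y3 y9 y15 by (simp add: power2_eq_square algebra_simps)
      ultimately show False using M K.coercive_imp[OF c] unfolding critical_bounds_def by (auto simp: y3)
    qed
    \<comment> \<open>The null vector \<open>f\<close> at \<open>r0\<close> serves all these
      \<open>M\<close> at once, since the form at \<open>f\<close> strictly decreases as the ratio
      grows. This covers \<open>M = 11\<close>, where the weight has a zero.\<close>
    show "\<exists>f. continuous_on {0..1} f \<and> second_variation (1 / (1 - 1 / M)) f f < 0" if M: "11 \<le> M" "M < M0" for M
    proof (intro exI[of _ f] conjI f(1))
      have "r0 < R M" using R_less[of M0 M] M M0 by simp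
      then have "0 < (2/5) * (R M - r0) * prim (\<lambda>s. (f s)\<^sup>2) 1" using f(2) by simp
      then show "second_variation (1 / (1 - 1 / M)) f f < 0"
        unfolding R_def[symmetric]
        using second_variation_decreasing[OF pwc_continuous[OF f(1)], of r0 "R M"] f(3) r0(1) R_le[OF M(1)] \<open>r0 < R M\<close>
        by simp
    qed
  qed
qed

section \<open>Factorization of bounded univalent maps\<close>

text \<open>The maps \<open>f / M\<close> for all \<open>M\<close> at once. Positive derivatives at
  0 multiply under composition and exclude rotations, so that derivative 1 characterizes the
  identity.\<close>

definition disk_maps :: "(complex \<Rightarrow> complex) set" where
  "disk_maps = {f. f holomorphic_on ball 0 1 \<and> inj_on f (ball 0 1) \<and> f ` ball 0 1 \<subseteq> ball 0 1 \<and>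
     f 0 = 0 \<and> (\<exists>x>0. deriv f 0 = of_real x)}"

lemma disk_mapsD:
  assumes "f \<in> disk_maps"
  shows "f holomorphic_on ball 0 1" "inj_on f (ball 0 1)" "\<And>z. z \<in> ball 0 1 \<Longrightarrow> f z \<in> ball 0 1" "f 0 = 0"
    "deriv f 0 = of_real (Re (deriv f 0))" "0 < Re (deriv f 0)" "Re (deriv f 0) \<le> 1"
proof -
  show f: "f holomorphic_on ball 0 1" "inj_on f (ball 0 1)" "\<And>z. z \<in> ball 0 1 \<Longrightarrow> f z \<in> ball 0 1" "f 0 = 0"
    "deriv f 0 = of_real (Re (deriv f 0))" "0 < Re (deriv f 0)"
    using assms unfolding disk_maps_def by (auto simp: image_subset_iff)
  have "norm (deriv f 0) \<le> 1"
    by (rule Schwarz_Lemma(2)[OF f(1,4), of 0]) (use f(3) in auto)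
  then show "Re (deriv f 0) \<le> 1" using complex_Re_le_cmod order_trans by blast
qed

lemma disk_mapsI:
  assumes "f holomorphic_on ball 0 1" "inj_on f (ball 0 1)" "\<And>z. z \<in> ball 0 1 \<Longrightarrow> f z \<in> ball 0 1" "f 0 = 0"
    "deriv f 0 = of_real x" "0 < x"
  shows "f \<in> disk_maps"
  using assms unfolding disk_maps_def by auto

lemma deriv_comp_0:
  assumes "f holomorphic_on ball 0 1" "g holomorphic_on ball 0 1" "g 0 = 0"
  shows "deriv (f \<circ> g) 0 = deriv f 0 * deriv g 0"
  using assms by (subst deriv_chain) (auto simp: holomorphic_on_imp_differentiable_at[of _ "ball 0 1"])

lemma disk_maps_comp:
  assumes "f \<in> disk_maps" "g \<in> disk_maps"
  shows "f \<circ> g \<in> disk_maps" "deriv (f \<circ> g) 0 = deriv f 0 * deriv g 0"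
proof -
  note F = disk_mapsD[OF assms(1)] and G = disk_mapsD[OF assms(2)]
  show d: "deriv (f \<circ> g) 0 = deriv f 0 * deriv g 0" by (rule deriv_comp_0[OF F(1) G(1,4)])
  show "f \<circ> g \<in> disk_maps"
  proof (rule disk_mapsI)
    show "f \<circ> g holomorphic_on ball 0 1"
      using F(1) G(1,3) by (auto intro!: holomorphic_on_compose_gen)
    show "inj_on (f \<circ> g) (ball 0 1)"
      by (rule comp_inj_on[OF G(2) inj_on_subset[OF F(2)]]) (use G(3) in auto)
    show "deriv (f \<circ> g) 0 = of_real (Re (deriv f 0) * Re (deriv g 0))" using d F(5) G(5) by (metis of_real_mult)
  qed (use F G in auto)
qed

lemma disk_maps_id: "(\<lambda>z. z) \<in> disk_maps"
  by (rule disk_mapsI[where x = 1]) auto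

lemma disk_maps_identity:
  assumes "f \<in> disk_maps" "deriv f 0 = 1" "z \<in> ball 0 1"
  shows "f z = z"
proof -
  note F = disk_mapsD[OF assms(1)]
  obtain a where a: "\<And>z. norm z < 1 \<Longrightarrow> f z = a * z"
    using Schwarz_Lemma(3)[OF F(1,4), of 0] F(3) assms(2) by auto
  have "(f has_field_derivative a) (at 0)"
    by (rule has_field_derivative_transform_within_open[of "\<lambda>z. a * z" _ _ "ball 0 1"])
       (auto intro!: derivative_eq_intros simp: a)
  then have "a = 1" using assms(2) DERIV_imp_deriv by blast
  with a assms(3) show ?thesis by simp
qed

lemma normalized_Riemann_map:
  assumes "open S" "simply_connected S" "0 \<in> S" "S \<noteq> UNIV"
  obtains f g x where "f holomorphic_on ball 0 1" "g holomorphic_on S" "f 0 = 0" "deriv f 0 = of_real x" "0 < x"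
    "\<And>z. z \<in> ball 0 1 \<Longrightarrow> f z \<in> S \<and> g (f z) = z" "\<And>z. z \<in> S \<Longrightarrow> g z \<in> ball 0 1 \<and> f (g z) = z"
proof -
  have "\<exists>F G. F holomorphic_on S \<and> G holomorphic_on ball 0 1 \<and>
      (\<forall>z\<in>S. F z \<in> ball 0 1 \<and> G (F z) = z) \<and> (\<forall>z\<in>ball 0 1. G z \<in> S \<and> F (G z) = z)"
    using Riemann_mapping_theorem[of S] assms by blast
  then obtain F G where F: "F holomorphic_on S" "G holomorphic_on ball 0 1"
    "\<And>z. z \<in> S \<Longrightarrow> F z \<in> ball 0 1 \<and> G (F z) = z" "\<And>z. z \<in> ball 0 1 \<Longrightarrow> G z \<in> S \<and> F (G z) = z"
    by blast
  obtain m n where m: "m (F 0) = 0" "m holomorphic_on ball 0 1" "m ` ball 0 1 \<subseteq> ball 0 1"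
    "n holomorphic_on ball 0 1" "n ` ball 0 1 \<subseteq> ball 0 1"
    "\<And>z. z \<in> ball 0 1 \<Longrightarrow> m (n z) = z" "\<And>z. z \<in> ball 0 1 \<Longrightarrow> n (m z) = z"
    using ball_biholomorphism_exists[of "F 0"] F(3)[OF assms(3)] by blast
  have n0: "n 0 = F 0" using m(7)[of "F 0"] m(1) F(3)[OF assms(3)] by simp
  define H where "H = G \<circ> n"
  have H: "H holomorphic_on ball 0 1" unfolding H_def
    by (rule holomorphic_on_compose_gen[OF m(4) F(2) m(5)])
  have H0: "H 0 = 0" using F(3)[OF assms(3)] by (simp add: H_def n0)
  have injH: "inj_on H (ball 0 1)"
    by (rule inj_on_inverseI[of _ "m \<circ> F"]) (use m(5,6) F(4) in \<open>force simp: H_def\<close>)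
  define c where "c = deriv H 0"
  have c: "c \<noteq> 0" unfolding c_def by (rule holomorphic_injective_imp_regular[OF H _ injH]) auto
  define a where "a = cnj (sgn c)"
  have a: "norm a = 1" using c by (simp add: a_def norm_sgn)
  have ca: "c * a = of_real (norm c)"
    using c by (simp add: a_def sgn_eq complex_cnj_divide complex_norm_square[symmetric] power2_eq_square field_simps)
  have aH: "(\<lambda>z. a * z) ` ball 0 1 \<subseteq> ball 0 1" using a by (auto simp: norm_mult)
  show ?thesis
  proof (rule that)
    show "H \<circ> (\<lambda>z. a * z) holomorphic_on ball 0 1"
      by (rule holomorphic_on_compose_gen[OF _ H aH]) (auto intro!: holomorphic_intros)
    have "m \<circ> F holomorphic_on S" by (rule holomorphic_on_compose_gen[OF F(1) m(2)]) (use F(3) in auto)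
    then show "(\<lambda>z. inverse a * (m \<circ> F) z) holomorphic_on S" by (intro holomorphic_intros)
    show "(H \<circ> (\<lambda>z. a * z)) 0 = 0" by (simp add: H0)
    show "deriv (H \<circ> (\<lambda>z. a * z)) 0 = of_real (norm c)"
      by (subst deriv_comp_0[OF H]) (auto intro!: holomorphic_intros simp: c_def[symmetric] ca)
    show "0 < norm c" using c by simp
    show "(H \<circ> (\<lambda>z. a * z)) z \<in> S \<and> inverse a * (m \<circ> F) ((H \<circ> (\<lambda>z. a * z)) z) = z" if z: "z \<in> ball 0 1" for z
    proof -
      have "a * z \<in> ball 0 1" using z aH by blast
      moreover have "a \<noteq> 0" using a by auto
      ultimately show ?thesis using m(5,6) F(4) by (auto simp: H_def image_subset_iff)
    qed
    show "inverse a * (m \<circ> F) z \<in> ball 0 1 \<and> (H \<circ> (\<lambda>z. a * z)) (inverse a * (m \<circ> F) z) = z" if z: "z \<in> S" for z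
    proof -
      have a0: "a \<noteq> 0" using a by auto
      have "m (F z) \<in> ball 0 1" "n (m (F z)) = F z" "G (F z) = z" using m(3,7) F(3)[OF z] by blast+
      moreover have "a * (inverse a * m (F z)) = m (F z)" using a0 by simp
      ultimately show ?thesis using a by (simp only: H_def comp_def) (simp add: norm_mult norm_inverse)
    qed
  qed
qed

text \<open>Being biholomorphic to the disk, the image is simply connected; being bounded as well,
  it has a connected complement. This links every omitted point of the disk to the exterior.\<close>

lemma disk_map_image:
  assumes "f \<in> disk_maps"
  shows "open (f ` ball 0 1)" "simply_connected (f ` ball 0 1)" "connected (f ` ball 0 1)" "connected (- f ` ball 0 1)"
proof -
  note F = disk_mapsD[OF assms]
  show o: "open (f ` ball 0 1)" by (rule open_mapping_thm3[OF F(1) _ F(2)]) simp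
  obtain g where g: "g holomorphic_on (f ` ball 0 1)" "\<And>z. z \<in> ball 0 1 \<Longrightarrow> deriv f z * deriv g (f z) = 1"
      "\<And>z. z \<in> ball 0 1 \<Longrightarrow> g (f z) = z"
    using holomorphic_has_inverse[OF F(1) open_ball F(2)] by blast
  have inv: "g w \<in> ball 0 1 \<and> f (g w) = w" if "w \<in> f ` ball 0 1" for w
  proof -
    from that obtain z where "z \<in> ball 0 1" "w = f z" by blast
    with g(3)[of z] show ?thesis by simp
  qed
  have "\<exists>h k. h holomorphic_on f ` ball 0 1 \<and> k holomorphic_on ball 0 1 \<and>
      (\<forall>w\<in>f ` ball 0 1. h w \<in> ball 0 1 \<and> k (h w) = w) \<and> (\<forall>z\<in>ball 0 1. k z \<in> f ` ball 0 1 \<and> h (k z) = z)"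
    by (intro exI[of _ g] exI[of _ f] conjI ballI F(1) g(1,3) inv imageI) (simp_all add: inv)
  from Riemann_mapping_theorem[THEN iffD2, OF disjI2[OF disjI2[OF this]]]
  show s: "simply_connected (f ` ball 0 1)" by simp
  have "bounded (f ` ball 0 1)" by (rule bounded_subset[of "ball 0 1"]) (use F(3) in auto)
  then show "connected (f ` ball 0 1)" "connected (- f ` ball 0 1)"
    using simply_connected_iff_simple[OF o] s by auto
qed

text \<open>A univalent self-map with \<open>f'(0) \<noteq> 1\<close> splits off an outer factor arbitrarily close to the identity:
  remove from the disk only that part of the complement of the image
  which is connected to the unit circle within a thin collar.\<close>

lemma disk_map_outer_factor:
  assumes f: "f \<in> disk_maps" and ne: "deriv f 0 \<noteq> 1" and rho: "0 < \<rho>" "\<rho> < 1"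
  obtains g h where "g \<in> disk_maps" "h \<in> disk_maps" "\<And>z. z \<in> ball 0 1 \<Longrightarrow> f z = g (h z)"
    "\<rho> \<le> Re (deriv g 0)" "Re (deriv g 0) < 1"
proof -
  note F = disk_mapsD[OF f]
  define D where "D = f ` ball 0 1"
  have D: "open D" "connected D" "connected (- D)" "D \<subseteq> ball 0 1" "0 \<in> D"
    using disk_map_image[OF f] F(3,4) by (auto simp: D_def image_iff intro!: bexI[of _ 0])
  \<comment> \<open>Otherwise the Schwarz lemma would apply to the inverse map as well, and both
    derivatives at 0 would have modulus 1.\<close>
  have "D \<noteq> ball 0 1"
  proof
    assume eq: "D = ball 0 1"
    obtain g where g: "g holomorphic_on D" "\<And>z. z \<in> ball 0 1 \<Longrightarrow> deriv f z * deriv g (f z) = 1"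
      "\<And>z. z \<in> ball 0 1 \<Longrightarrow> g (f z) = z"
      using holomorphic_has_inverse[OF F(1) open_ball F(2)] unfolding D_def by blast
    have "norm (deriv g 0) \<le> 1"
    proof (rule Schwarz_Lemma(2)[of g 0])
      show "g holomorphic_on ball 0 1" using g(1) eq by simp
      show "g 0 = 0" using g(3)[of 0] F(4) by simp
      show "norm (g z) < 1" if "norm z < 1" for z
      proof -
        have "z \<in> D" using that eq by simp
        then show ?thesis using g(3) by (auto simp: D_def)
      qed
    qed simp
    moreover have "norm (deriv f 0) * norm (deriv g 0) = 1" using g(2)[of 0] F(4) by (metis centre_in_ball norm_mult norm_one zero_less_one)
    moreover have "norm (deriv f 0) = Re (deriv f 0)" using F(5,6) by (metis abs_of_pos norm_of_real)
    ultimately have "1 \<le> Re (deriv f 0)"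
      by (metis F(6) less_imp_le mult_left_le)
    with F(5,7) have "deriv f 0 = 1" by (metis of_real_1 order_antisym)
    with ne show False by simp
  qed
  then obtain e where e: "e \<in> ball 0 1" "e \<notin> D" using D(4) by blast
  define K where "K = - (D \<union> ball 0 \<rho>)"
  define C where "C = connected_component_set K 2"
  have Kc: "closed K" unfolding K_def using D(1) by auto
  have outK: "- ball 0 1 \<subseteq> K" using D(4) rho by (auto simp: K_def)
  have CK: "C \<in> components K" unfolding C_def by (rule componentsI) (use outK in auto)
  have Ccl: "closed C" by (rule closed_components[OF Kc CK])
  have Cc: "connected C" by (rule in_components_connected[OF CK])
  have CsubK: "C \<subseteq> K" by (rule in_components_subset[OF CK])
  have outC: "- ball 0 1 \<subseteq> C"
  proof (rule components_maximal[OF CK _ outK])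
    show "connected (- ball 0 1 :: complex set)" by (rule connected_complement_bounded_convex) auto
    have "2 \<in> C" unfolding C_def using outK by (auto intro!: connected_component_refl)
    then show "C \<inter> - ball 0 1 \<noteq> {}" by auto
  qed
  \<comment> \<open>If the component ended at the unit circle, the annulus \<open>A\<close> would be
    a component of the compact set \<open>S\<close>, and Sura-Bura would give a compact, relatively
    open \<open>Q\<close> around it that avoids \<open>e\<close>. Then \<open>Q\<close> together
    with the exterior would be clopen in \<open>- D\<close> and miss \<open>e\<close>, against the
    connectedness of \<open>- D\<close>.\<close>
  have "\<exists>z\<in>C. norm z < 1"
  proof (rule ccontr)
    assume "\<not> ?thesis"
    then have Ceq: "C = - ball 0 1" using outC by force
    define S where "S = K \<inter> cball 0 2"
    define A where "A = cball 0 2 - ball (0 :: complex) 1"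
    have S: "compact S" unfolding S_def using Kc by (simp add: closed_Int_compact)
    have AS: "A \<subseteq> S" using outK by (auto simp: A_def S_def)
    have "A \<in> components S"
    proof -
      have A0: "2 \<in> A" by (simp add: A_def)
      have "connected_component_set S 2 \<subseteq> A"
      proof -
        have "connected_component_set S 2 \<subseteq> C"
          unfolding C_def by (rule connected_component_mono) (auto simp: S_def)
        moreover have "connected_component_set S 2 \<subseteq> S" by (rule connected_component_subset)
        ultimately show ?thesis by (auto simp: Ceq A_def S_def)
      qed
      moreover have "A \<subseteq> connected_component_set S 2"
      proof (rule connected_component_maximal[OF A0 _ AS])
        have "A = {z. 1 \<le> norm (z - 0) \<and> norm (z - 0) \<le> 2}" by (auto simp: A_def)
        then show "connected A" using connected_annulus(4)[of 1 "0 :: complex" 2] by simp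
      qed
      ultimately have "A = connected_component_set S 2" by blast
      then show ?thesis using A0 AS by (metis componentsI subsetD)
    qed
    moreover have "compact A" unfolding A_def by (auto intro!: compact_diff)
    moreover define U :: "complex set" where "U = - cball 0 (max \<rho> (norm e))"
    moreover have "open U" "A \<subseteq> U" using rho e by (auto simp: A_def U_def)
    ultimately obtain Q where Q: "openin (top_of_set S) Q" "compact Q" "A \<subseteq> Q" "Q \<subseteq> U"
      using Sura_Bura_clopen_subset[of S A U] closed_imp_locally_compact[OF compact_imp_closed[OF S]] by blast
    obtain V where V: "open V" "Q = S \<inter> V" using Q(1) by (auto simp: openin_open)
    define B where "B = Q \<union> - ball 0 1"
    have "closed B" unfolding B_def using compact_imp_closed[OF Q(2)] by auto
    moreover have "- D \<inter> B = - D \<inter> (V \<inter> U \<inter> ball 0 2 \<union> - cball 0 1)"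
    proof -
      have "z \<in> Q \<longleftrightarrow> z \<in> K \<and> norm z \<le> 2 \<and> z \<in> V" for z by (auto simp: V(2) S_def)
      moreover have "z \<in> K \<longleftrightarrow> z \<notin> D \<and> \<rho> \<le> norm z" for z by (auto simp: K_def not_less)
      moreover have "z \<in> U \<longleftrightarrow> \<rho> < norm z \<and> norm e < norm z" for z by (auto simp: U_def)
      moreover have "z \<in> Q" if "1 \<le> norm z" "norm z \<le> 2" for z using Q(3) that by (auto simp: A_def)
      moreover have "z \<in> U" if "z \<in> Q" for z using Q(4) that by auto
      ultimately have "z \<notin> D \<and> (z \<in> Q \<or> \<not> norm z < 1) \<longleftrightarrow>
          z \<notin> D \<and> (z \<in> V \<and> z \<in> U \<and> norm z < 2 \<or> \<not> norm z \<le> 1)" for z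
        using e(1) rho by (smt (verit))
      then have "z \<in> - D \<inter> B \<longleftrightarrow> z \<in> - D \<inter> (V \<inter> U \<inter> ball 0 2 \<union> - cball 0 1)" for z
        by (simp add: B_def)
      then show ?thesis by blast
    qed
    moreover have "open (V \<inter> U \<inter> ball 0 2 \<union> - cball 0 1)" unfolding U_def using V(1) by auto
    ultimately have "openin (top_of_set (- D)) (- D \<inter> B)" "closedin (top_of_set (- D)) (- D \<inter> B)"
      by (auto simp: openin_open closedin_closed)
    then have "- D \<inter> B = {} \<or> - D \<inter> B = - D" using D(3) by (auto simp: connected_clopen)
    moreover have "2 \<in> - D \<inter> B" using D(4) by (auto simp: B_def)
    moreover have "e \<notin> B" using e Q(4) by (auto simp: B_def U_def)
    ultimately show False using e(2) by auto
  qed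
  then obtain z0 where z0: "z0 \<in> C" "norm z0 < 1" by blast
  define S where "S = - C"
  have S: "open S" "D \<subseteq> S" "ball 0 \<rho> \<subseteq> S" "S \<subseteq> ball 0 1"
    using Ccl CsubK outC by (auto simp: S_def K_def)
  have "connected (D \<union> ball 0 \<rho>)" by (rule connected_Un) (use D rho in auto)
  then have "connected S" unfolding S_def using CK unfolding K_def by (rule component_complement_connected)
  moreover have "bounded S" by (rule bounded_subset[OF _ S(4)]) simp
  ultimately have scS: "simply_connected S"
    using simply_connected_iff_simple[OF S(1)] Cc by (simp add: S_def)
  have "0 \<in> S" "S \<noteq> UNIV" using S(2) D(5) z0 by (auto simp: S_def)
  then obtain g h x where g: "g holomorphic_on ball 0 1" "h holomorphic_on S" "g 0 = 0" "deriv g 0 = of_real x" "0 < x"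
    "\<And>z. z \<in> ball 0 1 \<Longrightarrow> g z \<in> S \<and> h (g z) = z" "\<And>z. z \<in> S \<Longrightarrow> h z \<in> ball 0 1 \<and> g (h z) = z"
    using normalized_Riemann_map[OF S(1) scS] by metis
  have gd: "g \<in> disk_maps"
  proof (rule disk_mapsI[OF g(1) _ _ g(3-5)])
    show "inj_on g (ball 0 1)" by (rule inj_on_inverseI[of _ h]) (use g(6) in auto)
    show "g z \<in> ball 0 1" if "z \<in> ball 0 1" for z using g(6)[OF that] S(4) by auto
  qed
  note G = disk_mapsD[OF gd]
  have h0: "h 0 = 0" using g(6)[of 0] g(3) by simp
  have fS: "f ` ball 0 1 \<subseteq> S" using S(2) D_def by simp
  have hf: "h \<circ> f holomorphic_on ball 0 1" by (rule holomorphic_on_compose_gen[OF F(1) g(2) fS])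
  have ghf: "f z = (g \<circ> (h \<circ> f)) z" if "z \<in> ball 0 1" for z
    using g(7)[of "f z"] fS that by (simp add: image_subset_iff)
  have "deriv f 0 = deriv (g \<circ> (h \<circ> f)) 0"
    by (rule complex_derivative_transform_within_open[of _ "ball 0 1"])
       (use F(1) ghf fS g holomorphic_on_compose_gen[OF hf g(1)] in \<open>auto simp: image_subset_iff\<close>)
  also have "\<dots> = deriv g 0 * deriv (h \<circ> f) 0" by (rule deriv_comp_0[OF g(1) hf]) (simp add: F(4) h0)
  finally have d: "deriv (h \<circ> f) 0 = of_real (Re (deriv f 0) / x)" using F(5) g(4,5) by (simp add: field_simps)
  show ?thesis
  proof (rule that[OF gd])
    show "h \<circ> f \<in> disk_maps"
    proof (rule disk_mapsI[OF hf _ _ _ d])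
      show "inj_on (h \<circ> f) (ball 0 1)"
      proof (rule inj_on_imageI2)
        show "inj_on (g \<circ> (h \<circ> f)) (ball 0 1)" using F(2) ghf by (metis (no_types, lifting) inj_on_cong)
      qed
      show "(h \<circ> f) z \<in> ball 0 1" if "z \<in> ball 0 1" for z
        using g(7)[of "f z"] fS that by (simp add: image_subset_iff)
      show "0 < Re (deriv f 0) / x" using F(6) g(5) by simp
    qed (simp add: F(4) h0)
    show "f z = g ((h \<circ> f) z)" if "z \<in> ball 0 1" for z using ghf[OF that] by simp
    \<comment> \<open>Since \<open>S\<close> contains \<open>ball 0 \<rho>\<close>, the Schwarz
      lemma applies to \<open>h\<close> after scaling by \<open>\<rho>\<close>. It bounds
      \<open>deriv h 0\<close> by \<open>1 / \<rho>\<close>, and so \<open>deriv g 0\<close> from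
      below.\<close>
    have hr: "(\<lambda>z. h (of_real \<rho> * z)) holomorphic_on ball 0 1"
    proof -
      have "h \<circ> (\<lambda>z. of_real \<rho> * z) holomorphic_on ball 0 1"
        by (rule holomorphic_on_compose_gen[OF _ g(2)]) (use S(3) rho in \<open>auto intro!: holomorphic_intros simp: norm_mult\<close>)
      then show ?thesis by (simp add: comp_def)
    qed
    have "norm (deriv (\<lambda>z. h (of_real \<rho> * z)) 0) \<le> 1"
    proof (rule Schwarz_Lemma(2)[OF hr, of 0])
      show "norm (h (of_real \<rho> * z)) < 1" if "norm z < 1" for z
      proof -
        have "of_real \<rho> * z \<in> S" using S(3) rho that by (auto simp: norm_mult)
        then show ?thesis using g(7) by auto
      qed
    qed (use h0 in auto)
    moreover have "deriv (\<lambda>z. h (of_real \<rho> * z)) 0 = deriv h 0 * of_real \<rho>"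
    proof -
      have "(h has_field_derivative deriv h 0) (at (of_real \<rho> * 0))"
        using holomorphic_derivI[OF g(2) S(1), of 0] S(2) D(5) by auto
      then have "((\<lambda>z. h (of_real \<rho> * z)) has_field_derivative deriv h 0 * of_real \<rho>) (at 0)"
        by (rule DERIV_chain2[where g = "\<lambda>z. of_real \<rho> * z" and x = 0]) (auto intro!: derivative_eq_intros)
      then show ?thesis by (rule DERIV_imp_deriv)
    qed
    moreover have "deriv g 0 * deriv h 0 = 1"
    proof -
      have "deriv (h \<circ> g) 0 = deriv h (g 0) * deriv g 0"
        by (rule deriv_chain) (use g(1,2,3) S D(5) in \<open>auto simp: holomorphic_on_imp_differentiable_at\<close>)
      moreover have "deriv (h \<circ> g) 0 = deriv (\<lambda>z. z) 0"
        by (rule complex_derivative_transform_within_open[of _ "ball 0 1"])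
           (use g(6) holomorphic_on_compose_gen[OF g(1,2)] in \<open>auto simp: image_subset_iff\<close>)
      ultimately show ?thesis by (simp add: g(3) mult.commute)
    qed
    ultimately show "\<rho> \<le> Re (deriv g 0)"
    proof -
      assume 1: "norm (deriv (\<lambda>z. h (of_real \<rho> * z)) 0) \<le> 1"
        and 2: "deriv (\<lambda>z. h (of_real \<rho> * z)) 0 = deriv h 0 * of_real \<rho>" and 3: "deriv g 0 * deriv h 0 = 1"
      have h': "deriv h 0 = of_real (1 / x)" using 3 g(4,5) by (simp add: field_simps)
      then have "\<rho> / x \<le> 1" using 1 g(5) rho unfolding 2 h' by (simp add: norm_mult norm_divide)
      then show ?thesis using g(4,5) by simp
    qed
    \<comment> \<open>Otherwise \<open>g\<close> would be the identity, and its image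
      \<open>S\<close> would contain the removed point \<open>z0\<close>.\<close>
    have "Re (deriv g 0) \<noteq> 1"
    proof
      assume "Re (deriv g 0) = 1"
      then have "deriv g 0 = 1" using G(5) by simp
      then have "g z0 = z0" by (rule disk_maps_identity[OF gd]) (use z0 in auto)
      moreover have "g z0 \<in> S" using g(6) z0(2) by auto
      ultimately show False using z0(1) by (simp add: S_def)
    qed
    with G(7) show "Re (deriv g 0) < 1" by simp
  qed
qed

text \<open>The common lower bound on the derivatives keeps the limit from being constant, so
  Hurwitz gives injectivity. The open mapping theorem then moves the image from the closed into the
  open disk.\<close>

lemma disk_maps_limit:
  fixes F :: "nat \<Rightarrow> complex \<Rightarrow> complex"
  assumes F: "\<And>n. F n \<in> disk_maps" and c: "0 < c" "\<And>n. c \<le> Re (deriv (F n) 0)"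
    and g: "g holomorphic_on ball 0 1" and ul: "\<And>K. compact K \<Longrightarrow> K \<subseteq> ball 0 1 \<Longrightarrow> uniform_limit K F g sequentially"
  shows "g \<in> disk_maps" "(\<lambda>n. deriv (F n) 0) \<longlonglongrightarrow> deriv g 0"
proof -
  note D = disk_mapsD[OF F]
  have pt: "(\<lambda>n. F n z) \<longlonglongrightarrow> g z" if "z \<in> ball 0 1" for z
    using tendsto_uniform_limitI[OF ul[of "{z}"]] that by auto
  have "uniform_limit (ball 0 (1/2)) F g sequentially"
    by (rule uniform_limit_on_subset[OF ul[of "cball 0 (1/2)"]]) auto
  from higher_deriv_complex_uniform_limit[OF this, of 0 1]
  show lim: "(\<lambda>n. deriv (F n) 0) \<longlonglongrightarrow> deriv g 0"
    using holomorphic_on_subset[OF D(1)] by (simp add: subset_ball)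
  have R: "(\<lambda>n. Re (deriv (F n) 0)) \<longlonglongrightarrow> Re (deriv g 0)" by (intro tendsto_intros lim)
  have "(\<lambda>n. complex_of_real (Re (deriv (F n) 0))) \<longlonglongrightarrow> of_real (Re (deriv g 0))" by (intro tendsto_intros R)
  then have "(\<lambda>n. deriv (F n) 0) \<longlonglongrightarrow> of_real (Re (deriv g 0))" using D(5) by simp
  then have dr: "deriv g 0 = of_real (Re (deriv g 0))" using lim LIMSEQ_unique by blast
  have pos: "c \<le> Re (deriv g 0)" using R c(2) by (intro LIMSEQ_le_const[OF R]) auto
  have nc: "\<not> g constant_on ball 0 1"
  proof
    assume "g constant_on ball 0 1"
    then obtain a where a: "\<And>z. z \<in> ball 0 1 \<Longrightarrow> g z = a" unfolding constant_on_def by blast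
    have "deriv g 0 = deriv (\<lambda>z. a) 0"
      by (rule complex_derivative_transform_within_open[OF g, of "\<lambda>z. a"]) (use a in auto)
    with pos c show False by simp
  qed
  have inj: "inj_on g (ball 0 1)"
    by (rule Hurwitz_injective[OF _ _ D(1) g ul nc D(2)]) auto
  have le: "norm (g z) \<le> 1" if "z \<in> ball 0 1" for z
    by (rule LIMSEQ_le_const2[OF tendsto_norm[OF pt[OF that]]]) (use D(3)[OF that] in \<open>auto intro!: exI[of _ 0] less_imp_le\<close>)
  have "open (g ` ball 0 1)" by (rule open_mapping_thm3[OF g _ inj]) simp
  then have "g ` ball 0 1 \<subseteq> interior (cball 0 1)" using le by (intro interior_maximal) auto
  then have b: "g z \<in> ball 0 1" if "z \<in> ball 0 1" for z using that unfolding interior_cball by blast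
  have "g 0 = 0" using LIMSEQ_unique[OF pt[of 0], of 0] D(4) by simp
  then show "g \<in> disk_maps" by (intro disk_mapsI[OF g inj b _ dr]) (use pos c in auto)
qed

lemma disk_maps_Montel:
  fixes F :: "nat \<Rightarrow> complex \<Rightarrow> complex"
  assumes F: "\<And>n. F n \<in> disk_maps"
  obtains g r where "g holomorphic_on ball 0 1" "strict_mono r"
    "\<And>K. compact K \<Longrightarrow> K \<subseteq> ball 0 1 \<Longrightarrow> uniform_limit K (F \<circ> r) g sequentially"
proof -
  have "\<exists>B. \<forall>h\<in>disk_maps. \<forall>z\<in>K. norm (h z) \<le> B" if "K \<subseteq> ball 0 1" for K
    using disk_mapsD(3) that by (intro exI[of _ 1]) (force intro: less_imp_le)
  note bd = this
  show ?thesis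
  proof (rule Montel[of "ball 0 1" disk_maps F])
    show "range F \<subseteq> disk_maps" using F by blast
    show "h holomorphic_on ball 0 1" if "h \<in> disk_maps" for h by (rule disk_mapsD(1)[OF that])
  qed (use bd that in auto)
qed

lemma tendsto_compose_uniform_limit:
  fixes F :: "nat \<Rightarrow> 'a::{heine_borel} \<Rightarrow> 'b::metric_space"
  assumes "uniform_limit K F g sequentially" "open S" "S \<subseteq> K" "a \<in> S" "x \<longlonglongrightarrow> a" "continuous_on S g"
  shows "(\<lambda>n. F n (x n)) \<longlonglongrightarrow> g a"
proof (rule tendstoI)
  fix e :: real assume e: "e > 0"
  have "(\<lambda>n. g (x n)) \<longlonglongrightarrow> g a"
    using assms by (intro isCont_tendsto_compose[OF _ assms(5)]) (simp add: continuous_on_eq_continuous_at)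
  then have "\<forall>\<^sub>F n in sequentially. dist (g (x n)) (g a) < e / 2" using e by (intro tendstoD) auto
  moreover have "\<forall>\<^sub>F n in sequentially. \<forall>z\<in>K. dist (F n z) (g z) < e / 2"
    using uniform_limitD[OF assms(1), of "e / 2"] e by auto
  moreover have "\<forall>\<^sub>F n in sequentially. x n \<in> S" using assms(2,4,5) by (metis topological_tendstoD)
  ultimately show "\<forall>\<^sub>F n in sequentially. dist (F n (x n)) (g a) < e"
  proof eventually_elim
    case (elim n)
    then have "dist (F n (x n)) (g (x n)) < e / 2" using assms(3) by auto
    with elim(1) show ?case by metric
  qed
qed

text \<open>Among all factorizations \<open>f = g \<circ> h\<close> with \<open>g'(0) \<ge> c\<close> one minimizes \<open>g'(0)\<close>; the minimum is \<open>c\<close>,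
  since otherwise a factor close to the identity could be moved from \<open>h\<close> to \<open>g\<close>.\<close>

lemma disk_map_factorization:
  assumes f: "f \<in> disk_maps" and c: "Re (deriv f 0) \<le> c" "c \<le> 1"
  obtains g h where "g \<in> disk_maps" "h \<in> disk_maps" "\<And>z. z \<in> ball 0 1 \<Longrightarrow> f z = g (h z)"
    "deriv g 0 = of_real c" "deriv h 0 = of_real (Re (deriv f 0) / c)"
proof -
  note F = disk_mapsD[OF f]
  have c0: "0 < c" using F(6) c by linarith
  define P where "P g h \<longleftrightarrow> g \<in> disk_maps \<and> h \<in> disk_maps \<and> (\<forall>z\<in>ball 0 1. f z = g (h z)) \<and> c \<le> Re (deriv g 0)" for g h
  have dP: "deriv f 0 = deriv g 0 * deriv h 0" if "P g h" for g h
  proof -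
    note G = disk_mapsD[of g] and H = disk_mapsD[of h]
    have "deriv f 0 = deriv (g \<circ> h) 0"
      by (rule complex_derivative_transform_within_open[of _ "ball 0 1"])
         (use that F(1) disk_mapsD(1)[OF disk_maps_comp(1)] in \<open>auto simp: P_def\<close>)
    then show ?thesis using disk_maps_comp(2)[of g h] that by (simp add: P_def)
  qed
  define X where "X = {Re (deriv g 0) | g h. P g h}"
  have "P (\<lambda>z. z) f" using f disk_maps_id c by (simp add: P_def)
  then have X0: "X \<noteq> {}" unfolding X_def by blast
  have bdd: "bdd_below X" unfolding X_def P_def by (rule bdd_belowI[of _ c]) auto
  define m where "m = Inf X"
  have "\<exists>x\<in>X. x < m + 1 / real (Suc n)" for n
    using cInf_lessD[OF X0, of "m + 1 / real (Suc n)"] by (auto simp: m_def)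
  then have "\<exists>g h. P g h \<and> Re (deriv g 0) < m + 1 / real (Suc n)" for n unfolding X_def by blast
  then obtain G H where GH: "\<And>n. P (G n) (H n)" "\<And>n. Re (deriv (G n) 0) < m + 1 / real (Suc n)" by metis
  have GHd: "G n \<in> disk_maps" "H n \<in> disk_maps" "c \<le> Re (deriv (G n) 0)" for n using GH(1)[of n] by (auto simp: P_def)
  obtain g r where g: "g holomorphic_on ball 0 1" "strict_mono r"
    "\<And>K. compact K \<Longrightarrow> K \<subseteq> ball 0 1 \<Longrightarrow> uniform_limit K (G \<circ> r) g sequentially"
    using disk_maps_Montel[of G] GHd(1) by blast
  obtain h s where h: "h holomorphic_on ball 0 1" "strict_mono s"
    "\<And>K. compact K \<Longrightarrow> K \<subseteq> ball 0 1 \<Longrightarrow> uniform_limit K ((H \<circ> r) \<circ> s) h sequentially"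
    using disk_maps_Montel[of "H \<circ> r"] GHd(2) by (metis comp_apply)
  define q where "q = r \<circ> s"
  have q: "strict_mono q" unfolding q_def using g(2) h(2) by (rule strict_mono_o)
  have Gq: "uniform_limit K (\<lambda>n. G (q n)) g sequentially" if "compact K" "K \<subseteq> ball 0 1" for K
    using filterlim_compose[OF g(3)[OF that] filterlim_subseq[OF h(2)]] by (simp add: q_def comp_def)
  have Hq: "uniform_limit K (\<lambda>n. H (q n)) h sequentially" if "compact K" "K \<subseteq> ball 0 1" for K
    using h(3)[OF that] by (simp add: q_def comp_def)
  \<comment> \<open>As the outer derivatives are at most 1, the inner ones are at least that of
    \<open>f\<close>; this keeps the limit of the inner factors from being constant.\<close>
  have hb: "Re (deriv f 0) \<le> Re (deriv (H n) 0)" for n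
  proof -
    have "deriv f 0 = of_real (Re (deriv (G n) 0)) * of_real (Re (deriv (H n) 0))"
      using dP[OF GH(1)] disk_mapsD(5)[OF GHd(1)] disk_mapsD(5)[OF GHd(2)] by metis
    then have "Re (deriv f 0) = Re (deriv (G n) 0) * Re (deriv (H n) 0)" by simp
    then show ?thesis
      using disk_mapsD(7)[OF GHd(1)[of n]] disk_mapsD(6)[OF GHd(2)[of n]] by (simp add: mult_left_le_one_le disk_mapsD(6)[OF GHd(1)[of n]] less_imp_le)
  qed
  have gd: "g \<in> disk_maps" "(\<lambda>n. deriv (G (q n)) 0) \<longlonglongrightarrow> deriv g 0"
    by (rule disk_maps_limit[OF _ c0 _ g(1) Gq]; use GHd in auto)+
  have hd: "h \<in> disk_maps" by (rule disk_maps_limit(1)[OF _ F(6) _ h(1) Hq]; use GHd hb in auto)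
  have fgh: "f z = g (h z)" if z: "z \<in> ball 0 1" for z
  proof -
    have hz: "h z \<in> ball 0 1" by (rule disk_mapsD(3)[OF hd z])
    define \<rho> where "\<rho> = (norm (h z) + 1) / 2"
    have r: "norm (h z) < \<rho>" "\<rho> < 1" using hz by (auto simp: \<rho>_def)
    have "(\<lambda>n. H (q n) z) \<longlonglongrightarrow> h z"
      using tendsto_uniform_limitI[OF Hq[of "{z}"]] z by auto
    then have "(\<lambda>n. G (q n) (H (q n) z)) \<longlonglongrightarrow> g (h z)"
      by (intro tendsto_compose_uniform_limit[where K = "cball 0 \<rho>" and S = "ball 0 \<rho>" and F = "\<lambda>n. G (q n)"] Gq)
         (use r in \<open>auto intro!: holomorphic_on_imp_continuous_on holomorphic_on_subset[OF g(1)]\<close>)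
    moreover have "G (q n) (H (q n) z) = f z" for n using GH(1)[of "q n"] z by (simp add: P_def)
    ultimately show ?thesis by (simp add: LIMSEQ_const_iff)
  qed
  have Rg: "(\<lambda>n. Re (deriv (G (q n)) 0)) \<longlonglongrightarrow> Re (deriv g 0)" by (intro tendsto_intros gd)
  have "c \<le> Re (deriv g 0)" by (rule LIMSEQ_le_const[OF Rg]) (use GHd in auto)
  then have Pgh: "P g h" using gd hd fgh by (auto simp: P_def)
  have "Re (deriv g 0) \<le> m"
  proof (rule LIMSEQ_le[OF Rg])
    have "(\<lambda>n. 1 / real (Suc n)) \<longlonglongrightarrow> 0" using LIMSEQ_inverse_real_of_nat by (simp add: inverse_eq_divide)
    from tendsto_add[OF tendsto_const LIMSEQ_subseq_LIMSEQ[OF this q]]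
    show "(\<lambda>n. m + 1 / real (Suc (q n))) \<longlonglongrightarrow> m" by (simp add: comp_def)
    show "\<exists>N. \<forall>n\<ge>N. Re (deriv (G (q n)) 0) \<le> m + 1 / real (Suc (q n))" using GH(2) by (auto intro: less_imp_le)
  qed
  have "Re (deriv g 0) = c"
  proof (rule ccontr)
    assume ne: "Re (deriv g 0) \<noteq> c"
    note Gd = disk_mapsD[OF gd(1)] and Hd = disk_mapsD[OF hd]
    have gc: "c < Re (deriv g 0)" using ne \<open>c \<le> Re (deriv g 0)\<close> by simp
    have "deriv h 0 \<noteq> 1"
      using dP[OF Pgh] c(1) gc by auto
    \<comment> \<open>The factor \<open>a\<close> split off from \<open>h\<close> then lowers the
      derivative of \<open>g\<close> strictly, but not below \<open>c\<close>.\<close>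
    moreover define \<rho> where "\<rho> = c / Re (deriv g 0)"
    have "0 < \<rho>" "\<rho> < 1" using gc c0 by (auto simp: \<rho>_def)
    ultimately obtain a b where ab: "a \<in> disk_maps" "b \<in> disk_maps" "\<And>z. z \<in> ball 0 1 \<Longrightarrow> h z = a (b z)"
        "\<rho> \<le> Re (deriv a 0)" "Re (deriv a 0) < 1"
      using disk_map_outer_factor[OF hd] by blast
    have "deriv (g \<circ> a) 0 = of_real (Re (deriv g 0)) * of_real (Re (deriv a 0))"
      using disk_maps_comp(2)[OF gd(1) ab(1)] Gd(5) disk_mapsD(5)[OF ab(1)] by metis
    then have d: "Re (deriv (g \<circ> a) 0) = Re (deriv g 0) * Re (deriv a 0)" by simp
    have "c = Re (deriv g 0) * \<rho>" using gc c0 by (simp add: \<rho>_def)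
    also have "\<dots> \<le> Re (deriv (g \<circ> a) 0)" unfolding d using ab(4) Gd(6) by (intro mult_left_mono) auto
    finally have "P (g \<circ> a) b" unfolding P_def using disk_maps_comp(1)[OF gd(1) ab(1)] ab fgh by auto
    then have "Re (deriv (g \<circ> a) 0) \<in> X" unfolding X_def by blast
    then have "m \<le> Re (deriv (g \<circ> a) 0)" unfolding m_def by (rule cInf_lower[OF _ bdd])
    also have "\<dots> < Re (deriv g 0) * 1" unfolding d using ab(5) Gd(6) by (intro mult_strict_left_mono) auto
    finally show False using \<open>Re (deriv g 0) \<le> m\<close> by simp
  qed
  then have gc: "deriv g 0 = of_real c" using disk_mapsD(5)[OF gd(1)] by simp
  have "deriv h 0 = of_real (Re (deriv f 0) / c)" using dP[OF Pgh] gc F(5) c0 by (simp add: field_simps)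
  with gd hd fgh gc show ?thesis by (intro that) auto
qed

section \<open>Discrete Loewner chains\<close>

fun chain :: "(nat \<Rightarrow> 'a \<Rightarrow> 'a) \<Rightarrow> nat \<Rightarrow> 'a \<Rightarrow> 'a" where
  "chain \<phi> 0 = (\<lambda>z. z)"
| "chain \<phi> (Suc n) = (\<lambda>z. \<phi> n (chain \<phi> n z))"

lemma chain_in_disk:
  assumes "\<And>j. j < n \<Longrightarrow> \<phi> j \<in> disk_maps" "z \<in> ball 0 1"
  shows "chain \<phi> n z \<in> ball 0 1"
  using assms(1)
proof (induction n)
  case (Suc n)
  then have "chain \<phi> n z \<in> ball 0 1" "\<phi> n \<in> disk_maps" by auto
  then show ?case using disk_mapsD(3)[of "\<phi> n"] by simp
qed (use assms(2) in simp)

text \<open>Each step splits the inner factor off what remains and appends it as the outermost map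
  of the chain so far. The last remainder has derivative 1 and is the identity.\<close>

lemma disk_map_chain:
  assumes f: "f \<in> disk_maps" and x: "x 0 = 1" "x N = Re (deriv f 0)" "\<And>j. j < N \<Longrightarrow> 0 < x (Suc j) \<and> x (Suc j) \<le> x j"
  obtains \<phi> where "\<And>j. j < N \<Longrightarrow> \<phi> j \<in> disk_maps" "\<And>j. j < N \<Longrightarrow> deriv (\<phi> j) 0 = of_real (x (Suc j) / x j)"
    "\<And>z. z \<in> ball 0 1 \<Longrightarrow> f z = chain \<phi> N z"
proof -
  have xpos: "0 < x j" if "j \<le> N" for j using x(1) x(3)[of "j - 1"] that by (cases j) auto
  have xN: "x N \<le> x j" if "j \<le> N" for j
    using that by (induction rule: inc_induct) (use x(3) in \<open>auto intro: order_trans\<close>)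
  have "\<exists>g \<phi>. g \<in> disk_maps \<and> Re (deriv g 0) = x N / x n \<and> (\<forall>j<n. \<phi> j \<in> disk_maps \<and> deriv (\<phi> j) 0 = of_real (x (Suc j) / x j)) \<and>
      (\<forall>z\<in>ball 0 1. f z = g (chain \<phi> n z))" if "n \<le> N" for n
    using that
  proof (induction n)
    case 0
    show ?case using f x(1,2) by (intro exI[of _ f]) auto
  next
    case (Suc n)
    have "n \<le> N" using Suc.prems by simp
    from Suc.IH[OF this] obtain g \<phi> where g: "g \<in> disk_maps" "Re (deriv g 0) = x N / x n"
      "\<forall>j<n. \<phi> j \<in> disk_maps \<and> deriv (\<phi> j) 0 = of_real (x (Suc j) / x j)"
      "\<forall>z\<in>ball 0 1. f z = g (chain \<phi> n z)" by blast
    have p: "0 < x n" "0 < x (Suc n)" "x (Suc n) \<le> x n" "x N \<le> x (Suc n)" "0 < x N"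
      using xpos x(3)[of n] xN Suc.prems by auto
    have "Re (deriv g 0) \<le> x N / x (Suc n)" "x N / x (Suc n) \<le> 1"
      unfolding g(2) using p by (auto intro!: divide_left_mono)
    then obtain a b where ab: "a \<in> disk_maps" "b \<in> disk_maps" "\<And>z. z \<in> ball 0 1 \<Longrightarrow> g z = a (b z)"
      "deriv a 0 = of_real (x N / x (Suc n))" "deriv b 0 = of_real (Re (deriv g 0) / (x N / x (Suc n)))"
      using disk_map_factorization[OF g(1)] by metis
    define \<phi>' where "\<phi>' = \<phi>(n := b)"
    have ch: "chain \<phi>' j = chain \<phi> j" if "j \<le> n" for j using that by (induction j) (auto simp: \<phi>'_def)
    have cb: "chain \<phi> j z \<in> ball 0 1" if "j \<le> n" "z \<in> ball 0 1" for j z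
      by (rule chain_in_disk[OF _ that(2)]) (use g(3) that(1) in auto)
    show ?case
    proof (intro exI[of _ a] exI[of _ \<phi>'] conjI allI impI ballI ab(1))
      show "Re (deriv a 0) = x N / x (Suc n)" using ab(4) by simp
      fix j assume "j < Suc n"
      then show "\<phi>' j \<in> disk_maps" "deriv (\<phi>' j) 0 = of_real (x (Suc j) / x j)"
        using g(2,3) ab(2,5) p by (auto simp: \<phi>'_def less_Suc_eq)
    next
      fix z :: complex assume "z \<in> ball 0 1"
      then show "f z = a (chain \<phi>' (Suc n) z)" using g(4) ab(3) cb[of n z] ch[of n] by (simp add: \<phi>'_def)
    qed
  qed
  from this[OF order_refl] obtain g \<phi> where g: "g \<in> disk_maps" "Re (deriv g 0) = x N / x N"
      "\<forall>j<N. \<phi> j \<in> disk_maps \<and> deriv (\<phi> j) 0 = of_real (x (Suc j) / x j)"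
      "\<forall>z\<in>ball 0 1. f z = g (chain \<phi> N z)" by blast
  have "deriv g 0 = 1" using g(2) disk_mapsD(5)[OF g(1)] xpos[of N] by simp
  moreover have cb: "chain \<phi> j z \<in> ball 0 1" if "j \<le> N" "z \<in> ball 0 1" for j z
    by (rule chain_in_disk[OF _ that(2)]) (use g(3) that(1) in auto)
  ultimately have "f z = chain \<phi> N z" if "z \<in> ball 0 1" for z
    using g(4) disk_maps_identity[OF g(1)] that by simp
  with g(3) show ?thesis by (intro that) auto
qed

section \<open>Slit maps and the Pick function\<close>

lemma koebe_eq_iff:
  assumes "norm z < 1" "norm w < 1"
  shows "koebe z = koebe w \<longleftrightarrow> z = w"
proof
  assume eq: "koebe z = koebe w"
  have ne: "(1 - z)\<^sup>2 \<noteq> 0" "(1 - w)\<^sup>2 \<noteq> 0" using assms by auto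
  have "z * (1 - w)\<^sup>2 = w * (1 - z)\<^sup>2"
    using eq ne unfolding koebe_def by (simp add: frac_eq_eq)
  then have "(z - w) * (1 - z * w) = 0" by (simp add: power2_eq_square algebra_simps)
  moreover have "norm (z * w) < 1" using assms mult_strict_mono[of "norm z" 1 "norm w" 1] by (simp add: norm_mult)
  then have "1 - z * w \<noteq> 0" by auto
  ultimately show "z = w" by simp
qed simp

lemma koebe_holomorphic: "koebe holomorphic_on ball 0 1"
  unfolding koebe_def[abs_def] by (intro holomorphic_intros) auto

lemma koebe_inj: "inj_on koebe (ball 0 1)"
  by (rule inj_onI) (simp add: koebe_eq_iff)

text \<open>Points of the disk are excluded from \<open>koebe\<^sup>-\<^sup>1((-\<infinity>, -1/4])\<close>
  because there \<open>1 / koebe z = z + 1/z - 2 \<in> [-4, 0)\<close>, which forces \<open>norm z = 1\<close>.\<close>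

lemma koebe_not_slit:
  assumes "norm z < 1" "koebe z = of_real s"
  shows "-1/4 < s"
proof (rule ccontr)
  assume "\<not> -1/4 < s"
  then have s: "s \<le> -1/4" by simp
  have ne: "1 - z \<noteq> 0" using assms by auto
  have q: "of_real s * (1 - z)\<^sup>2 = z" using assms(2) ne by (simp add: koebe_def field_simps)
  define b where "b = 2 + 1 / s"
  have b: "-2 \<le> b" "b < 2" using s by (auto simp: b_def divide_simps)
  have q2: "z\<^sup>2 - of_real b * z + 1 = 0"
  proof -
    have "of_real s * (z\<^sup>2 - of_real b * z + 1) = of_real s * (1 - z)\<^sup>2 - z"
      using s by (simp add: b_def power2_eq_square algebra_simps)
    then show ?thesis using q s by simp
  qed
  define x y where "x = Re z" and "y = Im z"
  have "Re (z\<^sup>2 - of_real b * z + 1) = 0" "Im (z\<^sup>2 - of_real b * z + 1) = 0" using q2 by simp_all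
  then have e: "x\<^sup>2 - y\<^sup>2 - b * x + 1 = 0" "2 * x * y - b * y = 0"
    by (simp_all add: x_def y_def power2_eq_square)
  have n: "x\<^sup>2 + y\<^sup>2 < 1" using assms(1) unfolding x_def y_def cmod_def by simp
  show False
  proof (cases "y = 0")
    case True
    then have "(x - b / 2)\<^sup>2 + (1 - b\<^sup>2 / 4) = 0" using e(1) by (simp add: power2_eq_square algebra_simps)
    moreover have "b\<^sup>2 \<le> 4" using b abs_le_square_iff[of b 2] by (simp add: abs_le_iff)
    ultimately have "(x - b / 2)\<^sup>2 = 0" "b\<^sup>2 = 4" using zero_le_power2[of "x - b / 2"] by linarith+
    then have "x = b / 2" by simp
    then have "x\<^sup>2 = (b / 2)\<^sup>2" by (simp only:)
    then have "x\<^sup>2 = b\<^sup>2 / 4" by (simp add: power_divide)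
    then have "x\<^sup>2 = 1" using \<open>b\<^sup>2 = 4\<close> by simp
    with n True show False by simp
  next
    case False
    then have "b = 2 * x" using e(2) by auto
    then have "x\<^sup>2 + y\<^sup>2 = 1" using e(1) by (simp add: power2_eq_square)
    with n show False by simp
  qed
qed

text \<open>For nonzero \<open>w\<close> the equation \<open>koebe z = w\<close> is quadratic with
  roots of product 1, so one root lies in the disk unless both have modulus 1. In that case
  \<open>2 + 1 / w\<close> is real and in \<open>[-2, 2]\<close>, which puts \<open>w\<close> on the
  slit.\<close>

lemma koebe_surj:
  assumes "\<And>s. w = of_real s \<Longrightarrow> -1/4 < s"
  obtains z where "norm z < 1" "koebe z = w"
proof (cases "w = 0")
  case True
  then show ?thesis by (intro that[of 0]) (auto simp: koebe_def)
next
  case False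
  define b where "b = (2 * w + 1) / w"
  define u where "u = (b + csqrt (b\<^sup>2 - 4)) / 2"
  define v where "v = (b - csqrt (b\<^sup>2 - 4)) / 2"
  have uv: "u * v = 1" "u + v = b"
    by (auto simp: u_def v_def field_simps) (simp add: power2_eq_square algebra_simps power2_csqrt[unfolded power2_eq_square])
  have root: "koebe z = w" if "z = u \<or> z = v" for z
  proof -
    have "z\<^sup>2 - b * z + 1 = 0" using that uv(1) unfolding uv(2)[symmetric] by (auto simp: power2_eq_square algebra_simps)
    then have "w * z\<^sup>2 - (2 * w + 1) * z + w = 0"
      using False by (simp add: b_def field_simps)
    then have e: "w * (1 - z)\<^sup>2 = z" by (simp add: power2_eq_square algebra_simps)
    then have "z \<noteq> 1" by auto
    with e show ?thesis by (simp add: koebe_def field_simps)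
  qed
  have nuv: "norm u * norm v = 1" using uv(1) by (metis norm_mult norm_one)
  have "norm u \<noteq> 1"
  proof
    assume n: "norm u = 1"
    then have "v = cnj u" using uv(1)
      by (metis complex_norm_square mult.commute mult_cancel_left mult_zero_left norm_zero of_real_1 one_power2 zero_neq_one)
    then have b: "b = of_real (2 * Re u)" using uv(2) by (simp add: complex_add_cnj)
    have "b = 2 + 1 / w" using False by (simp add: b_def field_simps)
    then have "1 / w = of_real (2 * Re u - 2)" using b by simp
    then have w: "w = of_real (1 / (2 * Re u - 2))" using False by (metis div_by_1 divide_divide_eq_right mult.left_neutral of_real_1 of_real_divide)
    have "\<bar>Re u\<bar> \<le> 1" using n abs_Re_le_cmod[of u] by simp
    moreover have "Re u \<noteq> 1" using w False by auto
    ultimately have "Re u < 1" "-1 \<le> Re u" by auto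
    then have "1 / (2 * Re u - 2) \<le> -1/4" by (simp add: divide_simps)
    with assms[OF w] show False by simp
  qed
  then have "norm u < 1 \<or> norm v < 1" using nuv
    by (metis less_linear linorder_not_le mult_le_cancel_left1 norm_ge_zero not_one_le_zero order_le_less)
  then show ?thesis using that root by blast
qed

text \<open>For \<open>\<rho> > 1\<close> this is the conformal map of the disk onto the disk cut
  along a segment of the negative real axis that ends at -1, with derivative
  \<open>1 / \<rho>\<close> at 0.\<close>

definition slit_map :: "real \<Rightarrow> complex \<Rightarrow> complex" where
  "slit_map \<rho> z = inv_into (ball 0 1) koebe (koebe z / of_real \<rho>)"

lemma pick_eq_slit_map: "pick M z = of_real M * slit_map M z"
  by (simp add: pick_def slit_map_def)

lemma koebe_scaled_in_image:
  assumes "1 \<le> \<rho>" "z \<in> ball 0 1"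
  shows "koebe z / of_real \<rho> \<in> koebe ` ball 0 1"
proof -
  have "-1/4 < s" if "koebe z / of_real \<rho> = of_real s" for s
  proof -
    have "koebe z = of_real (\<rho> * s)" using that assms by (simp add: field_simps)
    then have "-1/4 < \<rho> * s" using koebe_not_slit assms(2) by simp
    show ?thesis
    proof (rule ccontr)
      assume "\<not> -1/4 < s"
      then have "\<rho> * s \<le> 1 * s" using assms(1) by (intro mult_right_mono_neg) auto
      with \<open>\<not> -1/4 < s\<close> \<open>-1/4 < \<rho> * s\<close> show False by linarith
    qed
  qed
  then obtain u where "norm u < 1" "koebe u = koebe z / of_real \<rho>" by (rule koebe_surj)
  then show ?thesis by force
qed

lemma slit_map:
  assumes "1 \<le> \<rho>" "z \<in> ball 0 1"
  shows "slit_map \<rho> z \<in> ball 0 1" "koebe (slit_map \<rho> z) = koebe z / of_real \<rho>"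
  unfolding slit_map_def using koebe_scaled_in_image[OF assms]
  by (rule inv_into_into, rule f_inv_into_f)

lemma slit_map_unique:
  assumes "1 \<le> \<rho>" "z \<in> ball 0 1" "u \<in> ball 0 1" "koebe u = koebe z / of_real \<rho>"
  shows "slit_map \<rho> z = u"
  using slit_map[OF assms(1,2)] assms koebe_inj by (metis inj_onD)

lemma slit_map_1: "z \<in> ball 0 1 \<Longrightarrow> slit_map 1 z = z"
  by (rule slit_map_unique) auto

text \<open>This semigroup law makes the Pick function a chain of slit maps at the angle 0 for every
  subdivision of time.\<close>

lemma slit_map_comp:
  assumes "1 \<le> \<rho>" "1 \<le> \<sigma>" "z \<in> ball 0 1"
  shows "slit_map \<rho> (slit_map \<sigma> z) = slit_map (\<rho> * \<sigma>) z"
proof (rule slit_map_unique[symmetric])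
  show "1 \<le> \<rho> * \<sigma>" using mult_mono[of 1 \<rho> 1 \<sigma>] assms by simp
  show "slit_map \<rho> (slit_map \<sigma> z) \<in> ball 0 1" using assms slit_map(1) by blast
  show "koebe (slit_map \<rho> (slit_map \<sigma> z)) = koebe z / of_real (\<rho> * \<sigma>)"
    using assms slit_map by simp
qed (use assms in auto)

lemma slit_map_0: "1 \<le> \<rho> \<Longrightarrow> slit_map \<rho> 0 = 0"
  by (rule slit_map_unique) (auto simp: koebe_def)

lemma koebe_inverse_holomorphic: "inv_into (ball 0 1) koebe holomorphic_on koebe ` ball 0 1"
proof -
  obtain g where g: "g holomorphic_on koebe ` ball 0 1" "\<And>z. z \<in> ball 0 1 \<Longrightarrow> deriv koebe z * deriv g (koebe z) = 1"
      "\<And>z. z \<in> ball 0 1 \<Longrightarrow> g (koebe z) = z"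
    using holomorphic_has_inverse[OF koebe_holomorphic open_ball koebe_inj] by blast
  have "inv_into (ball 0 1) koebe w = g w" if "w \<in> koebe ` ball 0 1" for w
  proof -
    from that obtain z where "z \<in> ball 0 1" "w = koebe z" by blast
    then show ?thesis using g(3) inv_into_f_f[OF koebe_inj] by simp
  qed
  then show ?thesis by (intro holomorphic_transform[OF g(1)]) (rule sym)
qed

lemma slit_map_holomorphic: "1 \<le> \<rho> \<Longrightarrow> slit_map \<rho> holomorphic_on ball 0 1"
proof -
  assume r: "1 \<le> \<rho>"
  have "inv_into (ball 0 1) koebe \<circ> (\<lambda>z. koebe z / of_real \<rho>) holomorphic_on ball 0 1"
    by (rule holomorphic_on_compose_gen[OF _ koebe_inverse_holomorphic])
       (use r koebe_scaled_in_image[OF r] in \<open>auto intro!: holomorphic_intros koebe_holomorphic\<close>)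
  then show ?thesis by (simp add: comp_def slit_map_def[abs_def])
qed

lemma continuous_on_slit_map: "continuous_on ({1..} \<times> ball 0 1) (\<lambda>(\<rho>, z). slit_map \<rho> z)"
proof -
  have "continuous_on ({1..} \<times> ball 0 1) (\<lambda>p. inv_into (ball 0 1) koebe (koebe (snd p) / of_real (fst p)))"
  proof (rule continuous_on_compose2[OF holomorphic_on_imp_continuous_on[OF koebe_inverse_holomorphic]])
    show "continuous_on ({1..} \<times> ball 0 1) (\<lambda>p. koebe (snd p) / of_real (fst p))"
      by (intro continuous_intros continuous_on_compose2[OF holomorphic_on_imp_continuous_on[OF koebe_holomorphic]]) auto
    show "(\<lambda>p. koebe (snd p) / of_real (fst p)) ` ({1..} \<times> ball 0 1) \<subseteq> koebe ` ball 0 1"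
      using koebe_scaled_in_image by (auto simp del: mem_ball)
  qed
  then show ?thesis by (simp add: case_prod_unfold slit_map_def)
qed

text \<open>The functional equation
  \<open>\<rho> * Q * (1 - z)\<^sup>2 = z * (1 - Q)\<^sup>2\<close> determines the coefficients one
  after the other.\<close>

lemma slit_map_coeffs:
  assumes \<rho>: "1 \<le> \<rho>"
  defines "Q \<equiv> fps_expansion (slit_map \<rho>) 0" and "\<tau> \<equiv> 1 - 1 / \<rho>"
  shows "slit_map \<rho> has_fps_expansion Q" "fps_nth Q 0 = 0" "fps_nth Q 1 = of_real (1 / \<rho>)"
    "fps_nth Q 2 = of_real (1 / \<rho> * (2 * \<tau>))" "fps_nth Q 3 = of_real (1 / \<rho> * (5 * \<tau>\<^sup>2 - 2 * \<tau>))"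
    "fps_nth Q 4 = of_real (1 / \<rho> * (14 * \<tau> ^ 3 - 12 * \<tau>\<^sup>2 + 2 * \<tau>))"
proof -
  show Q: "slit_map \<rho> has_fps_expansion Q"
    unfolding Q_def by (rule has_fps_expansion_fps_expansion[of "ball 0 1"]) (auto intro: slit_map_holomorphic \<rho>)
  have Q0: "fps_nth Q 0 = 0" using has_fps_expansion_imp_0_eq_fps_nth_0[OF Q] slit_map_0[OF assms(1)] by simp
  have eq: "of_real \<rho> * slit_map \<rho> z * (1 - z)\<^sup>2 = z * (1 - slit_map \<rho> z)\<^sup>2" if "z \<in> ball 0 1" for z
  proof -
    have "slit_map \<rho> z \<noteq> 1" "z \<noteq> 1" using slit_map(1)[OF assms(1) that] that by auto
    then show ?thesis using slit_map(2)[OF assms(1) that] assms(1) by (simp add: koebe_def field_simps)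
  qed
  have 1: "(\<lambda>z. of_real \<rho> * slit_map \<rho> z * (1 - z)\<^sup>2) has_fps_expansion fps_const (of_real \<rho>) * Q * (1 - fps_X)\<^sup>2"
    by (intro fps_expansion_intros Q)
  have 2: "(\<lambda>z. z * (1 - slit_map \<rho> z)\<^sup>2) has_fps_expansion fps_X * (1 - Q)\<^sup>2"
    by (intro fps_expansion_intros Q)
  have "eventually (\<lambda>z::complex. z \<in> ball 0 1) (nhds 0)" by (intro eventually_nhds_in_open) auto
  then have ev: "eventually (\<lambda>z. of_real \<rho> * slit_map \<rho> z * (1 - z)\<^sup>2 = z * (1 - slit_map \<rho> z)\<^sup>2) (nhds 0)"
    by eventually_elim (rule eq)
  have "(\<lambda>z. of_real \<rho> * slit_map \<rho> z * (1 - z)\<^sup>2) has_fps_expansion fps_X * (1 - Q)\<^sup>2"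
    by (rule iffD2[OF has_fps_expansion_cong[OF ev refl] 2])
  from fps_expansion_unique_complex[OF 1 this]
  have E: "fps_const (of_real \<rho>) * Q * (1 - fps_X)\<^sup>2 = fps_X * (1 - Q)\<^sup>2" .
  have n: "fps_nth (fps_const (of_real \<rho>) * Q * (1 - fps_X)\<^sup>2) k = fps_nth (fps_X * (1 - Q)\<^sup>2) k" for k
    by (simp only: E)
  have L: "fps_const (of_real \<rho>) * Q * (1 - fps_X)\<^sup>2 = fps_const (of_real \<rho>) * (Q - (fps_X * Q + fps_X * Q) + fps_X * (fps_X * Q))"
    by (simp add: power2_eq_square algebra_simps)
  have R: "fps_X * (1 - Q)\<^sup>2 = fps_X * (1 - (Q + Q) + Q * Q)" by (simp add: power2_eq_square algebra_simps)
  have r0: "complex_of_real \<rho> \<noteq> 0" using assms by simp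
  have e1: "of_real \<rho> * fps_nth Q 1 = 1"
    using n[of 1] unfolding L R by (simp add: Q0 numeral_fps_const)
  have e2: "of_real \<rho> * (fps_nth Q 2 - 2 * fps_nth Q 1) = - 2 * fps_nth Q 1"
    using n[of 2] unfolding L R by (simp add: Q0 numeral_fps_const eval_nat_numeral fps_mult_nth)
  have e3: "of_real \<rho> * (fps_nth Q 3 - 2 * fps_nth Q 2 + fps_nth Q 1) = - 2 * fps_nth Q 2 + (fps_nth Q 1)\<^sup>2"
    using n[of 3] unfolding L R by (simp add: Q0 numeral_fps_const eval_nat_numeral fps_mult_nth)
  have e4: "of_real \<rho> * (fps_nth Q 4 - 2 * fps_nth Q 3 + fps_nth Q 2) = - 2 * fps_nth Q 3 + 2 * fps_nth Q 1 * fps_nth Q 2"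
    using n[of 4] unfolding L R by (simp add: Q0 numeral_fps_const eval_nat_numeral fps_mult_nth algebra_simps)
  show "fps_nth Q 0 = 0" by (rule Q0)
  show q1: "fps_nth Q 1 = of_real (1 / \<rho>)" using e1 r0 by (simp add: field_simps)
  show q2: "fps_nth Q 2 = of_real (1 / \<rho> * (2 * \<tau>))"
  proof -
    have "fps_nth Q 2 = 2 * fps_nth Q 1 - 2 * fps_nth Q 1 / of_real \<rho>" using e2 r0 by (simp add: field_simps)
    then show ?thesis unfolding q1 \<tau>_def by (simp add: algebra_simps)
  qed
  show q3: "fps_nth Q 3 = of_real (1 / \<rho> * (5 * \<tau>\<^sup>2 - 2 * \<tau>))"
  proof -
    have "fps_nth Q 3 = 2 * fps_nth Q 2 - fps_nth Q 1 + (- 2 * fps_nth Q 2 + (fps_nth Q 1)\<^sup>2) / of_real \<rho>"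
      using e3 r0 by (simp add: field_simps)
    also have "\<dots> = of_real (2 * (1 / \<rho> * (2 * \<tau>)) - 1 / \<rho> + (- 2 * (1 / \<rho> * (2 * \<tau>)) + (1 / \<rho>)\<^sup>2) / \<rho>)"
      unfolding q1 q2 by simp
    also have "2 * (1 / \<rho> * (2 * \<tau>)) - 1 / \<rho> + (- 2 * (1 / \<rho> * (2 * \<tau>)) + (1 / \<rho>)\<^sup>2) / \<rho> = 1 / \<rho> * (5 * \<tau>\<^sup>2 - 2 * \<tau>)"
      using assms unfolding \<tau>_def by (simp add: field_simps power2_eq_square)
    finally show ?thesis .
  qed
  show "fps_nth Q 4 = of_real (1 / \<rho> * (14 * \<tau> ^ 3 - 12 * \<tau>\<^sup>2 + 2 * \<tau>))"
  proof -
    have "fps_nth Q 4 = 2 * fps_nth Q 3 - fps_nth Q 2 + (- 2 * fps_nth Q 3 + 2 * fps_nth Q 1 * fps_nth Q 2) / of_real \<rho>"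
      using e4 r0 by (simp add: field_simps)
    also have "\<dots> = of_real (2 * (1 / \<rho> * (5 * \<tau>\<^sup>2 - 2 * \<tau>)) - 1 / \<rho> * (2 * \<tau>)
        + (- 2 * (1 / \<rho> * (5 * \<tau>\<^sup>2 - 2 * \<tau>)) + 2 * (1 / \<rho>) * (1 / \<rho> * (2 * \<tau>))) / \<rho>)"
      unfolding q1 q2 q3 by simp
    also have "2 * (1 / \<rho> * (5 * \<tau>\<^sup>2 - 2 * \<tau>)) - 1 / \<rho> * (2 * \<tau>)
        + (- 2 * (1 / \<rho> * (5 * \<tau>\<^sup>2 - 2 * \<tau>)) + 2 * (1 / \<rho>) * (1 / \<rho> * (2 * \<tau>))) / \<rho>
        = 1 / \<rho> * (14 * \<tau> ^ 3 - 12 * \<tau>\<^sup>2 + 2 * \<tau>)"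
      using assms unfolding \<tau>_def by (simp add: field_simps power2_eq_square power3_eq_cube)
    finally show ?thesis .
  qed
qed

lemma deriv_0_fps:
  fixes f :: "complex \<Rightarrow> complex"
  assumes "f has_fps_expansion F"
  shows "deriv f 0 = fps_nth F 1"
  using fps_nth_fps_expansion[OF assms, of 1] by simp

lemma slit_map_disk_maps:
  assumes "1 \<le> \<rho>"
  shows "slit_map \<rho> \<in> disk_maps" "deriv (slit_map \<rho>) 0 = of_real (1 / \<rho>)"
proof -
  show d: "deriv (slit_map \<rho>) 0 = of_real (1 / \<rho>)"
    using deriv_0_fps[OF slit_map_coeffs(1)[OF assms]] slit_map_coeffs(3)[OF assms] by simp
  show "slit_map \<rho> \<in> disk_maps"
  proof (rule disk_mapsI[OF slit_map_holomorphic[OF assms] _ slit_map(1)[OF assms] slit_map_0[OF assms] d])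
    show "inj_on (slit_map \<rho>) (ball 0 1)"
    proof (rule inj_onI)
      fix z w :: complex assume zw: "z \<in> ball 0 1" "w \<in> ball 0 1" "slit_map \<rho> z = slit_map \<rho> w"
      then have "koebe z / of_real \<rho> = koebe w / of_real \<rho>" using slit_map(2)[OF assms] by metis
      then show "z = w" using zw assms koebe_eq_iff[of z w] by simp
    qed
  qed (use assms in auto)
qed

lemma disk_maps_bounded_univalent:
  assumes "f \<in> disk_maps" "deriv f 0 = of_real (1 / M)" "1 \<le> M"
  shows "(\<lambda>z. of_real M * f z) \<in> bounded_univalent M"
proof -
  note F = disk_mapsD[OF assms(1)]
  have "deriv (\<lambda>z. of_real M * f z) 0 = of_real M * deriv f 0"
    using F(1) by (intro deriv_cmult holomorphic_on_imp_differentiable_at[of _ "ball 0 1"]) auto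
  then have d: "deriv (\<lambda>z. of_real M * f z) 0 = 1" using assms(2,3) by simp
  have n: "norm (of_real M * f z) < M" if "z \<in> ball 0 1" for z
  proof -
    have "norm (f z) < 1" using F(3)[OF that] by simp
    then have "M * norm (f z) < M * 1" using assms(3) by (intro mult_strict_left_mono) auto
    then show ?thesis using assms(3) by (simp add: norm_mult)
  qed
  have "inj_on (\<lambda>z. of_real M * f z) (ball 0 1)"
    using F(2) assms(3) by (simp add: inj_on_def)
  moreover have "(\<lambda>z. of_real M * f z) holomorphic_on ball 0 1" by (intro holomorphic_intros F(1))
  ultimately show ?thesis unfolding bounded_univalent_def using d n F(4) by simp
qed

lemma bounded_univalent_disk_maps:
  assumes "f \<in> bounded_univalent M" "0 < M"
  shows "(\<lambda>z. f z / of_real M) \<in> disk_maps" "deriv (\<lambda>z. f z / of_real M) 0 = of_real (1 / M)"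
proof -
  have f: "f holomorphic_on ball 0 1" "inj_on f (ball 0 1)" "f 0 = 0" "deriv f 0 = 1"
    "\<And>z. z \<in> ball 0 1 \<Longrightarrow> norm (f z) < M"
    using assms(1) by (auto simp: bounded_univalent_def)
  have "deriv (\<lambda>z. f z / of_real M) 0 = deriv f 0 / of_real M"
    by (rule deriv_cdivide_right) (use f(1) in \<open>auto simp: holomorphic_on_imp_differentiable_at\<close>)
  then show d: "deriv (\<lambda>z. f z / of_real M) 0 = of_real (1 / M)" by (simp add: f(4))
  show "(\<lambda>z. f z / of_real M) \<in> disk_maps"
    by (rule disk_mapsI[OF _ _ _ _ d])
       (use f assms(2) in \<open>auto intro!: holomorphic_intros simp: inj_on_def norm_divide\<close>)
qed

section \<open>Coefficients of compositions\<close>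

lemma fps_compose_coeffs:
  fixes a b :: "complex fps"
  assumes "fps_nth a 0 = 0" "fps_nth b 0 = 0"
  shows "fps_nth (a oo b) 1 = fps_nth a 1 * fps_nth b 1"
    "fps_nth (a oo b) 2 = fps_nth a 1 * fps_nth b 2 + fps_nth a 2 * (fps_nth b 1)\<^sup>2"
    "fps_nth (a oo b) 3 = fps_nth a 1 * fps_nth b 3 + 2 * fps_nth a 2 * fps_nth b 1 * fps_nth b 2
       + fps_nth a 3 * (fps_nth b 1) ^ 3"
    "fps_nth (a oo b) 4 = fps_nth a 1 * fps_nth b 4
       + fps_nth a 2 * (2 * fps_nth b 1 * fps_nth b 3 + (fps_nth b 2)\<^sup>2)
       + 3 * fps_nth a 3 * (fps_nth b 1)\<^sup>2 * fps_nth b 2 + fps_nth a 4 * (fps_nth b 1) ^ 4"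
  using assms by (simp_all add: fps_compose_nth eval_nat_numeral fps_mult_nth algebra_simps)

text \<open>For \<open>f = z + a\<^sub>2 z\<^sup>2 + a\<^sub>3 z\<^sup>3 + a\<^sub>4 z\<^sup>4 + \<dots>\<close> use the coordinates
  \<open>A = a\<^sub>2\<close>, \<open>B = (a\<^sub>2\<^sup>2 - a\<^sub>3) / 2\<close>, \<open>R = a\<^sub>4 - A\<^sup>3 + 4 A B\<close>. Composing \<open>x f\<close> with \<open>\<phi>\<close> from outside
  changes \<open>A\<close> and \<open>B\<close> by constants and \<open>R\<close> by a multiple of \<open>A\<close> plus a constant.\<close>

definition incr_A :: "real \<Rightarrow> complex fps \<Rightarrow> complex" where
  "incr_A x P = of_real x * (fps_nth P 2 / fps_nth P 1)"

definition incr_B :: "real \<Rightarrow> complex fps \<Rightarrow> complex" where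
  "incr_B x P = (of_real x)\<^sup>2 * ((fps_nth P 2 / fps_nth P 1)\<^sup>2 - fps_nth P 3 / fps_nth P 1) / 2"

definition incr_R :: "real \<Rightarrow> complex fps \<Rightarrow> complex" where
  "incr_R x P = (of_real x) ^ 3 * (fps_nth P 4 / fps_nth P 1) - (incr_A x P) ^ 3 + 4 * incr_A x P * incr_B x P"

text \<open>This is \<open>A ^ 3 - 4 * A * B + R\<close> after \<open>n\<close> steps: step
  \<open>i\<close> adds \<open>d i\<close> to \<open>A\<close>, \<open>b i\<close> to
  \<open>B\<close>, and \<open>c i - 2 * A * b i\<close> to \<open>R\<close>, with the old value of
  \<open>A\<close>.\<close>

definition total_a4 :: "(nat \<Rightarrow> complex) \<Rightarrow> (nat \<Rightarrow> complex) \<Rightarrow> (nat \<Rightarrow> complex) \<Rightarrow> nat \<Rightarrow> complex" where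
  "total_a4 d b c n = (\<Sum>i<n. d i) ^ 3 - 4 * (\<Sum>i<n. d i) * (\<Sum>i<n. b i) + (\<Sum>i<n. c i - 2 * (\<Sum>j<i. d j) * b i)"

lemma chain_coeffs:
  assumes P: "\<And>j. j < n \<Longrightarrow> \<phi> j has_fps_expansion P j" "\<And>j. j < n \<Longrightarrow> fps_nth (P j) 0 = 0"
      "\<And>j. j < n \<Longrightarrow> fps_nth (P j) 1 = of_real (x (Suc j) / x j)"
    and x: "x 0 = 1" "\<And>j. j \<le> n \<Longrightarrow> 0 < x j"
  defines "d \<equiv> \<lambda>j. incr_A (x j) (P j)" and "b \<equiv> \<lambda>j. incr_B (x j) (P j)" and "c \<equiv> \<lambda>j. incr_R (x j) (P j)"
  obtains W where "chain \<phi> n has_fps_expansion W" "fps_nth W 0 = 0" "fps_nth W 1 = of_real (x n)"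
    "fps_nth W 2 = of_real (x n) * (\<Sum>i<n. d i)"
    "fps_nth W 3 = of_real (x n) * ((\<Sum>i<n. d i)\<^sup>2 - 2 * (\<Sum>i<n. b i))"
    "fps_nth W 4 = of_real (x n) * total_a4 d b c n"
proof -
  have "\<exists>W. chain \<phi> m has_fps_expansion W \<and> fps_nth W 0 = 0 \<and> fps_nth W 1 = of_real (x m) \<and>
    fps_nth W 2 = of_real (x m) * (\<Sum>i<m. d i) \<and>
    fps_nth W 3 = of_real (x m) * ((\<Sum>i<m. d i)\<^sup>2 - 2 * (\<Sum>i<m. b i)) \<and>
    fps_nth W 4 = of_real (x m) * total_a4 d b c m" if "m \<le> n" for m
    using that
  proof (induction m)
    case 0
    have "chain \<phi> 0 has_fps_expansion fps_X" by (simp add: has_fps_expansion_fps_X)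
    then show ?case using x(1) by (intro exI[of _ fps_X]) (auto simp: total_a4_def)
  next
    case (Suc m)
    then obtain W where W: "chain \<phi> m has_fps_expansion W" "fps_nth W 0 = 0" "fps_nth W 1 = of_real (x m)"
      "fps_nth W 2 = of_real (x m) * (\<Sum>i<m. d i)"
      "fps_nth W 3 = of_real (x m) * ((\<Sum>i<m. d i)\<^sup>2 - 2 * (\<Sum>i<m. b i))"
      "fps_nth W 4 = of_real (x m) * total_a4 d b c m" using Suc_leD by blast
    have m: "m < n" using Suc.prems by simp
    define \<xi> \<xi>' where "\<xi> = complex_of_real (x m)" and "\<xi>' = complex_of_real (x (Suc m))"
    have ne: "\<xi> \<noteq> 0" "\<xi>' \<noteq> 0" using x(2)[of m] x(2)[of "Suc m"] Suc.prems by (auto simp: \<xi>_def \<xi>'_def)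
    define A B R where "A = (\<Sum>i<m. d i)" and "B = (\<Sum>i<m. b i)" and "R = (\<Sum>i<m. c i - 2 * (\<Sum>j<i. d j) * b i)"
    define p2 p3 p4 where "p2 = fps_nth (P m) 2 / fps_nth (P m) 1" and "p3 = fps_nth (P m) 3 / fps_nth (P m) 1"
      and "p4 = fps_nth (P m) 4 / fps_nth (P m) 1"
    have P1: "fps_nth (P m) 1 = \<xi>' / \<xi>" using P(3)[OF m] by (simp add: \<xi>_def \<xi>'_def)
    have Pk: "fps_nth (P m) 2 = \<xi>' / \<xi> * p2" "fps_nth (P m) 3 = \<xi>' / \<xi> * p3" "fps_nth (P m) 4 = \<xi>' / \<xi> * p4"
      unfolding p2_def p3_def p4_def P1 using ne by auto
    have D: "d m = \<xi> * p2" "b m = \<xi>\<^sup>2 * (p2\<^sup>2 - p3) / 2" "c m = \<xi> ^ 3 * p4 - (d m) ^ 3 + 4 * d m * b m"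
      by (simp_all add: d_def b_def c_def incr_A_def incr_B_def incr_R_def p2_def p3_def p4_def \<xi>_def)
    have Wk: "fps_nth W 1 = \<xi>" "fps_nth W 2 = \<xi> * A" "fps_nth W 3 = \<xi> * (A\<^sup>2 - 2 * B)"
      "fps_nth W 4 = \<xi> * (A ^ 3 - 4 * A * B + R)"
      using W by (simp_all add: \<xi>_def A_def B_def R_def total_a4_def)
    note C = fps_compose_coeffs[OF P(2)[OF m] W(2)]
    show ?case
    proof (intro exI[of _ "P m oo W"] conjI)
      have "(\<phi> m \<circ> chain \<phi> m) has_fps_expansion (P m oo W)" by (rule has_fps_expansion_compose[OF P(1)[OF m] W(1,2)])
      then show "chain \<phi> (Suc m) has_fps_expansion (P m oo W)" by (simp add: comp_def)
      show "fps_nth (P m oo W) 0 = 0" using P(2)[OF m] by simp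
      show "fps_nth (P m oo W) 1 = of_real (x (Suc m))" unfolding C Wk P1 using ne by (simp add: \<xi>'_def)
      show "fps_nth (P m oo W) 2 = of_real (x (Suc m)) * (\<Sum>i<Suc m. d i)"
        unfolding C Wk P1 Pk sum.lessThan_Suc A_def[symmetric] D \<xi>'_def[symmetric]
        using ne by (simp add: field_simps power2_eq_square)
      show "fps_nth (P m oo W) 3 = of_real (x (Suc m)) * ((\<Sum>i<Suc m. d i)\<^sup>2 - 2 * (\<Sum>i<Suc m. b i))"
        unfolding C Wk P1 Pk sum.lessThan_Suc A_def[symmetric] B_def[symmetric] D \<xi>'_def[symmetric]
        using ne by (simp add: field_simps power2_eq_square power3_eq_cube)
      have "total_a4 d b c (Suc m) = (A + d m) ^ 3 - 4 * (A + d m) * (B + b m) + (R + (c m - 2 * A * b m))"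
        by (simp add: total_a4_def A_def B_def R_def)
      note tot = this
      show "fps_nth (P m oo W) 4 = of_real (x (Suc m)) * total_a4 d b c (Suc m)"
        unfolding tot C Wk P1 Pk D \<xi>'_def[symmetric]
        using ne by (simp add: field_simps power2_eq_square power3_eq_cube power4_eq_xxxx)
    qed
  qed
  from this[OF order_refl] that show ?thesis by blast
qed

lemma taylor_coeff_chain:
  assumes f: "\<And>z. z \<in> ball 0 1 \<Longrightarrow> f z = of_real (1 / x n) * chain \<phi> n z"
    and P: "\<And>j. j < n \<Longrightarrow> \<phi> j \<in> disk_maps" "\<And>j. j < n \<Longrightarrow> deriv (\<phi> j) 0 = of_real (x (Suc j) / x j)"
    and x: "x 0 = 1" "\<And>j. j \<le> n \<Longrightarrow> 0 < x j"
  defines "d \<equiv> \<lambda>j. incr_A (x j) (fps_expansion (\<phi> j) 0)" and "b \<equiv> \<lambda>j. incr_B (x j) (fps_expansion (\<phi> j) 0)"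
    and "c \<equiv> \<lambda>j. incr_R (x j) (fps_expansion (\<phi> j) 0)"
  shows "taylor_coeff f 2 = (\<Sum>i<n. d i)" "taylor_coeff f 4 = total_a4 d b c n"
proof -
  have E: "\<phi> j has_fps_expansion fps_expansion (\<phi> j) 0" if "j < n" for j
    by (rule has_fps_expansion_fps_expansion[of "ball 0 1"]) (use disk_mapsD(1)[OF P(1)[OF that]] in auto)
  have E0: "fps_nth (fps_expansion (\<phi> j) 0) 0 = 0" if "j < n" for j
    using has_fps_expansion_imp_0_eq_fps_nth_0[OF E[OF that]] disk_mapsD(4)[OF P(1)[OF that]] by simp
  have E1: "fps_nth (fps_expansion (\<phi> j) 0) 1 = of_real (x (Suc j) / x j)" if "j < n" for j
    using deriv_0_fps[OF E[OF that]] P(2)[OF that] by simp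
  obtain W where W: "chain \<phi> n has_fps_expansion W"
    "fps_nth W 2 = of_real (x n) * (\<Sum>i<n. d i)" "fps_nth W 4 = of_real (x n) * total_a4 d b c n"
    using chain_coeffs[OF E E0 E1 x] unfolding d_def b_def c_def by blast
  have "(\<lambda>z. of_real (1 / x n) * chain \<phi> n z) has_fps_expansion fps_const (of_real (1 / x n)) * W"
    by (intro fps_expansion_intros W)
  moreover have "eventually (\<lambda>z::complex. z \<in> ball 0 1) (nhds 0)" by (intro eventually_nhds_in_open) auto
  then have ev: "eventually (\<lambda>z. f z = of_real (1 / x n) * chain \<phi> n z) (nhds 0)"
    by eventually_elim (rule f)
  ultimately have "f has_fps_expansion fps_const (of_real (1 / x n)) * W"
    using iffD2[OF has_fps_expansion_cong[OF ev refl]] by blast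
  then have "fps_expansion f 0 = fps_const (of_real (1 / x n)) * W" by (rule fps_expansion_eqI)
  then show "taylor_coeff f 2 = (\<Sum>i<n. d i)" "taylor_coeff f 4 = total_a4 d b c n"
    using W x(2)[of n] by (simp_all add: taylor_coeff_def)
qed

section \<open>Herglotz means\<close>

text \<open>Positive normalized functionals play the part of the probability measures on the circle.
  Linearity, monotonicity and the variance inequality \<open>mean_power2_le\<close> are the facts
  drawn from this.\<close>

definition mean :: "((real \<Rightarrow> real) \<Rightarrow> real) \<Rightarrow> bool" where
  "mean L \<longleftrightarrow> L (\<lambda>t. 1) = 1 \<and>
     (\<forall>f g a b. continuous_on UNIV f \<longrightarrow> continuous_on UNIV g \<longrightarrow> L (\<lambda>t. a * f t + b * g t) = a * L f + b * L g) \<and>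
     (\<forall>f. continuous_on UNIV f \<longrightarrow> (\<forall>t. 0 \<le> f t) \<longrightarrow> 0 \<le> L f)"

lemma mean_linear:
  "mean L \<Longrightarrow> continuous_on UNIV f \<Longrightarrow> continuous_on UNIV g \<Longrightarrow> L (\<lambda>t. a * f t + b * g t) = a * L f + b * L g"
  by (simp add: mean_def)

lemma mean_nonneg: "mean L \<Longrightarrow> continuous_on UNIV f \<Longrightarrow> (\<And>t. 0 \<le> f t) \<Longrightarrow> 0 \<le> L f"
  by (simp add: mean_def)

lemma mean_mono:
  assumes L: "mean L" and f: "continuous_on UNIV f" "continuous_on UNIV g" and le: "\<And>t. f t \<le> g t"
  shows "L f \<le> L g"
proof -
  have "0 \<le> L (\<lambda>t. 1 * g t + (-1) * f t)"
  proof (rule mean_nonneg[OF L])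
    show "continuous_on UNIV (\<lambda>t. 1 * g t + (-1) * f t)" by (intro continuous_intros f)
    show "0 \<le> 1 * g t + (-1) * f t" for t using le[of t] by simp
  qed
  then show ?thesis using mean_linear[OF L f(2,1), of 1 "-1"] by simp
qed

lemma mean_power2_le:
  assumes L: "mean L" and f: "continuous_on UNIV f"
  shows "(L f)\<^sup>2 \<le> L (\<lambda>t. (f t)\<^sup>2)"
proof -
  define a where "a = L f"
  have c2: "continuous_on UNIV (\<lambda>t. (f t)\<^sup>2)" by (intro continuous_intros f)
  have c: "continuous_on UNIV (\<lambda>t. 1 * (f t)\<^sup>2 + (- 2 * a) * f t)" by (intro continuous_intros f)
  have "0 \<le> L (\<lambda>t. 1 * (1 * (f t)\<^sup>2 + (- 2 * a) * f t) + a\<^sup>2 * 1)"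
  proof (rule mean_nonneg[OF L])
    show "continuous_on UNIV (\<lambda>t. 1 * (1 * (f t)\<^sup>2 + (- 2 * a) * f t) + a\<^sup>2 * 1)"
      by (intro continuous_intros f)
    have "1 * (1 * (f t)\<^sup>2 + (- 2 * a) * f t) + a\<^sup>2 * 1 = (f t - a)\<^sup>2" for t
      by (simp add: power2_eq_square algebra_simps)
    then show "0 \<le> 1 * (1 * (f t)\<^sup>2 + (- 2 * a) * f t) + a\<^sup>2 * 1" for t by simp
  qed
  also have "\<dots> = 1 * (1 * L (\<lambda>t. (f t)\<^sup>2) + (- 2 * a) * L f) + a\<^sup>2 * L (\<lambda>t. 1)"
    by (subst mean_linear[OF L c continuous_on_const], subst mean_linear[OF L c2 f]) (rule refl)
  also have "L (\<lambda>t. 1) = 1" using L by (simp add: mean_def)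
  finally show ?thesis by (simp add: a_def power2_eq_square)
qed

text \<open>Injectivity keeps \<open>\<phi> z / z\<close> free of zeros, so it has a logarithm, and
  the Schwarz lemma gives it modulus at most 1. The branch is shifted to be real at 0.\<close>

lemma disk_map_log:
  assumes \<phi>: "\<phi> \<in> disk_maps" "deriv \<phi> 0 = of_real \<rho>" "0 < \<rho>" "\<rho> < 1"
  obtains h where "h holomorphic_on ball 0 1" "\<And>z. z \<in> ball 0 1 \<Longrightarrow> \<phi> z = z * exp (- h z)"
    "\<And>z. z \<in> ball 0 1 \<Longrightarrow> 0 \<le> Re (h z)" "h 0 = of_real (- ln \<rho>)"
proof -
  note F = disk_mapsD[OF \<phi>(1)]
  obtain k where k: "k holomorphic_on ball 0 1" "\<And>z. norm z < 1 \<Longrightarrow> \<phi> z = z * k z" "deriv \<phi> 0 = k 0"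
    using Schwarz3[OF F(1,4)] by blast
  have k0: "k 0 = of_real \<rho>" using k(3) \<phi>(2) by simp
  have kn: "k z \<noteq> 0 \<and> norm (k z) \<le> 1" if z: "z \<in> ball 0 1" for z
  proof (cases "z = 0")
    case True
    then show ?thesis using k0 \<phi>(3,4) by simp
  next
    case False
    have "\<phi> z \<noteq> \<phi> 0" using inj_onD[OF F(2), of z 0] z False by auto
    moreover have "norm (\<phi> z) \<le> norm z" by (rule Schwarz_Lemma(1)[OF F(1,4)]) (use F(3) z in auto)
    ultimately show ?thesis using k(2)[of z] z False F(4) by (auto simp: norm_mult)
  qed
  obtain l where l: "l holomorphic_on ball 0 1" "\<And>z. z \<in> ball 0 1 \<Longrightarrow> k z = exp (l z)"
    using contractible_imp_holomorphic_log[OF k(1) convex_imp_contractible[OF convex_ball]] kn by metis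
  define h where "h z = - (l z - l 0) - of_real (ln \<rho>)" for z
  have e: "exp (- h z) = k z" if "z \<in> ball 0 1" for z
  proof -
    have "exp (- h z) = exp (l z) / exp (l 0) * exp (of_real (ln \<rho>))" by (simp add: h_def exp_diff exp_add)
    also have "\<dots> = k z" using l(2)[OF that] l(2)[of 0] k0 \<phi>(3) by (simp add: exp_of_real)
    finally show ?thesis .
  qed
  show ?thesis
  proof (rule that)
    show "h holomorphic_on ball 0 1" unfolding h_def by (intro holomorphic_intros l)
    show "\<phi> z = z * exp (- h z)" if "z \<in> ball 0 1" for z using e[OF that] k(2) that by simp
    show "0 \<le> Re (h z)" if z: "z \<in> ball 0 1" for z
    proof -
      have "exp (Re (- h z)) = norm (k z)" using e[OF z] by (metis norm_exp_eq_Re)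
      then have "exp (Re (- h z)) \<le> 1" using kn[OF z] by simp
      then show ?thesis by simp
    qed
    show "h 0 = of_real (- ln \<rho>)" by (simp add: h_def)
  qed
qed

text \<open>The function \<open>k = exp (- h)\<close> satisfies \<open>k' = - h' * k\<close>, which
  yields its coefficients recursively; in the ratios to \<open>P 1\<close> the factor
  \<open>exp (- h 0)\<close> cancels.\<close>

lemma exp_factor_coeffs:
  fixes h :: "complex \<Rightarrow> complex"
  assumes h: "h holomorphic_on ball 0 1" and \<phi>: "\<And>z. z \<in> ball 0 1 \<Longrightarrow> \<phi> z = z * exp (- h z)"
  defines "H \<equiv> fps_nth (fps_expansion h 0)" and "P \<equiv> fps_nth (fps_expansion \<phi> 0)"
  shows "P 2 / P 1 = - H 1" "P 3 / P 1 = - H 2 + (H 1)\<^sup>2 / 2" "P 4 / P 1 = - H 3 + H 1 * H 2 - (H 1) ^ 3 / 6"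
proof -
  define k where "k z = exp (- h z)" for z
  have k: "k holomorphic_on ball 0 1" unfolding k_def by (intro holomorphic_intros h)
  have Hf: "h has_fps_expansion fps_expansion h 0" and Kf: "k has_fps_expansion fps_expansion k 0"
    using h k by (auto intro!: has_fps_expansion_fps_expansion[of "ball 0 1"])
  define K where "K = fps_nth (fps_expansion k 0)"
  have ev: "eventually (\<lambda>z::complex. z \<in> ball 0 1) (nhds 0)" by (intro eventually_nhds_in_open) auto
  have "eventually (\<lambda>z. \<phi> z = z * k z) (nhds 0)" using ev by eventually_elim (simp only: \<phi> k_def)
  then have "\<phi> has_fps_expansion fps_X * fps_expansion k 0"
    by (rule iffD2[OF has_fps_expansion_cong[OF _ refl]]) (intro fps_expansion_intros Kf)
  then have "fps_expansion \<phi> 0 = fps_X * fps_expansion k 0" by (rule fps_expansion_eqI)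
  then have PK: "P (Suc n) = K n" for n by (simp add: P_def K_def)
  have "deriv k z = - deriv h z * k z" if "z \<in> ball 0 1" for z
  proof -
    have "(h has_field_derivative deriv h z) (at z)" using h that by (simp add: holomorphic_derivI)
    then have "(k has_field_derivative - deriv h z * k z) (at z)"
      unfolding k_def by (auto intro!: derivative_eq_intros)
    then show ?thesis by (rule DERIV_imp_deriv)
  qed
  then have "eventually (\<lambda>z. deriv k z = - deriv h z * k z) (nhds 0)" using ev by (auto elim: eventually_mono)
  then have "deriv k has_fps_expansion - fps_deriv (fps_expansion h 0) * fps_expansion k 0"
    by (rule iffD2[OF has_fps_expansion_cong[OF _ refl]]) (intro fps_expansion_intros Kf Hf)
  moreover have "deriv k has_fps_expansion fps_deriv (fps_expansion k 0)" by (intro fps_expansion_intros Kf)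
  ultimately have E: "fps_deriv (fps_expansion k 0) = - fps_deriv (fps_expansion h 0) * fps_expansion k 0"
    by (rule fps_expansion_unique_complex[rotated])
  have n: "of_nat (Suc n) * K (Suc n) = - (\<Sum>i=0..n. of_nat (Suc i) * H (Suc i) * K (n - i))" for n
    using arg_cong[OF E, of "\<lambda>F. fps_nth F n"]
    by (simp add: fps_mult_nth K_def H_def sum_negf mult.assoc)
  have "K 0 = exp (- h 0)" using has_fps_expansion_imp_0_eq_fps_nth_0[OF Kf] by (simp add: K_def k_def)
  then have K0: "K 0 \<noteq> 0" by simp
  have e1: "K 1 = - H 1 * K 0" using n[of 0] by simp
  have e2: "2 * K 2 = - (H 1 * K 1 + 2 * H 2 * K 0)" using n[of 1] by (simp add: eval_nat_numeral)
  have e3: "3 * K 3 = - (H 1 * K 2 + 2 * H 2 * K 1 + 3 * H 3 * K 0)" using n[of 2] by (simp add: eval_nat_numeral)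
  have k2: "K 2 = (- H 2 + (H 1)\<^sup>2 / 2) * K 0" using e2 unfolding e1 by (simp add: power2_eq_square algebra_simps)
  have k3: "K 3 = (- H 3 + H 1 * H 2 - (H 1) ^ 3 / 6) * K 0"
    using e3 unfolding e1 k2 by (simp add: power2_eq_square power3_eq_cube field_simps)
  have P: "P 1 = K 0" "P 2 = K 1" "P 3 = K 2" "P 4 = K 3" using PK[of 0] PK[of 1] PK[of 2] PK[of 3] by (simp_all add: eval_nat_numeral)
  show "P 2 / P 1 = - H 1" "P 3 / P 1 = - H 2 + (H 1)\<^sup>2 / 2" "P 4 / P 1 = - H 3 + H 1 * H 2 - (H 1) ^ 3 / 6"
    unfolding P e1 k2 k3 using K0 by simp_all
qed

text \<open>The angle is chosen so that the constant function \<open>h\<close> of the Pick function corresponds to the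
  point mass at \<open>0\<close>.\<close>

definition herglotz_mean :: "(complex \<Rightarrow> complex) \<Rightarrow> real \<Rightarrow> (real \<Rightarrow> real) \<Rightarrow> real" where
  "herglotz_mean h r f = integral {0..1} (\<lambda>s. f (pi - 2 * pi * s) * Re (h (circlepath 0 r s))) / Re (h 0)"

text \<open>Fourier coefficients of \<open>h\<close> on a circle: those of index \<open>k\<close>
  come from Cauchy's integral formula, those of index \<open>- k\<close> vanish by Cauchy's
  theorem.\<close>

lemma circle_moments:
  assumes h: "h holomorphic_on ball 0 1" and r: "0 < r" "r < 1"
  shows "((\<lambda>s. h (circlepath 0 r s) * exp (- (2 * of_real pi * \<i> * of_nat k * of_real s))) has_integral
      of_real r ^ k * fps_nth (fps_expansion h 0) k) {0..1}"
    and "0 < k \<Longrightarrow> ((\<lambda>s. h (circlepath 0 r s) * exp (2 * of_real pi * \<i> * of_nat k * of_real s)) has_integral 0) {0..1}"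
proof -
  have hc: "continuous_on (cball 0 r) h" "h holomorphic_on ball 0 r"
    using holomorphic_on_subset[OF h, of "cball 0 r"] holomorphic_on_subset[OF h, of "ball 0 r"] r
    by (auto intro!: holomorphic_on_imp_continuous_on simp: cball_subset_ball_iff subset_ball)
  have c: "circlepath 0 r s = of_real r * exp (2 * of_real pi * \<i> * of_real s)" for s by (simp add: circlepath)
  have v: "vector_derivative (circlepath 0 r) (at s) = 2 * of_real pi * \<i> * circlepath 0 r s" for s
    by (simp add: vector_derivative_circlepath c)
  have ne: "2 * of_real pi * \<i> \<noteq> (0::complex)" by simp
  have "((\<lambda>u. h u / (u - 0) ^ Suc k) has_contour_integral (2 * of_real pi * \<i> / fact k) * (deriv ^^ k) h 0) (circlepath 0 r)"
    using Cauchy_has_contour_integral_higher_derivative_circlepath[OF hc, of 0 k] r by simp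
  then have "((\<lambda>s. h (circlepath 0 r s) / (circlepath 0 r s) ^ Suc k * (2 * of_real pi * \<i> * circlepath 0 r s))
      has_integral (2 * of_real pi * \<i> / fact k) * (deriv ^^ k) h 0) {0..1}"
    unfolding has_contour_integral by (rule has_integral_eq[rotated]) (simp only: v diff_zero)
  from has_integral_mult_right[OF this, of "of_real r ^ k / (2 * of_real pi * \<i>)"]
  have "((\<lambda>s. of_real r ^ k / (2 * of_real pi * \<i>) * (h (circlepath 0 r s) / (circlepath 0 r s) ^ Suc k * (2 * of_real pi * \<i> * circlepath 0 r s)))
      has_integral of_real r ^ k / (2 * of_real pi * \<i>) * ((2 * of_real pi * \<i> / fact k) * (deriv ^^ k) h 0)) {0..1}" .
  moreover have "of_real r ^ k / (2 * of_real pi * \<i>) * ((2 * of_real pi * \<i> / fact k) * (deriv ^^ k) h 0)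
      = of_real r ^ k * fps_nth (fps_expansion h 0) k"
    using ne by (simp add: fps_expansion_def field_simps)
  moreover have "of_real r ^ k / (2 * of_real pi * \<i>) * (h (circlepath 0 r s) / (circlepath 0 r s) ^ Suc k * (2 * of_real pi * \<i> * circlepath 0 r s))
     = h (circlepath 0 r s) * exp (- (2 * of_real pi * \<i> * of_nat k * of_real s))" for s
  proof -
    have nz: "circlepath 0 r s \<noteq> 0" using r by (simp add: c)
    have p: "(circlepath 0 r s) ^ k = of_real r ^ k * exp (2 * of_real pi * \<i> * of_nat k * of_real s)"
      by (simp add: c power_mult_distrib flip: exp_of_nat_mult) (simp add: mult_ac)
    have "of_real r ^ k / (2 * of_real pi * \<i>) * (h (circlepath 0 r s) / (circlepath 0 r s) ^ Suc k * (2 * of_real pi * \<i> * circlepath 0 r s))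
      = h (circlepath 0 r s) * (of_real r ^ k / (circlepath 0 r s) ^ k)"
      using nz ne by (simp add: field_simps)
    also have "of_real r ^ k / (circlepath 0 r s) ^ k = exp (- (2 * of_real pi * \<i> * of_nat k * of_real s))"
      unfolding p using r by (simp add: exp_minus field_simps)
    finally show ?thesis .
  qed
  ultimately show "((\<lambda>s. h (circlepath 0 r s) * exp (- (2 * of_real pi * \<i> * of_nat k * of_real s))) has_integral
      of_real r ^ k * fps_nth (fps_expansion h 0) k) {0..1}" by (simp only:)
  assume k: "0 < k"
  have "((\<lambda>u. h u * u ^ (k - 1)) has_contour_integral 0) (circlepath 0 r)"
    by (rule Cauchy_theorem_convex_simple[of _ "ball 0 1"]) (use h r in \<open>auto intro!: holomorphic_intros simp: path_image_circlepath\<close>)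
  then have "((\<lambda>s. h (circlepath 0 r s) * (circlepath 0 r s) ^ (k - 1) * (2 * of_real pi * \<i> * circlepath 0 r s)) has_integral 0) {0..1}"
    unfolding has_contour_integral by (rule has_integral_eq[rotated]) (simp only: v diff_zero)
  from has_integral_mult_right[OF this, of "1 / (of_real r ^ k * (2 * of_real pi * \<i>))"]
  have "((\<lambda>s. 1 / (of_real r ^ k * (2 * of_real pi * \<i>)) * (h (circlepath 0 r s) * (circlepath 0 r s) ^ (k - 1) * (2 * of_real pi * \<i> * circlepath 0 r s)))
      has_integral 0) {0..1}" by simp
  moreover have "1 / (of_real r ^ k * (2 * of_real pi * \<i>)) * (h (circlepath 0 r s) * (circlepath 0 r s) ^ (k - 1) * (2 * of_real pi * \<i> * circlepath 0 r s))
     = h (circlepath 0 r s) * exp (2 * of_real pi * \<i> * of_nat k * of_real s)" for s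
  proof -
    have p: "(circlepath 0 r s) ^ k = of_real r ^ k * exp (2 * of_real pi * \<i> * of_nat k * of_real s)"
      by (simp add: c power_mult_distrib flip: exp_of_nat_mult) (simp add: mult_ac)
    have "(circlepath 0 r s) ^ (k - 1) * circlepath 0 r s = (circlepath 0 r s) ^ k"
      using k by (metis power_minus_mult)
    then have "1 / (of_real r ^ k * (2 * of_real pi * \<i>)) * (h (circlepath 0 r s) * (circlepath 0 r s) ^ (k - 1) * (2 * of_real pi * \<i> * circlepath 0 r s))
      = (2 * of_real pi * \<i>) / (2 * of_real pi * \<i>) * (h (circlepath 0 r s) * (circlepath 0 r s) ^ k / of_real r ^ k)"
      by (simp add: mult_ac)
    then show ?thesis unfolding p using r ne by simp
  qed
  ultimately show "((\<lambda>s. h (circlepath 0 r s) * exp (2 * of_real pi * \<i> * of_nat k * of_real s)) has_integral 0) {0..1}"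
    by (simp only:)
qed

text \<open>A radius below 1 keeps clear of boundary values, at the price of the factor
  \<open>r ^ k\<close>. The sign appears because the angle is measured from the direction of -1. In
  \<open>2 * Re h = h + cnj h\<close> the conjugate part has no moment of positive index, whence the
  2 in the denominator.\<close>

lemma herglotz_mean:
  assumes h: "h holomorphic_on ball 0 1" "\<And>z. z \<in> ball 0 1 \<Longrightarrow> 0 \<le> Re (h z)" "h 0 = of_real \<delta>" "0 < \<delta>"
    and r: "0 < r" "r < 1"
  shows "mean (herglotz_mean h r)"
    and "0 < k \<Longrightarrow> Complex (herglotz_mean h r (\<lambda>t. cos (real k * t))) (herglotz_mean h r (\<lambda>t. sin (real k * t))) =
      (- of_real r) ^ k * fps_nth (fps_expansion h 0) k / of_real (2 * \<delta>)"
proof -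
  define u where "u s = Re (h (circlepath 0 r s))" for s
  have ball: "circlepath 0 r s \<in> ball 0 1" for s using r by (simp add: circlepath norm_mult)
  have hcont: "continuous_on {0..1} (\<lambda>s. h (circlepath 0 r s))"
    by (rule continuous_on_compose2[OF holomorphic_on_imp_continuous_on[OF h(1)]])
       (use ball in \<open>auto simp: circlepath intro!: continuous_intros simp del: mem_ball\<close>)
  have uc: "continuous_on {0..1} u" unfolding u_def by (intro continuous_intros hcont)
  have u0: "0 \<le> u s" for s unfolding u_def by (rule h(2)[OF ball])
  have fc: "continuous_on {0..1} (\<lambda>s. f (pi - 2 * pi * s))" if "continuous_on UNIV f" for f :: "real \<Rightarrow> real"
    by (rule continuous_on_compose2[OF that]) (auto intro!: continuous_intros)
  have int: "(\<lambda>s. f (pi - 2 * pi * s) * u s) integrable_on {0..1}" if "continuous_on UNIV f" for f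
    by (intro integrable_continuous_real continuous_intros fc[OF that] uc)
  have L: "herglotz_mean h r f = integral {0..1} (\<lambda>s. f (pi - 2 * pi * s) * u s) / \<delta>" for f
    by (simp add: herglotz_mean_def u_def h(3))
  have H0: "fps_nth (fps_expansion h 0) 0 = of_real \<delta>" by (simp add: fps_expansion_def h(3))
  show "mean (herglotz_mean h r)" unfolding mean_def
  proof (intro conjI allI impI)
    from has_integral_linear[OF circle_moments(1)[OF h(1) r, of 0] bounded_linear_Re]
    have "(u has_integral \<delta>) {0..1}" by (simp add: comp_def u_def[abs_def] H0)
    then show "herglotz_mean h r (\<lambda>t. 1) = 1" unfolding L using h(4) by (simp add: integral_unique)
    fix f :: "real \<Rightarrow> real" assume f: "continuous_on UNIV f"
    { fix g :: "real \<Rightarrow> real" and a b assume g: "continuous_on UNIV g"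
      have "integral {0..1} (\<lambda>s. (a * f (pi - 2 * pi * s) + b * g (pi - 2 * pi * s)) * u s) =
          integral {0..1} (\<lambda>s. a * (f (pi - 2 * pi * s) * u s) + b * (g (pi - 2 * pi * s) * u s))"
        by (simp add: algebra_simps)
      also have "\<dots> = a * integral {0..1} (\<lambda>s. f (pi - 2 * pi * s) * u s) + b * integral {0..1} (\<lambda>s. g (pi - 2 * pi * s) * u s)"
        by (subst integral_add) (intro integrable_continuous_real continuous_intros fc f g uc | simp)+
      finally show "herglotz_mean h r (\<lambda>t. a * f t + b * g t) = a * herglotz_mean h r f + b * herglotz_mean h r g"
        unfolding L by (simp add: add_divide_distrib) }
    assume "\<forall>t. 0 \<le> f t"
    then have "0 \<le> integral {0..1} (\<lambda>s. f (pi - 2 * pi * s) * u s)"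
      by (intro integral_nonneg int f) (auto intro!: mult_nonneg_nonneg u0)
    then show "0 \<le> herglotz_mean h r f" unfolding L using h(4) by simp
  qed
  assume k: "0 < k"
  define m where "m = of_real r ^ k * fps_nth (fps_expansion h 0) k"
  define e where "e s = exp (- (2 * of_real pi * \<i> * of_nat k * of_real s))" for s :: real
  have "((\<lambda>s. (-1) ^ k / 2 * (h (circlepath 0 r s) * e s + cnj (h (circlepath 0 r s) * exp (2 * of_real pi * \<i> * of_nat k * of_real s))))
      has_integral (-1) ^ k / 2 * (m + cnj 0)) {0..1}"
    unfolding m_def e_def
    by (intro has_integral_mult_right has_integral_add circle_moments(1)[OF h(1) r]
          has_integral_linear[OF circle_moments(2)[OF h(1) r k] bounded_linear_cnj, unfolded comp_def])
  moreover have "(-1) ^ k / 2 * (h (circlepath 0 r s) * e s + cnj (h (circlepath 0 r s) * exp (2 * of_real pi * \<i> * of_nat k * of_real s)))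
      = of_real (u s) * Complex (cos (real k * (pi - 2 * pi * s))) (sin (real k * (pi - 2 * pi * s)))" for s
  proof -
    have "cnj (exp (2 * of_real pi * \<i> * of_nat k * of_real s)) = e s"
      by (simp add: e_def exp_cnj)
    then have "h (circlepath 0 r s) * e s + cnj (h (circlepath 0 r s) * exp (2 * of_real pi * \<i> * of_nat k * of_real s))
       = (h (circlepath 0 r s) + cnj (h (circlepath 0 r s))) * e s" by (simp add: algebra_simps)
    also have "\<dots> = of_real (2 * u s) * e s" by (simp add: u_def complex_add_cnj)
    finally have 1: "(-1) ^ k / 2 * (h (circlepath 0 r s) * e s + cnj (h (circlepath 0 r s) * exp (2 * of_real pi * \<i> * of_nat k * of_real s)))
       = of_real (u s) * ((-1) ^ k * e s)" by simp
    have "(-1) ^ k * e s = cis pi ^ k * cis (- (2 * pi * s)) ^ k"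
      by (simp add: e_def cis_conv_exp flip: exp_of_nat_mult) (simp add: mult_ac)
    also have "\<dots> = cis (pi + - (2 * pi * s)) ^ k" by (simp only: cis_mult power_mult_distrib[symmetric])
    also have "\<dots> = cis (real k * (pi - 2 * pi * s))" by (simp add: Complex.DeMoivre)
    finally show ?thesis unfolding 1 by (simp add: cis.code)
  qed
  ultimately have I: "((\<lambda>s. of_real (u s) * Complex (cos (real k * (pi - 2 * pi * s))) (sin (real k * (pi - 2 * pi * s))))
      has_integral (-1) ^ k / 2 * m) {0..1}" by simp
  have "((\<lambda>s. cos (real k * (pi - 2 * pi * s)) * u s) has_integral Re ((-1) ^ k / 2 * m)) {0..1}"
    "((\<lambda>s. sin (real k * (pi - 2 * pi * s)) * u s) has_integral Im ((-1) ^ k / 2 * m)) {0..1}"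
    using has_integral_linear[OF I bounded_linear_Re] has_integral_linear[OF I bounded_linear_Im]
    by (simp_all only: comp_def Re_complex_of_real Im_complex_of_real times_complex.sel complex.sel mult_zero_left diff_zero add_0_right mult.commute)
  then have "Complex (herglotz_mean h r (\<lambda>t. cos (real k * t))) (herglotz_mean h r (\<lambda>t. sin (real k * t))) = (-1) ^ k / 2 * m / of_real \<delta>"
    unfolding L by (simp add: integral_unique complex_eq_iff)
  also have "\<dots> = (- of_real r) ^ k * fps_nth (fps_expansion h 0) k / of_real (2 * \<delta>)"
    by (simp add: m_def power_minus[of "of_real r"])
  finally show "Complex (herglotz_mean h r (\<lambda>t. cos (real k * t))) (herglotz_mean h r (\<lambda>t. sin (real k * t))) =
      (- of_real r) ^ k * fps_nth (fps_expansion h 0) k / of_real (2 * \<delta>)" .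
qed

lemma mean_trig_bound:
  assumes "mean L"
  shows "norm (Complex (L (\<lambda>t. cos (k * t))) (L (\<lambda>t. sin (k * t)))) \<le> 1"
proof -
  have c: "continuous_on UNIV (\<lambda>t. cos (k * t))" "continuous_on UNIV (\<lambda>t. sin (k * t))" by (intro continuous_intros)+
  have "(L (\<lambda>t. cos (k * t)))\<^sup>2 + (L (\<lambda>t. sin (k * t)))\<^sup>2 \<le> L (\<lambda>t. (cos (k * t))\<^sup>2) + L (\<lambda>t. (sin (k * t))\<^sup>2)"
    using mean_power2_le[OF assms] c by (intro add_mono) auto
  also have "\<dots> = L (\<lambda>t. 1 * (cos (k * t))\<^sup>2 + 1 * (sin (k * t))\<^sup>2)"
    by (subst mean_linear[OF assms]) (auto intro!: continuous_intros)
  also have "\<dots> = 1" using assms by (simp add: mean_def)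
  finally show ?thesis by (simp add: cmod_def)
qed

text \<open>To first order \<open>exp (- h)\<close> is linear in \<open>h\<close>: the coefficients
  of \<open>h\<close> used here are at most \<open>8 * \<Delta> / x\<close>, so their products go
  into the error, while the linear terms are moments of the Herglotz mean.\<close>

lemma disk_map_step:
  fixes x \<Delta> :: real
  assumes \<phi>: "\<phi> \<in> disk_maps" "deriv \<phi> 0 = of_real (1 - \<Delta> / x)" and x: "0 < x" "x \<le> 1" and \<Delta>: "0 < \<Delta>" "\<Delta> \<le> x / 2"
  defines "P \<equiv> fps_expansion \<phi> 0"
  obtains L where "mean L"
    "norm (incr_A x P - of_real (2 * \<Delta>) * Complex (L (\<lambda>t. cos t)) (L (\<lambda>t. sin t))) \<le> (200 + 4 / x) * \<Delta>\<^sup>2"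
    "norm (incr_B x P - of_real (\<Delta> * x) * Complex (L (\<lambda>t. cos (2 * t))) (L (\<lambda>t. sin (2 * t)))) \<le> (200 + 4 / x) * \<Delta>\<^sup>2"
    "norm (incr_R x P - of_real (2 * \<Delta> * x\<^sup>2) * Complex (L (\<lambda>t. cos (3 * t))) (L (\<lambda>t. sin (3 * t)))) \<le> (200 + 4 / x) * \<Delta>\<^sup>2"
proof -
  define y where "y = \<Delta> / x"
  define \<delta> where "\<delta> = - ln (1 - y)"
  have y: "0 < y" "y \<le> 1/2" "\<Delta> = x * y" using x \<Delta> by (auto simp: y_def field_simps)
  have D1: "\<Delta> \<le> 1" using x \<Delta> by linarith
  have \<delta>: "y \<le> \<delta>" "\<delta> \<le> y + 2 * y\<^sup>2" "\<delta> \<le> 2 * y" "0 < \<delta>"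
  proof -
    show 1: "y \<le> \<delta>" using ln_le_minus_one[of "1 - y"] y by (simp add: \<delta>_def)
    show 2: "\<delta> \<le> y + 2 * y\<^sup>2" using ln_one_minus_pos_lower_bound[of y] y by (simp add: \<delta>_def)
    have "y * y \<le> y * (1/2)" using y by (intro mult_left_mono) auto
    then show "\<delta> \<le> 2 * y" using 2 by (simp add: power2_eq_square)
    show "0 < \<delta>" using 1 y by simp
  qed
  have \<rho>: "0 < 1 - y" "1 - y < 1" using y by auto
  obtain h where h: "h holomorphic_on ball 0 1" "\<And>z. z \<in> ball 0 1 \<Longrightarrow> \<phi> z = z * exp (- h z)"
    "\<And>z. z \<in> ball 0 1 \<Longrightarrow> 0 \<le> Re (h z)" "h 0 = of_real \<delta>"
    using disk_map_log[OF \<phi>(1) _ \<rho>] \<phi>(2) unfolding y_def[symmetric] \<delta>_def by blast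
  define H where "H = fps_nth (fps_expansion h 0)"
  have p: "fps_nth P 2 / fps_nth P 1 = - H 1" "fps_nth P 3 / fps_nth P 1 = - H 2 + (H 1)\<^sup>2 / 2"
      "fps_nth P 4 / fps_nth P 1 = - H 3 + H 1 * H 2 - (H 1) ^ 3 / 6"
    unfolding H_def P_def using exp_factor_coeffs[OF h(1), of \<phi>] h(2) by blast+
  \<comment> \<open>Close enough to 1 that \<open>(1 / r) ^ 3 \<le> 1 + \<Delta>\<close>, so that
    staying inside the disk costs only a second-order error.\<close>
  define r where "r = 1 / (1 + \<Delta> / 4)"
  have r: "0 < r" "r < 1" using \<Delta> by (auto simp: r_def)
  have rk: "1 \<le> (1 / r) ^ k" "(1 / r) ^ k \<le> 1 + \<Delta>" if "k \<le> 3" for k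
  proof -
    have e: "1 / r = 1 + \<Delta> / 4" by (simp add: r_def)
    show "1 \<le> (1 / r) ^ k" unfolding e using \<Delta> by (intro one_le_power) simp
    have "(1 / r) ^ k \<le> (1 + \<Delta> / 4) ^ 3" unfolding e using that \<Delta> by (intro power_increasing) auto
    also have "\<dots> = 1 + \<Delta> * (3/4 + 3/16 * \<Delta> + \<Delta> * \<Delta> / 64)" by (simp add: power3_eq_cube field_simps)
    also have "\<dots> \<le> 1 + \<Delta> * 1"
    proof -
      have "\<Delta> * \<Delta> \<le> 1 * 1" using D1 \<Delta> by (intro mult_mono) auto
      then show ?thesis using D1 \<Delta> by (intro add_left_mono mult_left_mono) auto
    qed
    finally show "(1 / r) ^ k \<le> 1 + \<Delta>" by simp
  qed
  define L where "L = herglotz_mean h r"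
  have L: "mean L" unfolding L_def by (rule herglotz_mean(1)[OF h(1,3,4) \<delta>(4) r])
  define m where "m k = Complex (L (\<lambda>t. cos (real k * t))) (L (\<lambda>t. sin (real k * t)))" for k
  have mb: "norm (m k) \<le> 1" for k unfolding m_def by (rule mean_trig_bound[OF L])
  have Hm: "H k = of_real (2 * \<delta> * (1 / r) ^ k) * ((-1) ^ k * m k)" if "0 < k" for k
  proof -
    have "m k = (- of_real r) ^ k * H k / of_real (2 * \<delta>)"
      unfolding m_def L_def H_def by (rule herglotz_mean(2)[OF h(1,3,4) \<delta>(4) r that])
    then have "(- of_real r) ^ k * H k = of_real (2 * \<delta>) * m k" using \<delta>(4) by simp
    then have "(-1) ^ k * ((-1) ^ k * of_real r ^ k * H k) = (-1) ^ k * (of_real (2 * \<delta>) * m k)"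
      by (simp only: power_minus[of "of_real r :: complex"])
    moreover have "(-1 :: complex) ^ k * (-1) ^ k = 1" by (simp flip: power_mult_distrib)
    then have "(-1) ^ k * ((-1) ^ k * of_real r ^ k * H k) = of_real r ^ k * H k" by (simp flip: mult.assoc)
    ultimately have "of_real r ^ k * H k = (-1) ^ k * (of_real (2 * \<delta>) * m k)" by simp
    then have "H k = (-1) ^ k * (of_real (2 * \<delta>) * m k) / of_real r ^ k" using r by (simp add: field_simps)
    then show ?thesis by (simp add: power_divide)
  qed
  have Hb: "norm (H k) \<le> 4 * \<delta>" and He: "norm (H k - of_real (2 * \<delta>) * ((-1) ^ k * m k)) \<le> 2 * \<delta> * \<Delta>"
    if "0 < k" "k \<le> 3" for k
  proof -
    have "norm (H k) = 2 * \<delta> * (1 / r) ^ k * norm (m k)"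
      unfolding Hm[OF that(1)] using \<delta>(4) r by (simp add: norm_mult norm_power norm_divide)
    also have "\<dots> \<le> 2 * \<delta> * 2 * 1"
      using rk[OF that(2)] D1 \<delta>(4) mb[of k] by (intro mult_mono) auto
    finally show "norm (H k) \<le> 4 * \<delta>" by simp
    have "H k - of_real (2 * \<delta>) * ((-1) ^ k * m k) = of_real (2 * \<delta> * ((1 / r) ^ k - 1)) * ((-1) ^ k * m k)"
      unfolding Hm[OF that(1)] by (simp add: algebra_simps)
    then have "norm (H k - of_real (2 * \<delta>) * ((-1) ^ k * m k)) = 2 * \<delta> * ((1 / r) ^ k - 1) * norm (m k)"
      using \<delta>(4) rk(1)[OF that(2)] by (simp only: norm_mult norm_of_real) (simp add: norm_power)
    also have "\<dots> \<le> 2 * \<delta> * \<Delta> * 1"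
      using rk[OF that(2)] \<delta>(4) mb[of k] \<Delta> by (intro mult_mono) auto
    finally show "norm (H k - of_real (2 * \<delta>) * ((-1) ^ k * m k)) \<le> 2 * \<delta> * \<Delta>" by simp
  qed
  have xd: "0 \<le> x * \<delta> - \<Delta>" "x * \<delta> - \<Delta> \<le> 2 * \<Delta>\<^sup>2 / x" "x * \<delta> \<le> 2 * \<Delta>"
  proof -
    show "0 \<le> x * \<delta> - \<Delta>" "x * \<delta> \<le> 2 * \<Delta>" using \<delta>(1,3) x unfolding y(3) by (auto simp: mult_left_mono)
    have "x * \<delta> \<le> x * (y + 2 * y\<^sup>2)" using \<delta>(2) x by (intro mult_left_mono) auto
    also have "\<dots> = \<Delta> + 2 * \<Delta>\<^sup>2 / x" using x by (simp add: y(3) power2_eq_square field_simps)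
    finally show "x * \<delta> - \<Delta> \<le> 2 * \<Delta>\<^sup>2 / x" by simp
  qed
  have xk: "norm (H k) * x \<le> 8 * \<Delta>" if "0 < k" "k \<le> 3" for k
  proof -
    have "norm (H k) * x \<le> 4 * \<delta> * x" using x by (intro mult_right_mono Hb that) auto
    then show ?thesis using xd(3) by (simp add: mult_ac)
  qed
  have main: "norm (of_real a * (of_real x * ((-1) ^ k * H k)) - of_real (2 * a * \<Delta>) * m k) \<le> a * (4 + 4 / x) * \<Delta>\<^sup>2"
    if k: "0 < k" "k \<le> 3" and a: "0 \<le> a" for k a
  proof -
    have sq2: "((-1 :: complex) ^ k)\<^sup>2 = 1" by (simp add: power2_eq_square flip: power_mult_distrib)
    have "of_real a * (of_real x * ((-1) ^ k * H k)) - of_real (2 * a * \<Delta>) * m k =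
       of_real (a * x) * ((-1) ^ k * (H k - of_real (2 * \<delta>) * ((-1) ^ k * m k))) + of_real (2 * a * (x * \<delta> - \<Delta>)) * m k"
      using sq2 by (simp add: algebra_simps flip: power2_eq_square)
    then have "norm (of_real a * (of_real x * ((-1) ^ k * H k)) - of_real (2 * a * \<Delta>) * m k) \<le>
       norm (of_real (a * x) * ((-1) ^ k * (H k - of_real (2 * \<delta>) * ((-1) ^ k * m k)))) + norm (of_real (2 * a * (x * \<delta> - \<Delta>)) * m k)"
      by (metis norm_triangle_ineq)
    also have "\<dots> = a * x * norm (H k - of_real (2 * \<delta>) * ((-1) ^ k * m k)) + 2 * a * (x * \<delta> - \<Delta>) * norm (m k)"
      using a x xd(1) by (simp only: norm_mult norm_of_real norm_power) (simp add: abs_mult)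
    also have "\<dots> \<le> a * x * (2 * \<delta> * \<Delta>) + 2 * a * (2 * \<Delta>\<^sup>2 / x) * 1"
      using a x xd He[OF k] mb[of k] by (intro add_mono mult_mono mult_left_mono mult_nonneg_nonneg) auto
    also have "\<dots> = a * (2 * \<Delta> * (x * \<delta>)) + a * (4 / x) * \<Delta>\<^sup>2" by (simp add: mult_ac)
    also have "\<dots> \<le> a * (2 * \<Delta> * (2 * \<Delta>)) + a * (4 / x) * \<Delta>\<^sup>2"
      using a \<Delta> xd(3) by (intro add_right_mono mult_left_mono) auto
    finally show ?thesis by (simp add: power2_eq_square algebra_simps)
  qed
  have iA: "incr_A x P = of_real x * ((-1) ^ 1 * H 1)" unfolding incr_A_def p by simp
  have iB: "incr_B x P = of_real (x / 2) * (of_real x * ((-1)\<^sup>2 * H 2)) + (of_real x * H 1)\<^sup>2 / 4"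
    unfolding incr_B_def p by (simp add: power2_eq_square field_simps)
  have iR: "incr_R x P = of_real (x\<^sup>2) * (of_real x * ((-1) ^ 3 * H 3)) - of_real x * ((of_real x * H 1) * (of_real x * H 2)) - (of_real x * H 1) ^ 3 / 6"
    unfolding incr_R_def iA unfolding incr_B_def p by (simp add: power2_eq_square power3_eq_cube field_simps)
  have n1: "norm (of_real x * H k) \<le> 8 * \<Delta>" if "0 < k" "k \<le> 3" for k
    using xk[OF that] x by (simp add: norm_mult mult.commute)
  show ?thesis
  proof (rule that[OF L])
    have x1: "0 < 4 / x" using x by simp
    show "norm (incr_A x P - of_real (2 * \<Delta>) * Complex (L (\<lambda>t. cos t)) (L (\<lambda>t. sin t))) \<le> (200 + 4 / x) * \<Delta>\<^sup>2"
    proof -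
      have "norm (incr_A x P - of_real (2 * \<Delta>) * m 1) \<le> 1 * (4 + 4 / x) * \<Delta>\<^sup>2"
        using main[of 1 1] unfolding iA by simp
      also have "\<dots> \<le> (200 + 4 / x) * \<Delta>\<^sup>2" by (intro mult_right_mono) auto
      finally show ?thesis by (simp add: m_def)
    qed
    show "norm (incr_B x P - of_real (\<Delta> * x) * Complex (L (\<lambda>t. cos (2 * t))) (L (\<lambda>t. sin (2 * t)))) \<le> (200 + 4 / x) * \<Delta>\<^sup>2"
    proof -
      define a b e where "a = of_real (x / 2) * (of_real x * ((-1)\<^sup>2 * H 2))" and "b = (of_real x * H 1)\<^sup>2 / 4"
        and "e = of_real (2 * (x / 2) * \<Delta>) * m 2"
      have "norm (a + b - e) \<le> norm (a - e) + norm b"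
        using norm_triangle_ineq[of "a - e" b] by (simp add: algebra_simps)
      also have "norm (a - e) \<le> (x / 2) * (4 + 4 / x) * \<Delta>\<^sup>2"
        unfolding a_def e_def by (rule main) (use x in auto)
      also have "norm b \<le> (8 * \<Delta>)\<^sup>2 / 4"
        unfolding b_def norm_divide norm_power using n1[of 1] \<Delta> by (intro frac_le power_mono) auto
      finally have "norm (incr_B x P - of_real (\<Delta> * x) * m 2) \<le> (x / 2) * (4 + 4 / x) * \<Delta>\<^sup>2 + (8 * \<Delta>)\<^sup>2 / 4"
        unfolding iB a_def b_def e_def by (simp add: mult_ac)
      also have "\<dots> = (18 + 2 * x) * \<Delta>\<^sup>2" using x by (simp add: power2_eq_square field_simps)
      also have "\<dots> \<le> (200 + 4 / x) * \<Delta>\<^sup>2" using x x1 by (intro mult_right_mono) (linarith, simp)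
      finally show ?thesis by (simp add: m_def)
    qed
    show "norm (incr_R x P - of_real (2 * \<Delta> * x\<^sup>2) * Complex (L (\<lambda>t. cos (3 * t))) (L (\<lambda>t. sin (3 * t)))) \<le> (200 + 4 / x) * \<Delta>\<^sup>2"
    proof -
      define a b c e where "a = of_real (x\<^sup>2) * (of_real x * ((-1) ^ 3 * H 3))" and "b = of_real x * ((of_real x * H 1) * (of_real x * H 2))"
        and "c = (of_real x * H 1) ^ 3 / 6" and "e = of_real (2 * x\<^sup>2 * \<Delta>) * m 3"
      have "norm (a - b - c - e) \<le> norm (a - e) + norm b + norm c"
      proof -
        have e: "a - b - c - e = (a - e) - b - c" by simp
        show ?thesis unfolding e using norm_triangle_ineq4[of "a - e - b" c] norm_triangle_ineq4[of "a - e" b] by linarith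
      qed
      also have "norm (a - e) \<le> x\<^sup>2 * (4 + 4 / x) * \<Delta>\<^sup>2" unfolding a_def e_def by (rule main) auto
      also have "norm b \<le> 1 * ((8 * \<Delta>) * (8 * \<Delta>))"
      proof -
        have "norm (of_real x * H 1) * norm (of_real x * H 2) \<le> (8 * \<Delta>) * (8 * \<Delta>)"
          by (rule mult_mono[OF n1 n1]) (use \<Delta> in auto)
        then have "x * (norm (of_real x * H 1) * norm (of_real x * H 2)) \<le> 1 * ((8 * \<Delta>) * (8 * \<Delta>))"
          by (rule mult_mono[OF x(2)]) auto
        moreover have "norm b = x * (norm (of_real x * H 1) * norm (of_real x * H 2))"
          unfolding b_def using x by (simp add: norm_mult)
        ultimately show ?thesis by simp
      qed
      also have "norm c \<le> (8 * \<Delta>) ^ 3 / 6"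
        unfolding c_def norm_divide norm_power using n1[of 1] \<Delta> by (intro frac_le power_mono) auto
      finally have "norm (a - b - c - e) \<le> x\<^sup>2 * (4 + 4 / x) * \<Delta>\<^sup>2 + 1 * ((8 * \<Delta>) * (8 * \<Delta>)) + (8 * \<Delta>) ^ 3 / 6" by simp
      also have "\<dots> = (4 * x\<^sup>2 + 4 * x + 64 + 256 / 3 * \<Delta>) * \<Delta>\<^sup>2"
        using x by (simp add: power2_eq_square power3_eq_cube field_simps)
      also have "\<dots> \<le> (200 + 4 / x) * \<Delta>\<^sup>2"
      proof (rule mult_right_mono)
        have "x\<^sup>2 \<le> 1" using x by (simp add: power_le_one)
        then show "4 * x\<^sup>2 + 4 * x + 64 + 256 / 3 * \<Delta> \<le> 200 + 4 / x" using x x1 D1 by linarith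
      qed simp
      finally show ?thesis unfolding iR a_def b_def c_def e_def by (simp add: m_def mult_ac)
    qed
  qed
qed

section \<open>Discretization of the second variation\<close>

text \<open>At \<open>s = 1\<close> the value is \<open>v N\<close>, one index beyond the
  \<open>N\<close> half-open cells; integrals do not see this point.\<close>

definition step_fun :: "nat \<Rightarrow> (nat \<Rightarrow> real) \<Rightarrow> real \<Rightarrow> real" where
  "step_fun N v s = v (nat \<lfloor>real N * s\<rfloor>)"

lemma step_fun_eq:
  assumes "0 < N" "real j / real N \<le> s" "s < real (Suc j) / real N"
  shows "step_fun N v s = v j"
proof -
  have "\<lfloor>real N * s\<rfloor> = int j" using assms by (intro floor_unique) (auto simp: field_simps)
  then show ?thesis by (simp add: step_fun_def)
qed

lemma pwc_step_fun:
  assumes "0 < N"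
  shows "pwc (step_fun N v)"
  unfolding pwc_def
proof
  define S where "S = (\<lambda>j. real j / real N) ` {..N}"
  have "continuous_on (\<Union>j\<in>{..<N}. {real j / real N<..<real (Suc j) / real N}) (step_fun N v)"
  proof (rule continuous_on_open_UN)
    fix j
    show "continuous_on {real j / real N<..<real (Suc j) / real N} (step_fun N v)"
      by (rule continuous_on_eq[of _ "\<lambda>s. v j"]) (use step_fun_eq[OF assms, of j] in auto)
  qed simp
  moreover have "{0..1} - S \<subseteq> (\<Union>j\<in>{..<N}. {real j / real N<..<real (Suc j) / real N})"
  proof
    fix s assume s: "s \<in> {0..1} - S"
    define j where "j = nat \<lfloor>real N * s\<rfloor>"
    have j: "real j \<le> real N * s" "real N * s < real j + 1"
      using s by (auto simp: j_def)
    have "real N * s \<le> real N" using s by (simp add: mult_left_le)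
    then have jN: "j \<le> N" using j(1) by linarith
    have "s \<noteq> real j / real N" using s jN by (auto simp: S_def)
    moreover have "real j / real N \<le> s" using j(1) assms by (simp add: pos_divide_le_eq mult.commute)
    ultimately have "real j / real N < s" by simp
    moreover have "s < real (Suc j) / real N" using j(2) assms by (simp add: pos_less_divide_eq mult.commute add.commute)
    moreover have "j \<noteq> N" using \<open>real j / real N < s\<close> s assms by auto
    ultimately show "s \<in> (\<Union>j\<in>{..<N}. {real j / real N<..<real (Suc j) / real N})" using jN by auto
  qed
  ultimately have "continuous_on ({0..1} - S) (step_fun N v)" by (rule continuous_on_subset)
  then show "\<exists>S. finite S \<and> continuous_on ({0..1} - S) (step_fun N v)" by (intro exI[of _ S]) (auto simp: S_def)
  have "step_fun N v ` {0..1} \<subseteq> v ` {..N}"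
  proof
    fix y assume "y \<in> step_fun N v ` {0..1}"
    then obtain s where s: "0 \<le> s" "s \<le> 1" "y = step_fun N v s" by auto
    have "real N * s \<le> real N" using s by (simp add: mult_left_le)
    then have "nat \<lfloor>real N * s\<rfloor> \<le> N" by linarith
    then show "y \<in> v ` {..N}" using s by (auto simp: step_fun_def)
  qed
  then show "bounded (step_fun N v ` {0..1})" by (meson bounded_subset finite_imageI finite_atMost finite_imp_bounded)
qed

lemma prim_diff_bound:
  assumes f: "pwc f" and ab: "0 \<le> a" "a \<le> b" "b \<le> 1" and le: "\<And>s. a \<le> s \<Longrightarrow> s < b \<Longrightarrow> \<bar>f s - c\<bar> \<le> e"
  shows "\<bar>prim f b - prim f a - c * (b - a)\<bar> \<le> e * (b - a)"
proof -
  have "integral {0..a} f + integral {a..b} f = integral {0..b} f"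
    by (rule Henstock_Kurzweil_Integration.integral_combine) (use ab f in \<open>auto intro!: pwc_integrable\<close>)
  then have "prim f b - prim f a = integral {a..b} f" by (simp add: prim_def)
  \<comment> \<open>The bound is given on a half-open cell, so the value at \<open>b\<close> is
    replaced by \<open>c\<close>.\<close>
  moreover define g where "g s = (if s = b then c else f s)" for s
  have "integral {a..b} f = integral {a..b} g"
    by (rule integral_spike[of "{b}"]) (auto simp: g_def)
  moreover have gi: "g integrable_on {a..b}"
    by (rule integrable_spike_finite[of "{b}" _ _ f]) (use pwc_integrable[OF f] ab in \<open>auto simp: g_def\<close>)
  have "norm (integral {a..b} (\<lambda>s. g s - c)) \<le> e * (b - a)"
  proof (cases "a = b")
    case False
    have e0: "0 \<le> e" using le[of a] ab False abs_ge_zero order_trans by (metis order_le_less order_refl)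
    have "((\<lambda>s. g s - c) has_integral integral {a..b} (\<lambda>s. g s - c)) (cbox a b)"
      using gi by (auto intro!: integrable_integral integrable_diff)
    from has_integral_bound[OF e0 this] show ?thesis
      using le e0 ab by (auto simp: g_def split: if_splits)
  qed simp
  moreover have "integral {a..b} (\<lambda>s. g s - c) = integral {a..b} g - c * (b - a)"
    using gi ab by (subst integral_diff) auto
  ultimately show ?thesis by simp
qed

lemma prim_Riemann_sum:
  assumes f: "pwc f" and N: "0 < N"
    and le: "\<And>j s. j < N \<Longrightarrow> real j / real N \<le> s \<Longrightarrow> s < real (Suc j) / real N \<Longrightarrow> \<bar>f s - G j\<bar> \<le> e"
    and n: "n \<le> N"
  shows "\<bar>prim f (real n / real N) - (\<Sum>j<n. G j) / real N\<bar> \<le> e * (real n / real N)"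
  using n
proof (induction n)
  case (Suc n)
  have d: "real (Suc n) / real N - real n / real N = 1 / real N" by (simp add: add_divide_distrib)
  have "\<bar>prim f (real (Suc n) / real N) - prim f (real n / real N) - G n * (real (Suc n) / real N - real n / real N)\<bar>
      \<le> e * (real (Suc n) / real N - real n / real N)"
    by (rule prim_diff_bound[OF f]) (use Suc.prems N le[of n] in \<open>auto simp: divide_simps\<close>)
  then have "\<bar>prim f (real (Suc n) / real N) - prim f (real n / real N) - G n / real N\<bar> \<le> e / real N"
    unfolding d by simp
  moreover have "\<bar>prim f (real n / real N) - (\<Sum>j<n. G j) / real N\<bar> \<le> e * (real n / real N)"
    using Suc by simp
  moreover have "(\<Sum>j<Suc n. G j) / real N = (\<Sum>j<n. G j) / real N + G n / real N" by (simp add: add_divide_distrib)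
  moreover have "e * (real (Suc n) / real N) = e * (real n / real N) + e / real N" by (simp add: add_divide_distrib algebra_simps)
  ultimately show ?case by linarith
qed simp

text \<open>The sine part of \<open>Re a_4\<close> along a chain of mesh \<open>\<Delta>\<close>,
  with the mean of the sine of the double angle replaced by \<open>2 * v\<close>, as is right for
  small angles.\<close>

definition discrete_form :: "real \<Rightarrow> nat \<Rightarrow> (nat \<Rightarrow> real) \<Rightarrow> real" where
  "discrete_form T N v = (let \<Delta> = T / real N; S = (\<Sum>j<N. v j) * \<Delta> in
     - 24 * T * S\<^sup>2 + 16 * S * ((\<Sum>j<N. (1 - real j * \<Delta>) * v j) * \<Delta>)
     + 8 * ((\<Sum>j<N. (1 - real j * \<Delta>) * v j * ((\<Sum>i<j. v i) * \<Delta>)) * \<Delta>))"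

lemma summation_by_parts:
  fixes v :: "nat \<Rightarrow> real" and \<Delta> :: real
  defines "\<sigma> \<equiv> \<lambda>j. (\<Sum>i<j. v i) * \<Delta>"
  shows "(\<Sum>j<n. (1 - real j * \<Delta>) * v j) * \<Delta> = (1 - real n * \<Delta>) * \<sigma> n + \<Delta> * (\<Sum>j<n. \<sigma> (Suc j))"
    "2 * ((\<Sum>j<n. (1 - real j * \<Delta>) * v j * \<sigma> j) * \<Delta>) =
      (1 - real n * \<Delta>) * (\<sigma> n)\<^sup>2 + \<Delta> * (\<Sum>j<n. (\<sigma> (Suc j))\<^sup>2) - \<Delta>\<^sup>2 * (\<Sum>j<n. (1 - real j * \<Delta>) * (v j)\<^sup>2)"
proof -
  have s: "\<sigma> (Suc j) = \<sigma> j + v j * \<Delta>" for j by (simp add: \<sigma>_def algebra_simps)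
  have s0: "\<sigma> 0 = 0" by (simp add: \<sigma>_def)
  show "(\<Sum>j<n. (1 - real j * \<Delta>) * v j) * \<Delta> = (1 - real n * \<Delta>) * \<sigma> n + \<Delta> * (\<Sum>j<n. \<sigma> (Suc j))"
    by (induction n) (simp_all add: s s0 algebra_simps)
  show "2 * ((\<Sum>j<n. (1 - real j * \<Delta>) * v j * \<sigma> j) * \<Delta>) =
      (1 - real n * \<Delta>) * (\<sigma> n)\<^sup>2 + \<Delta> * (\<Sum>j<n. (\<sigma> (Suc j))\<^sup>2) - \<Delta>\<^sup>2 * (\<Sum>j<n. (1 - real j * \<Delta>) * (v j)\<^sup>2)"
    by (induction n) (simp_all add: s s0 power2_eq_square algebra_simps)
qed

text \<open>Summation by parts gives the sums the shape of the nonlocal terms of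
  \<open>second_variation\<close> with reversed sign; the sum multiplied by
  \<open>\<Delta>\<^sup>2\<close> is a mesh error.\<close>

lemma discrete_form_eq:
  fixes T :: real and v :: "nat \<Rightarrow> real"
  assumes N: "0 < N"
  defines "\<Delta> \<equiv> T / real N" and "\<sigma> \<equiv> \<lambda>j. (\<Sum>i<j. v i) * (T / real N)"
  shows "discrete_form T N v = 4 * \<Delta> * (\<Sum>j<N. (\<sigma> (Suc j) + 2 * \<sigma> N)\<^sup>2) - (60 * T - 20) * (\<sigma> N)\<^sup>2
    - 4 * \<Delta>\<^sup>2 * (\<Sum>j<N. (1 - real j * \<Delta>) * (v j)\<^sup>2)"
proof -
  note p = summation_by_parts[of \<Delta> v N, folded \<Delta>_def]
  have NT: "real N * \<Delta> = T" using N by (simp add: \<Delta>_def)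
  have \<sigma>: "\<sigma> = (\<lambda>j. (\<Sum>i<j. v i) * \<Delta>)" by (simp add: \<sigma>_def \<Delta>_def)
  have "discrete_form T N v = - 24 * T * (\<sigma> N)\<^sup>2 + 16 * \<sigma> N * ((\<Sum>j<N. (1 - real j * \<Delta>) * v j) * \<Delta>)
     + 4 * (2 * ((\<Sum>j<N. (1 - real j * \<Delta>) * v j * \<sigma> j) * \<Delta>))"
    by (simp add: discrete_form_def Let_def \<sigma> \<Delta>_def[symmetric])
  also have "\<dots> = - 24 * T * (\<sigma> N)\<^sup>2 + 16 * \<sigma> N * ((1 - T) * \<sigma> N + \<Delta> * (\<Sum>j<N. \<sigma> (Suc j)))
     + 4 * ((1 - T) * (\<sigma> N)\<^sup>2 + \<Delta> * (\<Sum>j<N. (\<sigma> (Suc j))\<^sup>2) - \<Delta>\<^sup>2 * (\<Sum>j<N. (1 - real j * \<Delta>) * (v j)\<^sup>2))"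
    using p unfolding \<sigma> NT by simp
  also have "\<dots> = 4 * \<Delta> * (\<Sum>j<N. (\<sigma> (Suc j) + 2 * \<sigma> N)\<^sup>2) - (60 * T - 20) * (\<sigma> N)\<^sup>2
    - 4 * \<Delta>\<^sup>2 * (\<Sum>j<N. (1 - real j * \<Delta>) * (v j)\<^sup>2)"
  proof -
    have "(\<Sum>j<N. (\<sigma> (Suc j) + 2 * \<sigma> N)\<^sup>2) = (\<Sum>j<N. (\<sigma> (Suc j))\<^sup>2 + 4 * \<sigma> N * \<sigma> (Suc j) + 4 * (\<sigma> N)\<^sup>2)"
      by (rule sum.cong) (auto simp: power2_eq_square algebra_simps)
    also have "\<dots> = (\<Sum>j<N. (\<sigma> (Suc j))\<^sup>2) + 4 * \<sigma> N * (\<Sum>j<N. \<sigma> (Suc j)) + real N * (4 * (\<sigma> N)\<^sup>2)"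
      by (simp add: sum.distrib sum_distrib_left)
    finally have "\<Delta> * (\<Sum>j<N. (\<sigma> (Suc j) + 2 * \<sigma> N)\<^sup>2) =
        \<Delta> * (\<Sum>j<N. (\<sigma> (Suc j))\<^sup>2) + 4 * \<sigma> N * (\<Delta> * (\<Sum>j<N. \<sigma> (Suc j))) + (real N * \<Delta>) * (4 * (\<sigma> N)\<^sup>2)"
      by (simp add: algebra_simps)
    then show ?thesis unfolding NT by (simp add: power2_eq_square algebra_simps)
  qed
  finally show ?thesis .
qed

text \<open>The weight is sampled at left endpoints and the primitive at right endpoints, to match
  \<open>discrete_form_eq\<close>. The errors add up to \<open>40 + 4 * 6 + 4 = 68\<close>, rounded
  to 100.\<close>

lemma second_variation_step_fun:
  assumes N: "0 < N" and T: "10 / 11 \<le> T" "T < 1" and v: "\<And>j. \<bar>v j\<bar> \<le> V"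
  shows "\<bar>T ^ 3 * second_variation (1 / T) (step_fun N v) (step_fun N v)
      - ((\<Sum>j<N. T\<^sup>2 * legendre_weight (1 / T) (real j / real N) * (v j)\<^sup>2) * (T / real N) - discrete_form T N v)\<bar> \<le> 100 * V\<^sup>2 / real N"
    and "prim (\<lambda>s. (step_fun N v s)\<^sup>2) 1 = (\<Sum>j<N. (v j)\<^sup>2) / real N"
proof -
  define f where "f = step_fun N v"
  define r where "r = 1 / T"
  have V: "0 \<le> V" using v[of 0] by linarith
  have r: "1 \<le> r" "r \<le> 11/10" using T by (auto simp: r_def field_simps)
  have pf: "pwc f" unfolding f_def by (rule pwc_step_fun[OF N])
  have fj: "f s = v j" if "real j / real N \<le> s" "s < real (Suc j) / real N" for j s
    unfolding f_def by (rule step_fun_eq[OF N that])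
  have NN: "real N / real N = 1" using N by simp
  define \<sigma> where "\<sigma> j = (\<Sum>i<j. v i) * (T / real N)" for j
  have X: "prim f (real j / real N) = \<sigma> j / T" if "j \<le> N" for j
    using prim_Riemann_sum[OF pf N _ that, of v 0] fj T by (simp add: \<sigma>_def)
  have "\<bar>prim (\<lambda>s. (f s)\<^sup>2) (real N / real N) - (\<Sum>j<N. (v j)\<^sup>2) / real N\<bar> \<le> 0 * (real N / real N)"
    by (rule prim_Riemann_sum[OF pwc_power2[OF pf] N _ order_refl]) (simp add: fj)
  then show "prim (\<lambda>s. (step_fun N v s)\<^sup>2) 1 = (\<Sum>j<N. (v j)\<^sup>2) / real N"
    unfolding NN f_def by simp
  have v2: "(v j)\<^sup>2 \<le> V\<^sup>2" for j using v[of j] V by (metis abs_ge_zero power2_abs power_mono)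
  have wl: "\<bar>legendre_weight r s - legendre_weight r u\<bar> \<le> 40 * \<bar>s - u\<bar>" if "s \<in> {0..1}" "u \<in> {0..1}" for s u
  proof -
    have "legendre_weight r s - legendre_weight r u = (s - u) * (16 * (s + u) - (24 * r - 16))"
      by (simp add: legendre_weight_def power2_eq_square algebra_simps)
    moreover have "\<bar>16 * (s + u) - (24 * r - 16)\<bar> \<le> 40" using that r by (auto simp: abs_le_iff)
    ultimately show ?thesis by (simp add: abs_mult mult_left_mono mult.commute)
  qed
  have in01: "s \<in> {0..1}" "real j / real N \<in> {0..1}" "real (Suc j) / real N \<in> {0..1}" "\<bar>s - real j / real N\<bar> \<le> 1 / real N"
      "\<bar>s - real (Suc j) / real N\<bar> \<le> 1 / real N"
    if "j < N" "real j / real N \<le> s" "s < real (Suc j) / real N" for j s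
  proof -
    have "real (Suc j) / real N = real j / real N + 1 / real N" by (simp add: add_divide_distrib)
    moreover have "real (Suc j) / real N \<le> 1" "0 \<le> real j / real N" using that(1) N by (auto simp: divide_simps)
    ultimately show "s \<in> {0..1}" "real j / real N \<in> {0..1}" "real (Suc j) / real N \<in> {0..1}" "\<bar>s - real j / real N\<bar> \<le> 1 / real N"
      "\<bar>s - real (Suc j) / real N\<bar> \<le> 1 / real N"
      using that(2,3) unfolding atLeastAtMost_iff by (((intro conjI)?; linarith)+)
  qed
  have "\<bar>prim (\<lambda>s. legendre_weight r s * (f s * f s)) (real N / real N)
      - (\<Sum>j<N. legendre_weight r (real j / real N) * (v j)\<^sup>2) / real N\<bar> \<le> (40 * V\<^sup>2 / real N) * (real N / real N)"
  proof (rule prim_Riemann_sum[OF _ N _ order_refl])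
    show "pwc (\<lambda>s. legendre_weight r s * (f s * f s))" by (intro pwc_intros pwc_legendre_weight pf)
    fix j s assume j: "j < N" "real j / real N \<le> s" "s < real (Suc j) / real N"
    have "\<bar>legendre_weight r s - legendre_weight r (real j / real N)\<bar> * (v j)\<^sup>2 \<le> (40 * \<bar>s - real j / real N\<bar>) * V\<^sup>2"
      by (intro mult_mono wl in01[OF j] v2) auto
    also have "\<dots> \<le> (40 * (1 / real N)) * V\<^sup>2" by (intro mult_right_mono mult_left_mono in01[OF j]) auto
    finally show "\<bar>legendre_weight r s * (f s * f s) - legendre_weight r (real j / real N) * (v j)\<^sup>2\<bar> \<le> 40 * V\<^sup>2 / real N"
      unfolding fj[OF j(2,3)] by (simp add: power2_eq_square abs_mult flip: left_diff_distrib)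
  qed
  then have 1: "\<bar>prim (\<lambda>s. legendre_weight r s * (f s * f s)) 1
      - (\<Sum>j<N. legendre_weight r (real j / real N) * (v j)\<^sup>2) / real N\<bar> \<le> 40 * V\<^sup>2 / real N" unfolding NN by simp
  have fV: "\<bar>f s\<bar> \<le> V" for s using v by (simp add: f_def step_fun_def)
  have Xb: "\<bar>prim f s\<bar> \<le> V" if "s \<in> {0..1}" for s
  proof -
    have "\<bar>prim f s - prim f 0 - 0 * (s - 0)\<bar> \<le> V * (s - 0)"
      by (rule prim_diff_bound[OF pf]) (use that fV in auto)
    also have "\<dots> \<le> V" using that V by (simp add: mult_left_le)
    finally show ?thesis by simp
  qed
  have "\<bar>prim (\<lambda>s. (prim f s + 2 * prim f 1) * (prim f s + 2 * prim f 1)) (real N / real N)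
      - (\<Sum>j<N. (prim f (real (Suc j) / real N) + 2 * prim f 1)\<^sup>2) / real N\<bar> \<le> (6 * V\<^sup>2 / real N) * (real N / real N)"
  proof (rule prim_Riemann_sum[OF _ N _ order_refl])
    show "pwc (\<lambda>s. (prim f s + 2 * prim f 1) * (prim f s + 2 * prim f 1))" by (intro pwc_intros pf)
    fix j s assume j: "j < N" "real j / real N \<le> s" "s < real (Suc j) / real N"
    define a b where "a = prim f s + 2 * prim f 1" and "b = prim f (real (Suc j) / real N) + 2 * prim f 1"
    have "\<bar>prim f (real (Suc j) / real N) - prim f s - 0 * (real (Suc j) / real N - s)\<bar> \<le> V * (real (Suc j) / real N - s)"
      by (rule prim_diff_bound[OF pf]) (use in01[OF j] j fV in auto)
    also have "\<dots> \<le> V * (1 / real N)" using in01(5)[OF j] V by (intro mult_left_mono) auto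
    finally have d: "\<bar>a - b\<bar> \<le> V / real N" by (simp add: a_def b_def abs_minus_commute)
    have "\<bar>a + b\<bar> \<le> 6 * V" using Xb[OF in01(1)[OF j]] Xb[OF in01(3)[OF j]] Xb[of 1] unfolding a_def b_def by (simp add: abs_le_iff)
    then have "\<bar>a - b\<bar> * \<bar>a + b\<bar> \<le> (V / real N) * (6 * V)" using d V by (intro mult_mono) auto
    moreover have "a * a - b\<^sup>2 = (a - b) * (a + b)" by (simp add: power2_eq_square algebra_simps)
    ultimately show "\<bar>(prim f s + 2 * prim f 1) * (prim f s + 2 * prim f 1) - (prim f (real (Suc j) / real N) + 2 * prim f 1)\<^sup>2\<bar> \<le> 6 * V\<^sup>2 / real N"
      unfolding a_def[symmetric] b_def[symmetric] by (simp add: abs_mult power2_eq_square mult_ac)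
  qed
  then have 2: "\<bar>prim (\<lambda>s. (prim f s + 2 * prim f 1) * (prim f s + 2 * prim f 1)) 1
      - (\<Sum>j<N. (\<sigma> (Suc j) / T + 2 * (\<sigma> N / T))\<^sup>2) / real N\<bar> \<le> 6 * V\<^sup>2 / real N"
    using X[of N] X NN by (simp add: Suc_le_eq del: of_nat_Suc)
  define E where "E = (T / real N)\<^sup>2 * (\<Sum>j<N. (1 - real j * (T / real N)) * (v j)\<^sup>2)"
  have E: "0 \<le> E" "E \<le> V\<^sup>2 / real N"
  proof -
    have x: "0 \<le> 1 - real j * (T / real N)" "1 - real j * (T / real N) \<le> 1" if "j < N" for j
    proof -
      have "real j * T \<le> real N * 1" using that T by (intro mult_mono) auto
      then show "0 \<le> 1 - real j * (T / real N)" using N by (simp add: field_simps)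
      show "1 - real j * (T / real N) \<le> 1" using T by simp
    qed
    show "0 \<le> E" unfolding E_def
      by (intro mult_nonneg_nonneg sum_nonneg) (simp_all only: lessThan_iff x zero_le_power2)
    have "(\<Sum>j<N. (1 - real j * (T / real N)) * (v j)\<^sup>2) \<le> (\<Sum>j<N. 1 * V\<^sup>2)"
    proof (rule sum_mono)
      fix j assume "j \<in> {..<N}"
      then show "(1 - real j * (T / real N)) * (v j)\<^sup>2 \<le> 1 * V\<^sup>2" by (intro mult_mono x(2) v2) auto
    qed
    then have "E \<le> (T / real N)\<^sup>2 * (real N * V\<^sup>2)" unfolding E_def by (intro mult_left_mono) auto
    also have "\<dots> = T\<^sup>2 * (V\<^sup>2 / real N)" using N by (simp add: power2_eq_square field_simps)
    also have "\<dots> \<le> 1 * (V\<^sup>2 / real N)" using T by (intro mult_right_mono) (auto simp: power_le_one)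
    finally show "E \<le> V\<^sup>2 / real N" by simp
  qed
  define a1 a2 b1 b2 where "a1 = prim (\<lambda>s. legendre_weight r s * (f s * f s)) 1"
    and "a2 = (\<Sum>j<N. legendre_weight r (real j / real N) * (v j)\<^sup>2) / real N"
    and "b1 = prim (\<lambda>s. (prim f s + 2 * prim f 1) * (prim f s + 2 * prim f 1)) 1"
    and "b2 = (\<Sum>j<N. (\<sigma> (Suc j) / T + 2 * (\<sigma> N / T))\<^sup>2) / real N"
  have T3: "0 \<le> T ^ 3" "T ^ 3 \<le> 1" using T by (auto simp: power_le_one)
  have sv: "second_variation r f f = a1 - 4 * b1 + (60 - 20 / T) * (\<sigma> N / T)\<^sup>2"
    unfolding second_variation_def a1_def b1_def using X[of N] N by (simp add: r_def power2_eq_square)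
  have A: "(\<Sum>j<N. T\<^sup>2 * legendre_weight r (real j / real N) * (v j)\<^sup>2) * (T / real N) = T ^ 3 * a2"
    unfolding a2_def by (simp add: sum_distrib_left sum_distrib_right sum_divide_distrib power2_eq_square power3_eq_cube mult_ac)
  have B: "4 * (T / real N) * (\<Sum>j<N. (\<sigma> (Suc j) + 2 * \<sigma> N)\<^sup>2) = 4 * T ^ 3 * b2"
  proof -
    have "(\<Sum>j<N. (\<sigma> (Suc j) / T + 2 * (\<sigma> N / T))\<^sup>2) = (\<Sum>j<N. (\<sigma> (Suc j) + 2 * \<sigma> N)\<^sup>2 / T\<^sup>2)"
      by (rule sum.cong) (auto simp: power_divide simp flip: add_divide_distrib)
    also have "\<dots> = (\<Sum>j<N. (\<sigma> (Suc j) + 2 * \<sigma> N)\<^sup>2) / T\<^sup>2" by (simp add: sum_divide_distrib)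
    finally show ?thesis unfolding b2_def using T by (simp add: power2_eq_square power3_eq_cube)
  qed
  have "T ^ 3 * second_variation r f f - (T ^ 3 * a2 - discrete_form T N v) = T ^ 3 * (a1 - a2) - 4 * (T ^ 3 * (b1 - b2)) - 4 * E"
    unfolding sv discrete_form_eq[OF N] \<sigma>_def[symmetric] B E_def[symmetric]
    using T by (simp add: E_def power2_eq_square power3_eq_cube field_simps)
  moreover have "\<bar>T ^ 3 * (a1 - a2)\<bar> \<le> 1 * (40 * (V\<^sup>2 / real N))"
    unfolding abs_mult using 1 T3 by (intro mult_mono) (auto simp: a1_def a2_def)
  moreover have "\<bar>T ^ 3 * (b1 - b2)\<bar> \<le> 1 * (6 * (V\<^sup>2 / real N))"
    unfolding abs_mult using 2 T3 by (intro mult_mono) (auto simp: b1_def b2_def)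
  ultimately have "\<bar>T ^ 3 * second_variation r f f - (T ^ 3 * a2 - discrete_form T N v)\<bar> \<le> 68 * (V\<^sup>2 / real N)"
    using E by linarith
  also have "\<dots> \<le> 100 * (V\<^sup>2 / real N)" by (intro mult_right_mono) auto
  finally show "\<bar>T ^ 3 * second_variation (1 / T) (step_fun N v) (step_fun N v)
      - ((\<Sum>j<N. T\<^sup>2 * legendre_weight (1 / T) (real j / real N) * (v j)\<^sup>2) * (T / real N) - discrete_form T N v)\<bar> \<le> 100 * V\<^sup>2 / real N"
    using A by (simp add: r_def f_def)
qed

section \<open>The real part of the fourth coefficient\<close>

lemma sum_sequences_bound:
  fixes u x :: "nat \<Rightarrow> real"
  assumes "0 \<le> \<Delta>" "\<And>j. j < N \<Longrightarrow> \<bar>x j\<bar> \<le> 1" "n \<le> N"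
  shows "\<bar>(\<Sum>j<n. x j * u j) * \<Delta>\<bar> \<le> (\<Sum>j<N. \<bar>u j\<bar>) * \<Delta>"
proof -
  have "\<bar>\<Sum>j<n. x j * u j\<bar> \<le> (\<Sum>j<n. \<bar>x j * u j\<bar>)" by (rule sum_abs)
  also have "\<dots> \<le> (\<Sum>j<n. 1 * \<bar>u j\<bar>)"
    unfolding abs_mult using assms by (intro sum_mono mult_right_mono) auto
  also have "\<dots> \<le> (\<Sum>j<N. \<bar>u j\<bar>)" using assms by (simp, intro sum_mono2) auto
  finally show ?thesis unfolding abs_mult using assms(1) by (simp add: mult_right_mono)
qed

text \<open>Sums of absolute values are the right norm: the cutoff changes a sine mean by a multiple
  of \<open>e1\<close>, of which only the sum will be small. The constant 48 is
  \<open>24 + 16 + 8\<close>, from the three terms of the form.\<close>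

lemma discrete_form_diff:
  fixes u v :: "nat \<Rightarrow> real"
  assumes N: "0 < N" and T: "0 < T" "T < 1"
  defines "\<Delta> \<equiv> T / real N"
  defines "U \<equiv> (\<Sum>j<N. \<bar>u j\<bar>) * \<Delta>" and "V \<equiv> (\<Sum>j<N. \<bar>v j\<bar>) * \<Delta>" and "W \<equiv> (\<Sum>j<N. \<bar>u j - v j\<bar>) * \<Delta>"
  shows "\<bar>discrete_form T N u - discrete_form T N v\<bar> \<le> 48 * W * (U + V)"
proof -
  define x where "x j = 1 - real j * \<Delta>" for j
  have \<Delta>: "0 \<le> \<Delta>" using T by (simp add: \<Delta>_def)
  have x: "\<bar>x j\<bar> \<le> 1" if "j < N" for j
  proof -
    have "real j * T \<le> real N * 1" using that T by (intro mult_mono) auto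
    then show ?thesis using N T by (simp add: x_def \<Delta>_def field_simps abs_le_iff)
  qed
  define \<sigma> where "\<sigma> f n = (\<Sum>i<n. f i) * \<Delta>" for f :: "nat \<Rightarrow> real" and n
  define X where "X f = (\<Sum>j<N. x j * f j) * \<Delta>" for f
  define Z where "Z f = (\<Sum>j<N. x j * f j * \<sigma> f j) * \<Delta>" for f
  have df: "discrete_form T N f = - 24 * T * (\<sigma> f N)\<^sup>2 + 16 * \<sigma> f N * X f + 8 * Z f" for f
    by (simp add: discrete_form_def Let_def \<sigma>_def X_def Z_def x_def \<Delta>_def)
  have \<sigma>b: "\<bar>\<sigma> f n\<bar> \<le> (\<Sum>j<N. \<bar>f j\<bar>) * \<Delta>" if "n \<le> N" for f n
    using sum_sequences_bound[of \<Delta> N "\<lambda>j. 1" n f] \<Delta> that by (simp add: \<sigma>_def)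
  have Xb: "\<bar>X f\<bar> \<le> (\<Sum>j<N. \<bar>f j\<bar>) * \<Delta>" for f
    unfolding X_def by (rule sum_sequences_bound[OF \<Delta> x order_refl])
  have \<sigma>d: "\<sigma> u n - \<sigma> v n = \<sigma> (\<lambda>j. u j - v j) n" for n
    by (simp add: \<sigma>_def sum_subtractf left_diff_distrib)
  have Xd: "X u - X v = X (\<lambda>j. u j - v j)"
    by (simp add: X_def sum_subtractf left_diff_distrib right_diff_distrib)
  have b: "\<bar>\<sigma> u n\<bar> \<le> U" "\<bar>\<sigma> v n\<bar> \<le> V" "\<bar>\<sigma> u n - \<sigma> v n\<bar> \<le> W" if "n \<le> N" for n
    using \<sigma>b[OF that] unfolding U_def V_def W_def \<sigma>d by auto
  have bX: "\<bar>X u\<bar> \<le> U" "\<bar>X u - X v\<bar> \<le> W" using Xb unfolding U_def W_def Xd by auto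
  have nn: "0 \<le> U" "0 \<le> V" "0 \<le> W" unfolding U_def V_def W_def using \<Delta> by (auto intro!: mult_nonneg_nonneg sum_nonneg)
  have 1: "\<bar>T * ((\<sigma> u N)\<^sup>2 - (\<sigma> v N)\<^sup>2)\<bar> \<le> W * (U + V)"
  proof -
    have "\<bar>T * ((\<sigma> u N)\<^sup>2 - (\<sigma> v N)\<^sup>2)\<bar> = T * (\<bar>\<sigma> u N - \<sigma> v N\<bar> * \<bar>\<sigma> u N + \<sigma> v N\<bar>)"
    proof -
      have "T * ((\<sigma> u N)\<^sup>2 - (\<sigma> v N)\<^sup>2) = T * ((\<sigma> u N - \<sigma> v N) * (\<sigma> u N + \<sigma> v N))"
        by (simp add: power2_eq_square algebra_simps)
      then show ?thesis using T by (simp add: abs_mult)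
    qed
    also have "\<dots> \<le> 1 * (W * (U + V))"
      using b[of N] nn T by (intro mult_mono mult_nonneg_nonneg) auto
    finally show ?thesis by simp
  qed
  have 2: "\<bar>\<sigma> u N * X u - \<sigma> v N * X v\<bar> \<le> W * U + V * W"
  proof -
    have "\<sigma> u N * X u - \<sigma> v N * X v = (\<sigma> u N - \<sigma> v N) * X u + \<sigma> v N * (X u - X v)" by (simp add: algebra_simps)
    moreover have "\<bar>(\<sigma> u N - \<sigma> v N) * X u\<bar> \<le> W * U" "\<bar>\<sigma> v N * (X u - X v)\<bar> \<le> V * W"
      unfolding abs_mult using b[of N] bX nn by (auto intro!: mult_mono)
    ultimately show ?thesis by linarith
  qed
  have 3: "\<bar>Z u - Z v\<bar> \<le> W * U + V * W"
  proof -
    have "Z u - Z v = (\<Sum>j<N. x j * ((u j - v j) * \<sigma> u j + v j * (\<sigma> u j - \<sigma> v j))) * \<Delta>"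
      by (simp add: Z_def sum_subtractf[symmetric] left_diff_distrib[symmetric]) (simp add: algebra_simps)
    also have "\<bar>\<dots>\<bar> \<le> (\<Sum>j<N. \<bar>(u j - v j) * \<sigma> u j + v j * (\<sigma> u j - \<sigma> v j)\<bar>) * \<Delta>"
      by (rule sum_sequences_bound[OF \<Delta> x order_refl])
    also have "\<dots> \<le> (\<Sum>j<N. \<bar>u j - v j\<bar> * U + \<bar>v j\<bar> * W) * \<Delta>"
    proof (intro mult_right_mono sum_mono \<Delta>)
      fix j assume "j \<in> {..<N}"
      then have "\<bar>(u j - v j) * \<sigma> u j\<bar> \<le> \<bar>u j - v j\<bar> * U" "\<bar>v j * (\<sigma> u j - \<sigma> v j)\<bar> \<le> \<bar>v j\<bar> * W"
        unfolding abs_mult using b[of j] by (auto intro!: mult_left_mono)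
      then show "\<bar>(u j - v j) * \<sigma> u j + v j * (\<sigma> u j - \<sigma> v j)\<bar> \<le> \<bar>u j - v j\<bar> * U + \<bar>v j\<bar> * W" by linarith
    qed
    also have "\<dots> = W * U + V * W"
    proof -
      have "(\<Sum>j<N. \<bar>u j - v j\<bar> * U + \<bar>v j\<bar> * W) = (\<Sum>j<N. \<bar>u j - v j\<bar>) * U + (\<Sum>j<N. \<bar>v j\<bar>) * W"
        by (simp add: sum.distrib sum_distrib_right)
      then have "(\<Sum>j<N. \<bar>u j - v j\<bar> * U + \<bar>v j\<bar> * W) * \<Delta> =
          ((\<Sum>j<N. \<bar>u j - v j\<bar>) * \<Delta>) * U + ((\<Sum>j<N. \<bar>v j\<bar>) * \<Delta>) * W"
        by (simp add: algebra_simps)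
      then show ?thesis unfolding W_def[symmetric] V_def[symmetric] .
    qed
    finally show ?thesis .
  qed
  have "discrete_form T N u - discrete_form T N v = - 24 * (T * ((\<sigma> u N)\<^sup>2 - (\<sigma> v N)\<^sup>2))
      + 16 * (\<sigma> u N * X u - \<sigma> v N * X v) + 8 * (Z u - Z v)"
    unfolding df by (simp add: algebra_simps)
  moreover have "\<bar>y\<bar> \<le> 24 * P + 16 * Q + 8 * Q"
    if "y = - 24 * p + 16 * q + 8 * z" "\<bar>p\<bar> \<le> P" "\<bar>q\<bar> \<le> Q" "\<bar>z\<bar> \<le> Q" for y p q z P Q :: real
    using that by linarith
  ultimately have "\<bar>discrete_form T N u - discrete_form T N v\<bar> \<le> 24 * (W * (U + V)) + 16 * (W * U + V * W) + 8 * (W * U + V * W)"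
    using 1 2 3 by blast
  also have "\<dots> = 48 * W * (U + V)" by (simp add: algebra_simps)
  finally show ?thesis .
qed

text \<open>The coefficient of \<open>e1\<close> at time \<open>t\<close> in the limit of mesh zero:
  \<open>24 * T\<^sup>2 - 12 * \<beta> + 4 * \<xi>\<close>, where
  \<open>\<beta> = T - T\<^sup>2 / 2\<close> and \<open>\<xi> = t - t\<^sup>2 / 2\<close> are the
  integrals of one minus time up to \<open>T\<close> and \<open>t\<close>.\<close>

definition mass1 :: "real \<Rightarrow> real \<Rightarrow> real" where
  "mass1 T t = 30 * T\<^sup>2 - 12 * T + 4 * t - 2 * t\<^sup>2"

definition pick_a4 :: "real \<Rightarrow> real" where
  "pick_a4 T = 14 * T ^ 3 - 12 * T\<^sup>2 + 2 * T"

text \<open>The driving measures have moments \<open>(1 - e\<^sub>k) + \<i> s\<^sub>k\<close>, where \<open>e\<^sub>k\<close> and \<open>s\<^sub>k\<^sup>2\<close> are of the same order.\<close>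

lemma Re_total_a4:
  fixes e1 e2 e3 s1 s2 s3 :: "nat \<Rightarrow> real"
  assumes N: "0 < N" and T: "0 < T" "T < 1"
  defines "\<Delta> \<equiv> T / real N"
  defines "t \<equiv> \<lambda>j. real j * \<Delta>" and "x \<equiv> \<lambda>j. 1 - real j * \<Delta>"
  defines "d \<equiv> \<lambda>j. of_real (2 * \<Delta>) * Complex (1 - e1 j) (s1 j)"
    and "b \<equiv> \<lambda>j. of_real (\<Delta> * x j) * Complex (1 - e2 j) (s2 j)"
    and "c \<equiv> \<lambda>j. of_real (2 * \<Delta> * (x j)\<^sup>2) * Complex (1 - e3 j) (s3 j)"
  defines "\<eta> \<equiv> \<lambda>n. (\<Sum>j<n. e1 j) * \<Delta>" and "\<sigma> \<equiv> \<lambda>n. (\<Sum>j<n. s1 j) * \<Delta>"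
  assumes e: "\<And>j. j < N \<Longrightarrow> 0 \<le> e1 j" "\<And>j. j < N \<Longrightarrow> 0 \<le> e2 j"
  shows "Re (\<Sum>j<N. d j) = 2 * (T - \<eta> N)"
    "Re (total_a4 d b c N) \<le> pick_a4 T + 30 * \<Delta> + 12 * \<Delta> * \<eta> N
       - (\<Sum>j<N. mass1 T (t j) * e1 j - (8 * T + 4 * t j) * x j * e2 j + 2 * (x j)\<^sup>2 * e3 j) * \<Delta>
       + (- 24 * T * (\<sigma> N)\<^sup>2 + 8 * \<sigma> N * ((\<Sum>j<N. x j * s2 j) * \<Delta>) + 4 * ((\<Sum>j<N. x j * s2 j * \<sigma> j) * \<Delta>))
       + 24 * (\<eta> N)\<^sup>2 + 24 * \<eta> N * (\<sigma> N)\<^sup>2"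
proof -
  have \<Delta>: "0 < \<Delta>" using T N by (simp add: \<Delta>_def)
  have NT: "real N * \<Delta> = T" using N by (simp add: \<Delta>_def)
  have D1: "\<Delta> < 1"
  proof -
    have "\<Delta> = T / real N" by (simp add: \<Delta>_def)
    also have "\<dots> \<le> T / 1" using N T by (intro divide_left_mono) auto
    finally show ?thesis using T by simp
  qed
  have xpos: "0 \<le> x j" "x j \<le> 1" "t j \<le> T" "0 \<le> t j" if "j < N" for j
  proof -
    show 1: "t j \<le> T" using that \<Delta> unfolding t_def NT[symmetric] by (intro mult_right_mono) auto
    show "0 \<le> x j" "x j \<le> 1" "0 \<le> t j" using 1 T \<Delta> by (auto simp: x_def t_def)
  qed
  define \<beta> where "\<beta> = (\<Sum>j<N. x j) * \<Delta>"
  define \<xi> where "\<xi> n = (\<Sum>j<n. x j) * \<Delta>" for n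
  define \<eta>B where "\<eta>B = (\<Sum>j<N. x j * e2 j) * \<Delta>"
  define SB where "SB = (\<Sum>j<N. x j * s2 j) * \<Delta>"
  have A: "Re (\<Sum>j<n. d j) = 2 * (t n - \<eta> n)" "Im (\<Sum>j<n. d j) = 2 * \<sigma> n" for n
    by (simp_all add: d_def \<eta>_def \<sigma>_def t_def sum_subtractf sum_distrib_left sum_distrib_right right_diff_distrib left_diff_distrib mult_ac)
  have tN: "t N = T" by (simp add: t_def NT)
  show "Re (\<Sum>j<N. d j) = 2 * (T - \<eta> N)" unfolding A tN by simp
  have B: "Re (\<Sum>j<N. b j) = \<beta> - \<eta>B" "Im (\<Sum>j<N. b j) = SB"
    by (simp_all add: b_def \<beta>_def \<eta>B_def SB_def sum_subtractf sum_distrib_left sum_distrib_right right_diff_distrib left_diff_distrib mult_ac)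
  have dsum: "(\<Sum>i<n. d i) = Complex (2 * (t n - \<eta> n)) (2 * \<sigma> n)" for n
    using A[of n] by (simp only: complex_eq_iff complex.sel)
  have bsum: "(\<Sum>j<N. b j) = Complex (\<beta> - \<eta>B) SB" using B by (simp only: complex_eq_iff complex.sel)
  have Z: "Re (z ^ 3) = (Re z) ^ 3 - 3 * Re z * (Im z)\<^sup>2" for z
    by (simp add: power3_eq_cube power2_eq_square algebra_simps)
  have C: "Re (c j - 2 * (\<Sum>i<j. d i) * b j) = 2 * \<Delta> * (x j)\<^sup>2 * (1 - e3 j)
      - 4 * \<Delta> * x j * ((t j - \<eta> j) * (1 - e2 j) - \<sigma> j * s2 j)" for j
    unfolding dsum by (simp add: c_def b_def algebra_simps)
  have R: "Re (total_a4 d b c N) = 8 * ((T - \<eta> N) ^ 3 - 3 * (T - \<eta> N) * (\<sigma> N)\<^sup>2)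
      - 8 * ((T - \<eta> N) * (\<beta> - \<eta>B) - \<sigma> N * SB)
      + (\<Sum>j<N. 2 * \<Delta> * (x j)\<^sup>2 * (1 - e3 j) - 4 * \<Delta> * x j * ((t j - \<eta> j) * (1 - e2 j) - \<sigma> j * s2 j))"
  proof -
    have "Re (total_a4 d b c N) = Re (Complex (2 * (T - \<eta> N)) (2 * \<sigma> N) ^ 3)
        - Re (4 * Complex (2 * (T - \<eta> N)) (2 * \<sigma> N) * Complex (\<beta> - \<eta>B) SB)
        + (\<Sum>j<N. Re (c j - 2 * (\<Sum>i<j. d i) * b j))"
      unfolding total_a4_def dsum[of N] bsum tN by simp
    then show ?thesis unfolding C Z by (simp add: power3_eq_cube power2_eq_square algebra_simps)
  qed
  \<comment> \<open>Abel summation trades the accumulated \<open>\<eta> j\<close> for the single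
    \<open>e1 j\<close>; this is the origin of the term \<open>4 * \<xi> (Suc j)\<close> in the
    linear part.\<close>
  have Ab: "(\<Sum>j<n. x j * \<eta> j) * \<Delta> = \<xi> n * \<eta> n - (\<Sum>j<n. \<xi> (Suc j) * e1 j) * \<Delta>" for n
    by (induction n) (simp_all add: \<xi>_def \<eta>_def algebra_simps)
  have xi: "\<xi> (Suc j) = t j + \<Delta> - t j * (t j + \<Delta>) / 2" for j
    by (induction j) (simp_all add: \<xi>_def x_def t_def field_simps)
  have beta: "\<beta> = T - T\<^sup>2 / 2 + T * \<Delta> / 2"
  proof -
    obtain n where n: "N = Suc n" using N by (cases N) auto
    have tn: "t n = T - \<Delta>" unfolding t_def NT[symmetric] n by (simp add: algebra_simps)
    have "\<beta> = \<xi> (Suc n)" by (simp add: \<beta>_def \<xi>_def n)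
    then show ?thesis unfolding xi tn by (simp add: power2_eq_square field_simps)
  qed
  have x2: "(\<Sum>j<n. 2 * \<Delta> * (x j)\<^sup>2 - 4 * \<Delta> * x j * t j) =
      2 * t n - 4 * (t n) * (t n - \<Delta>) + t n * (t n - \<Delta>) * (2 * t n - \<Delta>)" for n
    by (induction n) (simp_all add: x_def t_def power2_eq_square algebra_simps)
  \<comment> \<open>The value when all means are point masses at the angle 0; it misses the
    coefficient of the Pick function only by the error of the Riemann sums.\<close>
  define P0 where "P0 = 8 * T ^ 3 - 8 * T * \<beta> + (\<Sum>j<N. 2 * \<Delta> * (x j)\<^sup>2 - 4 * \<Delta> * x j * t j)"
  have P0: "P0 \<le> pick_a4 T + 30 * \<Delta>"
  proof -
    have "P0 = pick_a4 T + \<Delta> * (4 * T - 7 * T\<^sup>2 + T * \<Delta>)"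
      unfolding P0_def x2 tN beta pick_a4_def by (simp add: power2_eq_square power3_eq_cube algebra_simps)
    also have "\<dots> \<le> pick_a4 T + \<Delta> * 30"
    proof (intro add_left_mono mult_left_mono)
      have "T * \<Delta> \<le> 1 * 1" using T D1 \<Delta> by (intro mult_mono) auto
      then show "4 * T - 7 * T\<^sup>2 + T * \<Delta> \<le> 30" using T by (smt (verit) zero_le_power2)
    qed (use \<Delta> in simp)
    finally show ?thesis by simp
  qed
  define Lin where "Lin = (\<Sum>j<N. (24 * T\<^sup>2 - 12 * \<beta> + 4 * \<xi> (Suc j)) * e1 j - (8 * T + 4 * t j) * x j * e2 j + 2 * (x j)\<^sup>2 * e3 j) * \<Delta>"
  define Quad where "Quad = - 24 * T * (\<sigma> N)\<^sup>2 + 8 * \<sigma> N * SB + 4 * ((\<Sum>j<N. x j * s2 j * \<sigma> j) * \<Delta>)"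
  have "Re (total_a4 d b c N) = P0 - Lin + Quad
     + (24 * T * (\<eta> N)\<^sup>2 - 8 * (\<eta> N) ^ 3 + 24 * \<eta> N * (\<sigma> N)\<^sup>2 - 8 * \<eta> N * \<eta>B - 4 * ((\<Sum>j<N. x j * e2 j * \<eta> j) * \<Delta>))"
  proof -
    have s: "(\<Sum>j<N. 2 * \<Delta> * (x j)\<^sup>2 * (1 - e3 j) - 4 * \<Delta> * x j * ((t j - \<eta> j) * (1 - e2 j) - \<sigma> j * s2 j)) =
      (\<Sum>j<N. 2 * \<Delta> * (x j)\<^sup>2 - 4 * \<Delta> * x j * t j) - (\<Sum>j<N. 2 * (x j)\<^sup>2 * e3 j) * \<Delta>
      + 4 * ((\<Sum>j<N. x j * \<eta> j) * \<Delta>) + 4 * ((\<Sum>j<N. t j * x j * e2 j) * \<Delta>) - 4 * ((\<Sum>j<N. x j * e2 j * \<eta> j) * \<Delta>)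
      + 4 * ((\<Sum>j<N. x j * s2 j * \<sigma> j) * \<Delta>)"
      by (simp add: sum_subtractf[symmetric] sum.distrib[symmetric] sum_distrib_right sum_distrib_left) (simp add: algebra_simps)
    have l: "Lin = (24 * T\<^sup>2 - 12 * \<beta>) * \<eta> N + 4 * ((\<Sum>j<N. \<xi> (Suc j) * e1 j) * \<Delta>) - 8 * T * \<eta>B
       - 4 * ((\<Sum>j<N. t j * x j * e2 j) * \<Delta>) + (\<Sum>j<N. 2 * (x j)\<^sup>2 * e3 j) * \<Delta>"
      unfolding Lin_def \<eta>_def \<eta>B_def
      by (simp add: sum_subtractf[symmetric] sum.distrib[symmetric] sum_distrib_right sum_distrib_left) (simp add: algebra_simps)
    have "\<xi> N = \<beta>" by (simp add: \<xi>_def \<beta>_def)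
    then show ?thesis unfolding R s l Quad_def P0_def Ab
      by (simp add: power2_eq_square power3_eq_cube algebra_simps)
  qed
  \<comment> \<open>The dropped terms are nonpositive because \<open>e1\<close>, \<open>e2\<close>
    and \<open>x\<close> are nonnegative.\<close>
  moreover have "24 * T * (\<eta> N)\<^sup>2 - 8 * (\<eta> N) ^ 3 + 24 * \<eta> N * (\<sigma> N)\<^sup>2 - 8 * \<eta> N * \<eta>B - 4 * ((\<Sum>j<N. x j * e2 j * \<eta> j) * \<Delta>)
      \<le> 24 * (\<eta> N)\<^sup>2 + 24 * \<eta> N * (\<sigma> N)\<^sup>2"
  proof -
    have \<eta>0: "0 \<le> \<eta> n" if "n \<le> N" for n
      unfolding \<eta>_def using \<Delta> e(1) that by (intro mult_nonneg_nonneg sum_nonneg) auto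
    have "0 \<le> \<eta>B" unfolding \<eta>B_def using \<Delta> e(2) xpos by (intro mult_nonneg_nonneg sum_nonneg) auto
    moreover have "0 \<le> (\<Sum>j<N. x j * e2 j * \<eta> j) * \<Delta>"
      using \<Delta> e(2) xpos \<eta>0 by (intro mult_nonneg_nonneg sum_nonneg) auto
    moreover have "24 * T * (\<eta> N)\<^sup>2 \<le> 24 * 1 * (\<eta> N)\<^sup>2" using T by (intro mult_right_mono) auto
    moreover have "0 \<le> 8 * (\<eta> N) ^ 3" "0 \<le> 8 * \<eta> N * \<eta>B" using \<eta>0[of N] calculation(1) by auto
    ultimately show ?thesis by linarith
  qed
  moreover have "(\<Sum>j<N. mass1 T (t j) * e1 j - (8 * T + 4 * t j) * x j * e2 j + 2 * (x j)\<^sup>2 * e3 j) * \<Delta> - 12 * \<Delta> * \<eta> N \<le> Lin"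
  proof -
    have "(\<Sum>j<N. mass1 T (t j) * e1 j - (8 * T + 4 * t j) * x j * e2 j + 2 * (x j)\<^sup>2 * e3 j) * \<Delta> - 12 * \<Delta> * \<eta> N
      = (\<Sum>j<N. (mass1 T (t j) - 12 * \<Delta>) * e1 j - (8 * T + 4 * t j) * x j * e2 j + 2 * (x j)\<^sup>2 * e3 j) * \<Delta>"
      unfolding \<eta>_def
      by (simp add: sum_subtractf[symmetric] sum.distrib[symmetric] sum_distrib_right sum_distrib_left) (simp add: algebra_simps)
    also have "\<dots> \<le> Lin" unfolding Lin_def
    proof (intro mult_right_mono sum_mono add_right_mono diff_right_mono)
      fix j assume "j \<in> {..<N}"
      then have j: "j < N" by simp
      show "0 \<le> e1 j" by (rule e(1)[OF j])
      have "24 * T\<^sup>2 - 12 * \<beta> + 4 * \<xi> (Suc j) = mass1 T (t j) + \<Delta> * (4 - 6 * T - 2 * t j)"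
        unfolding beta xi mass1_def by (simp add: power2_eq_square algebra_simps)
      moreover have "\<Delta> * (- 12) \<le> \<Delta> * (4 - 6 * T - 2 * t j)" using \<Delta> xpos[OF j] T by (intro mult_left_mono) auto
      ultimately show "mass1 T (t j) - 12 * \<Delta> \<le> 24 * T\<^sup>2 - 12 * \<beta> + 4 * \<xi> (Suc j)" by simp
    qed (use \<Delta> in simp)
    finally show ?thesis .
  qed
  ultimately show "Re (total_a4 d b c N) \<le> pick_a4 T + 30 * \<Delta> + 12 * \<Delta> * \<eta> N
       - (\<Sum>j<N. mass1 T (t j) * e1 j - (8 * T + 4 * t j) * x j * e2 j + 2 * (x j)\<^sup>2 * e3 j) * \<Delta>
       + (- 24 * T * (\<sigma> N)\<^sup>2 + 8 * \<sigma> N * ((\<Sum>j<N. x j * s2 j) * \<Delta>) + 4 * ((\<Sum>j<N. x j * s2 j * \<sigma> j) * \<Delta>))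
       + 24 * (\<eta> N)\<^sup>2 + 24 * \<eta> N * (\<sigma> N)\<^sup>2"
    using P0 unfolding Quad_def SB_def by linarith
qed

section \<open>The coercive case\<close>

text \<open>The right-hand side is the excess of Pontryagin's Hamiltonian in the direction with cosine \<open>y\<close>.
  It factors as \<open>(1 - y) * g y\<close>, where \<open>g 1\<close> is twice the Legendre weight and \<open>g y \<ge> 2 * T * (11 * T - 10)\<close>;
  the cutoff makes up for the decrease of \<open>g\<close> away from \<open>y = 1\<close>.\<close>

lemma hamiltonian_lower:
  fixes T t y \<kappa> :: real
  assumes T: "10 / 11 < T" "T < 1" and \<kappa>: "0 < \<kappa>" "\<kappa> \<le> 11 - 10 / T" and t: "0 \<le> t" "t \<le> T" and y: "-1 \<le> y" "y \<le> 1"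
  defines "\<mu> \<equiv> 40 / (\<kappa> * T\<^sup>2)"
  shows "min (\<kappa> * T\<^sup>2) (2 * T * (11 * T - 10)) * (1 - y)
     + (T\<^sup>2 * legendre_weight (1 / T) (t / T) - \<kappa> * T\<^sup>2) * ((1 - y\<^sup>2) * (max 0 (1 - \<mu> * (1 - y)))\<^sup>2)
     \<le> mass1 T t * (1 - y) - (8 * T + 4 * t) * (1 - t) * (1 - (2 * y\<^sup>2 - 1)) + 2 * (1 - t)\<^sup>2 * (1 - (4 * y ^ 3 - 3 * y))"
proof -
  define g where "g y = 2 * (2 * (1 - t) * y + 1 - 2 * t - 2 * T)\<^sup>2 + 2 * T * (11 * T - 10)" for y
  define D where "D = T\<^sup>2 * legendre_weight (1 / T) (t / T)"
  define c where "c = min (\<kappa> * T\<^sup>2) (2 * T * (11 * T - 10))"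
  define \<zeta> where "\<zeta> = max 0 (1 - \<mu> * (1 - y))"
  have kT: "0 < \<kappa> * T\<^sup>2" using \<kappa> T by simp
  have D: "D = (4 * t - 3 + 2 * T)\<^sup>2 + T * (11 * T - 10)"
    unfolding D_def legendre_weight_square using T by (simp add: field_simps power2_eq_square)
  have g1: "g 1 = 2 * D" unfolding D g_def by (simp add: power2_eq_square algebra_simps)
  have Dk: "0 \<le> D - \<kappa> * T\<^sup>2"
  proof -
    have "\<kappa> * T\<^sup>2 \<le> (11 - 10 / T) * T\<^sup>2" using \<kappa> by (intro mult_right_mono) auto
    also have "\<dots> = T * (11 * T - 10)" using T by (simp add: power2_eq_square field_simps)
    finally show ?thesis unfolding D using zero_le_power2[of "4 * t - 3 + 2 * T"] by linarith
  qed
  have "c + (D - \<kappa> * T\<^sup>2) * ((1 + y) * \<zeta>\<^sup>2) \<le> g y"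
  proof (cases "\<mu> * (1 - y) < 1")
    case False
    then have "\<zeta> = 0" by (simp add: \<zeta>_def)
    then show ?thesis unfolding c_def g_def by (simp add: min.coboundedI2)
  next
    case True
    have lam: "0 < \<mu>" unfolding \<mu>_def using kT by simp
    have ch: "0 \<le> \<zeta>" "\<zeta> \<le> 1" using True lam y by (auto simp: \<zeta>_def)
    then have "\<zeta>\<^sup>2 \<le> 1" by (simp add: power_le_one)
    then have "(1 + y) * \<zeta>\<^sup>2 \<le> 2 * 1" using y by (intro mult_mono) auto
    then have "(D - \<kappa> * T\<^sup>2) * ((1 + y) * \<zeta>\<^sup>2) \<le> (D - \<kappa> * T\<^sup>2) * 2" using Dk by (intro mult_left_mono) auto
    also have "\<dots> = g 1 - 2 * (\<kappa> * T\<^sup>2)" using g1 by simp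
    \<comment> \<open>Within the cutoff, \<open>40 * (1 - y) < \<kappa> * T\<^sup>2\<close>, while
      \<open>g\<close> falls by at most \<open>40 * (1 - y)\<close>; this is the 40 in
      \<open>\<mu>\<close>.\<close>
    also have "g 1 \<le> g y + \<kappa> * T\<^sup>2"
    proof -
      define p q where "p = 2 * (1 - t) + 1 - 2 * t - 2 * T" and "q = 2 * (1 - t) * y + 1 - 2 * t - 2 * T"
      have pq: "p - q = 2 * (1 - t) * (1 - y)" by (simp add: p_def q_def algebra_simps)
      define z where "z = (1 - t) * y"
      have "\<bar>z\<bar> \<le> 1 * 1" unfolding z_def abs_mult using y t T by (intro mult_mono) auto
      moreover have "p + q = 5 - 6 * t - 4 * T + 2 * z - 1" unfolding p_def q_def z_def by (simp add: algebra_simps)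
      ultimately have "\<bar>p + q\<bar> \<le> 10" using t T by linarith
      moreover have "0 \<le> p - q" "p - q \<le> 2 * (1 - y)"
      proof -
        have "(1 - t) * (1 - y) \<le> 1 * (1 - y)" "0 \<le> (1 - t) * (1 - y)" using t T y by (intro mult_right_mono mult_nonneg_nonneg; simp)+
        moreover have "p - q = 2 * ((1 - t) * (1 - y))" unfolding pq by simp
        ultimately show "0 \<le> p - q" "p - q \<le> 2 * (1 - y)" by linarith+
      qed
      moreover have "(p - q) * (p + q) \<le> (p - q) * 10" by (intro mult_left_mono) (use calculation in linarith)+
      moreover have "(p - q) * 10 \<le> (2 * (1 - y)) * 10" by (intro mult_right_mono) (use calculation in linarith)+
      ultimately have "(p - q) * (p + q) \<le> (2 * (1 - y)) * 10" by (meson order_trans)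
      moreover have "g 1 - g y = 2 * ((p - q) * (p + q))" by (simp add: g_def p_def q_def power2_eq_square algebra_simps)
      moreover have "40 * (1 - y) < \<kappa> * T\<^sup>2" using True kT by (simp add: \<mu>_def field_simps)
      ultimately show ?thesis by linarith
    qed
    finally have "(D - \<kappa> * T\<^sup>2) * ((1 + y) * \<zeta>\<^sup>2) \<le> g y - \<kappa> * T\<^sup>2" by simp
    moreover have "c \<le> \<kappa> * T\<^sup>2" by (simp add: c_def)
    ultimately show ?thesis by linarith
  qed
  then have "(1 - y) * (c + (D - \<kappa> * T\<^sup>2) * ((1 + y) * \<zeta>\<^sup>2)) \<le> (1 - y) * g y" using y by (intro mult_left_mono) auto
  moreover have "(1 - y) * g y = mass1 T t * (1 - y) - (8 * T + 4 * t) * (1 - t) * (1 - (2 * y\<^sup>2 - 1)) + 2 * (1 - t)\<^sup>2 * (1 - (4 * y ^ 3 - 3 * y))"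
    unfolding g_def mass1_def by (simp add: power2_eq_square power3_eq_cube algebra_simps)
  moreover have "(1 - y) * (c + (D - \<kappa> * T\<^sup>2) * ((1 + y) * \<zeta>\<^sup>2)) = c * (1 - y) + (D - \<kappa> * T\<^sup>2) * ((1 - y\<^sup>2) * \<zeta>\<^sup>2)"
    by (simp add: power2_eq_square algebra_simps)
  ultimately show ?thesis unfolding c_def D_def \<zeta>_def by simp
qed

text \<open>The square of the plain sine times the weight may exceed the excess at large angles;
  with the cutoff it stays below at all angles. The difference from the sine is at most
  \<open>\<mu> * (1 - cos \<theta>)\<close>, hence of higher order than the sine itself near
  0.\<close>

definition cutoff_sin :: "real \<Rightarrow> real \<Rightarrow> real" where
  "cutoff_sin \<mu> \<theta> = sin \<theta> * max 0 (1 - \<mu> * (1 - cos \<theta>))"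

lemma continuous_cutoff_sin: "continuous_on UNIV (cutoff_sin \<mu>)"
  unfolding cutoff_sin_def[abs_def] by (intro continuous_intros)

lemma cutoff_factor: "0 \<le> \<mu> \<Longrightarrow> 0 \<le> max 0 (1 - \<mu> * (1 - cos \<theta>)) \<and> max 0 (1 - \<mu> * (1 - cos \<theta>)) \<le> (1::real)"
  by (auto simp: max_def intro!: mult_nonneg_nonneg)

lemma mean_diff: "mean L \<Longrightarrow> continuous_on UNIV f \<Longrightarrow> continuous_on UNIV g \<Longrightarrow> L (\<lambda>t. f t - g t) = L f - L g"
  using mean_linear[of L f g 1 "-1"] by simp

lemma mean_cmult: "mean L \<Longrightarrow> continuous_on UNIV f \<Longrightarrow> L (\<lambda>t. c * f t) = c * L f"
  using mean_linear[of L f f c 0] by simp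

lemma mean_const: "mean L \<Longrightarrow> L (\<lambda>t. c) = c"
  using mean_cmult[of L "\<lambda>t. 1" c] by (simp add: mean_def)

lemma mean_abs_le:
  assumes L: "mean L" and f: "continuous_on UNIV f" "continuous_on UNIV g" and le: "\<And>t. \<bar>f t\<bar> \<le> g t"
  shows "\<bar>L f\<bar> \<le> L g"
proof -
  have "L f \<le> L g" by (rule mean_mono[OF L f]) (use le abs_le_iff in blast)
  moreover have "L (\<lambda>t. (-1) * f t) \<le> L g"
    by (rule mean_mono[OF L _ f(2)]) (use f le in \<open>auto intro!: continuous_intros simp: abs_le_iff\<close>)
  ultimately show ?thesis using mean_cmult[OF L f(1), of "-1"] by (simp add: abs_le_iff)
qed

lemma abs_sin_mult_le: "\<bar>sin \<theta>\<bar> * (1 - cos \<theta>) \<le> 1 - cos (\<theta> :: real)"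
  using mult_right_mono[of "\<bar>sin \<theta>\<bar>" 1 "1 - cos \<theta>"] by simp

lemma sin_squared_le: "(sin \<theta>)\<^sup>2 \<le> 2 * (1 - cos (\<theta> :: real))"
proof -
  have "(sin \<theta>)\<^sup>2 = (1 - cos \<theta>) * (1 + cos \<theta>)" using sin_squared_eq[of \<theta>] by (simp add: power2_eq_square algebra_simps)
  also have "\<dots> \<le> (1 - cos \<theta>) * 2" by (intro mult_left_mono) (use cos_le_one[of \<theta>] in auto)
  finally show ?thesis by simp
qed

text \<open>The mean of \<open>1 - cos\<close> controls everything:
  \<open>(sin \<theta>)\<^sup>2\<close>, \<open>sin (2 * \<theta>) - 2 * sin \<theta>\<close> and
  the effect of the cutoff are all bounded by multiples of \<open>1 - cos \<theta>\<close>.\<close>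

lemma mean_trig_estimates:
  assumes L: "mean L" and \<mu>: "0 \<le> \<mu>"
  defines "e1 \<equiv> 1 - L (\<lambda>t. cos t)" and "e2 \<equiv> 1 - L (\<lambda>t. cos (2 * t))" and "s1 \<equiv> L (\<lambda>t. sin t)"
    and "s2 \<equiv> L (\<lambda>t. sin (2 * t))" and "v \<equiv> L (cutoff_sin \<mu>)"
  shows "0 \<le> e1" "e1 \<le> 2" "0 \<le> e2" "s1\<^sup>2 \<le> 2 * e1" "v\<^sup>2 \<le> 2 * e1" "\<bar>v\<bar> \<le> 1"
    "\<bar>s2 - 2 * s1\<bar> \<le> 2 * e1" "\<bar>s1 - v\<bar> \<le> \<mu> * e1"
proof -
  note cc = continuous_cutoff_sin
  have ci: "continuous_on UNIV (\<lambda>t::real. cos t)" "continuous_on UNIV (\<lambda>t::real. sin t)"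
    "continuous_on UNIV (\<lambda>t::real. sin (2 * t))" "continuous_on UNIV (\<lambda>t::real. cos (2 * t))"
    "continuous_on UNIV (\<lambda>t::real. 1 - cos t)" "continuous_on UNIV (\<lambda>t::real. (sin t)\<^sup>2)"
    by (intro continuous_intros)+
  have E1: "e1 = L (\<lambda>t. 1 - cos t)" using mean_diff[OF L continuous_on_const ci(1), of 1] mean_const[OF L, of 1] by (simp add: e1_def)
  have E2: "e2 = L (\<lambda>t. 1 - cos (2 * t))" using mean_diff[OF L continuous_on_const ci(4), of 1] mean_const[OF L, of 1] by (simp add: e2_def)
  show "0 \<le> e1" unfolding E1 by (rule mean_nonneg[OF L ci(5)]) simp
  show "0 \<le> e2" unfolding E2 by (rule mean_nonneg[OF L]) (auto intro!: continuous_intros)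
  have "L (\<lambda>t. 1 - cos t) \<le> L (\<lambda>t. 2)"
    by (rule mean_mono[OF L ci(5)]) (auto simp: diff_le_eq intro: order_trans[OF _ cos_ge_minus_one] simp flip: diff_le_eq)
  then show "e1 \<le> 2" unfolding E1 mean_const[OF L] .
  have S: "L (\<lambda>t. (sin t)\<^sup>2) \<le> 2 * e1"
    unfolding E1 mean_cmult[OF L ci(5), symmetric]
    by (rule mean_mono[OF L ci(6) _ sin_squared_le]) (intro continuous_intros)
  then show "s1\<^sup>2 \<le> 2 * e1" using mean_power2_le[OF L ci(2)] unfolding s1_def by linarith
  have fac: "\<bar>cutoff_sin \<mu> t\<bar> \<le> \<bar>sin t\<bar>" for t
    using cutoff_factor[OF \<mu>, of t] unfolding cutoff_sin_def abs_mult by (simp add: mult_left_le)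
  have "L (\<lambda>t. (cutoff_sin \<mu> t)\<^sup>2) \<le> L (\<lambda>t. (sin t)\<^sup>2)"
    by (rule mean_mono[OF L _ ci(6)]) (use fac in \<open>auto intro!: continuous_intros cc simp: abs_le_square_iff\<close>)
  then show "v\<^sup>2 \<le> 2 * e1" using mean_power2_le[OF L cc, of \<mu>] S unfolding v_def by linarith
  have "\<bar>v\<bar> \<le> L (\<lambda>t. 1)" unfolding v_def
    by (rule mean_abs_le[OF L cc continuous_on_const]) (use fac abs_sin_le_one order_trans in blast)
  then show "\<bar>v\<bar> \<le> 1" by (simp add: mean_const[OF L])
  have "L (\<lambda>t. sin (2 * t) - 2 * sin t) = s2 - 2 * s1"
    unfolding s1_def s2_def using mean_linear[OF L ci(3,2), of 1 "-2"] by simp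
  moreover have "\<bar>L (\<lambda>t. sin (2 * t) - 2 * sin t)\<bar> \<le> L (\<lambda>t. 2 * (1 - cos t))"
  proof (rule mean_abs_le[OF L])
    show "\<bar>sin (2 * t) - 2 * sin t\<bar> \<le> 2 * (1 - cos t)" for t :: real
    proof -
      have "sin (2 * t) - 2 * sin t = - 2 * (sin t * (1 - cos t))" unfolding sin_double by (simp add: algebra_simps)
      then have "\<bar>sin (2 * t) - 2 * sin t\<bar> = 2 * (\<bar>sin t\<bar> * (1 - cos t))" by (simp add: abs_mult)
      then show ?thesis using abs_sin_mult_le[of t] by simp
    qed
  qed (auto intro!: continuous_intros)
  ultimately show "\<bar>s2 - 2 * s1\<bar> \<le> 2 * e1" unfolding E1 mean_cmult[OF L ci(5), symmetric] by simp
  have "\<bar>L (\<lambda>t. sin t - cutoff_sin \<mu> t)\<bar> \<le> L (\<lambda>t. \<mu> * (1 - cos t))"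
  proof (rule mean_abs_le[OF L])
    show "\<bar>sin t - cutoff_sin \<mu> t\<bar> \<le> \<mu> * (1 - cos t)" for t :: real
    proof -
      have "sin t - cutoff_sin \<mu> t = sin t * (1 - max 0 (1 - \<mu> * (1 - cos t)))" by (simp add: cutoff_sin_def algebra_simps)
      moreover have "\<bar>1 - max 0 (1 - \<mu> * (1 - cos t))\<bar> \<le> \<mu> * (1 - cos t)" using cutoff_factor[OF \<mu>, of t] by (auto simp: max_def)
      ultimately have "\<bar>sin t - cutoff_sin \<mu> t\<bar> \<le> 1 * (\<mu> * (1 - cos t))"
        by (simp only: abs_mult) (intro mult_mono; simp)
      then show ?thesis by simp
    qed
  qed (auto intro!: continuous_intros cc)
  then show "\<bar>s1 - v\<bar> \<le> \<mu> * e1"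
    unfolding s1_def v_def E1 mean_diff[OF L ci(2) cc] mean_cmult[OF L ci(5)] .
qed

text \<open>The pointwise bound is averaged, and the variance inequality replaces the mean of the
  squared cutoff sine by the square of its mean. The factor in front is nonnegative because
  \<open>\<kappa>\<close> is at most the minimum \<open>11 - 10 / T\<close> of the weight.\<close>

lemma mean_hamiltonian:
  fixes T t \<kappa> :: real
  assumes L: "mean L" and T: "10 / 11 < T" "T < 1" and \<kappa>: "0 < \<kappa>" "\<kappa> \<le> 11 - 10 / T" and t: "0 \<le> t" "t \<le> T"
  defines "\<mu> \<equiv> 40 / (\<kappa> * T\<^sup>2)"
  shows "min (\<kappa> * T\<^sup>2) (2 * T * (11 * T - 10)) * (1 - L (\<lambda>t. cos t))
     + (T\<^sup>2 * legendre_weight (1 / T) (t / T) - \<kappa> * T\<^sup>2) * (L (cutoff_sin \<mu>))\<^sup>2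
     \<le> mass1 T t * (1 - L (\<lambda>t. cos t)) - (8 * T + 4 * t) * (1 - t) * (1 - L (\<lambda>t. cos (2 * t)))
       + 2 * (1 - t)\<^sup>2 * (1 - L (\<lambda>t. cos (3 * t)))"
proof -
  define c D a b where "c = min (\<kappa> * T\<^sup>2) (2 * T * (11 * T - 10))" and "D = T\<^sup>2 * legendre_weight (1 / T) (t / T) - \<kappa> * T\<^sup>2"
    and "a = (8 * T + 4 * t) * (1 - t)" and "b = 2 * (1 - t)\<^sup>2"
  have D: "0 \<le> D"
  proof -
    have "\<kappa> \<le> legendre_weight (1 / T) (t / T)"
    proof -
      have "\<kappa> \<le> 11 - 10 * (1 / T)" using \<kappa>(2) by simp
      then show ?thesis
        unfolding legendre_weight_square using zero_le_power2[of "4 * (t / T) - (3 * (1 / T) - 2)"] by linarith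
    qed
    then have "T\<^sup>2 * \<kappa> \<le> T\<^sup>2 * legendre_weight (1 / T) (t / T)" by (intro mult_left_mono) auto
    then show ?thesis by (simp add: D_def mult.commute)
  qed
  have ci: "continuous_on UNIV (\<lambda>t::real. cos t)" "continuous_on UNIV (\<lambda>t::real. cos (2 * t))"
      "continuous_on UNIV (\<lambda>t::real. cos (3 * t))" "continuous_on UNIV (\<lambda>t. (cutoff_sin \<mu> t)\<^sup>2)"
      "continuous_on UNIV (\<lambda>t::real. 1 - cos t)" "continuous_on UNIV (\<lambda>t::real. 1 - cos (2 * t))" "continuous_on UNIV (\<lambda>t::real. 1 - cos (3 * t))"
    by (intro continuous_intros continuous_cutoff_sin)+
  have "L (\<lambda>\<theta>. c * (1 - cos \<theta>) + D * (cutoff_sin \<mu> \<theta>)\<^sup>2) \<le>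
     L (\<lambda>\<theta>. mass1 T t * (1 - cos \<theta>) - a * (1 - cos (2 * \<theta>)) + b * (1 - cos (3 * \<theta>)))"
  proof (rule mean_mono[OF L])
    fix \<theta> :: real
    have "cos (3 * \<theta>) = 4 * cos \<theta> ^ 3 - 3 * cos \<theta>" by (rule cos_treble_cos)
    moreover have "cos (2 * \<theta>) = 2 * (cos \<theta>)\<^sup>2 - 1" by (rule cos_double_cos)
    moreover have "(cutoff_sin \<mu> \<theta>)\<^sup>2 = (1 - (cos \<theta>)\<^sup>2) * (max 0 (1 - \<mu> * (1 - cos \<theta>)))\<^sup>2"
      by (simp add: cutoff_sin_def power_mult_distrib sin_squared_eq)
    ultimately show "c * (1 - cos \<theta>) + D * (cutoff_sin \<mu> \<theta>)\<^sup>2 \<le> mass1 T t * (1 - cos \<theta>) - a * (1 - cos (2 * \<theta>)) + b * (1 - cos (3 * \<theta>))"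
      using hamiltonian_lower[OF T \<kappa> t, of "cos \<theta>"] by (simp add: c_def D_def a_def b_def \<mu>_def)
  qed (intro continuous_intros continuous_cutoff_sin)+
  moreover have "L (\<lambda>\<theta>. c * (1 - cos \<theta>) + D * (cutoff_sin \<mu> \<theta>)\<^sup>2) = c * (1 - L (\<lambda>t. cos t)) + D * L (\<lambda>t. (cutoff_sin \<mu> t)\<^sup>2)"
    using mean_linear[OF L ci(5,4)] mean_diff[OF L continuous_on_const ci(1)] mean_const[OF L] by simp
  moreover have "L (\<lambda>\<theta>. (mass1 T t * (1 - cos \<theta>) - a * (1 - cos (2 * \<theta>))) + b * (1 - cos (3 * \<theta>))) =
      mass1 T t * (1 - L (\<lambda>t. cos t)) - a * (1 - L (\<lambda>t. cos (2 * t))) + b * (1 - L (\<lambda>t. cos (3 * t)))"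
  proof -
    have "continuous_on UNIV (\<lambda>\<theta>. mass1 T t * (1 - cos \<theta>) + (- a) * (1 - cos (2 * \<theta>)))" by (intro continuous_intros)
    from mean_linear[OF L this ci(7), of 1 b] mean_linear[OF L ci(5,6), of "mass1 T t" "- a"]
    show ?thesis
      using mean_diff[OF L continuous_on_const ci(1)] mean_diff[OF L continuous_on_const ci(2)] mean_diff[OF L continuous_on_const ci(3)] mean_const[OF L]
      by simp
  qed
  moreover have "D * (L (cutoff_sin \<mu>))\<^sup>2 \<le> D * L (\<lambda>t. (cutoff_sin \<mu> t)\<^sup>2)"
    by (intro mult_left_mono mean_power2_le[OF L continuous_cutoff_sin] D)
  ultimately show ?thesis unfolding c_def D_def a_def b_def by simp
qed

lemma sum_abs_power2_le:
  fixes f :: "nat \<Rightarrow> real"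
  shows "(\<Sum>j<N. \<bar>f j\<bar>)\<^sup>2 \<le> real N * (\<Sum>j<N. (f j)\<^sup>2)"
proof -
  have "(\<Sum>j<N. \<bar>f j\<bar> * 1)\<^sup>2 \<le> (\<Sum>j<N. \<bar>f j\<bar>\<^sup>2) * (\<Sum>j<N. 1\<^sup>2)" by (rule Cauchy_Schwarz_ineq_sum)
  then show ?thesis by (simp add: mult.commute)
qed

text \<open>A gain of \<open>C * E\<close> is left over, where \<open>E\<close> is the total of
  \<open>e1\<close>: \<open>Q4\<close> provides the excess, and \<open>Q3\<close> applies coercivity
  to the step function of the cutoff means. The remaining terms are of order \<open>u * E\<close>
  with \<open>u = sqrt (2 * E)\<close>, or of the size of the mesh, so it suffices that
  \<open>u\<close> is small.\<close>

lemma discrete_sufficiency: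
  fixes T \<kappa> :: real and L :: "nat \<Rightarrow> (real \<Rightarrow> real) \<Rightarrow> real"
  assumes T: "10 / 11 < T" "T < 1" and \<kappa>: "0 < \<kappa>" "\<kappa> \<le> 11 - 10 / T"
    and coer: "\<And>f. pwc f \<Longrightarrow> \<kappa> * prim (\<lambda>s. (f s)\<^sup>2) 1 \<le> second_variation (1 / T) f f"
    and N: "0 < N" and L: "\<And>j. mean (L j)"
  defines "\<mu> \<equiv> 40 / (\<kappa> * T\<^sup>2)" and "C \<equiv> min (\<kappa> * T\<^sup>2) (2 * T * (11 * T - 10))"
  defines "\<Delta> \<equiv> T / real N"
  defines "d \<equiv> \<lambda>j. of_real (2 * \<Delta>) * Complex (L j (\<lambda>t. cos t)) (L j (\<lambda>t. sin t))"
    and "b \<equiv> \<lambda>j. of_real (\<Delta> * (1 - real j * \<Delta>)) * Complex (L j (\<lambda>t. cos (2 * t))) (L j (\<lambda>t. sin (2 * t)))"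
    and "c \<equiv> \<lambda>j. of_real (2 * \<Delta> * (1 - real j * \<Delta>)\<^sup>2) * Complex (L j (\<lambda>t. cos (3 * t))) (L j (\<lambda>t. sin (3 * t)))"
  defines "\<eta> \<equiv> T - Re (\<Sum>j<N. d j) / 2"
  shows "0 \<le> \<eta>" "(60 + 96 * \<mu>) * sqrt (2 * \<eta>) \<le> C \<Longrightarrow> sqrt (2 * \<eta>) \<le> 1 \<Longrightarrow> Re (total_a4 d b c N) \<le> pick_a4 T + 154 / real N"
proof -
  define e1 e2 e3 s1 s2 s3 v where "e1 = (\<lambda>j. 1 - L j (\<lambda>t. cos t))" and "e2 = (\<lambda>j. 1 - L j (\<lambda>t. cos (2 * t)))"
    and "e3 = (\<lambda>j. 1 - L j (\<lambda>t. cos (3 * t)))" and "s1 = (\<lambda>j. L j (\<lambda>t. sin t))" and "s2 = (\<lambda>j. L j (\<lambda>t. sin (2 * t)))"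
    and "s3 = (\<lambda>j. L j (\<lambda>t. sin (3 * t)))" and "v = (\<lambda>j. L j (cutoff_sin \<mu>))"
  have T0: "0 < T" using T by simp
  have kT: "0 < \<kappa> * T\<^sup>2" using \<kappa> T0 by simp
  have mu: "0 < \<mu>" unfolding \<mu>_def using kT by simp
  have \<Delta>: "0 < \<Delta>" using T0 N by (simp add: \<Delta>_def)
  have NT: "real N * \<Delta> = T" using N by (simp add: \<Delta>_def)
  have DN: "\<Delta> \<le> 1 / real N" using T N by (simp add: \<Delta>_def divide_right_mono)
  have est: "0 \<le> e1 j" "e1 j \<le> 2" "0 \<le> e2 j" "(s1 j)\<^sup>2 \<le> 2 * e1 j" "(v j)\<^sup>2 \<le> 2 * e1 j" "\<bar>v j\<bar> \<le> 1"
    "\<bar>s2 j - 2 * s1 j\<bar> \<le> 2 * e1 j" "\<bar>s1 j - v j\<bar> \<le> \<mu> * e1 j" for j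
    unfolding e1_def e2_def s1_def s2_def v_def
    by (rule mean_trig_estimates[OF L less_imp_le[OF mu]])+
  define x t where "x = (\<lambda>j. 1 - real j * \<Delta>)" and "t = (\<lambda>j. real j * \<Delta>)"
  define S where "S n = (\<Sum>j<n. s1 j) * \<Delta>" for n
  define E where "E = (\<Sum>j<N. e1 j) * \<Delta>"
  have d: "d = (\<lambda>j. of_real (2 * \<Delta>) * Complex (1 - e1 j) (s1 j))"
    and b: "b = (\<lambda>j. of_real (\<Delta> * x j) * Complex (1 - e2 j) (s2 j))"
    and c: "c = (\<lambda>j. of_real (2 * \<Delta> * (x j)\<^sup>2) * Complex (1 - e3 j) (s3 j))"
    by (simp_all add: d_def b_def c_def x_def e1_def e2_def e3_def s1_def s2_def s3_def)
  define H where "H j = mass1 T (t j) * e1 j - (8 * T + 4 * t j) * x j * e2 j + 2 * (x j)\<^sup>2 * e3 j" for j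
  define SB R where "SB = (\<Sum>j<N. x j * s2 j) * \<Delta>" and "R = (\<Sum>j<N. x j * s2 j * S j) * \<Delta>"
  have total: "Re (\<Sum>j<N. d j) = 2 * (T - E)"
    "Re (total_a4 d b c N) \<le> pick_a4 T + 30 * \<Delta> + 12 * \<Delta> * E - (\<Sum>j<N. H j) * \<Delta>
       + (- 24 * T * (S N)\<^sup>2 + 8 * S N * SB + 4 * R) + 24 * E\<^sup>2 + 24 * E * (S N)\<^sup>2"
    using Re_total_a4(1)[OF N T0 T(2), of e1 e2 s1, folded \<Delta>_def] Re_total_a4(2)[OF N T0 T(2), of e1 e2 s1 s2 e3 s3, folded \<Delta>_def] est
    unfolding d b c E_def S_def H_def SB_def R_def x_def t_def by blast+
  have eta: "\<eta> = E" unfolding \<eta>_def total(1) by (simp add: field_simps)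
  have E0: "0 \<le> E" unfolding E_def using est(1) \<Delta> by (intro mult_nonneg_nonneg sum_nonneg) auto
  then show "0 \<le> \<eta>" by (simp add: eta)
  assume small: "(60 + 96 * \<mu>) * sqrt (2 * \<eta>) \<le> C" "sqrt (2 * \<eta>) \<le> 1"
  define u where "u = sqrt (2 * E)"
  have u: "0 \<le> u" "u \<le> 1" "u\<^sup>2 = 2 * E" using small(2) E0 by (simp_all add: u_def eta)
  have E2: "E \<le> 2"
  proof -
    have "E \<le> (\<Sum>j<N. 2) * \<Delta>" unfolding E_def using est(2) \<Delta> by (intro mult_right_mono sum_mono) auto
    also have "\<dots> = 2 * T" using NT by simp
    finally show ?thesis using T by simp
  qed
  have l1: "(\<Sum>j<N. \<bar>f j\<bar>) * \<Delta> \<le> u" if f: "\<And>j. (f j)\<^sup>2 \<le> 2 * e1 j" for f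
  proof -
    have "((\<Sum>j<N. \<bar>f j\<bar>) * \<Delta>)\<^sup>2 = (\<Sum>j<N. \<bar>f j\<bar>)\<^sup>2 * \<Delta>\<^sup>2" by (simp add: power_mult_distrib)
    also have "\<dots> \<le> (real N * (\<Sum>j<N. (f j)\<^sup>2)) * \<Delta>\<^sup>2" by (intro mult_right_mono sum_abs_power2_le) auto
    also have "\<dots> \<le> (real N * (\<Sum>j<N. 2 * e1 j)) * \<Delta>\<^sup>2" using f by (intro mult_right_mono mult_left_mono sum_mono) auto
    also have "\<dots> = (real N * \<Delta>) * (2 * E)" by (simp add: E_def power2_eq_square sum_distrib_left[symmetric])
    also have "\<dots> \<le> 1 * (2 * E)" unfolding NT using T E0 by (intro mult_right_mono) auto
    finally have "((\<Sum>j<N. \<bar>f j\<bar>) * \<Delta>)\<^sup>2 \<le> u\<^sup>2" using u by simp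
    then show ?thesis using u(1) by (rule power2_le_imp_le)
  qed
  have U: "(\<Sum>j<N. \<bar>s1 j\<bar>) * \<Delta> \<le> u" "(\<Sum>j<N. \<bar>v j\<bar>) * \<Delta> \<le> u" using l1 est(4,5) by blast+
  have S: "\<bar>S n\<bar> \<le> u" if "n \<le> N" for n
    using sum_sequences_bound[of \<Delta> N "\<lambda>_. 1" n s1] that \<Delta> U(1) by (simp add: S_def)
  have W: "(\<Sum>j<N. \<bar>s1 j - v j\<bar>) * \<Delta> \<le> \<mu> * E"
  proof -
    have "(\<Sum>j<N. \<bar>s1 j - v j\<bar>) * \<Delta> \<le> (\<Sum>j<N. \<mu> * e1 j) * \<Delta>" using est(8) \<Delta> by (intro mult_right_mono sum_mono) auto
    also have "\<dots> = \<mu> * E" by (simp add: E_def sum_distrib_left[symmetric])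
    finally show ?thesis .
  qed
  have x1: "\<bar>x j\<bar> \<le> 1" if "j < N" for j
  proof -
    have "real j * \<Delta> \<le> real N * \<Delta>" using that \<Delta> by (intro mult_right_mono) auto
    moreover have "0 \<le> real j * \<Delta>" using \<Delta> by simp
    ultimately show ?thesis using T unfolding NT x_def by (simp add: abs_le_iff)
  qed
  define w where "w j = s2 j - 2 * s1 j" for j
  have w: "(\<Sum>j<N. \<bar>w j\<bar>) * \<Delta> \<le> 2 * E"
  proof -
    have "(\<Sum>j<N. \<bar>w j\<bar>) * \<Delta> \<le> (\<Sum>j<N. 2 * e1 j) * \<Delta>" using est(7) \<Delta> unfolding w_def by (intro mult_right_mono sum_mono) auto
    also have "\<dots> = 2 * E" by (simp add: E_def sum_distrib_left[symmetric])
    finally show ?thesis .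
  qed
  have Q1: "- 24 * T * (S N)\<^sup>2 + 8 * S N * SB + 4 * R \<le> discrete_form T N s1 + 24 * (u * E)"
  proof -
    have s2: "s2 j = 2 * s1 j + w j" for j by (simp add: w_def)
    have "SB = 2 * ((\<Sum>j<N. x j * s1 j) * \<Delta>) + (\<Sum>j<N. x j * w j) * \<Delta>"
      unfolding SB_def s2 distrib_left sum.distrib distrib_right by (simp add: sum_distrib_left mult_ac)
    moreover have "R = 2 * ((\<Sum>j<N. x j * s1 j * S j) * \<Delta>) + (\<Sum>j<N. x j * w j * S j) * \<Delta>"
      unfolding R_def s2 distrib_left distrib_right sum.distrib by (simp add: sum_distrib_left mult_ac)
    moreover have "discrete_form T N s1 = - 24 * T * (S N)\<^sup>2 + 16 * S N * ((\<Sum>j<N. x j * s1 j) * \<Delta>) + 8 * ((\<Sum>j<N. x j * s1 j * S j) * \<Delta>)"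
      by (simp only: discrete_form_def Let_def \<Delta>_def[symmetric] S_def x_def)
    ultimately have "- 24 * T * (S N)\<^sup>2 + 8 * S N * SB + 4 * R =
        discrete_form T N s1 + 8 * (S N * ((\<Sum>j<N. x j * w j) * \<Delta>)) + 4 * ((\<Sum>j<N. x j * w j * S j) * \<Delta>)"
      by (simp only: distrib_left)
    moreover have "S N * ((\<Sum>j<N. x j * w j) * \<Delta>) \<le> u * (2 * E)"
    proof -
      define k where "k = (\<Sum>j<N. x j * w j) * \<Delta>"
      have "\<bar>k\<bar> \<le> (\<Sum>j<N. \<bar>w j\<bar>) * \<Delta>"
        unfolding k_def by (rule sum_sequences_bound[OF less_imp_le[OF \<Delta>] x1 order_refl])
      then have "\<bar>k\<bar> \<le> 2 * E" using w by (rule order_trans)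
      then have "\<bar>S N\<bar> * \<bar>k\<bar> \<le> u * (2 * E)" by (rule mult_mono[OF S[OF order_refl] _ u(1) abs_ge_zero])
      moreover have "S N * k \<le> \<bar>S N\<bar> * \<bar>k\<bar>" unfolding abs_mult[symmetric] by (rule abs_ge_self)
      ultimately show ?thesis unfolding k_def[symmetric] by (rule order_trans[rotated])
    qed
    moreover have "(\<Sum>j<N. x j * w j * S j) * \<Delta> \<le> u * (2 * E)"
    proof -
      have "x j * w j * S j \<le> u * \<bar>w j\<bar>" if "j < N" for j
      proof -
        have "\<bar>x j\<bar> * \<bar>w j\<bar> * \<bar>S j\<bar> \<le> (1 * \<bar>w j\<bar>) * u" using x1 S that u by (intro mult_mono mult_nonneg_nonneg) auto
        then show ?thesis by (simp add: abs_mult[symmetric] mult.commute abs_le_iff)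
      qed
      then have "(\<Sum>j<N. x j * w j * S j) * \<Delta> \<le> (\<Sum>j<N. u * \<bar>w j\<bar>) * \<Delta>" using \<Delta> by (intro mult_right_mono sum_mono) auto
      also have "\<dots> = u * ((\<Sum>j<N. \<bar>w j\<bar>) * \<Delta>)" by (simp add: sum_distrib_left[symmetric])
      also have "\<dots> \<le> u * (2 * E)" using w u by (intro mult_left_mono) auto
      finally show ?thesis .
    qed
    ultimately show ?thesis by linarith
  qed
  have Q2: "discrete_form T N s1 \<le> discrete_form T N v + 96 * (\<mu> * (u * E))"
  proof -
    define U' V' W' where "U' = (\<Sum>j<N. \<bar>s1 j\<bar>) * \<Delta>" and "V' = (\<Sum>j<N. \<bar>v j\<bar>) * \<Delta>" and "W' = (\<Sum>j<N. \<bar>s1 j - v j\<bar>) * \<Delta>"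
    have p: "0 \<le> U'" "0 \<le> V'" "0 \<le> W'" unfolding U'_def V'_def W'_def using \<Delta> by (auto intro!: mult_nonneg_nonneg sum_nonneg)
    have "discrete_form T N s1 - discrete_form T N v \<le> 48 * W' * (U' + V')"
      using discrete_form_diff[OF N T0 T(2), of s1 v] unfolding U'_def V'_def W'_def \<Delta>_def by simp
    moreover have "W' * (U' + V') \<le> (\<mu> * E) * (u + u)"
      by (intro mult_mono add_mono) (use U W p mu E0 in \<open>auto simp: U'_def V'_def W'_def\<close>)
    ultimately show ?thesis by (simp add: algebra_simps)
  qed
  define D where "D j = T\<^sup>2 * legendre_weight (1 / T) (real j / real N)" for j
  have tj: "t j / T = real j / real N" for j using T0 by (simp add: t_def \<Delta>_def)
  have Q3: "discrete_form T N v \<le> (\<Sum>j<N. (D j - \<kappa> * T\<^sup>2) * (v j)\<^sup>2) * \<Delta> + 100 / real N"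
  proof -
    define P where "P = (\<Sum>j<N. (v j)\<^sup>2)"
    define G where "G = (\<Sum>j<N. D j * (v j)\<^sup>2) * \<Delta>"
    have T': "10 / 11 \<le> T" using T by simp
    note SV = second_variation_step_fun[OF N T' T(2), of v 1, OF est(6)]
    have "\<kappa> * (P / real N) \<le> second_variation (1 / T) (step_fun N v) (step_fun N v)"
      using coer[OF pwc_step_fun[OF N, of v]] unfolding SV(2) P_def .
    then have *: "T ^ 3 * (\<kappa> * (P / real N)) \<le> T ^ 3 * second_variation (1 / T) (step_fun N v) (step_fun N v)"
      using T0 by (intro mult_left_mono) auto
    have **: "T ^ 3 * (\<kappa> * (P / real N)) = \<kappa> * T\<^sup>2 * P * \<Delta>" by (simp add: \<Delta>_def power2_eq_square power3_eq_cube)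
    have "\<kappa> * T\<^sup>2 * P * \<Delta> \<le> G - discrete_form T N v + 100 / real N"
    proof -
      have "\<bar>T ^ 3 * second_variation (1 / T) (step_fun N v) (step_fun N v) - (G - discrete_form T N v)\<bar> \<le> 100 * 1\<^sup>2 / real N"
        unfolding D_def G_def \<Delta>_def by (rule SV(1))
      moreover have "100 * 1\<^sup>2 / real N = 100 / real N" by simp
      ultimately show ?thesis using * ** by linarith
    qed
    moreover have "(\<Sum>j<N. (D j - \<kappa> * T\<^sup>2) * (v j)\<^sup>2) * \<Delta> = G - \<kappa> * T\<^sup>2 * P * \<Delta>"
      by (simp add: G_def P_def sum_subtractf left_diff_distrib sum_distrib_left mult.assoc)
    ultimately show ?thesis by linarith
  qed
  have Q4: "(\<Sum>j<N. (D j - \<kappa> * T\<^sup>2) * (v j)\<^sup>2) * \<Delta> \<le> (\<Sum>j<N. H j) * \<Delta> - C * E"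
  proof -
    have "C * e1 j + (D j - \<kappa> * T\<^sup>2) * (v j)\<^sup>2 \<le> H j" if "j < N" for j
    proof -
      have "t j \<le> T" unfolding t_def NT[symmetric] using that \<Delta> by (intro mult_right_mono) auto
      moreover have "0 \<le> t j" using \<Delta> by (simp add: t_def)
      moreover have "x j = 1 - t j" by (simp add: x_def t_def)
      ultimately show ?thesis
        using mean_hamiltonian[OF L T \<kappa>, of "t j" j]
        by (simp add: H_def C_def D_def e1_def e2_def e3_def v_def \<mu>_def tj)
    qed
    then have "(\<Sum>j<N. C * e1 j + (D j - \<kappa> * T\<^sup>2) * (v j)\<^sup>2) * \<Delta> \<le> (\<Sum>j<N. H j) * \<Delta>"
      using \<Delta> by (intro mult_right_mono sum_mono) auto
    then show ?thesis by (simp add: sum.distrib distrib_right E_def sum_distrib_left[symmetric])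
  qed
  have "E\<^sup>2 + E * (S N)\<^sup>2 \<le> 3 * E * E"
  proof -
    have "(S N)\<^sup>2 \<le> u\<^sup>2" using S[of N] u by (metis abs_ge_zero order_refl power2_abs power_mono)
    then have "E * (S N)\<^sup>2 \<le> E * (2 * E)" using u E0 by (intro mult_left_mono) auto
    then show ?thesis by (simp add: power2_eq_square)
  qed
  moreover have "\<Delta> * E \<le> (1 / real N) * 2" using DN E2 E0 by (intro mult_mono) auto
  \<comment> \<open>24 from \<open>Q1\<close>, \<open>96 * \<mu>\<close> from \<open>Q2\<close>, and
    36 from \<open>72 * E \<le> 36 * u\<close> make \<open>60 + 96 * \<mu>\<close>.\<close>
  moreover have "24 * (u * E) + 96 * (\<mu> * (u * E)) + 72 * E * E \<le> C * E"
  proof -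
    have "u * u \<le> u * 1" using u by (intro mult_left_mono) auto
    then have "2 * E \<le> u" using u(3) by (simp add: power2_eq_square)
    then have "24 * u + 96 * \<mu> * u + 72 * E \<le> (60 + 96 * \<mu>) * u" by (simp add: algebra_simps)
    also have "\<dots> \<le> C" using small(1) by (simp add: u_def eta)
    finally have "(24 * u + 96 * \<mu> * u + 72 * E) * E \<le> C * E" using E0 by (intro mult_right_mono)
    then show ?thesis by (simp add: algebra_simps)
  qed
  \<comment> \<open>\<open>154 = 30 + 24 + 100\<close>: two mesh errors of \<open>total\<close>, the
    second by \<open>E \<le> 2\<close>, and the one of \<open>Q3\<close>.\<close>
  ultimately show "Re (total_a4 d b c N) \<le> pick_a4 T + 154 / real N"
    using total(2) Q1 Q2 Q3 Q4 DN by (simp add: algebra_simps)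
qed

section \<open>From the discrete estimate to all bounded univalent functions near the Pick
  function\<close>

lemma mult_diff_norm_le:
  fixes a a' b b' :: complex
  assumes "norm (a - a') \<le> e" "norm (b - b') \<le> f" "norm a \<le> A" "norm b' \<le> B"
  shows "norm (a * b - a' * b') \<le> A * f + e * B"
proof -
  have "a * b - a' * b' = a * (b - b') + (a - a') * b'" by (simp add: algebra_simps)
  also have "norm \<dots> \<le> norm a * norm (b - b') + norm (a - a') * norm b'" by (metis norm_mult norm_triangle_ineq)
  also have "\<dots> \<le> A * f + e * B"
    using assms norm_ge_zero[of a] norm_ge_zero[of "a - a'"] by (intro add_mono mult_mono) (auto intro: order_trans[OF norm_ge_zero])
  finally show ?thesis .
qed

text \<open>All partial sums have modulus at most 3, so the cube, the product and the last sum of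
  \<open>total_a4\<close> contribute \<open>27 + 24 + 13 = 64\<close>.\<close>

lemma total_a4_perturb:
  fixes d b c d' b' c' :: "nat \<Rightarrow> complex"
  assumes \<Delta>: "0 \<le> \<Delta>" "real N * \<Delta> \<le> 1" and \<epsilon>: "0 \<le> \<epsilon>"
    and n: "\<And>j. j < N \<Longrightarrow> norm (d j) \<le> 3 * \<Delta>" "\<And>j. j < N \<Longrightarrow> norm (d' j) \<le> 3 * \<Delta>"
      "\<And>j. j < N \<Longrightarrow> norm (b j) \<le> 3 * \<Delta>" "\<And>j. j < N \<Longrightarrow> norm (b' j) \<le> 3 * \<Delta>"
    and e: "\<And>j. j < N \<Longrightarrow> norm (d j - d' j) \<le> \<epsilon> * \<Delta>" "\<And>j. j < N \<Longrightarrow> norm (b j - b' j) \<le> \<epsilon> * \<Delta>"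
      "\<And>j. j < N \<Longrightarrow> norm (c j - c' j) \<le> \<epsilon> * \<Delta>"
  shows "norm ((\<Sum>j<N. d j) - (\<Sum>j<N. d' j)) \<le> \<epsilon>" "norm (total_a4 d b c N - total_a4 d' b' c' N) \<le> 64 * \<epsilon>"
proof -
  have sb: "norm (\<Sum>j<m. f j) \<le> k" if "\<And>j. j < N \<Longrightarrow> norm (f j) \<le> k * \<Delta>" "m \<le> N" "0 \<le> k" for f :: "nat \<Rightarrow> complex" and k m
  proof -
    have "norm (\<Sum>j<m. f j) \<le> (\<Sum>j<m. k * \<Delta>)" by (rule sum_norm_le) (use that in auto)
    also have "\<dots> = k * (real m * \<Delta>)" by simp
    also have "\<dots> \<le> k * (real N * \<Delta>)" using that \<Delta> by (intro mult_left_mono mult_right_mono) auto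
    also have "\<dots> \<le> k * 1" using \<Delta> that by (intro mult_left_mono) auto
    finally show ?thesis by simp
  qed
  define D D' B B' where "D m = (\<Sum>j<m. d j)" and "D' m = (\<Sum>j<m. d' j)" and "B = (\<Sum>j<N. b j)" and "B' = (\<Sum>j<N. b' j)" for m
  have D: "norm (D m) \<le> 3" "norm (D' m) \<le> 3" if "m \<le> N" for m unfolding D_def D'_def using n that by (auto intro!: sb)
  have B: "norm B \<le> 3" "norm B' \<le> 3" unfolding B_def B'_def using n by (auto intro!: sb)
  have DD: "norm (D m - D' m) \<le> \<epsilon>" if "m \<le> N" for m
    unfolding D_def D'_def sum_subtractf[symmetric] by (rule sb) (use e \<epsilon> that in auto)
  have BB: "norm (B - B') \<le> \<epsilon>" unfolding B_def B'_def sum_subtractf[symmetric] by (rule sb) (use e \<epsilon> in auto)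
  show "norm ((\<Sum>j<N. d j) - (\<Sum>j<N. d' j)) \<le> \<epsilon>" using DD[of N] by (simp add: D_def D'_def)
  have sq: "norm (D N * D N - D' N * D' N) \<le> 3 * \<epsilon> + \<epsilon> * 3" using DD[of N] D[of N] by (intro mult_diff_norm_le) auto
  have cb: "norm (D N * (D N * D N) - D' N * (D' N * D' N)) \<le> 3 * (3 * \<epsilon> + \<epsilon> * 3) + \<epsilon> * 9"
  proof (rule mult_diff_norm_le)
    have "norm (D' N) * norm (D' N) \<le> 3 * 3" using D[of N] by (intro mult_mono) auto
    then show "norm (D' N * D' N) \<le> 9" by (simp add: norm_mult)
  qed (use sq DD[of N] D[of N] in auto)
  have db: "norm (D N * B - D' N * B') \<le> 3 * \<epsilon> + \<epsilon> * 3" using DD[of N] D[of N] BB B by (intro mult_diff_norm_le) auto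
  define g where "g i = (c i - 2 * D i * b i) - (c' i - 2 * D' i * b' i)" for i
  have g: "norm (\<Sum>i<N. g i) \<le> 13 * \<epsilon>"
  proof (rule sb)
    fix i assume i: "i < N"
    have "g i = (c i - c' i) - 2 * (D i * b i - D' i * b' i)" by (simp add: g_def algebra_simps)
    then have "norm (g i) \<le> norm (c i - c' i) + norm (2 * (D i * b i - D' i * b' i))" by (metis norm_triangle_ineq4)
    also have "\<dots> = norm (c i - c' i) + 2 * norm (D i * b i - D' i * b' i)" by (simp only: norm_mult norm_numeral)
    also have "norm (D i * b i - D' i * b' i) \<le> 3 * (\<epsilon> * \<Delta>) + \<epsilon> * (3 * \<Delta>)"
      using i DD[of i] D[of i] e n by (intro mult_diff_norm_le) auto
    finally show "norm (g i) \<le> 13 * \<epsilon> * \<Delta>" using e(3)[OF i] by (simp add: mult_ac)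
  qed (use \<epsilon> in auto)
  have "total_a4 d b c N - total_a4 d' b' c' N = (D N * (D N * D N) - D' N * (D' N * D' N)) - 4 * (D N * B - D' N * B') + (\<Sum>i<N. g i)"
    unfolding total_a4_def D_def[symmetric] D'_def[symmetric] B_def[symmetric] B'_def[symmetric] g_def sum_subtractf
    by (simp add: power3_eq_cube algebra_simps)
  also have "norm \<dots> \<le> norm (D N * (D N * D N) - D' N * (D' N * D' N)) + norm (4 * (D N * B - D' N * B')) + norm (\<Sum>i<N. g i)"
    by (rule order_trans[OF norm_triangle_ineq add_right_mono[OF norm_triangle_ineq4]])
  also have "norm (4 * (D N * B - D' N * B')) = 4 * norm (D N * B - D' N * B')" by (simp only: norm_mult norm_numeral)
  also have "norm (D N * (D N * D N) - D' N * (D' N * D' N)) + 4 * norm (D N * B - D' N * B') + norm (\<Sum>i<N. g i)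
      \<le> (3 * (3 * \<epsilon> + \<epsilon> * 3) + \<epsilon> * 9) + 4 * (3 * \<epsilon> + \<epsilon> * 3) + 13 * \<epsilon>"
    using cb db g by (intro add_mono mult_left_mono) auto
  finally show "norm (total_a4 d b c N - total_a4 d' b' c' N) \<le> 64 * \<epsilon>" by simp
qed

lemma taylor_coeff_pick:
  assumes "1 \<le> M"
  shows "taylor_coeff (pick M) 2 = of_real (2 * (1 - 1 / M))" "taylor_coeff (pick M) 4 = of_real (pick_a4 (1 - 1 / M))"
proof -
  have "(\<lambda>z. of_real M * slit_map M z) has_fps_expansion fps_const (of_real M) * fps_expansion (slit_map M) 0"
    by (intro fps_expansion_intros slit_map_coeffs(1) assms)
  then have "taylor_coeff (pick M) n = of_real M * fps_nth (fps_expansion (slit_map M) 0) n" for n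
    unfolding taylor_coeff_def pick_eq_slit_map[abs_def] using fps_nth_fps_expansion by (fastforce simp: fps_expansion_def)
  then show "taylor_coeff (pick M) 2 = of_real (2 * (1 - 1 / M))" "taylor_coeff (pick M) 4 = of_real (pick_a4 (1 - 1 / M))"
    using slit_map_coeffs(4,6)[OF assms] assms by (simp_all add: pick_a4_def)
qed

text \<open>For a fixed \<open>f\<close> the chain can be refined at will, while the deficit
  \<open>\<eta>\<close> stays tied to \<open>Re a_2\<close> up to a mesh error. So the discrete
  estimate applies for all large \<open>N\<close>, and its error disappears in the limit.\<close>

lemma Re_a4_le_pick:
  assumes M: "11 < M" and co: "coercive_at (1 / (1 - 1 / M))"
  obtains \<delta> where "0 < \<delta>"
    "\<And>f. f \<in> bounded_univalent M \<Longrightarrow> 2 * (1 - 1 / M) - \<delta> \<le> Re (taylor_coeff f 2) \<Longrightarrow> Re (taylor_coeff f 4) \<le> pick_a4 (1 - 1 / M)"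
proof -
  define T where "T = 1 - 1 / M"
  have T: "10 / 11 < T" "T < 1" using M by (auto simp: T_def field_simps)
  obtain \<kappa>' where k': "0 < \<kappa>'" "\<And>f. pwc f \<Longrightarrow> \<kappa>' * prim (\<lambda>s. (f s)\<^sup>2) 1 \<le> second_variation (1 / T) f f"
    using co unfolding coercive_at_def T_def by blast
  \<comment> \<open>Lowered so that the weight minus \<open>\<kappa>\<close> stays
    nonnegative.\<close>
  define \<kappa> where "\<kappa> = min \<kappa>' (11 - 10 / T)"
  have \<kappa>: "0 < \<kappa>" "\<kappa> \<le> 11 - 10 / T" using k'(1) T by (auto simp: \<kappa>_def field_simps)
  have coer: "\<kappa> * prim (\<lambda>s. (f s)\<^sup>2) 1 \<le> second_variation (1 / T) f f" if f: "pwc f" for f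
  proof -
    have "\<kappa> * prim (\<lambda>s. (f s)\<^sup>2) 1 \<le> \<kappa>' * prim (\<lambda>s. (f s)\<^sup>2) 1"
      by (intro mult_right_mono prim_nonneg pwc_power2 f) (auto simp: \<kappa>_def)
    then show ?thesis using k'(2)[OF f] by linarith
  qed
  define \<mu> C where "\<mu> = 40 / (\<kappa> * T\<^sup>2)" and "C = min (\<kappa> * T\<^sup>2) (2 * T * (11 * T - 10))"
  have mu: "0 < \<mu>" "0 < C" using \<kappa> T by (auto simp: \<mu>_def C_def)
  define u where "u = min 1 (C / (60 + 96 * \<mu>))"
  have u: "0 < u" "u \<le> 1" "(60 + 96 * \<mu>) * u \<le> C" 
  proof -
    have "u \<le> C / (60 + 96 * \<mu>)" by (simp add: u_def)
    then show "(60 + 96 * \<mu>) * u \<le> C" using mu by (simp add: pos_le_divide_eq mult.commute)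
    have "0 < C / (60 + 96 * \<mu>)" using mu by simp
    then show "0 < u" "u \<le> 1" by (auto simp: u_def)
  qed
  define K where "K = 200 + 4 * M"
  show thesis
  \<comment> \<open>The condition is \<open>2 * \<eta> \<le> u\<^sup>2\<close>; one half of it is
    granted to the distance of \<open>a_2\<close>, the other half to the mesh error.\<close>
  proof (rule that[of "u\<^sup>2 / 2"])
    show "0 < u\<^sup>2 / 2" using u by simp
  next
    fix f assume f: "f \<in> bounded_univalent M" and a2: "2 * (1 - 1 / M) - u\<^sup>2 / 2 \<le> Re (taylor_coeff f 2)"
    have main: "Re (taylor_coeff f 4) \<le> pick_a4 T + (154 + 64 * K) / real N"
      if N: "0 < N" "2 * M \<le> real N" "K \<le> real N" "2 * K / u\<^sup>2 \<le> real N" for N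
    proof -
      define \<Delta> where "\<Delta> = T / real N"
      define x where "x j = 1 - real j * \<Delta>" for j
      have \<Delta>: "0 < \<Delta>" using T N by (simp add: \<Delta>_def)
      have NT: "real N * \<Delta> = T" using N by (simp add: \<Delta>_def)
      have DN: "\<Delta> \<le> 1 / real N" using T N by (simp add: \<Delta>_def divide_right_mono)
      have D2: "\<Delta> \<le> 1 / (2 * M)"
      proof -
        have "1 / real N \<le> 1 / (2 * M)" using N M by (intro divide_left_mono) auto
        then show ?thesis using DN by linarith
      qed
      have x0: "x 0 = 1" by (simp add: x_def)
      have xN: "x N = 1 / M" using NT by (simp add: x_def T_def)
      have xS: "x (Suc j) = x j - \<Delta>" for j by (simp add: x_def algebra_simps)
      have xge: "1 / M \<le> x j" "x j \<le> 1" if "j \<le> N" for j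
      proof -
        have "real j * \<Delta> \<le> real N * \<Delta>" using that \<Delta> by (intro mult_right_mono) auto
        then show "1 / M \<le> x j" "x j \<le> 1" using \<Delta> unfolding NT by (auto simp: x_def T_def)
      qed
      have xpos: "0 < x j" if "j \<le> N" for j using xge[OF that] M by (smt (verit) divide_pos_pos)
      have xstep: "0 < x (Suc j) \<and> x (Suc j) \<le> x j" if "j < N" for j using xpos[of "Suc j"] that \<Delta> xS[of j] by simp
      have F: "(\<lambda>z. f z / of_real M) \<in> disk_maps" "deriv (\<lambda>z. f z / of_real M) 0 = of_real (1 / M)"
        using bounded_univalent_disk_maps[OF f] M by auto
      obtain \<phi> where \<phi>: "\<And>j. j < N \<Longrightarrow> \<phi> j \<in> disk_maps" "\<And>j. j < N \<Longrightarrow> deriv (\<phi> j) 0 = of_real (x (Suc j) / x j)"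
        "\<And>z. z \<in> ball 0 1 \<Longrightarrow> f z / of_real M = chain \<phi> N z"
      proof (rule disk_map_chain[of "\<lambda>z. f z / of_real M" x N, OF F(1) x0])
        show "x N = Re (deriv (\<lambda>z. f z / of_real M) 0)" unfolding F(2) xN by simp
      qed (use xstep that in blast)+
      define P where "P j = fps_expansion (\<phi> j) 0" for j
      define d b c where "d = (\<lambda>j. incr_A (x j) (P j))" and "b = (\<lambda>j. incr_B (x j) (P j))" and "c = (\<lambda>j. incr_R (x j) (P j))"
      have fc: "f z = of_real (1 / x N) * chain \<phi> N z" if "z \<in> ball 0 1" for z
        using \<phi>(3)[OF that] M by (simp add: xN field_simps)
      note tc = taylor_coeff_chain[of f x N \<phi>, OF fc \<phi>(1,2) x0 xpos]
      have coeffs: "taylor_coeff f 2 = (\<Sum>i<N. d i)" "taylor_coeff f 4 = total_a4 d b c N"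
        using tc unfolding d_def b_def c_def P_def by blast+
      have "\<exists>L. mean L \<and>
         norm (d j - of_real (2 * \<Delta>) * Complex (L (\<lambda>t. cos t)) (L (\<lambda>t. sin t))) \<le> K * \<Delta>\<^sup>2 \<and>
         norm (b j - of_real (\<Delta> * x j) * Complex (L (\<lambda>t. cos (2 * t))) (L (\<lambda>t. sin (2 * t)))) \<le> K * \<Delta>\<^sup>2 \<and>
         norm (c j - of_real (2 * \<Delta> * (x j)\<^sup>2) * Complex (L (\<lambda>t. cos (3 * t))) (L (\<lambda>t. sin (3 * t)))) \<le> K * \<Delta>\<^sup>2" if j: "j < N" for j
      proof -
        have xj: "0 < x j" "x j \<le> 1" "1 / M \<le> x j" using j xpos xge by (auto simp: less_imp_le)
        have "deriv (\<phi> j) 0 = of_real (1 - \<Delta> / x j)" using \<phi>(2)[OF j] xj by (simp add: xS diff_divide_distrib)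
        moreover have "\<Delta> \<le> x j / 2" using D2 xj by simp
        moreover have "(200 + 4 / x j) * \<Delta>\<^sup>2 \<le> K * \<Delta>\<^sup>2"
          using xj M by (intro mult_right_mono) (auto simp: K_def field_simps)
        moreover obtain L where "mean L"
          "norm (d j - of_real (2 * \<Delta>) * Complex (L (\<lambda>t. cos t)) (L (\<lambda>t. sin t))) \<le> (200 + 4 / x j) * \<Delta>\<^sup>2"
          "norm (b j - of_real (\<Delta> * x j) * Complex (L (\<lambda>t. cos (2 * t))) (L (\<lambda>t. sin (2 * t)))) \<le> (200 + 4 / x j) * \<Delta>\<^sup>2"
          "norm (c j - of_real (2 * \<Delta> * (x j)\<^sup>2) * Complex (L (\<lambda>t. cos (3 * t))) (L (\<lambda>t. sin (3 * t)))) \<le> (200 + 4 / x j) * \<Delta>\<^sup>2"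
          unfolding d_def b_def c_def P_def by (rule disk_map_step[OF \<phi>(1)[OF j] calculation(1) xj(1,2) \<Delta> calculation(2)])
        ultimately show ?thesis by (intro exI[of _ L]) linarith
      qed
      then obtain L' where L': "\<And>j. j < N \<Longrightarrow> mean (L' j) \<and>
         norm (d j - of_real (2 * \<Delta>) * Complex (L' j (\<lambda>t. cos t)) (L' j (\<lambda>t. sin t))) \<le> K * \<Delta>\<^sup>2 \<and>
         norm (b j - of_real (\<Delta> * x j) * Complex (L' j (\<lambda>t. cos (2 * t))) (L' j (\<lambda>t. sin (2 * t)))) \<le> K * \<Delta>\<^sup>2 \<and>
         norm (c j - of_real (2 * \<Delta> * (x j)\<^sup>2) * Complex (L' j (\<lambda>t. cos (3 * t))) (L' j (\<lambda>t. sin (3 * t)))) \<le> K * \<Delta>\<^sup>2"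
        by metis
      \<comment> \<open>Beyond \<open>N\<close> any mean will do;
        \<open>discrete_sufficiency\<close> asks for one at every index.\<close>
      define L where "L j = (if j < N then L' j else L' 0)" for j
      have L: "mean (L j)" for j using L' N by (auto simp: L_def)
      define d' where "d' = (\<lambda>j. of_real (2 * \<Delta>) * Complex (L j (\<lambda>t. cos t)) (L j (\<lambda>t. sin t)))"
      define b' where "b' = (\<lambda>j. of_real (\<Delta> * x j) * Complex (L j (\<lambda>t. cos (2 * t))) (L j (\<lambda>t. sin (2 * t))))"
      define c' where "c' = (\<lambda>j. of_real (2 * \<Delta> * (x j)\<^sup>2) * Complex (L j (\<lambda>t. cos (3 * t))) (L j (\<lambda>t. sin (3 * t))))"
      define \<epsilon> where "\<epsilon> = K * \<Delta>"
      have K: "0 < K" using M by (simp add: K_def)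
      have eps: "0 \<le> \<epsilon>" "\<epsilon> \<le> K / real N" "\<epsilon> \<le> 1"
      proof -
        show "0 \<le> \<epsilon>" using K \<Delta> by (simp add: \<epsilon>_def)
        show 1: "\<epsilon> \<le> K / real N" using mult_left_mono[OF DN less_imp_le[OF K]] by (simp add: \<epsilon>_def)
        have "K / real N \<le> 1" using N by simp
        then show "\<epsilon> \<le> 1" using 1 by linarith
      qed
      have diff: "norm (d j - d' j) \<le> \<epsilon> * \<Delta>" "norm (b j - b' j) \<le> \<epsilon> * \<Delta>" "norm (c j - c' j) \<le> \<epsilon> * \<Delta>" if "j < N" for j
        using L'[OF that] that by (simp_all add: d'_def b'_def c'_def L_def \<epsilon>_def power2_eq_square mult.assoc)
      have nd: "norm (d' j) \<le> 2 * \<Delta>" "norm (b' j) \<le> \<Delta>" if "j < N" for j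
      proof -
        have "norm (d' j) \<le> (2 * \<Delta>) * 1" unfolding d'_def norm_mult
          using mean_trig_bound[OF L[of j], of 1] \<Delta> by (intro mult_mono) auto
        moreover have "norm (b' j) \<le> (\<Delta> * 1) * 1" unfolding b'_def norm_mult
          using mean_trig_bound[OF L[of j], of 2] \<Delta> xpos[of j] xge[of j] that by (intro mult_mono) (auto simp: norm_mult mult_left_le)
        ultimately show "norm (d' j) \<le> 2 * \<Delta>" "norm (b' j) \<le> \<Delta>" by simp_all
      qed
      have nb: "norm (d j) \<le> 3 * \<Delta>" "norm (d' j) \<le> 3 * \<Delta>" "norm (b j) \<le> 3 * \<Delta>" "norm (b' j) \<le> 3 * \<Delta>" if "j < N" for j
      proof -
        have "\<epsilon> * \<Delta> \<le> 1 * \<Delta>" using eps \<Delta> by (intro mult_right_mono) auto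
        then show "norm (d j) \<le> 3 * \<Delta>" "norm (b j) \<le> 3 * \<Delta>"
          using diff(1,2)[OF that] nd[OF that] norm_triangle_sub[of "d j" "d' j"] norm_triangle_sub[of "b j" "b' j"] \<Delta> by linarith+
        show "norm (d' j) \<le> 3 * \<Delta>" "norm (b' j) \<le> 3 * \<Delta>" using nd[OF that] \<Delta> by linarith+
      qed
      have NT1: "real N * \<Delta> \<le> 1" using NT T by simp
      note pert = total_a4_perturb[of \<Delta> N \<epsilon> d d' b b' c c', OF less_imp_le[OF \<Delta>] NT1 eps(1) nb diff]
      define \<eta> where "\<eta> = T - Re (\<Sum>j<N. d' j) / 2"
      note suff = discrete_sufficiency[OF T \<kappa> coer N(1), of L, OF _ L, folded \<Delta>_def, folded x_def, folded d'_def b'_def c'_def \<mu>_def C_def, folded \<eta>_def]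
      have eta: "0 \<le> \<eta>" using suff(1) by simp
      have "\<bar>Re ((\<Sum>j<N. d j) - (\<Sum>j<N. d' j))\<bar> \<le> \<epsilon>" using pert(1) abs_Re_le_cmod order_trans by blast
      then have "Re (taylor_coeff f 2) \<le> Re (\<Sum>j<N. d' j) + \<epsilon>" unfolding coeffs(1) minus_complex.sel by linarith
      then have "\<eta> \<le> u\<^sup>2 / 4 + K / real N / 2" using a2 eps(2) by (simp add: \<eta>_def T_def)
      also have "K / real N \<le> u\<^sup>2 / 2"
        using N u by (simp add: field_simps)
      finally have "2 * \<eta> \<le> u\<^sup>2" by simp
      then have su: "sqrt (2 * \<eta>) \<le> u" using u by (simp add: real_le_lsqrt)
      have "(60 + 96 * \<mu>) * sqrt (2 * \<eta>) \<le> (60 + 96 * \<mu>) * u" using su mu by (intro mult_left_mono) auto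
      then have "Re (total_a4 d' b' c' N) \<le> pick_a4 T + 154 / real N"
    proof -
      have "sqrt (2 * \<eta>) \<le> 1" using u su by linarith
      moreover have "(60 + 96 * \<mu>) * sqrt (2 * \<eta>) \<le> C" using calculation \<open>(60 + 96 * \<mu>) * sqrt (2 * \<eta>) \<le> (60 + 96 * \<mu>) * u\<close> u(3) by linarith
      ultimately show ?thesis by (intro suff(2))
    qed
      moreover have "\<bar>Re (total_a4 d b c N - total_a4 d' b' c' N)\<bar> \<le> 64 * \<epsilon>" using pert(2) abs_Re_le_cmod order_trans by blast
      ultimately have "Re (taylor_coeff f 4) \<le> pick_a4 T + 154 / real N + 64 * \<epsilon>" unfolding coeffs(2) minus_complex.sel by linarith
      also have "\<dots> \<le> pick_a4 T + 154 / real N + 64 * (K / real N)" using eps(2) by simp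
      finally show ?thesis by (simp add: add_divide_distrib)
    qed
    have "Re (taylor_coeff f 4) \<le> pick_a4 T + 0"
    proof (rule tendsto_lowerbound)
      show "((\<lambda>N. pick_a4 T + (154 + 64 * K) / real N) \<longlongrightarrow> pick_a4 T + 0) sequentially"
        by (intro tendsto_intros lim_const_over_n)
      obtain n0 where n0: "max 1 (max (2 * M) (max K (2 * K / u\<^sup>2))) \<le> real n0" using real_arch_simple by blast
      show "\<forall>\<^sub>F N in sequentially. Re (taylor_coeff f 4) \<le> pick_a4 T + (154 + 64 * K) / real N"
      proof (rule eventually_sequentiallyI[of n0])
        fix N assume "n0 \<le> N"
        then have "real n0 \<le> real N" by simp
        then have N: "max 1 (max (2 * M) (max K (2 * K / u\<^sup>2))) \<le> real N" using n0 by linarith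
        then have "0 < real N" by linarith
        then show "Re (taylor_coeff f 4) \<le> pick_a4 T + (154 + 64 * K) / real N"
          using N by (intro main) auto
      qed
    qed simp
    then show "Re (taylor_coeff f 4) \<le> pick_a4 (1 - 1 / M)" by (simp add: T_def)
  qed
qed

lemma taylor_coeff_2_diff_le:
  assumes f: "f holomorphic_on ball 0 1" and g: "g holomorphic_on ball 0 1" and le: "\<And>z. z \<in> cball 0 (1/2) \<Longrightarrow> norm (f z - g z) \<le> e"
  shows "norm (taylor_coeff f 2 - taylor_coeff g 2) \<le> 4 * e"
proof -
  have fg: "(\<lambda>z. f z - g z) holomorphic_on ball 0 1" by (intro holomorphic_intros f g)
  have "norm ((deriv ^^ 2) (\<lambda>z. f z - g z) 0) \<le> fact 2 * e / (1/2) ^ 2"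
  proof (rule Cauchy_inequality)
    show "(\<lambda>z. f z - g z) holomorphic_on ball 0 (1/2)" by (rule holomorphic_on_subset[OF fg]) auto
    show "continuous_on (cball 0 (1/2)) (\<lambda>z. f z - g z)"
      by (rule continuous_on_subset[OF holomorphic_on_imp_continuous_on[OF fg]]) auto
  qed (use le in auto)
  moreover have "(deriv ^^ 2) (\<lambda>z. f z - g z) 0 = (deriv ^^ 2) f 0 - (deriv ^^ 2) g 0"
    using higher_deriv_diff[OF f g open_ball, of 0 2] by simp
  moreover have "taylor_coeff f 2 - taylor_coeff g 2 = ((deriv ^^ 2) f 0 - (deriv ^^ 2) g 0) / 2"
    by (simp add: taylor_coeff_def fps_expansion_def diff_divide_distrib)
  ultimately have "norm (taylor_coeff f 2 - taylor_coeff g 2) \<le> fact 2 * e / (1/2) ^ 2 / 2" by (simp only: norm_divide norm_numeral divide_right_mono zero_le_numeral)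
  then show ?thesis by (simp add: power2_eq_square)
qed

lemma pick_holomorphic: "1 \<le> M \<Longrightarrow> pick M holomorphic_on ball 0 1"
  unfolding pick_eq_slit_map[abs_def] by (intro holomorphic_intros slit_map_holomorphic)

lemma pick_locally_maximizes:
  assumes M: "11 < M" and co: "coercive_at (1 / (1 - 1 / M))"
  shows "pick_locally_maximizes_Re_a4 M"
proof -
  obtain \<delta> where \<delta>: "0 < \<delta>"
    "\<And>f. f \<in> bounded_univalent M \<Longrightarrow> 2 * (1 - 1 / M) - \<delta> \<le> Re (taylor_coeff f 2) \<Longrightarrow> Re (taylor_coeff f 4) \<le> pick_a4 (1 - 1 / M)"
    using Re_a4_le_pick[OF assms] by blast
  have M1: "1 \<le> M" using M by simp
  have "Re (taylor_coeff f 4) \<le> Re (taylor_coeff (pick M) 4)"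
    if cl: "\<forall>z\<in>cball 0 (1/2). dist (f z) (pick M z) < \<delta> / 4" and f: "f \<in> bounded_univalent M" for f
  proof -
    have "norm (taylor_coeff f 2 - taylor_coeff (pick M) 2) \<le> 4 * (\<delta> / 4)"
      by (rule taylor_coeff_2_diff_le)
         (use f cl M1 in \<open>auto simp: bounded_univalent_def dist_norm less_imp_le intro: pick_holomorphic\<close>)
    then have "\<bar>Re (taylor_coeff f 2 - taylor_coeff (pick M) 2)\<bar> \<le> \<delta>" using abs_Re_le_cmod order_trans by fastforce
    then show ?thesis using \<delta>(2)[OF f] unfolding taylor_coeff_pick[OF M1] by simp
  qed
  moreover have "cball 0 (1/2) \<subseteq> ball (0::complex) 1" by auto
  ultimately show ?thesis
    unfolding pick_locally_maximizes_Re_a4_def eventually_locally_uniform_nhds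
    using \<delta>(1) by (intro exI[of _ "cball 0 (1/2)"] exI[of _ "\<delta> / 4"]) auto
qed

section \<open>Compositions of rotated slit maps\<close>

definition rot_slit :: "real \<Rightarrow> real \<Rightarrow> complex \<Rightarrow> complex" where
  "rot_slit \<theta> \<rho> w = cis (- \<theta>) * slit_map \<rho> (cis \<theta> * w)"

lemma rot_slit_derivs:
  assumes \<rho>: "1 \<le> \<rho>"
  shows "rot_slit \<theta> \<rho> holomorphic_on ball 0 1"
    "fps_nth (fps_expansion (rot_slit \<theta> \<rho>) 0) n = cis (- \<theta>) * cis \<theta> ^ n * fps_nth (fps_expansion (slit_map \<rho>) 0) n"
proof -
  have im: "cis \<theta> * w \<in> ball 0 1" if "w \<in> ball 0 1" for w using that by (simp add: norm_mult)
  have h: "(\<lambda>w. slit_map \<rho> (cis \<theta> * w)) holomorphic_on ball 0 1"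
    using holomorphic_on_compose_gen[of "\<lambda>w. cis \<theta> * w" "ball 0 1" "slit_map \<rho>" "ball 0 1"] slit_map_holomorphic[OF \<rho>] im
    by (auto simp: comp_def image_subset_iff intro!: holomorphic_intros simp del: mem_ball)
  then show "rot_slit \<theta> \<rho> holomorphic_on ball 0 1"
    unfolding rot_slit_def[abs_def] by (intro holomorphic_intros)
  have "(deriv ^^ n) (rot_slit \<theta> \<rho>) 0 = cis (- \<theta>) * (deriv ^^ n) (\<lambda>w. slit_map \<rho> (cis \<theta> * w)) 0"
    unfolding rot_slit_def[abs_def] by (rule higher_deriv_cmult[OF h]) auto
  also have "(deriv ^^ n) (\<lambda>w. slit_map \<rho> (cis \<theta> * w)) 0 = cis \<theta> ^ n * (deriv ^^ n) (slit_map \<rho>) (cis \<theta> * 0)"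
    by (rule higher_deriv_compose_linear[OF slit_map_holomorphic[OF \<rho>], where S = "ball 0 1"]) (use im in \<open>auto simp del: mem_ball\<close>)
  finally show "fps_nth (fps_expansion (rot_slit \<theta> \<rho>) 0) n = cis (- \<theta>) * cis \<theta> ^ n * fps_nth (fps_expansion (slit_map \<rho>) 0) n"
    by (simp add: fps_expansion_def)
qed

lemma rot_slit_disk_maps:
  assumes \<rho>: "1 \<le> \<rho>"
  shows "rot_slit \<theta> \<rho> \<in> disk_maps" "deriv (rot_slit \<theta> \<rho>) 0 = of_real (1 / \<rho>)"
proof -
  have "deriv (rot_slit \<theta> \<rho>) 0 = fps_nth (fps_expansion (rot_slit \<theta> \<rho>) 0) 1" by (simp add: fps_expansion_def)
  also have "\<dots> = cis (- \<theta>) * cis \<theta> ^ 1 * of_real (1 / \<rho>)"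
    unfolding rot_slit_derivs(2)[OF \<rho>] slit_map_coeffs(3)[OF \<rho>] ..
  also have "\<dots> = of_real (1 / \<rho>)" by (simp add: cis_mult)
  finally show d: "deriv (rot_slit \<theta> \<rho>) 0 = of_real (1 / \<rho>)" .
  note S = disk_mapsD[OF slit_map_disk_maps(1)[OF \<rho>]]
  have im: "cis \<theta> * w \<in> ball 0 1" if "w \<in> ball 0 1" for w using that by (simp add: norm_mult)
  show "rot_slit \<theta> \<rho> \<in> disk_maps"
  proof (rule disk_mapsI[OF rot_slit_derivs(1)[OF \<rho>] _ _ _ d])
    show "inj_on (rot_slit \<theta> \<rho>) (ball 0 1)"
    proof (rule inj_onI)
      fix z w :: complex assume z: "z \<in> ball 0 1" and w: "w \<in> ball 0 1" and eq: "rot_slit \<theta> \<rho> z = rot_slit \<theta> \<rho> w"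
      then have "slit_map \<rho> (cis \<theta> * z) = slit_map \<rho> (cis \<theta> * w)" by (simp add: rot_slit_def)
      then show "z = w" using inj_onD[OF S(2) _ im[OF z] im[OF w]] by simp
    qed
    show "rot_slit \<theta> \<rho> z \<in> ball 0 1" if "z \<in> ball 0 1" for z
      using S(3)[OF im[OF that]] by (simp add: rot_slit_def norm_mult)
    show "rot_slit \<theta> \<rho> 0 = 0" by (simp add: rot_slit_def slit_map_0[OF \<rho>])
  qed (use \<rho> in auto)
qed

text \<open>A rotated slit map drives the chain by the point mass at \<open>\<theta>\<close> during
  the whole passage from \<open>x\<close> to \<open>x'\<close>, so its increments are exact and free
  of the error of \<open>disk_map_step\<close>.\<close>

lemma rot_slit_incr:
  fixes x x' \<theta> :: real
  assumes x: "0 < x'" "x' \<le> x"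
  defines "P \<equiv> fps_expansion (rot_slit \<theta> (x / x')) 0"
  shows "incr_A x P = of_real (2 * (x - x')) * cis \<theta>" "incr_B x P = of_real ((x\<^sup>2 - x'\<^sup>2) / 2) * cis (2 * \<theta>)"
    "incr_R x P = of_real (2 * (x - x') * x'\<^sup>2) * cis (3 * \<theta>)"
proof -
  define \<rho> \<tau> e where "\<rho> = x / x'" and "\<tau> = 1 - 1 / \<rho>" and "e = cis \<theta>"
  have \<rho>: "1 \<le> \<rho>" using x by (simp add: \<rho>_def)
  have e: "cis (- \<theta>) * e = 1" by (simp add: e_def cis_mult)
  have r0: "of_real \<rho> \<noteq> (0::complex)" using \<rho> by simp
  note Q = slit_map_coeffs[OF \<rho>, folded \<tau>_def]
  have P: "fps_nth P n = cis (- \<theta>) * e ^ n * fps_nth (fps_expansion (slit_map \<rho>) 0) n" for n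
    unfolding P_def \<rho>_def[symmetric] e_def by (rule rot_slit_derivs(2)[OF \<rho>])
  have P1: "fps_nth P 1 = of_real (1 / \<rho>)" unfolding P Q(3) using e by simp
  have "cis (- \<theta>) * e ^ 2 = (cis (- \<theta>) * e) * e" "cis (- \<theta>) * e ^ 3 = (cis (- \<theta>) * e) * e ^ 2" "cis (- \<theta>) * e ^ 4 = (cis (- \<theta>) * e) * e ^ 3"
    by (simp_all add: power2_eq_square power3_eq_cube power4_eq_xxxx)
  then have R: "fps_nth P 2 / fps_nth P 1 = e * of_real (2 * \<tau>)" "fps_nth P 3 / fps_nth P 1 = e\<^sup>2 * of_real (5 * \<tau>\<^sup>2 - 2 * \<tau>)"
    "fps_nth P 4 / fps_nth P 1 = e ^ 3 * of_real (14 * \<tau> ^ 3 - 12 * \<tau>\<^sup>2 + 2 * \<tau>)"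
    unfolding P1 unfolding P Q(4-6) e using r0 by (simp_all add: field_simps)
  have e2: "cis (2 * \<theta>) = e\<^sup>2" "cis (3 * \<theta>) = e ^ 3" by (simp_all add: e_def Complex.DeMoivre)
  define c :: complex where "c = of_real x"
  define t :: complex where "t = of_real \<tau>"
  have x': "x' = x * (1 - \<tau>)" using x by (simp add: \<tau>_def \<rho>_def)
  have A: "incr_A x P = c * (e * (2 * t))" unfolding incr_A_def R c_def t_def by simp
  show "incr_A x P = of_real (2 * (x - x')) * cis \<theta>"
    unfolding A x' e_def[symmetric] c_def t_def by (simp add: algebra_simps)
  have B: "incr_B x P = c\<^sup>2 * ((e * (2 * t))\<^sup>2 - e\<^sup>2 * (5 * t\<^sup>2 - 2 * t)) / 2"
    unfolding incr_B_def R c_def t_def by simp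
  show "incr_B x P = of_real ((x\<^sup>2 - x'\<^sup>2) / 2) * cis (2 * \<theta>)"
    unfolding B x' e2 c_def t_def by (simp add: power2_eq_square algebra_simps)
  have half: "4 * a * (b / 2) = 2 * a * b" for a b :: complex by simp
  have "incr_R x P = c ^ 3 * (e ^ 3 * (14 * t ^ 3 - 12 * t\<^sup>2 + 2 * t)) - (c * (e * (2 * t))) ^ 3
      + 2 * (c * (e * (2 * t))) * (c\<^sup>2 * ((e * (2 * t))\<^sup>2 - e\<^sup>2 * (5 * t\<^sup>2 - 2 * t)))"
    unfolding incr_R_def A B R half by (simp add: c_def t_def)
  then show "incr_R x P = of_real (2 * (x - x') * x'\<^sup>2) * cis (3 * \<theta>)"
    unfolding x' e2 c_def t_def by (simp add: power2_eq_square power3_eq_cube algebra_simps)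
qed

definition slit_total :: "(nat \<Rightarrow> real) \<Rightarrow> (nat \<Rightarrow> real) \<Rightarrow> nat \<Rightarrow> complex" where
  "slit_total x \<theta> N = total_a4 (\<lambda>j. of_real (2 * (x j - x (Suc j))) * cis (\<theta> j))
     (\<lambda>j. of_real (((x j)\<^sup>2 - (x (Suc j))\<^sup>2) / 2) * cis (2 * \<theta> j))
     (\<lambda>j. of_real (2 * (x j - x (Suc j)) * (x (Suc j))\<^sup>2) * cis (3 * \<theta> j)) N"

abbreviation slit_chain :: "(nat \<Rightarrow> real) \<Rightarrow> (nat \<Rightarrow> real) \<Rightarrow> nat \<Rightarrow> complex \<Rightarrow> complex" where
  "slit_chain x \<theta> \<equiv> chain (\<lambda>j. rot_slit (\<theta> j) (x j / x (Suc j)))"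

lemma total_a4_cong:
  assumes "\<And>j. j < n \<Longrightarrow> d j = d' j" "\<And>j. j < n \<Longrightarrow> b j = b' j" "\<And>j. j < n \<Longrightarrow> c j = c' j"
  shows "total_a4 d b c n = total_a4 d' b' c' n"
proof -
  have "(\<Sum>j<i. d j) = (\<Sum>j<i. d' j)" if "i \<le> n" for i using assms(1) that by (intro sum.cong) auto
  then show ?thesis unfolding total_a4_def using assms(2,3) by simp
qed

context
  fixes x \<theta> :: "nat \<Rightarrow> real" and N :: nat
  assumes x: "x 0 = 1" "\<And>j. j < N \<Longrightarrow> 0 < x (Suc j) \<and> x (Suc j) \<le> x j"
begin

lemma slit_times_pos: "j \<le> N \<Longrightarrow> 0 < x j"
  using x by (cases j) auto

lemma slit_ratio: "j < N \<Longrightarrow> 1 \<le> x j / x (Suc j)"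
  using x by simp

lemma slit_times_le_1: "n \<le> N \<Longrightarrow> x n \<le> 1"
  by (induction n) (use x in \<open>auto simp: Suc_le_eq intro: order_trans less_imp_le\<close>)

lemma slit_chain_disk_maps:
  "n \<le> N \<Longrightarrow> slit_chain x \<theta> n \<in> disk_maps \<and> deriv (slit_chain x \<theta> n) 0 = of_real (x n)"
proof (induction n)
  case 0
  then show ?case using disk_maps_id x(1) by simp
next
  case (Suc n)
  define \<rho> where "\<rho> = x n / x (Suc n)"
  have \<rho>: "1 \<le> \<rho>" using slit_ratio Suc.prems by (simp add: \<rho>_def)
  have IH: "slit_chain x \<theta> n \<in> disk_maps" "deriv (slit_chain x \<theta> n) 0 = of_real (x n)" using Suc by auto
  have ch: "slit_chain x \<theta> (Suc n) = rot_slit (\<theta> n) \<rho> \<circ> slit_chain x \<theta> n" by (simp add: comp_def \<rho>_def)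
  have "deriv (slit_chain x \<theta> (Suc n)) 0 = of_real (1 / \<rho> * x n)"
    unfolding ch disk_maps_comp(2)[OF rot_slit_disk_maps(1)[OF \<rho>] IH(1)] rot_slit_disk_maps(2)[OF \<rho>] IH(2) of_real_mult ..
  also have "1 / \<rho> * x n = x (Suc n)" using slit_times_pos[of n] Suc.prems by (simp add: \<rho>_def)
  finally show ?case using disk_maps_comp(1)[OF rot_slit_disk_maps(1)[OF \<rho>] IH(1)] unfolding ch by blast
qed

lemma slit_chain_bounded_univalent:
  assumes "x N = 1 / M" "1 \<le> M"
  shows "(\<lambda>z. of_real M * slit_chain x \<theta> N z) \<in> bounded_univalent M"
  using slit_chain_disk_maps[of N] assms by (intro disk_maps_bounded_univalent) auto

lemma taylor_coeff_slit_chain: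
  assumes M: "x N = 1 / M" "1 \<le> M" and f: "\<And>z. z \<in> ball 0 1 \<Longrightarrow> f z = of_real M * slit_chain x \<theta> N z"
  shows "taylor_coeff f 4 = slit_total x \<theta> N"
proof -
  have "f z = of_real (1 / x N) * slit_chain x \<theta> N z" if "z \<in> ball 0 1" for z using f[OF that] M by simp
  then have "taylor_coeff f 4 = total_a4 (\<lambda>j. incr_A (x j) (fps_expansion (rot_slit (\<theta> j) (x j / x (Suc j))) 0))
     (\<lambda>j. incr_B (x j) (fps_expansion (rot_slit (\<theta> j) (x j / x (Suc j))) 0))
     (\<lambda>j. incr_R (x j) (fps_expansion (rot_slit (\<theta> j) (x j / x (Suc j))) 0)) N"
    by (rule taylor_coeff_chain(2)) (use rot_slit_disk_maps[OF slit_ratio] slit_times_pos x(1) in auto)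
  also have "\<dots> = slit_total x \<theta> N"
    unfolding slit_total_def by (rule total_a4_cong) (use rot_slit_incr x(2) in blast)+
  finally show ?thesis .
qed

text \<open>Unrotated slit maps compose by the semigroup law, and a rotated one is trivial here, so
  the chain collapses to a single slit map. At parameter 0 of a family this identifies the Pick
  function.\<close>

lemma slit_chain_aligned:
  assumes al: "\<And>j. j < N \<Longrightarrow> \<theta> j = 0 \<or> x (Suc j) = x j" and z: "z \<in> ball 0 1"
  shows "n \<le> N \<Longrightarrow> slit_chain x \<theta> n z = slit_map (1 / x n) z"
proof (induction n)
  case 0
  then show ?case using slit_map_1[OF z] x(1) by simp
next
  case (Suc n)
  have IH: "slit_chain x \<theta> n z = slit_map (1 / x n) z" and n: "n < N" using Suc by auto
  have pos: "0 < x n" "0 < x (Suc n)" using slit_times_pos n by auto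
  have \<rho>: "1 \<le> 1 / x n" using slit_times_le_1[of n] n pos by simp
  have "rot_slit (\<theta> n) (x n / x (Suc n)) w = slit_map (x n / x (Suc n)) w" if "w \<in> ball 0 1" for w
  proof (cases "\<theta> n = 0")
    case False
    then have 1: "x n / x (Suc n) = 1" using al[OF n] pos by simp
    have "cis (\<theta> n) * w \<in> ball 0 1" using that by (simp add: norm_mult)
    then show ?thesis unfolding 1 rot_slit_def slit_map_1[OF that] using slit_map_1[of "cis (\<theta> n) * w"]
      by (simp add: cis_mult flip: mult.assoc)
  qed (simp add: rot_slit_def)
  then have "slit_chain x \<theta> (Suc n) z = slit_map (x n / x (Suc n)) (slit_map (1 / x n) z)"
    using IH slit_map(1)[OF \<rho> z] by simp
  also have "\<dots> = slit_map (x n / x (Suc n) * (1 / x n)) z" by (rule slit_map_comp[OF slit_ratio[OF n] \<rho> z])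
  also have "x n / x (Suc n) * (1 / x n) = 1 / x (Suc n)" using pos by simp
  finally show ?case .
qed

end

lemma continuous_on_slit_chain:
  fixes x \<theta> :: "real \<Rightarrow> nat \<Rightarrow> real"
  assumes x: "\<And>\<epsilon>. \<epsilon> \<in> {0..1} \<Longrightarrow> x \<epsilon> 0 = 1" "\<And>\<epsilon> j. \<epsilon> \<in> {0..1} \<Longrightarrow> j < N \<Longrightarrow> 0 < x \<epsilon> (Suc j) \<and> x \<epsilon> (Suc j) \<le> x \<epsilon> j"
    and cont: "\<And>j. continuous_on {0..1} (\<lambda>\<epsilon>. x \<epsilon> j)" "\<And>j. continuous_on {0..1} (\<lambda>\<epsilon>. \<theta> \<epsilon> j)"
  shows "n \<le> N \<Longrightarrow> continuous_on ({0..1} \<times> ball 0 1) (\<lambda>p. slit_chain (x (fst p)) (\<theta> (fst p)) n (snd p))"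
proof (induction n)
  case 0
  then show ?case by (simp add: continuous_on_snd)
next
  case (Suc n)
  have IH: "continuous_on ({0..1} \<times> ball 0 1) (\<lambda>p. slit_chain (x (fst p)) (\<theta> (fst p)) n (snd p))" using Suc by simp
  have in_disk: "slit_chain (x (fst p)) (\<theta> (fst p)) n (snd p) \<in> ball 0 1" if "p \<in> {0..1} \<times> ball 0 1" for p
  proof -
    have "slit_chain (x (fst p)) (\<theta> (fst p)) n \<in> disk_maps"
      using slit_chain_disk_maps[of "x (fst p)" N n "\<theta> (fst p)"] x that Suc.prems by auto
    then show ?thesis using disk_mapsD(3) that by auto
  qed
  have cx: "continuous_on ({0..1} \<times> ball 0 1) (\<lambda>p::real \<times> complex. x (fst p) j)"
    and ct: "continuous_on ({0..1} \<times> ball 0 1) (\<lambda>p::real \<times> complex. \<theta> (fst p) j)" for j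
    by (rule continuous_on_compose2[OF cont(1) continuous_on_fst[OF continuous_on_id]], force)
       (rule continuous_on_compose2[OF cont(2) continuous_on_fst[OF continuous_on_id]], force)
  have pos: "x (fst p) (Suc n) \<noteq> 0" if "p \<in> {0..1} \<times> ball (0::complex) 1" for p
    using x(2)[of "fst p" n] that Suc.prems by auto
  have cc: "continuous_on ({0..1} \<times> ball 0 1) (\<lambda>p::real \<times> complex. cis (\<theta> (fst p) n))" "continuous_on ({0..1} \<times> ball 0 1) (\<lambda>p::real \<times> complex. cis (- \<theta> (fst p) n))"
    using ct[of n] by (auto intro!: continuous_on_cis continuous_on_minus)
  have "continuous_on ({0..1} \<times> ball 0 1) (\<lambda>p. (\<lambda>(\<rho>, z). slit_map \<rho> z)
      (x (fst p) n / x (fst p) (Suc n), cis (\<theta> (fst p) n) * slit_chain (x (fst p)) (\<theta> (fst p)) n (snd p)))"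
  proof (rule continuous_on_compose2[OF continuous_on_slit_map])
    show "continuous_on ({0..1} \<times> ball 0 1) (\<lambda>p.
      (x (fst p) n / x (fst p) (Suc n), cis (\<theta> (fst p) n) * slit_chain (x (fst p)) (\<theta> (fst p)) n (snd p)))"
      using pos by (intro continuous_on_Pair continuous_on_divide continuous_on_mult cx cc IH) blast
    show "(\<lambda>p. (x (fst p) n / x (fst p) (Suc n), cis (\<theta> (fst p) n) * slit_chain (x (fst p)) (\<theta> (fst p)) n (snd p))) ` ({0..1} \<times> ball 0 1)
        \<subseteq> {1..} \<times> ball 0 1"
    proof (rule image_subsetI)
      fix p :: "real \<times> complex" assume p: "p \<in> {0..1} \<times> ball 0 1"
      have "1 \<le> x (fst p) n / x (fst p) (Suc n)" using x(2)[of "fst p" n] p Suc.prems by auto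
      moreover have "cis (\<theta> (fst p) n) * slit_chain (x (fst p)) (\<theta> (fst p)) n (snd p) \<in> ball 0 1"
        using in_disk[OF p] by (simp add: norm_mult)
      ultimately show "(x (fst p) n / x (fst p) (Suc n), cis (\<theta> (fst p) n) * slit_chain (x (fst p)) (\<theta> (fst p)) n (snd p)) \<in> {1..} \<times> ball 0 1"
        by blast
    qed
  qed
  then have "continuous_on ({0..1} \<times> ball 0 1) (\<lambda>p. cis (- \<theta> (fst p) n) * slit_map (x (fst p) n / x (fst p) (Suc n))
      (cis (\<theta> (fst p) n) * slit_chain (x (fst p)) (\<theta> (fst p)) n (snd p)))"
    by (intro continuous_on_mult cc) simp
  moreover have "slit_chain X \<Theta> (Suc n) w = cis (- \<Theta> n) * slit_map (X n / X (Suc n)) (cis (\<Theta> n) * slit_chain X \<Theta> n w)" for X \<Theta> w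
    by (simp add: rot_slit_def[of "\<Theta> n"])
  ultimately show ?case by (simp only:)
qed

text \<open>At parameter 0 the family is the Pick function, and joint continuity is uniform over a
  compact set of points. So every neighbourhood contains all members with small parameter, among
  which \<open>gt\<close> supplies one with a larger coefficient.\<close>

lemma not_pick_locally_maximizes:
  fixes x \<theta> :: "real \<Rightarrow> nat \<Rightarrow> real"
  assumes M: "1 \<le> M"
    and x: "\<And>\<epsilon>. \<epsilon> \<in> {0..1} \<Longrightarrow> x \<epsilon> 0 = 1" "\<And>\<epsilon> j. \<epsilon> \<in> {0..1} \<Longrightarrow> j < N \<Longrightarrow> 0 < x \<epsilon> (Suc j) \<and> x \<epsilon> (Suc j) \<le> x \<epsilon> j"
      "\<And>\<epsilon>. \<epsilon> \<in> {0..1} \<Longrightarrow> x \<epsilon> N = 1 / M"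
    and cont: "\<And>j. continuous_on {0..1} (\<lambda>\<epsilon>. x \<epsilon> j)" "\<And>j. continuous_on {0..1} (\<lambda>\<epsilon>. \<theta> \<epsilon> j)"
    and al: "\<And>j. j < N \<Longrightarrow> \<theta> 0 j = 0 \<or> x 0 (Suc j) = x 0 j"
    and gt: "\<And>\<delta>. 0 < \<delta> \<Longrightarrow> \<exists>\<epsilon>. 0 < \<epsilon> \<and> \<epsilon> < \<delta> \<and> \<epsilon> \<le> 1 \<and> Re (slit_total (x 0) (\<theta> 0) N) < Re (slit_total (x \<epsilon>) (\<theta> \<epsilon>) N)"
  shows "\<not> pick_locally_maximizes_Re_a4 M"
proof
  define g where "g p = slit_chain (x (fst p)) (\<theta> (fst p)) N (snd p)" for p
  assume "pick_locally_maximizes_Re_a4 M"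
  then obtain C e where C: "compact C" "C \<subseteq> ball 0 1" "0 < e"
    and max: "\<And>f. \<forall>z\<in>C. dist (f z) (pick M z) < e \<Longrightarrow> f \<in> bounded_univalent M \<Longrightarrow> Re (taylor_coeff f 4) \<le> Re (taylor_coeff (pick M) 4)"
    unfolding pick_locally_maximizes_Re_a4_def eventually_locally_uniform_nhds by blast
  have 0: "(0::real) \<in> {0..1}" by simp
  have p: "pick M z = of_real M * g (0, z)" if "z \<in> ball 0 1" for z
    using slit_chain_aligned[of "x 0" N "\<theta> 0" z N, OF x(1)[OF 0] x(2)[OF 0] al that] x(3)[OF 0] by (simp add: g_def pick_eq_slit_map)
  have p4: "taylor_coeff (pick M) 4 = slit_total (x 0) (\<theta> 0) N"
    by (rule taylor_coeff_slit_chain[OF x(1)[OF 0] x(2)[OF 0] x(3)[OF 0] M]) (use p in \<open>auto simp: g_def\<close>)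
  have "continuous_on ({0..1} \<times> C) g"
    unfolding g_def by (rule continuous_on_subset[OF continuous_on_slit_chain[OF x(1,2) cont order_refl]]) (use C in auto)
  then have uc: "uniformly_continuous_on ({0..1} \<times> C) g"
    by (rule compact_uniformly_continuous) (intro compact_Times C compact_Icc)
  have eM: "0 < e / M" using C(3) M by simp
  obtain d where d: "0 < d" "\<And>p q. p \<in> {0..1} \<times> C \<Longrightarrow> q \<in> {0..1} \<times> C \<Longrightarrow> dist q p < d \<Longrightarrow> dist (g q) (g p) < e / M"
    by (rule uniformly_continuous_onE[OF uc eM]) blast
  obtain \<epsilon> where \<epsilon>: "0 < \<epsilon>" "\<epsilon> < d" "\<epsilon> \<le> 1" and gt': "Re (slit_total (x 0) (\<theta> 0) N) < Re (slit_total (x \<epsilon>) (\<theta> \<epsilon>) N)"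
    using gt[OF d(1)] by blast
  have e01: "\<epsilon> \<in> {0..1}" using \<epsilon> by simp
  define f where "f z = of_real M * slit_chain (x \<epsilon>) (\<theta> \<epsilon>) N z" for z
  have "f \<in> bounded_univalent M"
    unfolding f_def by (rule slit_chain_bounded_univalent[OF x(1)[OF e01] x(2)[OF e01] x(3)[OF e01] M])
  moreover have "taylor_coeff f 4 = slit_total (x \<epsilon>) (\<theta> \<epsilon>) N"
    by (rule taylor_coeff_slit_chain[OF x(1)[OF e01] x(2)[OF e01] x(3)[OF e01] M]) (auto simp: f_def)
  moreover have "\<forall>z\<in>C. dist (f z) (pick M z) < e"
  proof
    fix z assume z: "z \<in> C"
    have "dist (g (\<epsilon>, z)) (g (0, z)) < e / M"
      by (rule d(2)) (use z \<epsilon> in \<open>auto simp: dist_Pair_Pair\<close>)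
    then have "M * dist (g (\<epsilon>, z)) (g (0, z)) < e" using M by (simp add: field_simps)
    moreover have "f z - pick M z = of_real M * (g (\<epsilon>, z) - g (0, z))"
      using p[of z] z C(2) by (auto simp: f_def g_def algebra_simps)
    ultimately show "dist (f z) (pick M z) < e" using M by (simp add: dist_norm norm_mult)
  qed
  ultimately show False using max[of f] p4 gt' by simp
qed

text \<open>A short first slit at the angle \<open>\<phi>\<close> with \<open>cos \<phi> = T - 1/2\<close>, where the Hamiltonian at time \<open>0\<close>
  is minimal, changes \<open>Re a\<^sub>4\<close> at the rate \<open>(1 - cos \<phi>) * 2 * T * (10 - 11 * T)\<close>.\<close>

lemma not_pick_locally_maximizes_less_11:
  assumes M: "1 < M" "M < 11"
  shows "\<not> pick_locally_maximizes_Re_a4 M"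
proof -
  define T where "T = 1 - 1 / M"
  have T: "0 < T" "T < 10 / 11" using M by (auto simp: T_def field_simps)
  \<comment> \<open>At time 0 the excess is \<open>1 - y\<close> times
    \<open>2 * (2 * y + 1 - 2 * T)\<^sup>2 + 2 * T * (11 * T - 10)\<close>; this \<open>y\<close>
    makes the square vanish.\<close>
  define y where "y = T - 1 / 2"
  define \<phi> where "\<phi> = arccos y"
  have cy: "cos \<phi> = y" unfolding \<phi>_def by (rule cos_arccos) (use T in \<open>auto simp: y_def\<close>)
  define x where "x = (\<lambda>\<epsilon> j::nat. if j = 0 then 1 else if j = 1 then 1 - T * \<epsilon> else 1 / M)"
  define \<theta> where "\<theta> = (\<lambda>(\<epsilon>::real) j::nat. if j = 0 then \<phi> else 0)"
  \<comment> \<open>\<open>slit_total\<close> of the two slits as a polynomial in the length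
    \<open>w\<close> of the first one; \<open>l\<close> will be its derivative at 0.\<close>
  define P where "P w = (2 * (cis \<phi> * w + of_real T - w)) ^ 3
     - 4 * (2 * (cis \<phi> * w + of_real T - w)) * ((1 - (1 - w)\<^sup>2) / 2 * cis (2 * \<phi>) + ((1 - w)\<^sup>2 - (1 - of_real T)\<^sup>2) / 2)
     + (2 * w * (1 - w)\<^sup>2 * cis (3 * \<phi>) + 2 * (of_real T - w) * (1 - of_real T)\<^sup>2 - 2 * (2 * w * cis \<phi>) * (((1 - w)\<^sup>2 - (1 - of_real T)\<^sup>2) / 2))"
    for w :: complex
  define l :: complex where "l = 3 * (2 * of_real T)\<^sup>2 * (2 * (cis \<phi> - 1))
     - 2 * (2 * (cis \<phi> - 1) * (1 - (1 - of_real T)\<^sup>2) + 4 * of_real T * (cis (2 * \<phi>) - 1))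
     + (2 * cis (3 * \<phi>) - 2 * (1 - of_real T)\<^sup>2 - 2 * cis \<phi> * (1 - (1 - of_real T)\<^sup>2))"
  have half: "4 * a * (b / 2 * e + c / 2) = 2 * a * (b * e + c)" "2 * a * (c / 2) = a * c" for a b c e :: complex
    by (simp_all add: algebra_simps)
  have "(P has_field_derivative l) (at (of_real 0))"
    unfolding P_def[abs_def] half l_def by (auto intro!: derivative_eq_intros) (simp add: power2_eq_square power3_eq_cube algebra_simps)
  then have "((\<lambda>h. P (of_real h)) has_vector_derivative l) (at 0)" by (rule has_vector_derivative_real_field)
  then have der: "((\<lambda>h. Re (P (of_real h))) has_real_derivative Re l) (at 0)" by (rule has_field_derivative_Re)
  have "Re l = - (1 - y) * (2 * T * (11 * T - 10))"
  proof -
    have Re_mult: "Re (of_real a * z) = a * Re z" for a z by simp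
    have "Re (cis (2 * \<phi>)) = 2 * y\<^sup>2 - 1" "Re (cis (3 * \<phi>)) = 4 * y ^ 3 - 3 * y" "Re (cis \<phi>) = y"
      using cos_double_cos[of \<phi>] cos_treble_cos[of \<phi>] cy by simp_all
    moreover have "l = of_real (24 * T\<^sup>2 - 4 * (2 * T - T\<^sup>2) - 2 * (2 * T - T\<^sup>2)) * cis \<phi> - of_real (8 * T) * cis (2 * \<phi>) + of_real 2 * cis (3 * \<phi>)
        + of_real (- 24 * T\<^sup>2 + 4 * (2 * T - T\<^sup>2) + 8 * T - 2 * (1 - T)\<^sup>2)"
      unfolding l_def by (simp add: power2_eq_square algebra_simps)
    ultimately have "Re l = (24 * T\<^sup>2 - 4 * (2 * T - T\<^sup>2) - 2 * (2 * T - T\<^sup>2)) * y - (8 * T) * (2 * y\<^sup>2 - 1) + 2 * (4 * y ^ 3 - 3 * y)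
        + (- 24 * T\<^sup>2 + 4 * (2 * T - T\<^sup>2) + 8 * T - 2 * (1 - T)\<^sup>2)"
      by (simp only: Re_complex_of_real plus_complex.sel minus_complex.sel Re_mult)
    then show ?thesis unfolding y_def by (simp add: power2_eq_square power3_eq_cube field_simps)
  qed
  moreover have "0 < (1 - y) * (2 * T * (10 - 11 * T))" using T by (intro mult_pos_pos) (auto simp: y_def)
  ultimately have "0 < Re l" by (simp add: algebra_simps)
  then obtain d where d: "0 < d" "\<And>h. 0 < h \<Longrightarrow> h < d \<Longrightarrow> Re (P (of_real 0)) < Re (P (of_real h))"
    using DERIV_pos_inc_right[OF der] by auto
  have xM: "1 / M = 1 - T" by (simp add: T_def)
  have tot: "slit_total (x \<epsilon>) (\<theta> \<epsilon>) 2 = P (of_real (T * \<epsilon>))" for \<epsilon>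
    unfolding slit_total_def total_a4_def P_def x_def \<theta>_def xM
    by (simp add: numeral_2_eq_2 lessThan_Suc del: One_nat_def) (simp add: algebra_simps)
  show ?thesis
  proof (rule not_pick_locally_maximizes[where x = x and \<theta> = \<theta> and N = 2])
    show "0 < x \<epsilon> (Suc j) \<and> x \<epsilon> (Suc j) \<le> x \<epsilon> j" if "\<epsilon> \<in> {0..1}" "j < 2" for \<epsilon> j
    proof -
      define z where "z = T * \<epsilon>"
      have "z \<le> T" "0 \<le> z" unfolding z_def using that T mult_left_mono[of \<epsilon> 1 T] by auto
      moreover have "j = 0 \<or> j = 1" using that by auto
      ultimately show ?thesis using T unfolding x_def xM z_def[symmetric] by (elim disjE) simp_all
    qed
    show "continuous_on {0..1} (\<lambda>\<epsilon>. x \<epsilon> j)" "continuous_on {0..1} (\<lambda>\<epsilon>. \<theta> \<epsilon> j)" for j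
      unfolding x_def \<theta>_def by (cases "j = 0"; cases "j = 1"; simp; intro continuous_intros)+
    fix \<delta> :: real assume "0 < \<delta>"
    define \<epsilon> where "\<epsilon> = min (min (\<delta> / 2) 1) (d / (2 * T))"
    have "0 < \<epsilon>" "\<epsilon> < \<delta>" "\<epsilon> \<le> 1" "\<epsilon> \<le> d / (2 * T)" using \<open>0 < \<delta>\<close> d(1) T by (auto simp: \<epsilon>_def)
    moreover have "0 < T * \<epsilon>" "T * \<epsilon> < d" using calculation T d(1) by (auto simp: field_simps)
    ultimately show "\<exists>\<epsilon>. 0 < \<epsilon> \<and> \<epsilon> < \<delta> \<and> \<epsilon> \<le> 1 \<and> Re (slit_total (x 0) (\<theta> 0) 2) < Re (slit_total (x \<epsilon>) (\<theta> \<epsilon>) 2)"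
      unfolding tot using d(2)[of "T * \<epsilon>"] by (intro exI[of _ \<epsilon>]) auto
  qed (use M in \<open>auto simp: x_def \<theta>_def\<close>)
qed

section \<open>The indefinite case\<close>

definition bdd01 :: "(real \<Rightarrow> complex) \<Rightarrow> bool" where
  "bdd01 R \<longleftrightarrow> (\<exists>K. \<forall>\<epsilon>\<in>{0..1}. norm (R \<epsilon>) \<le> K)"

lemma bdd01_const: "bdd01 (\<lambda>\<epsilon>. c)"
  unfolding bdd01_def by blast

lemma bdd01_of_real: "bdd01 of_real"
  unfolding bdd01_def by (intro exI[of _ 1]) auto

lemma bdd01_add:
  assumes "bdd01 R" "bdd01 S"
  shows "bdd01 (\<lambda>\<epsilon>. R \<epsilon> + S \<epsilon>)"
proof -
  obtain K L where "\<forall>\<epsilon>\<in>{0..1}. norm (R \<epsilon>) \<le> K" "\<forall>\<epsilon>\<in>{0..1}. norm (S \<epsilon>) \<le> L" using assms unfolding bdd01_def by blast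
  then have "\<forall>\<epsilon>\<in>{0..1}. norm (R \<epsilon> + S \<epsilon>) \<le> K + L" by (auto intro!: norm_triangle_mono)
  then show ?thesis unfolding bdd01_def by blast
qed

lemma bdd01_mult:
  assumes "bdd01 R" "bdd01 S"
  shows "bdd01 (\<lambda>\<epsilon>. R \<epsilon> * S \<epsilon>)"
proof -
  obtain K L where "\<forall>\<epsilon>\<in>{0..1}. norm (R \<epsilon>) \<le> K" "\<forall>\<epsilon>\<in>{0..1}. norm (S \<epsilon>) \<le> L" using assms unfolding bdd01_def by blast
  then have "\<forall>\<epsilon>\<in>{0..1}. norm (R \<epsilon> * S \<epsilon>) \<le> K * L" unfolding norm_mult by (auto intro!: mult_mono intro: order_trans[OF norm_ge_zero])
  then show ?thesis unfolding bdd01_def by blast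
qed

lemmas bdd01_intros = bdd01_const bdd01_of_real bdd01_add bdd01_mult

text \<open>The linear term is imaginary because reversing all angles conjugates the coefficients.\<close>

definition quad_expansion :: "(real \<Rightarrow> complex) \<Rightarrow> real \<Rightarrow> real \<Rightarrow> real \<Rightarrow> bool" where
  "quad_expansion Z p q r \<longleftrightarrow> (\<exists>R. bdd01 R \<and>
     (\<forall>\<epsilon>\<in>{0..1}. Z \<epsilon> = of_real p + \<i> * of_real q * of_real \<epsilon> + of_real r * of_real \<epsilon> * of_real \<epsilon> + of_real \<epsilon> * of_real \<epsilon> * of_real \<epsilon> * R \<epsilon>))"

lemma quad_expansion_real: "quad_expansion (\<lambda>\<epsilon>. of_real a) a 0 0"
  unfolding quad_expansion_def by (intro exI[of _ "\<lambda>_. 0"]) (simp add: bdd01_const)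

lemma quad_expansion_add:
  assumes "quad_expansion Z p q r" "quad_expansion W p' q' r'"
  shows "quad_expansion (\<lambda>\<epsilon>. Z \<epsilon> + W \<epsilon>) (p + p') (q + q') (r + r')"
proof -
  obtain R S where RS: "bdd01 R" "bdd01 S"
    "\<forall>\<epsilon>\<in>{0..1}. Z \<epsilon> = of_real p + \<i> * of_real q * of_real \<epsilon> + of_real r * of_real \<epsilon> * of_real \<epsilon> + of_real \<epsilon> * of_real \<epsilon> * of_real \<epsilon> * R \<epsilon>"
    "\<forall>\<epsilon>\<in>{0..1}. W \<epsilon> = of_real p' + \<i> * of_real q' * of_real \<epsilon> + of_real r' * of_real \<epsilon> * of_real \<epsilon> + of_real \<epsilon> * of_real \<epsilon> * of_real \<epsilon> * S \<epsilon>"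
    using assms unfolding quad_expansion_def by blast
  show ?thesis unfolding quad_expansion_def
    by (intro exI[of _ "\<lambda>\<epsilon>. R \<epsilon> + S \<epsilon>"] conjI bdd01_intros RS(1,2)) (use RS(3,4) in \<open>simp add: algebra_simps\<close>)
qed

lemma quad_expansion_mult:
  assumes "quad_expansion Z p q r" "quad_expansion W p' q' r'"
  shows "quad_expansion (\<lambda>\<epsilon>. Z \<epsilon> * W \<epsilon>) (p * p') (p * q' + q * p') (p * r' + r * p' - q * q')"
proof -
  obtain R S where RS: "bdd01 R" "bdd01 S"
    and Z: "\<And>\<epsilon>. \<epsilon>\<in>{0..1} \<Longrightarrow> Z \<epsilon> = of_real p + \<i> * of_real q * of_real \<epsilon> + of_real r * of_real \<epsilon> * of_real \<epsilon> + of_real \<epsilon> * of_real \<epsilon> * of_real \<epsilon> * R \<epsilon>"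
    and W: "\<And>\<epsilon>. \<epsilon>\<in>{0..1} \<Longrightarrow> W \<epsilon> = of_real p' + \<i> * of_real q' * of_real \<epsilon> + of_real r' * of_real \<epsilon> * of_real \<epsilon> + of_real \<epsilon> * of_real \<epsilon> * of_real \<epsilon> * S \<epsilon>"
    using assms unfolding quad_expansion_def by blast
  define F where "F \<epsilon> = \<i> * of_real (q * r' + r * q') + of_real (r * r') * of_real \<epsilon>
      + (of_real p + \<i> * of_real q * of_real \<epsilon> + of_real r * of_real \<epsilon> * of_real \<epsilon>) * S \<epsilon>
      + R \<epsilon> * (of_real p' + \<i> * of_real q' * of_real \<epsilon> + of_real r' * of_real \<epsilon> * of_real \<epsilon>)
      + of_real \<epsilon> * of_real \<epsilon> * of_real \<epsilon> * (R \<epsilon> * S \<epsilon>)" for \<epsilon> :: real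
  have bF: "bdd01 F" unfolding F_def by (intro bdd01_intros RS)
  have prod: "(P + I * Q * e + A * e * e + e * e * e * X) * (P' + I * Q' * e + A' * e * e + e * e * e * Y) =
      P * P' + I * (P * Q' + Q * P') * e + (P * A' + A * P' - Q * Q') * e * e
      + e * e * e * (I * (Q * A' + A * Q') + A * A' * e + (P + I * Q * e + A * e * e) * Y + X * (P' + I * Q' * e + A' * e * e) + e * e * e * (X * Y))"
    if "I * I = -1" for P Q A P' Q' A' e X Y I :: complex
  proof -
    have I: "I * (I * z) = - z" for z using that by (simp add: mult.assoc[symmetric])
    show ?thesis by (simp add: algebra_simps I)
  qed
  show ?thesis unfolding quad_expansion_def
    by (intro exI[of _ F] conjI bF) (simp add: Z W prod F_def)
qed

lemma quad_expansion_sum: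
  fixes n :: nat
  assumes "\<And>j. j < n \<Longrightarrow> quad_expansion (Z j) (p j) (q j) (r j)"
  shows "quad_expansion (\<lambda>\<epsilon>. \<Sum>j<n. Z j \<epsilon>) (\<Sum>j<n. p j) (\<Sum>j<n. q j) (\<Sum>j<n. r j)"
  using assms
proof (induction n)
  case 0
  then show ?case using quad_expansion_real[of 0] by simp
next
  case (Suc n)
  then show ?case using quad_expansion_add[of "\<lambda>\<epsilon>. \<Sum>j<n. Z j \<epsilon>" _ _ _ "Z n"] by simp
qed

lemma quad_expansion_cis: "quad_expansion (\<lambda>\<epsilon>. of_real a * cis (\<epsilon> * v)) a (a * v) (- a * v\<^sup>2 / 2)"
proof -
  have "quad_expansion (\<lambda>\<epsilon>. cis (\<epsilon> * v)) 1 v (- v\<^sup>2 / 2)"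
  proof -
    define R where "R \<epsilon> = (cis (\<epsilon> * v) - (of_real 1 + \<i> * of_real v * of_real \<epsilon> + of_real (- v\<^sup>2 / 2) * of_real \<epsilon> * of_real \<epsilon>)) / of_real \<epsilon> ^ 3" for \<epsilon>
    have "norm (R \<epsilon>) \<le> \<bar>v\<bar> ^ 3" if \<epsilon>: "\<epsilon> \<in> {0..1}" for \<epsilon>
    proof (cases "\<epsilon> = 0")
      case False
      define z where "z = \<i> * of_real (\<epsilon> * v)"
      have "(\<Sum>k\<le>2. z ^ k / fact k) = of_real 1 + \<i> * of_real v * of_real \<epsilon> + of_real (- v\<^sup>2 / 2) * of_real \<epsilon> * of_real \<epsilon>"
        by (simp add: z_def numeral_2_eq_2 power_mult_distrib)
      moreover have "cis (\<epsilon> * v) = exp z" by (simp add: z_def cis_conv_exp)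
      ultimately have "norm (R \<epsilon>) = norm (exp z - (\<Sum>k\<le>2. z ^ k / fact k)) / \<epsilon> ^ 3"
        using that by (simp add: R_def norm_divide norm_power)
      also have "\<dots> \<le> (exp \<bar>Re z\<bar> * norm z ^ Suc 2 / fact 2) / \<epsilon> ^ 3"
        using \<epsilon> by (intro divide_right_mono Taylor_exp) auto
      also have "\<dots> = \<bar>v\<bar> ^ 3 / 2"
        using False \<epsilon> by (simp add: z_def norm_mult abs_mult power_mult_distrib eval_nat_numeral)
      also have "\<dots> \<le> \<bar>v\<bar> ^ 3" by simp
      finally show ?thesis .
    qed (simp add: R_def)
    then have "bdd01 R" unfolding bdd01_def by blast
    moreover have "cis (\<epsilon> * v) = of_real 1 + \<i> * of_real v * of_real \<epsilon> + of_real (- v\<^sup>2 / 2) * of_real \<epsilon> * of_real \<epsilon> + of_real \<epsilon> * of_real \<epsilon> * of_real \<epsilon> * R \<epsilon>" for \<epsilon>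
      by (cases "\<epsilon> = 0") (simp_all add: R_def power3_eq_cube)
    ultimately show ?thesis unfolding quad_expansion_def by blast
  qed
  from quad_expansion_mult[OF quad_expansion_real[of a] this] show ?thesis by (simp add: algebra_simps)
qed

lemma quad_expansion_increase:
  assumes Z: "quad_expansion Z p q r" and r: "0 < r" and \<delta>: "0 < \<delta>"
  shows "\<exists>\<epsilon>. 0 < \<epsilon> \<and> \<epsilon> < \<delta> \<and> \<epsilon> \<le> 1 \<and> Re (Z 0) < Re (Z \<epsilon>)"
proof -
  obtain R K where R: "\<And>\<epsilon>. \<epsilon> \<in> {0..1} \<Longrightarrow> norm (R \<epsilon>) \<le> K"
    "\<And>\<epsilon>. \<epsilon> \<in> {0..1} \<Longrightarrow> Z \<epsilon> = of_real p + \<i> * of_real q * of_real \<epsilon> + of_real r * of_real \<epsilon> * of_real \<epsilon> + of_real \<epsilon> * of_real \<epsilon> * of_real \<epsilon> * R \<epsilon>"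
    using Z unfolding quad_expansion_def bdd01_def by blast
  have "norm (R 0) \<le> K" using R(1)[of 0] by simp
  then have K: "0 \<le> K" by (rule order_trans[OF norm_ge_zero])
  \<comment> \<open>Small enough that the cubic remainder takes at most half of the quadratic
    gain.\<close>
  define \<epsilon> where "\<epsilon> = min (min (\<delta> / 2) 1) (r / (2 * (K + 1)))"
  have \<epsilon>: "0 < \<epsilon>" "\<epsilon> < \<delta>" "\<epsilon> \<le> 1" "\<epsilon> \<le> r / (2 * (K + 1))" using \<delta> r K by (auto simp: \<epsilon>_def)
  have e01: "\<epsilon> \<in> {0..1}" using \<epsilon> by simp
  have "\<epsilon> * K \<le> \<epsilon> * (K + 1)" using \<epsilon> by simp
  also have "\<dots> \<le> r / (2 * (K + 1)) * (K + 1)" using \<epsilon> K by (intro mult_right_mono) auto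
  also have "\<dots> = r / 2"
  proof -
    have "r / (2 * k) * k = r / 2" if "k \<noteq> 0" for k using that by simp
    note this[of "K + 1"]
    moreover have "K + 1 \<noteq> 0" using K by simp
    ultimately show ?thesis by blast
  qed
  finally have eK: "\<epsilon> * K < r" using r by simp
  have "Re (Z \<epsilon>) = p + r * \<epsilon> * \<epsilon> + \<epsilon> * \<epsilon> * \<epsilon> * Re (R \<epsilon>)"
    unfolding R(2)[OF e01] by (simp flip: of_real_mult)
  also have "Re (R \<epsilon>) \<ge> - K" using R(1)[OF e01] abs_Re_le_cmod[of "R \<epsilon>"] by linarith
  then have "\<epsilon> * \<epsilon> * \<epsilon> * Re (R \<epsilon>) \<ge> \<epsilon> * \<epsilon> * \<epsilon> * (- K)" using \<epsilon> by (intro mult_left_mono) auto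
  then have "p + r * \<epsilon> * \<epsilon> + \<epsilon> * \<epsilon> * \<epsilon> * Re (R \<epsilon>) \<ge> p + \<epsilon> * \<epsilon> * (r - \<epsilon> * K)" by (simp add: algebra_simps)
  moreover have "0 < \<epsilon> * \<epsilon> * (r - \<epsilon> * K)" using \<epsilon> eK by simp
  moreover have "Re (Z 0) = p" using R(2)[of 0] by simp
  ultimately show ?thesis using \<epsilon> by (intro exI[of _ \<epsilon>]) auto
qed

lemma sum_telescope_product:
  fixes y w :: "nat \<Rightarrow> real"
  shows "(\<Sum>j<n. (\<Sum>i<j. w i) * (y j - y (Suc j))) = (\<Sum>j<n. w j * (y (Suc j) - y n))"
proof (induction n)
  case (Suc n)
  have "(\<Sum>j<n. w j * (y (Suc j) - y (Suc n))) = (\<Sum>j<n. w j * (y (Suc j) - y n)) + (\<Sum>j<n. w j) * (y n - y (Suc n))"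
    unfolding right_diff_distrib sum_subtractf sum_distrib_right[symmetric] by (simp add: algebra_simps)
  then show ?case using Suc by simp
qed simp

text \<open>For slits at the angles \<open>\<epsilon> * v j\<close> the increments are exact, and
  the second-order coefficient is minus the discretized \<open>T ^ 3\<close> multiple of the second
  variation. The mesh errors \<open>8 + 4 + 20\<close> make the 32.\<close>

lemma quad_expansion_slit_total:
  fixes T V :: real and v :: "nat \<Rightarrow> real"
  assumes N: "0 < N" and T: "0 < T" "T < 1" and v: "\<And>j. \<bar>v j\<bar> \<le> V"
  defines "x \<equiv> \<lambda>j. 1 - real j * (T / real N)"
  obtains p q r where "quad_expansion (\<lambda>\<epsilon>. slit_total x (\<lambda>j. \<epsilon> * v j) N) p q r"
    "discrete_form T N v - (\<Sum>j<N. T\<^sup>2 * legendre_weight (1 / T) (real j / real N) * (v j)\<^sup>2) * (T / real N) - 32 * V\<^sup>2 / real N \<le> r"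
proof -
  define \<Delta> where "\<Delta> = T / real N"
  have \<Delta>: "0 < \<Delta>" using T N by (simp add: \<Delta>_def)
  have NT: "real N * \<Delta> = T" using N by (simp add: \<Delta>_def)
  have DN: "\<Delta> \<le> 1 / real N" using T N by (simp add: \<Delta>_def divide_right_mono)
  have x: "x j = 1 - real j * \<Delta>" for j by (simp add: x_def \<Delta>_def)
  have xS: "x (Suc j) = x j - \<Delta>" for j by (simp add: x algebra_simps)
  have xN: "x N = 1 - T" using NT by (simp add: x)
  have x01: "0 \<le> x j" "x j \<le> 1" if "j \<le> N" for j
  proof -
    have "real j * \<Delta> \<le> real N * \<Delta>" using that \<Delta> by (intro mult_right_mono) auto
    then show "0 \<le> x j" "x j \<le> 1" using T \<Delta> unfolding NT by (auto simp: x)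
  qed
  define \<beta> where "\<beta> j = ((x j)\<^sup>2 - (x (Suc j))\<^sup>2) / 2" for j
  define \<gamma> where "\<gamma> j = 2 * (x j - x (Suc j)) * (x (Suc j))\<^sup>2" for j
  define S where "S n = (\<Sum>i<n. v i) * \<Delta>" for n
  define W where "W n = (\<Sum>i<n. (v i)\<^sup>2) * \<Delta>" for n
  have qd: "quad_expansion (\<lambda>\<epsilon>. \<Sum>j<n. of_real (2 * (x j - x (Suc j))) * cis (\<epsilon> * v j)) (2 * (1 - x n)) (2 * S n) (- W n)" for n
  proof -
    have "quad_expansion (\<lambda>\<epsilon>. of_real (2 * (x j - x (Suc j))) * cis (\<epsilon> * v j)) (2 * \<Delta>) (2 * \<Delta> * v j) (- \<Delta> * (v j)\<^sup>2)" for j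
      using quad_expansion_cis[of "2 * (x j - x (Suc j))" "v j"] by (simp add: xS)
    then have "quad_expansion (\<lambda>\<epsilon>. \<Sum>j<n. of_real (2 * (x j - x (Suc j))) * cis (\<epsilon> * v j)) (\<Sum>j<n. 2 * \<Delta>) (\<Sum>j<n. 2 * \<Delta> * v j) (\<Sum>j<n. - \<Delta> * (v j)\<^sup>2)"
      by (intro quad_expansion_sum)
    moreover have "(\<Sum>j<n. 2 * \<Delta>) = 2 * (1 - x n)" by (simp add: x)
    moreover have "(\<Sum>j<n. 2 * \<Delta> * v j) = 2 * S n" "(\<Sum>j<n. - \<Delta> * (v j)\<^sup>2) = - W n"
      by (simp_all add: S_def W_def sum_distrib_left sum_distrib_right sum_negf mult_ac)
    ultimately show ?thesis by simp
  qed
  have qb: "quad_expansion (\<lambda>\<epsilon>. of_real (\<beta> j) * cis (2 * (\<epsilon> * v j))) (\<beta> j) (2 * (\<beta> j * v j)) (- 2 * (\<beta> j * (v j)\<^sup>2))" for j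
    using quad_expansion_cis[of "\<beta> j" "2 * v j"] by (simp add: power_mult_distrib mult_ac)
  have qc: "quad_expansion (\<lambda>\<epsilon>. of_real (\<gamma> j) * cis (3 * (\<epsilon> * v j))) (\<gamma> j) (3 * (\<gamma> j * v j)) (- (9/2) * (\<gamma> j * (v j)\<^sup>2))" for j
    using quad_expansion_cis[of "\<gamma> j" "3 * v j"] by (simp add: power_mult_distrib mult_ac)
  have qm: "quad_expansion (\<lambda>\<epsilon>. - Z \<epsilon>) (- p) (- q) (- r)" if "quad_expansion Z p q r" for Z p q r
    using quad_expansion_mult[OF quad_expansion_real[of "-1"] that] by simp
  have q2: "quad_expansion (\<lambda>\<epsilon>. of_real a * Z \<epsilon>) (a * p) (a * q) (a * r)" if "quad_expansion Z p q r" for Z p q r a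
    using quad_expansion_mult[OF quad_expansion_real[of a] that] by simp
  have qB: "quad_expansion (\<lambda>\<epsilon>. \<Sum>j<N. of_real (\<beta> j) * cis (2 * (\<epsilon> * v j))) (\<Sum>j<N. \<beta> j) (\<Sum>j<N. 2 * (\<beta> j * v j)) (\<Sum>j<N. - 2 * (\<beta> j * (v j)\<^sup>2))"
    by (rule quad_expansion_sum[OF qb])
  have qE: "quad_expansion (\<lambda>\<epsilon>. \<Sum>j<N. of_real (\<gamma> j) * cis (3 * (\<epsilon> * v j)) +
      of_real (- 2) * ((\<Sum>i<j. of_real (2 * (x i - x (Suc i))) * cis (\<epsilon> * v i)) * (of_real (\<beta> j) * cis (2 * (\<epsilon> * v j)))))
    (\<Sum>j<N. \<gamma> j + - 2 * (2 * (1 - x j) * \<beta> j))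
    (\<Sum>j<N. 3 * (\<gamma> j * v j) + - 2 * (2 * (1 - x j) * (2 * (\<beta> j * v j)) + 2 * S j * \<beta> j))
    (\<Sum>j<N. - (9/2) * (\<gamma> j * (v j)\<^sup>2) + -2 * (2 * (1 - x j) * (- 2 * (\<beta> j * (v j)\<^sup>2)) + - W j * \<beta> j - 2 * S j * (2 * (\<beta> j * v j))))"
    by (rule quad_expansion_sum[OF quad_expansion_add[OF qc q2[OF quad_expansion_mult[OF qd qb]]]])
  note qD = qd[of N]
  note qT = quad_expansion_add[OF quad_expansion_add[OF quad_expansion_mult[OF qD quad_expansion_mult[OF qD qD]]
      q2[OF quad_expansion_mult[OF qD qB], of "-4"]] qE]
  define b0 b1 b2 where "b0 = (\<Sum>j<N. \<beta> j)" and "b1 = (\<Sum>j<N. \<beta> j * v j)" and "b2 = (\<Sum>j<N. \<beta> j * (v j)\<^sup>2)"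
  define cc where "cc = (\<Sum>j<N. - (9/2) * (\<gamma> j * (v j)\<^sup>2) + -2 * (2 * (1 - x j) * (- 2 * (\<beta> j * (v j)\<^sup>2)) + - W j * \<beta> j - 2 * S j * (2 * (\<beta> j * v j))))"
  define r where "r = - 12 * T\<^sup>2 * W N - 24 * T * (S N)\<^sup>2 + 16 * T * b2 + 4 * W N * b0 + 16 * S N * b1 + cc"
  obtain p q where pq: "quad_expansion (\<lambda>\<epsilon>. slit_total x (\<lambda>j. \<epsilon> * v j) N) p q r"
  proof -
    have eq: "slit_total x (\<lambda>j. \<epsilon> * v j) N =
      (\<Sum>j<N. of_real (2 * (x j - x (Suc j))) * cis (\<epsilon> * v j)) * ((\<Sum>j<N. of_real (2 * (x j - x (Suc j))) * cis (\<epsilon> * v j)) * (\<Sum>j<N. of_real (2 * (x j - x (Suc j))) * cis (\<epsilon> * v j)))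
      + of_real (- 4) * ((\<Sum>j<N. of_real (2 * (x j - x (Suc j))) * cis (\<epsilon> * v j)) * (\<Sum>j<N. of_real (\<beta> j) * cis (2 * (\<epsilon> * v j))))
      + (\<Sum>j<N. of_real (\<gamma> j) * cis (3 * (\<epsilon> * v j)) + of_real (- 2) * ((\<Sum>i<j. of_real (2 * (x i - x (Suc i))) * cis (\<epsilon> * v i)) * (of_real (\<beta> j) * cis (2 * (\<epsilon> * v j)))))" for \<epsilon>
      unfolding slit_total_def total_a4_def \<beta>_def[symmetric] \<gamma>_def[symmetric] power3_eq_cube
      by (simp add: mult.assoc)
    have rr: "2 * (1 - x N) * (2 * (1 - x N) * - W N + - W N * (2 * (1 - x N)) - 2 * S N * (2 * S N)) + - W N * (2 * (1 - x N) * (2 * (1 - x N)))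
        - 2 * S N * (2 * (1 - x N) * (2 * S N) + 2 * S N * (2 * (1 - x N)))
        + -4 * (2 * (1 - x N) * (\<Sum>j<N. - 2 * (\<beta> j * (v j)\<^sup>2)) + - W N * (\<Sum>j<N. \<beta> j) - 2 * S N * (\<Sum>j<N. 2 * (\<beta> j * v j)))
        + (\<Sum>j<N. - (9/2) * (\<gamma> j * (v j)\<^sup>2) + -2 * (2 * (1 - x j) * (- 2 * (\<beta> j * (v j)\<^sup>2)) + - W j * \<beta> j - 2 * S j * (2 * (\<beta> j * v j)))) = r"
      unfolding r_def cc_def[symmetric] b0_def[symmetric] b1_def b2_def xN sum_distrib_left[symmetric]
      by (simp add: power2_eq_square algebra_simps)
    show thesis by (rule that, unfold eq) (rule qT[unfolded rr])
  qed
  moreover have "discrete_form T N v - (\<Sum>j<N. T\<^sup>2 * legendre_weight (1 / T) (real j / real N) * (v j)\<^sup>2) * (T / real N) - 32 * V\<^sup>2 / real N \<le> r"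
  proof -
    have V: "0 \<le> V" using v[of 0] by linarith
    have v2: "(v j)\<^sup>2 \<le> V\<^sup>2" for j using v[of j] V by (metis abs_ge_zero power2_abs power_mono)
    have \<beta>: "\<beta> j = x j * \<Delta> - \<Delta>\<^sup>2 / 2" for j unfolding \<beta>_def xS by (simp add: power2_eq_square field_simps)
    have \<gamma>: "\<gamma> j = 2 * \<Delta> * (x j - \<Delta>)\<^sup>2" for j unfolding \<gamma>_def xS by simp
    define SW where "SW = (\<Sum>j<N. S j * v j) * \<Delta>"
    have b0: "b0 = (1 - (1 - T)\<^sup>2) / 2"
    proof -
      have "(\<Sum>j<n. \<beta> j) = ((x 0)\<^sup>2 - (x n)\<^sup>2) / 2" for n by (induction n) (simp_all add: \<beta>_def field_simps)
      then show ?thesis by (simp add: b0_def xN) (simp add: x)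
    qed
    have b1: "b1 = (\<Sum>j<N. x j * v j) * \<Delta> - \<Delta> / 2 * S N"
      unfolding b1_def S_def \<beta> by (simp add: left_diff_distrib right_diff_distrib sum_subtractf sum_distrib_left sum_distrib_right power2_eq_square mult_ac)
    \<comment> \<open>Abel summation turns the accumulated squares \<open>W j\<close> into a weight
      on each single \<open>(v j)\<^sup>2\<close>.\<close>
    have tau: "(\<Sum>j<N. W j * \<beta> j) = (\<Sum>j<N. \<Delta> * (v j)\<^sup>2 * ((x (Suc j))\<^sup>2 - (1 - T)\<^sup>2)) / 2"
    proof -
      have "(\<Sum>j<N. W j * \<beta> j) = (\<Sum>j<N. (\<Sum>i<j. \<Delta> * (v i)\<^sup>2) * ((x j)\<^sup>2 - (x (Suc j))\<^sup>2)) / 2"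
        unfolding sum_divide_distrib by (rule sum.cong) (simp_all add: W_def \<beta>_def sum_distrib_left mult.commute)
      then show ?thesis unfolding sum_telescope_product[of "\<lambda>i. \<Delta> * (v i)\<^sup>2" "\<lambda>j. (x j)\<^sup>2"] xN .
    qed
    have cc: "cc = (\<Sum>j<N. (- (9/2) * \<gamma> j + 8 * (1 - x j) * \<beta> j) * (v j)\<^sup>2) + 2 * (\<Sum>j<N. W j * \<beta> j) + 8 * (\<Sum>j<N. \<beta> j * S j * v j)"
      unfolding cc_def by (simp add: sum.distrib sum_subtractf sum_distrib_left algebra_simps)
    have s: "(\<Sum>j<N. \<beta> j * S j * v j) = (\<Sum>j<N. x j * v j * S j) * \<Delta> - \<Delta> / 2 * SW"
      unfolding \<beta> SW_def by (simp add: left_diff_distrib right_diff_distrib sum_subtractf sum_distrib_left sum_distrib_right power2_eq_square mult_ac)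
    define D where "D j = T\<^sup>2 * legendre_weight (1 / T) (real j / real N)" for j
    have D: "D j = 16 * (1 - x j)\<^sup>2 - (24 - 16 * T) * (1 - x j) + 15 * T\<^sup>2 - 22 * T + 9" for j
    proof -
      define s where "s = real j / real N"
      have u: "1 - x j = T * s" by (simp add: x \<Delta>_def s_def)
      show ?thesis unfolding D_def legendre_weight_def s_def[symmetric] u using T by (simp add: power2_eq_square field_simps)
    qed
    \<comment> \<open>The total coefficient of \<open>(v j)\<^sup>2\<close>, which equals
      \<open>- (D j * \<Delta>)\<close> up to second order in \<open>\<Delta>\<close>.\<close>
    define kk where "kk j = - 12 * T\<^sup>2 * \<Delta> + 16 * T * \<beta> j + 4 * \<Delta> * b0 - (9/2) * \<gamma> j + 8 * (1 - x j) * \<beta> j + \<Delta> * ((x (Suc j))\<^sup>2 - (1 - T)\<^sup>2)" for j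
    have kk: "- (D j * \<Delta>) - 20 * \<Delta> * \<Delta> \<le> kk j" if "j < N" for j
    proof -
      have "kk j = \<Delta> * (- D j - 8 * T * \<Delta> + 16 * x j * \<Delta> - 8 * \<Delta>\<^sup>2 - 4 * (1 - x j) * \<Delta>)"
        unfolding kk_def D b0 \<beta> \<gamma> xS by (simp add: power2_eq_square field_simps)
      moreover have "- D j - 20 * \<Delta> \<le> - D j - 8 * T * \<Delta> + 16 * x j * \<Delta> - 8 * \<Delta>\<^sup>2 - 4 * (1 - x j) * \<Delta>"
      proof -
        have "T * \<Delta> \<le> 1 * \<Delta>" using T \<Delta> by (intro mult_right_mono) auto
        moreover have "0 \<le> x j * \<Delta>" using x01[of j] that \<Delta> by simp
        moreover have "\<Delta> \<le> 1"
        proof -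
          have "1 / real N \<le> 1" using N by simp
          then show ?thesis using DN by linarith
        qed
        then have "\<Delta>\<^sup>2 \<le> 1 * \<Delta>" using \<Delta> unfolding power2_eq_square by (intro mult_right_mono) auto
        moreover have "4 * (1 - x j) * \<Delta> = 4 * \<Delta> - 4 * (x j * \<Delta>)" by (simp add: algebra_simps)
        moreover have "16 * x j * \<Delta> = 16 * (x j * \<Delta>)" "8 * T * \<Delta> = 8 * (T * \<Delta>)" by simp_all
        ultimately show ?thesis by linarith
      qed
      ultimately have "\<Delta> * (- D j - 20 * \<Delta>) \<le> kk j" using \<Delta> by (metis mult_left_mono less_imp_le)
      then show ?thesis by (simp add: algebra_simps)
    qed
    have df: "discrete_form T N v = - 24 * T * (S N)\<^sup>2 + 16 * S N * ((\<Sum>j<N. x j * v j) * \<Delta>) + 8 * ((\<Sum>j<N. x j * v j * S j) * \<Delta>)"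
      by (simp only: discrete_form_def Let_def \<Delta>_def[symmetric] S_def x)
    have "r = discrete_form T N v - 8 * \<Delta> * (S N)\<^sup>2 - 4 * \<Delta> * SW + (\<Sum>j<N. kk j * (v j)\<^sup>2)"
    proof -
      have "(\<Sum>j<N. kk j * (v j)\<^sup>2) = - 12 * T\<^sup>2 * W N + 16 * T * b2 + 4 * b0 * W N
         + (\<Sum>j<N. (- (9/2) * \<gamma> j + 8 * (1 - x j) * \<beta> j) * (v j)\<^sup>2) + (\<Sum>j<N. \<Delta> * (v j)\<^sup>2 * ((x (Suc j))\<^sup>2 - (1 - T)\<^sup>2))"
        unfolding W_def b2_def sum_distrib_left sum_distrib_right sum.distrib[symmetric]
        by (rule sum.cong) (simp_all add: kk_def algebra_simps)
      then show ?thesis unfolding r_def cc tau s b1 df by (simp add: power2_eq_square algebra_simps)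
    qed
    moreover have "- (\<Sum>j<N. D j * (v j)\<^sup>2) * \<Delta> - 20 * \<Delta> * V\<^sup>2 \<le> (\<Sum>j<N. kk j * (v j)\<^sup>2)"
    proof -
      have "(\<Sum>j<N. - (D j * \<Delta>) * (v j)\<^sup>2 - 20 * \<Delta> * \<Delta> * V\<^sup>2) \<le> (\<Sum>j<N. kk j * (v j)\<^sup>2)"
      proof (rule sum_mono)
        fix j assume "j \<in> {..<N}"
        then have "(- (D j * \<Delta>) - 20 * \<Delta> * \<Delta>) * (v j)\<^sup>2 \<le> kk j * (v j)\<^sup>2" by (intro mult_right_mono kk) auto
        moreover have "20 * \<Delta> * \<Delta> * (v j)\<^sup>2 \<le> 20 * \<Delta> * \<Delta> * V\<^sup>2" using v2 \<Delta> by (intro mult_left_mono) auto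
        ultimately show "- (D j * \<Delta>) * (v j)\<^sup>2 - 20 * \<Delta> * \<Delta> * V\<^sup>2 \<le> kk j * (v j)\<^sup>2" by (simp add: left_diff_distrib)
      qed
      moreover have "(\<Sum>j<N. - (D j * \<Delta>) * (v j)\<^sup>2 - 20 * \<Delta> * \<Delta> * V\<^sup>2) = - (\<Sum>j<N. D j * (v j)\<^sup>2) * \<Delta> - 20 * \<Delta> * V\<^sup>2 * (real N * \<Delta>)"
        by (simp add: sum_subtractf sum_distrib_left sum_distrib_right sum_negf mult_ac)
      moreover have "20 * \<Delta> * V\<^sup>2 * (real N * \<Delta>) \<le> 20 * \<Delta> * V\<^sup>2 * 1" unfolding NT using T \<Delta> by (intro mult_left_mono) auto
      ultimately show ?thesis by simp
    qed
    moreover have S: "\<bar>S n\<bar> \<le> V" if "n \<le> N" for n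
    proof -
      have "\<bar>\<Sum>i<n. v i\<bar> \<le> (\<Sum>i<n. V)" using v by (intro order_trans[OF sum_abs] sum_mono)
      then have "\<bar>S n\<bar> \<le> (real n * V) * \<Delta>" using \<Delta> by (simp add: S_def abs_mult)
      also have "\<dots> = V * (real n * \<Delta>)" by simp
      also have "\<dots> \<le> V * (real N * \<Delta>)" using that \<Delta> V by (intro mult_left_mono mult_right_mono) auto
      also have "\<dots> \<le> V * 1" unfolding NT using T V by (intro mult_left_mono) auto
      finally show ?thesis by simp
    qed
    have "\<Delta> * (S N)\<^sup>2 \<le> \<Delta> * V\<^sup>2" using S[of N] \<Delta> V by (metis abs_ge_zero less_imp_le mult_left_mono order_refl power2_abs power_mono)
    moreover have "SW \<le> V\<^sup>2"
    proof -
      have "S j * v j \<le> V * V" if "j < N" for j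
      proof -
        have "\<bar>S j\<bar> * \<bar>v j\<bar> \<le> V * V" using S[of j] v[of j] that V by (intro mult_mono) auto
        then show ?thesis by (metis abs_ge_self abs_mult order_trans)
      qed
      then have "SW \<le> (\<Sum>j<N. V * V) * \<Delta>" unfolding SW_def using \<Delta> by (intro mult_right_mono sum_mono) auto
      also have "\<dots> = V\<^sup>2 * (real N * \<Delta>)" by (simp add: power2_eq_square)
      also have "\<dots> \<le> V\<^sup>2 * 1" unfolding NT using T by (intro mult_left_mono) auto
      finally show ?thesis by simp
    qed
    then have "\<Delta> * SW \<le> \<Delta> * V\<^sup>2" using \<Delta> by (intro mult_left_mono) auto
    moreover have "\<Delta> * V\<^sup>2 \<le> 1 / real N * V\<^sup>2" using DN by (intro mult_right_mono) auto
    ultimately have "discrete_form T N v - (\<Sum>j<N. D j * (v j)\<^sup>2) * \<Delta> - 32 * (1 / real N * V\<^sup>2) \<le> r"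
      by (simp add: mult.assoc)
    then show ?thesis unfolding D_def \<Delta>_def by simp
  qed
  ultimately show thesis by (rule that)
qed

text \<open>The sampled step functions converge uniformly to \<open>f\<close>. The cross term is
  controlled by the bound \<open>K\<close> of the Euler operator at \<open>f\<close>, the square
  term by \<open>second_variation_upper\<close>. The \<open>min 1\<close> keeps every sample point
  in the domain, whatever the index.\<close>

lemma second_variation_step_fun_limit:
  fixes f :: "real \<Rightarrow> real"
  assumes f: "continuous_on {0..1} f" and r: "1 \<le> r" "r \<le> 6/5" and neg: "second_variation r f f < 0"
  obtains n0 where "\<And>N. n0 \<le> N \<Longrightarrow> 0 < N \<Longrightarrow>
    second_variation r (step_fun N (\<lambda>j. f (min 1 (real j / real N)))) (step_fun N (\<lambda>j. f (min 1 (real j / real N)))) \<le> second_variation r f f / 2"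
proof -
  define g where "g = euler_op r f"
  have pf: "pwc f" by (rule pwc_continuous[OF f])
  have pe: "pwc (euler_op r f)" unfolding euler_op_def[abs_def]
    by (intro pwc_intros pwc_legendre_weight pf pwc_continuous[OF continuous_on_prim])
  then obtain K where "\<forall>s\<in>{0..1}. \<bar>g s\<bar> \<le> K"
    unfolding pwc_def bounded_iff g_def by auto
  then have K: "\<bar>g s\<bar> \<le> K" if "s \<in> {0..1}" for s using that by blast
  have K0: "0 \<le> K" using K[of 0] by simp
  define S where "S = second_variation r f f"
  \<comment> \<open>The bound by 1 gives \<open>\<omega>\<^sup>2 \<le> \<omega>\<close>, so both
    error terms become linear in \<open>\<omega>\<close>.\<close>
  define \<omega> where "\<omega> = min 1 (- S / (2 * (2 * K + 100)))"
  have om: "0 < \<omega>" "\<omega> \<le> 1" "\<omega> * (2 * K + 100) \<le> - S / 2"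
  proof -
    have p: "0 < 2 * K + 100" using K0 by simp
    have "0 < - S / (2 * (2 * K + 100))" using neg p by (intro divide_pos_pos) (simp_all add: S_def)
    then show "0 < \<omega>" "\<omega> \<le> 1" by (auto simp: \<omega>_def)
    have "\<omega> * (2 * K + 100) \<le> (- S / (2 * (2 * K + 100))) * (2 * K + 100)" using p by (intro mult_right_mono) (auto simp: \<omega>_def)
    also have "\<dots> = - S / 2" using p by (simp add: field_simps)
    finally show "\<omega> * (2 * K + 100) \<le> - S / 2" .
  qed
  have "uniformly_continuous_on {0..1} f" by (rule compact_uniformly_continuous[OF f compact_Icc])
  then obtain d where d: "0 < d" "\<And>s u. s \<in> {0..1} \<Longrightarrow> u \<in> {0..1} \<Longrightarrow> \<bar>u - s\<bar> < d \<Longrightarrow> \<bar>f u - f s\<bar> < \<omega>"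
    unfolding uniformly_continuous_on_def dist_real_def using om(1) by blast
  obtain n0 where n0: "1 / d < real n0" using reals_Archimedean2 by blast
  show thesis
  proof (rule that[of n0])
    fix N assume N: "n0 \<le> N" "0 < N"
    define v where "v j = f (min 1 (real j / real N))" for j
    define h where "h s = step_fun N v s - f s" for s
    have ps: "pwc (step_fun N v)" by (rule pwc_step_fun[OF N(2)])
    have ph: "pwc h" unfolding h_def by (intro pwc_intros ps pf)
    have hs: "\<bar>h s\<bar> \<le> \<omega>" if s: "s \<in> {0..1}" for s
    proof -
      define j where "j = nat \<lfloor>real N * s\<rfloor>"
      have p: "0 \<le> real N * s" using s by simp
      have j: "real j \<le> real N * s" "real N * s < real j + 1" unfolding j_def using p by linarith+
      have jN: "real j / real N \<le> s" using j N by (simp add: field_simps)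
      have "1 / d < real N" using n0 N(1) by (meson less_le_trans of_nat_le_iff)
      then have "1 / real N < d" using d(1) N by (simp add: field_simps)
      moreover have "s < (real j + 1) / real N" using j(2) N(2) by (simp add: pos_less_divide_eq mult.commute)
      then have "s - real j / real N < 1 / real N" by (simp add: add_divide_distrib)
      ultimately have "\<bar>min 1 (real j / real N) - s\<bar> < d" using jN s by auto
      then have "\<bar>f (min 1 (real j / real N)) - f s\<bar> < \<omega>" using s jN by (intro d(2)) auto
      then show ?thesis unfolding h_def step_fun_def v_def j_def by simp
    qed
    have "step_fun N v = (\<lambda>s. 1 * f s + 1 * h s)" by (simp add: h_def)
    then have "second_variation r (step_fun N v) (step_fun N v) = S + 2 * second_variation r f h + second_variation r h h"
      using second_variation_combination[OF pf ph, of r 1 1] by (simp add: S_def)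
    also have "second_variation r f h \<le> \<omega> * K"
    proof -
      have "second_variation r f h = prim (\<lambda>s. h s * g s) 1"
        unfolding second_variation_commute[of r f h] g_def by (rule second_variation_euler[OF ph pf])
      also have "\<dots> \<le> prim (\<lambda>s. \<omega> * K) 1"
      proof (rule prim_mono)
        show "h s * g s \<le> \<omega> * K" if "s \<in> {0..1}" for s
        proof -
          have "\<bar>h s\<bar> * \<bar>g s\<bar> \<le> \<omega> * K" using hs[OF that] K[OF that] om by (intro mult_mono) auto
          then show ?thesis by (metis abs_ge_self abs_mult order_trans)
        qed
      qed (use pe in \<open>auto intro!: pwc_intros ph simp: g_def\<close>)
      finally show ?thesis by (simp add: prim_const)
    qed
    also have "second_variation r h h \<le> 100 * \<omega>"
    proof -
      have "prim (\<lambda>s. (h s)\<^sup>2) 1 \<le> prim (\<lambda>s. \<omega>) 1"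
      proof (rule prim_mono)
        show "(h s)\<^sup>2 \<le> \<omega>" if "s \<in> {0..1}" for s
        proof -
          have "\<bar>h s\<bar> * \<bar>h s\<bar> \<le> \<omega> * 1" using hs[OF that] om by (intro mult_mono) auto
          then show ?thesis by (simp add: power2_eq_square flip: abs_mult)
        qed
      qed (auto intro!: pwc_intros ph)
      then show ?thesis using second_variation_upper[OF ph r] by (simp add: prim_const)
    qed
    finally have "second_variation r (step_fun N v) (step_fun N v) \<le> S + (\<omega> * (2 * K + 100))" by (simp add: algebra_simps)
    then show "second_variation r (step_fun N (\<lambda>j. f (min 1 (real j / real N)))) (step_fun N (\<lambda>j. f (min 1 (real j / real N)))) \<le> second_variation r f f / 2"
      using om(3) unfolding v_def[abs_def] S_def by simp
  qed
qed

lemma not_pick_locally_maximizes_negative: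
  fixes f :: "real \<Rightarrow> real"
  assumes M: "11 \<le> M" and f: "continuous_on {0..1} f" and neg: "second_variation (1 / (1 - 1 / M)) f f < 0"
  shows "\<not> pick_locally_maximizes_Re_a4 M"
proof -
  define T where "T = 1 - 1 / M"
  have T: "10 / 11 \<le> T" "T < 1" using M by (auto simp: T_def field_simps)
  have T0: "0 < T" using T by simp
  have r: "1 \<le> 1 / T" "1 / T \<le> 6/5" using T by (auto simp: field_simps)
  obtain V where "\<forall>s\<in>{0..1}. \<bar>f s\<bar> \<le> V"
    using pwc_continuous[OF f] unfolding pwc_def bounded_iff by auto
  then have V: "\<bar>f s\<bar> \<le> V" if "s \<in> {0..1}" for s using that by blast
  obtain n0 where n0: "\<And>N. n0 \<le> N \<Longrightarrow> 0 < N \<Longrightarrow>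
    second_variation (1 / T) (step_fun N (\<lambda>j. f (min 1 (real j / real N)))) (step_fun N (\<lambda>j. f (min 1 (real j / real N)))) \<le> second_variation (1 / T) f f / 2"
    using second_variation_step_fun_limit[OF f r] neg unfolding T_def by blast
  define S where "S = second_variation (1 / T) f f"
  have S: "S < 0" using neg by (simp add: S_def T_def)
  define a where "a = T ^ 3 * (- S / 2)"
  have a: "0 < a" unfolding a_def by (intro mult_pos_pos) (use T0 S in auto)
  \<comment> \<open>\<open>132 = 100 + 32\<close>: the errors of
    \<open>second_variation_step_fun\<close> and \<open>quad_expansion_slit_total\<close>.\<close>
  obtain n1 where n1: "132 * V\<^sup>2 / a < real n1" using reals_Archimedean2 by blast
  define N where "N = max 1 (max n0 n1)"
  have N: "0 < N" "n0 \<le> N" "n1 \<le> N" by (auto simp: N_def)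
  have Va: "132 * V\<^sup>2 / real N < a"
  proof -
    have "132 * V\<^sup>2 / a < real N" using n1 N(3) by (meson less_le_trans of_nat_le_iff)
    then show ?thesis using a N(1) by (simp add: field_simps)
  qed
  define v where "v = (\<lambda>j. f (min 1 (real j / real N)))"
  have vV: "\<bar>v j\<bar> \<le> V" for j unfolding v_def by (rule V) auto
  define x where "x = (\<lambda>j. 1 - real j * (T / real N))"
  obtain p q r where Q: "quad_expansion (\<lambda>\<epsilon>. slit_total x (\<lambda>j. \<epsilon> * v j) N) p q r"
    "discrete_form T N v - (\<Sum>j<N. T\<^sup>2 * legendre_weight (1 / T) (real j / real N) * (v j)\<^sup>2) * (T / real N) - 32 * V\<^sup>2 / real N \<le> r"
    unfolding x_def by (rule quad_expansion_slit_total[OF N(1) T0 T(2) vV])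
  have "T ^ 3 * second_variation (1 / T) (step_fun N v) (step_fun N v) \<le> T ^ 3 * (S / 2)"
    using n0[OF N(2,1)] T0 unfolding v_def S_def by (intro mult_left_mono) auto
  moreover have "T ^ 3 * (S / 2) = - a" by (simp add: a_def)
  ultimately have "0 < r"
    using Q(2) Va second_variation_step_fun(1)[of N T v V, OF N(1) T vV] unfolding abs_le_iff by linarith
  show ?thesis
  proof (rule not_pick_locally_maximizes[where x = "\<lambda>_. x" and \<theta> = "\<lambda>\<epsilon> j. \<epsilon> * v j" and N = N])
    show "0 < x (Suc j) \<and> x (Suc j) \<le> x j" if "j < N" for j
    proof -
      have "real (Suc j) * (T / real N) \<le> real N * (T / real N)" using that T0 by (intro mult_right_mono) auto
      also have "\<dots> = T" using N by simp
      finally have "0 < x (Suc j)" using T unfolding x_def by linarith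
      moreover have "x (Suc j) = x j - T / real N" by (simp add: x_def algebra_simps add_divide_distrib)
      moreover have "0 < T / real N" using T0 N by simp
      ultimately show ?thesis by linarith
    qed
    show "x N = 1 / M" using N by (simp add: x_def T_def)
    show "\<exists>\<epsilon>. 0 < \<epsilon> \<and> \<epsilon> < \<delta> \<and> \<epsilon> \<le> 1 \<and> Re (slit_total x (\<lambda>j. 0 * v j) N) < Re (slit_total x (\<lambda>j. \<epsilon> * v j) N)"
      if "0 < \<delta>" for \<delta> by (rule quad_expansion_increase[OF Q(1) \<open>0 < r\<close> that])
  qed (use M in \<open>auto simp: x_def intro!: continuous_intros\<close>)
qed

theorem theorem12:
  fixes y :: "real \<Rightarrow> nat \<Rightarrow> real \<Rightarrow> real"
  assumes "\<And>M. M > 11 \<Longrightarrow> solves_cauchy_problem M (y M)"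
  shows "\<exists>M\<^sub>0. M\<^sub>0 \<in> critical_bounds y \<and> (\<forall>M\<in>critical_bounds y. M \<le> M\<^sub>0) \<and>
           (\<forall>M>M\<^sub>0. pick_locally_maximizes_Re_a4 M) \<and>
           (\<forall>M. 1 < M \<and> M < M\<^sub>0 \<longrightarrow> \<not> pick_locally_maximizes_Re_a4 M)"
proof -
  obtain M0 where M0: "11 < M0" "M0 \<in> critical_bounds y" "\<And>M. M \<in> critical_bounds y \<Longrightarrow> M \<le> M0"
    "\<And>M. M0 < M \<Longrightarrow> coercive_at (1 / (1 - 1 / M))"
    "\<And>M. 11 \<le> M \<Longrightarrow> M < M0 \<Longrightarrow> \<exists>f. continuous_on {0..1} f \<and> second_variation (1 / (1 - 1 / M)) f f < 0"
    using critical_bound[OF assms] by metis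
  have "pick_locally_maximizes_Re_a4 M" if "M0 < M" for M
    using pick_locally_maximizes M0(1,4) that by simp
  moreover have "\<not> pick_locally_maximizes_Re_a4 M" if "1 < M" "M < M0" for M
  proof (cases "M < 11")
    case True
    then show ?thesis using not_pick_locally_maximizes_less_11 that by blast
  next
    case False
    then show ?thesis using not_pick_locally_maximizes_negative M0(5)[of M] that by auto
  qed
  ultimately show ?thesis using M0(2,3) by blast
qed

end
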